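(* Let $n\geq 3$ and let $\Omega\subset\mathbb{R}^n$ be a bounded outward-minimizing domain with smooth boundary $\Sigma=\partial\Omega$. Fix an origin in $\mathbb{R}^n$ and set $r=|x|$. Then for every $k>0$, $$\int_\Sigma r^k\,d\mu\geq\frac{n-1}{n-1+k}\,|\mathbb{S}^{n-1}|^{-\frac{k}{n-1}}\,|\Sigma|^{\frac{n-1+k}{n-1}}+k\int_\Omega r^{k-1}\,dx.$$ Equality holds if and only if $\Sigma$ is a round sphere centered at the chosen origin.
   Context: A domain is a connected open set. $d\mu$ is the area measure on $\Sigma$, $|\Sigma|$ its total area, and $|\mathbb{S}^{n-1}|$ the area of the unit sphere. Outward minimizing: for a finite-perimeter set $E$ let $P(E)=\mathcal{H}^{n-1}(\partial^*E)$, with $\partial^*E$ the reduced boundary. A bounded finite-perimeter set $\Omega$ is outward minimizing if $P(E)\geq P(\Omega)$ for every bounded finite-perimeter set $E$ that contains $\Omega$ up to measure zero. *)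

theory Defs
  imports "HOL-Analysis.Analysis"
begin

section \<open>Smooth functions and domains with smooth boundary\<close>

text \<open>Functions of class $C^k$ on an open set.  In finite dimension it is enough to ask that
  all directional derivatives are of class $C^{k-1}$.\<close>

primrec C_k_on :: "nat \<Rightarrow> 'a::euclidean_space set \<Rightarrow> ('a \<Rightarrow> 'b::real_normed_vector) \<Rightarrow> bool" where
  "C_k_on 0 S f \<longleftrightarrow> continuous_on S f"
| "C_k_on (Suc k) S f \<longleftrightarrow>
     (\<forall>x\<in>S. f differentiable (at x)) \<and> (\<forall>v. C_k_on k S (\<lambda>x. frechet_derivative f (at x) v))"

definition smooth_on :: "'a::euclidean_space set \<Rightarrow> ('a \<Rightarrow> 'b::real_normed_vector) \<Rightarrow> bool" where
  "smooth_on S f \<longleftrightarrow> (\<forall>k. C_k_on k S f)"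

text \<open>Near each boundary point the set is a strict sublevel set of a smooth function
  without critical points, and the boundary is the corresponding level set.\<close>

definition smooth_boundary :: "'a::euclidean_space set \<Rightarrow> bool" where
  "smooth_boundary \<Omega> \<longleftrightarrow>
     (\<forall>p\<in>frontier \<Omega>. \<exists>U (g :: 'a \<Rightarrow> real).
        open U \<and> p \<in> U \<and> smooth_on U g \<and>
        (\<forall>x\<in>U. frechet_derivative g (at x) \<noteq> (\<lambda>v. 0)) \<and>
        \<Omega> \<inter> U = {x \<in> U. g x < 0} \<and>
        frontier \<Omega> \<inter> U = {x \<in> U. g x = 0})"

section \<open>Hausdorff measure\<close>

text \<open>The $m$-dimensional Hausdorff measure, normalised to agree with Lebesgue measure on
  $m$-dimensional planes.  The case distinction keeps empty sets in a cover from
  contributing when $m = 0$, since \<open>0 ^ 0 = 1\<close>; boundedness is required because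
  \<^const>\<open>diameter\<close> is meaningful only for bounded sets.\<close>

definition hausdorff_content :: "nat \<Rightarrow> real \<Rightarrow> 'a::metric_space set \<Rightarrow> ennreal" where
  "hausdorff_content m \<delta> A =
     (INF C \<in> {C :: nat \<Rightarrow> 'a set. A \<subseteq> (\<Union>i. C i) \<and> (\<forall>i. bounded (C i) \<and> diameter (C i) \<le> \<delta>)}.
        \<Sum>i. if C i = {} then 0 else ennreal (unit_ball_vol (real m) * (diameter (C i) / 2) ^ m))"

definition hausdorff :: "nat \<Rightarrow> 'a::metric_space set \<Rightarrow> ennreal" where
  "hausdorff m A = (SUP \<delta> \<in> {0<..}. hausdorff_content m \<delta> A)"

text \<open>The area measure: $\mathcal{H}^{n-1}$ on the Borel sets of an $n$-dimensional space.  On a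
  smooth hypersurface it restricts to the Riemannian area measure.\<close>

definition area_measure :: "'a::euclidean_space measure" where
  "area_measure = measure_of UNIV (sets borel) (hausdorff (DIM('a) - 1))"

section \<open>Sets of finite perimeter\<close>

definition test_field :: "('a::euclidean_space \<Rightarrow> 'a) \<Rightarrow> bool" where
  "test_field \<phi> \<longleftrightarrow> C_k_on 1 UNIV \<phi> \<and> compact (closure {x. \<phi> x \<noteq> 0})"

definition divergence :: "('a::euclidean_space \<Rightarrow> 'a) \<Rightarrow> 'a \<Rightarrow> real" where
  "divergence \<phi> x = (\<Sum>b\<in>Basis. frechet_derivative \<phi> (at x) b \<bullet> b)"

definition finite_perimeter :: "'a::euclidean_space set \<Rightarrow> bool" where
  "finite_perimeter E \<longleftrightarrow> E \<in> sets lebesgue \<and>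
     (\<exists>C. \<forall>\<phi>. test_field \<phi> \<and> (\<forall>x. norm (\<phi> x) \<le> 1) \<longrightarrow> (LINT x:E|lebesgue. divergence \<phi> x) \<le> C)"

text \<open>The Gauss--Green measure $\mu_E$ of \<open>E\<close> in polar form: \<open>M\<close> is its total variation
  $|\mu_E|$ and \<open>\<nu>\<close> its density, so that $\int_E \mathrm{div}\,\varphi = \int \varphi\cdot\nu\,dM$.
  For a set of finite perimeter such a pair exists (Riesz), \<open>M\<close> is unique, and \<open>\<nu>\<close> is unique
  \<open>M\<close>-almost everywhere.\<close>

definition gauss_green :: "'a::euclidean_space set \<Rightarrow> 'a measure \<Rightarrow> ('a \<Rightarrow> 'a) \<Rightarrow> bool" where
  "gauss_green E M \<nu> \<longleftrightarrow>
     sets M = sets borel \<and> finite_measure M \<and>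
     \<nu> \<in> borel_measurable borel \<and> (AE x in M. norm (\<nu> x) = 1) \<and>
     (\<forall>\<phi>. test_field \<phi> \<longrightarrow> (LINT x:E|lebesgue. divergence \<phi> x) = (LINT x|M. \<phi> x \<bullet> \<nu> x))"

text \<open>De Giorgi's reduced boundary: the points \<open>x\<close> of the support of $|\mu_E|$ at which
  $\mu_E(B_\rho(x)) / |\mu_E|(B_\rho(x))$ converges to a unit vector as $\rho \to 0^+$.\<close>

definition reduced_boundary :: "'a::euclidean_space set \<Rightarrow> 'a set" where
  "reduced_boundary E =
     {x. \<exists>M \<nu>. gauss_green E M \<nu> \<and> (\<forall>\<rho>>0. measure M (ball x \<rho>) > 0) \<and>
        (\<exists>l. norm l = 1 \<and>
          ((\<lambda>\<rho>. (LINT y:ball x \<rho>|M. \<nu> y) /\<^sub>R measure M (ball x \<rho>)) \<longlongrightarrow> l) (at_right 0))}"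

definition perimeter :: "'a::euclidean_space set \<Rightarrow> ennreal" where
  "perimeter E = hausdorff (DIM('a) - 1) (reduced_boundary E)"

definition outward_minimizing :: "'a::euclidean_space set \<Rightarrow> bool" where
  "outward_minimizing \<Omega> \<longleftrightarrow> bounded \<Omega> \<and> finite_perimeter \<Omega> \<and>
     (\<forall>E. bounded E \<and> finite_perimeter E \<and> \<Omega> - E \<in> null_sets lebesgue
        \<longrightarrow> perimeter E \<ge> perimeter \<Omega>)"

end

theory Submission
  imports Defs
begin

text \<open>
  Write both integrals in layers: \<open>r\<^sup>k\<close> is the integral of \<open>k t\<^sup>k\<^sup>-\<^sup>1\<close> over \<open>0 < t \<le> r\<close>, so the left-hand side is
  the integral of \<open>k t\<^sup>k\<^sup>-\<^sup>1 |\<Sigma> - B\<^sub>t|\<close> over \<open>t > 0\<close>, and in polar coordinates the volume term is the integral of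
  \<open>k t\<^sup>k\<^sup>-\<^sup>1 |\<partial>B\<^sub>t \<inter> \<Omega>|\<close>.  Let \<open>R\<close> be the radius of the sphere of area \<open>|\<Sigma>|\<close>.  It suffices that for every \<open>t\<close>
  \[ |\Sigma \setminus B_t| \ge |\partial B_t \cap \Omega| + \max(0, |\Sigma| - |\partial B_t|), \]
  since the last term integrates to the isoperimetric constant.  Radial projection onto \<open>\<partial>B\<^sub>t\<close> is
  1-Lipschitz outside \<open>B\<^sub>t\<close> and maps \<open>\<Sigma> - B\<^sub>t\<close> onto a set containing \<open>\<partial>B\<^sub>t \<inter> \<Omega>\<close>; this settles \<open>t \<ge> R\<close>.  For
  \<open>t \<le> R\<close> compare \<open>\<Omega>\<close> with \<open>\<Omega> \<union> B\<^sub>t\<close>: outward minimality gives \<open>|\<Sigma> \<inter> B\<^sub>t| \<le> |\<partial>B\<^sub>t - \<Omega>|\<close>.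

  In the equality case both estimates are equalities for almost every \<open>t\<close>.  The projection contracts strictly
  beyond \<open>B\<^sub>t\<close>, which forces \<open>\<Omega>\<close> into the closed ball of radius \<open>R\<close>.  If for some \<open>t < R\<close> the sphere \<open>\<partial>B\<^sub>t\<close> left the closure of
  \<open>\<Omega>\<close>, cutting a cap off \<open>B\<^sub>t\<close> would give a better competitor; hence \<open>B\<^sub>R\<close> lies in the closure of \<open>\<Omega>\<close>.
\<close>

section \<open>Hausdorff measure\<close>

text \<open>Area is Hausdorff measure taken straight from covers, and minimality speaks of reduced
  boundaries, so much of the work lies in linking both to the elementary geometry of spheres. On
  spheres the exact value of Hausdorff measure is needed: the lower bound comes from an isodiametric
  inequality applied to thin truncated cones, the upper bound from a density argument with sharp
  constant, and both are expressed through \<open>cone_measure\<close>. For flat discs an upper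
  bound is proved by the same density argument. For perimeters two one-sided inclusions are
  established: the frontier of the smooth set \<Omega> lies in its reduced boundary, by a local
  Gauss-Green formula, and the reduced boundary of any set lies in its topological frontier. Every
  competitor has the form \<Omega> \<union> F with F open: a large ball, which shows that \<Sigma>
  has finite area, a ball of radius t, or a ball with a cap cut off; their finite perimeter comes
  from cutting off test fields. Integrals over a hyperplane are written as averages over a slab of
  height 1 throughout.\<close>

definition hausdorff_cost :: "nat \<Rightarrow> 'a::metric_space set \<Rightarrow> ennreal" where
  "hausdorff_cost m A = (if A = {} then 0 else ennreal (unit_ball_vol (real m) * (diameter A / 2) ^ m))"

lemma hausdorff_cost_empty [simp]: "hausdorff_cost m {} = 0"
  by (simp add: hausdorff_cost_def)

lemma hausdorff_content_le:
  assumes "A \<subseteq> (\<Union>i. C i)" "\<And>i. bounded (C i)" "\<And>i. diameter (C i) \<le> \<delta>"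
  shows "hausdorff_content m \<delta> A \<le> (\<Sum>i. hausdorff_cost m (C i))"
  unfolding hausdorff_content_def hausdorff_cost_def
  by (rule INF_lower) (use assms in auto)

lemma le_hausdorff_content:
  assumes "\<And>C. A \<subseteq> (\<Union>i. C i) \<Longrightarrow> (\<And>i. bounded (C i)) \<Longrightarrow> (\<And>i. diameter (C i) \<le> \<delta>)
      \<Longrightarrow> x \<le> (\<Sum>i. hausdorff_cost m (C i))"
  shows "x \<le> hausdorff_content m \<delta> A"
  unfolding hausdorff_content_def
  by (rule INF_greatest) (use assms in \<open>auto simp: hausdorff_cost_def\<close>)

lemma hausdorff_content_lessE:
  assumes "hausdorff_content m \<delta> A < t"
  obtains C where "A \<subseteq> (\<Union>i. C i)" "\<And>i. bounded (C i)" "\<And>i. diameter (C i) \<le> \<delta>"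
    "(\<Sum>i. hausdorff_cost m (C i)) < t"
  using assms unfolding hausdorff_content_def INF_less_iff hausdorff_cost_def by auto

lemma hausdorff_content_mono:
  assumes "A \<subseteq> B" "\<delta>' \<le> \<delta>"
  shows "hausdorff_content m \<delta> A \<le> hausdorff_content m \<delta>' B"
  by (rule le_hausdorff_content, rule hausdorff_content_le) (use assms in \<open>auto intro: order_trans\<close>)

lemma hausdorff_content_empty [simp]: "\<delta> \<ge> 0 \<Longrightarrow> hausdorff_content m \<delta> {} = 0"
  using hausdorff_content_le[of "{}" "\<lambda>_. {}" \<delta> m] by auto

lemma hausdorff_content_UN:
  "hausdorff_content m \<delta> (\<Union>i::nat. A i) \<le> (\<Sum>i. hausdorff_content m \<delta> (A i))"
proof (cases "\<forall>i. hausdorff_content m \<delta> (A i) < top")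
  case False
  then obtain i where "hausdorff_content m \<delta> (A i) = top"
    by (auto simp: less_top[symmetric])
  moreover have "hausdorff_content m \<delta> (A i) \<le> (\<Sum>i. hausdorff_content m \<delta> (A i))"
    using sum_le_suminf[of "\<lambda>i. hausdorff_content m \<delta> (A i)" "{i}"] by auto
  ultimately show ?thesis by (simp add: top_unique)
next
  case True
  show ?thesis
  proof (rule ennreal_le_epsilon)
    fix e :: real assume e: "0 < e"
    have "\<exists>C. A i \<subseteq> (\<Union>j. C j) \<and> (\<forall>j. bounded (C j)) \<and> (\<forall>j. diameter (C j) \<le> \<delta>) \<and>
        (\<Sum>j. hausdorff_cost m (C j)) \<le> hausdorff_content m \<delta> (A i) + ennreal (e * (1/2) ^ Suc i)" for i :: nat
    proof -
      have "hausdorff_content m \<delta> (A i) < hausdorff_content m \<delta> (A i) + ennreal (e * (1/2) ^ Suc i)"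
        using ennreal_add_left_cancel_less[of "hausdorff_content m \<delta> (A i)" 0 "ennreal (e * (1/2) ^ Suc i)"]
          True[rule_format, of i] e by (simp add: less_top del: power_Suc)
      then show ?thesis
        by (elim hausdorff_content_lessE) (auto intro: less_imp_le)
    qed
    then obtain C where C: "\<And>i. A i \<subseteq> (\<Union>j. C i j)" "\<And>i j. bounded (C i j)" "\<And>i j. diameter (C i j) \<le> \<delta>"
        "\<And>i. (\<Sum>j. hausdorff_cost m (C i j)) \<le> hausdorff_content m \<delta> (A i) + ennreal (e * (1/2) ^ Suc i)"
      by metis
    have "hausdorff_content m \<delta> (\<Union>i. A i) \<le> (\<Sum>k. hausdorff_cost m (case_prod C (prod_decode k)))"
    proof (rule hausdorff_content_le)
      show "(\<Union>i. A i) \<subseteq> (\<Union>k. case_prod C (prod_decode k))"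
      proof safe
        fix x i assume "x \<in> A i"
        then obtain j where "x \<in> C i j" using C(1)[of i] by auto
        then show "x \<in> (\<Union>k. case_prod C (prod_decode k))"
          by (intro UN_I[of "prod_encode (i, j)"]) auto
      qed
    qed (auto simp: C split: prod.split)
    also have "\<dots> = (\<Sum>i. \<Sum>j. hausdorff_cost m (C i j))"
      using suminf_ennreal_2dimen[of "\<lambda>i. \<Sum>j. hausdorff_cost m (C i j)" "\<lambda>p. hausdorff_cost m (case_prod C p)"]
      by (simp add: o_def)
    also have "\<dots> \<le> (\<Sum>i. hausdorff_content m \<delta> (A i) + ennreal (e * (1/2) ^ Suc i))"
      by (intro suminf_le C) auto
    also have "\<dots> = (\<Sum>i. hausdorff_content m \<delta> (A i)) + (\<Sum>i. ennreal (e * (1/2) ^ Suc i))"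
      by (rule suminf_add[symmetric]) auto
    also have "(\<Sum>i. ennreal (e * (1/2) ^ Suc i)) = ennreal e"
    proof (rule suminf_ennreal_eq)
      show "(\<lambda>i. e * (1/2) ^ Suc i) sums e"
        using sums_mult[OF power_half_series, of e] by simp
    qed (use e in auto)
    finally show "hausdorff_content m \<delta> (\<Union>i. A i) \<le> (\<Sum>i. hausdorff_content m \<delta> (A i)) + ennreal e" .
  qed
qed

lemma hausdorff_content_le_hausdorff: "\<delta> > 0 \<Longrightarrow> hausdorff_content m \<delta> A \<le> hausdorff m A"
  unfolding hausdorff_def by (rule SUP_upper) auto

lemma hausdorff_le:
  assumes "\<And>\<delta>. \<delta> > 0 \<Longrightarrow> hausdorff_content m \<delta> A \<le> x"
  shows "hausdorff m A \<le> x"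
  unfolding hausdorff_def by (rule SUP_least) (use assms in auto)

lemma hausdorff_mono: "A \<subseteq> B \<Longrightarrow> hausdorff m A \<le> hausdorff m B"
  by (rule hausdorff_le)
     (meson hausdorff_content_le_hausdorff hausdorff_content_mono order_refl order_trans)

lemma hausdorff_empty [simp]: "hausdorff m {} = 0"
proof -
  have "hausdorff m {} \<le> (0::ennreal)" by (rule hausdorff_le) auto
  then show ?thesis by auto
qed

lemma hausdorff_UN: "hausdorff m (\<Union>i::nat. A i) \<le> (\<Sum>i. hausdorff m (A i))"
proof (rule hausdorff_le)
  fix \<delta> :: real assume "\<delta> > 0"
  have "hausdorff_content m \<delta> (\<Union>i. A i) \<le> (\<Sum>i. hausdorff_content m \<delta> (A i))"
    by (rule hausdorff_content_UN)
  also have "\<dots> \<le> (\<Sum>i. hausdorff m (A i))"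
    by (intro suminf_le hausdorff_content_le_hausdorff \<open>\<delta> > 0\<close>) auto
  finally show "hausdorff_content m \<delta> (\<Union>i. A i) \<le> \<dots>" .
qed

lemma hausdorff_content_Un:
  assumes "\<delta> \<ge> 0"
  shows "hausdorff_content m \<delta> (A \<union> B) \<le> hausdorff_content m \<delta> A + hausdorff_content m \<delta> B"
proof -
  have "hausdorff_content m \<delta> (\<Union>i. binaryset A B i) \<le> (\<Sum>i. hausdorff_content m \<delta> (binaryset A B i))"
    by (rule hausdorff_content_UN)
  also have "\<dots> = hausdorff_content m \<delta> A + hausdorff_content m \<delta> B"
    using assms by (intro suminf_binaryset_eq) auto
  finally show ?thesis by (simp add: UN_binaryset_eq)
qed

lemma hausdorff_Un: "hausdorff m (A \<union> B) \<le> hausdorff m A + hausdorff m B"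
proof -
  have "hausdorff m (\<Union>i. binaryset A B i) \<le> (\<Sum>i. hausdorff m (binaryset A B i))"
    by (rule hausdorff_UN)
  also have "\<dots> = hausdorff m A + hausdorff m B"
    by (intro suminf_binaryset_eq) auto
  finally show ?thesis by (simp add: UN_binaryset_eq)
qed

text \<open>A supremum along an increasing sequence of contents is additive by
  \<open>ennreal_SUP_add\<close>; \<open>hausdorff_separated\<close> needs this form.\<close>

lemma hausdorff_eq_SUP_seq: "hausdorff m A = (SUP n. hausdorff_content m (1 / real (Suc n)) A)"
proof (rule antisym)
  show "hausdorff m A \<le> (SUP n. hausdorff_content m (1 / real (Suc n)) A)"
  proof (rule hausdorff_le)
    fix \<delta> :: real assume "\<delta> > 0"
    then obtain n where "inverse (real (Suc n)) < \<delta>" using reals_Archimedean by blast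
    then have "hausdorff_content m \<delta> A \<le> hausdorff_content m (1 / real (Suc n)) A"
      by (intro hausdorff_content_mono) (auto simp: inverse_eq_divide)
    also have "\<dots> \<le> (SUP n. hausdorff_content m (1 / real (Suc n)) A)"
      by (rule SUP_upper) auto
    finally show "hausdorff_content m \<delta> A \<le> \<dots>" .
  qed
qed (auto intro!: SUP_least hausdorff_content_le_hausdorff)

text \<open>A covering set of diameter below \<epsilon> cannot meet both A and B, so at fine scales
  each cover splits into a cover of A and a cover of B with no set charged twice.\<close>

lemma hausdorff_separated:
  assumes "\<epsilon> > 0" "\<And>x y. x \<in> A \<Longrightarrow> y \<in> B \<Longrightarrow> \<epsilon> \<le> dist x y"
  shows "hausdorff m A + hausdorff m B \<le> hausdorff m (A \<union> B)"
proof -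
  have *: "hausdorff_content m \<delta> A + hausdorff_content m \<delta> B \<le> hausdorff m (A \<union> B)"
    if \<delta>: "0 < \<delta>" "\<delta> < \<epsilon>" for \<delta>
  proof -
    have "hausdorff_content m \<delta> A + hausdorff_content m \<delta> B \<le> hausdorff_content m \<delta> (A \<union> B)"
    proof (rule le_hausdorff_content)
      fix C :: "nat \<Rightarrow> 'a set"
      assume C: "A \<union> B \<subseteq> (\<Union>i. C i)" "\<And>i. bounded (C i)" "\<And>i. diameter (C i) \<le> \<delta>"
      define CA where "CA i = (if C i \<inter> A = {} then {} else C i)" for i
      define CB where "CB i = (if C i \<inter> B = {} then {} else C i)" for i
      have "hausdorff_content m \<delta> A \<le> (\<Sum>i. hausdorff_cost m (CA i))"
        using C \<delta> by (intro hausdorff_content_le) (fastforce simp: CA_def)+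
      moreover have "hausdorff_content m \<delta> B \<le> (\<Sum>i. hausdorff_cost m (CB i))"
        using C \<delta> by (intro hausdorff_content_le) (fastforce simp: CB_def)+
      ultimately have "hausdorff_content m \<delta> A + hausdorff_content m \<delta> B
          \<le> (\<Sum>i. hausdorff_cost m (CA i)) + (\<Sum>i. hausdorff_cost m (CB i))"
        by (rule add_mono)
      also have "\<dots> = (\<Sum>i. hausdorff_cost m (CA i) + hausdorff_cost m (CB i))"
        by (rule suminf_add) auto
      also have "\<dots> \<le> (\<Sum>i. hausdorff_cost m (C i))"
      proof (rule suminf_le)
        fix i
        have "C i \<inter> A = {} \<or> C i \<inter> B = {}"
        proof (rule ccontr)
          assume "\<not> (C i \<inter> A = {} \<or> C i \<inter> B = {})"
          then obtain x y where "x \<in> C i" "x \<in> A" "y \<in> C i" "y \<in> B" by blast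
          then show False
            using diameter_bounded_bound[OF C(2)[of i], of x y] C(3)[of i] assms(2)[of x y] \<delta> by linarith
        qed
        then show "hausdorff_cost m (CA i) + hausdorff_cost m (CB i) \<le> hausdorff_cost m (C i)"
          by (auto simp: CA_def CB_def)
      qed auto
      finally show "hausdorff_content m \<delta> A + hausdorff_content m \<delta> B \<le> \<dots>" .
    qed
    also have "\<dots> \<le> hausdorff m (A \<union> B)" by (rule hausdorff_content_le_hausdorff) fact
    finally show ?thesis .
  qed
  have inc: "incseq (\<lambda>n. hausdorff_content m (1 / real (Suc n)) A)" for A :: "'a set"
    by (auto intro!: incseq_SucI hausdorff_content_mono simp: field_simps)
  have "hausdorff m A + hausdorff m B
      = (SUP n. hausdorff_content m (1 / real (Suc n)) A + hausdorff_content m (1 / real (Suc n)) B)"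
    unfolding hausdorff_eq_SUP_seq by (rule ennreal_SUP_add[symmetric]) (rule inc)+
  also have "\<dots> \<le> hausdorff m (A \<union> B)"
  proof (rule SUP_least)
    fix n
    obtain k where k: "inverse (real (Suc k)) < \<epsilon>" using assms(1) reals_Archimedean by blast
    \<comment> \<open>The estimate \<open>*\<close> holds only at scales below \<epsilon>; passing
      to the finer scale of index \<open>?N\<close> increases both contents.\<close>
    let ?N = "max n k"
    have "inverse (real (Suc ?N)) \<le> inverse (real (Suc k))" by (intro le_imp_inverse_le) auto
    then have N: "1 / real (Suc ?N) < \<epsilon>" using k by (simp add: inverse_eq_divide del: of_nat_Suc)
    have "hausdorff_content m (1 / real (Suc n)) A + hausdorff_content m (1 / real (Suc n)) B \<le>
        hausdorff_content m (1 / real (Suc ?N)) A + hausdorff_content m (1 / real (Suc ?N)) B"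
      by (intro add_mono incseqD[OF inc]) auto
    also have "\<dots> \<le> hausdorff m (A \<union> B)" by (rule *) (use N in auto)
    finally show "hausdorff_content m (1 / real (Suc n)) A + hausdorff_content m (1 / real (Suc n)) B \<le> \<dots>" .
  qed
  finally show ?thesis .
qed

text \<open>The gap may depend on the index: the induction peels off the first set, whose distance
  to all later sets has the single bound \<epsilon> k. This suits rings that accumulate at a closed
  set.\<close>

lemma hausdorff_sum_separated:
  assumes "\<And>i j x y. i < j \<Longrightarrow> x \<in> A i \<Longrightarrow> y \<in> A j \<Longrightarrow> \<epsilon> i \<le> dist x y" "\<And>i. \<epsilon> i > 0"
  shows "(\<Sum>i<N. hausdorff m (A i)) \<le> hausdorff m (\<Union>i<N. A (i::nat))"
proof -
  have "(\<Sum>i<N. hausdorff m (A (k + i))) \<le> hausdorff m (\<Union>i<N. A (k + i))" for k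
  proof (induction N arbitrary: k)
    case (Suc N)
    have "(\<Sum>i<Suc N. hausdorff m (A (k + i))) = hausdorff m (A k) + (\<Sum>i<N. hausdorff m (A (Suc k + i)))"
      by (subst sum.lessThan_Suc_shift) simp
    also have "\<dots> \<le> hausdorff m (A k) + hausdorff m (\<Union>i<N. A (Suc k + i))"
      by (intro add_left_mono Suc.IH)
    also have "\<dots> \<le> hausdorff m (A k \<union> (\<Union>i<N. A (Suc k + i)))"
    proof (rule hausdorff_separated[OF assms(2)[of k]])
      fix x y assume x: "x \<in> A k" and "y \<in> (\<Union>i<N. A (Suc k + i))"
      then obtain i where "y \<in> A (Suc k + i)" by auto
      then show "\<epsilon> k \<le> dist x y" using x by (intro assms(1)) auto
    qed
    also have "A k \<union> (\<Union>i<N. A (Suc k + i)) = (\<Union>i<Suc N. A (k + i))"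
      by (force simp: lessThan_Suc_eq_insert_0)
    finally show ?case .
  qed auto
  from this[of 0] show ?thesis by simp
qed

section \<open>Borel sets are measurable for the Hausdorff outer measure\<close>

lemma suminf_tail_ennreal:
  fixes f :: "nat \<Rightarrow> ennreal"
  assumes "(\<Sum>i. f i) < top" "e > 0"
  obtains k where "(\<Sum>i. f (i + k)) < ennreal e"
proof -
  define r where "r i = enn2real (f i)" for i
  have r: "r i \<ge> 0" "f i = ennreal (r i)" for i
    using ennreal_suminf_lessD[OF assms(1), of i] by (auto simp: r_def)
  then have f: "f = (\<lambda>i. ennreal (r i))" by auto
  have sm: "summable r" using assms(1) r(1) unfolding f by (intro summable_suminf_not_top) auto
  from suminf_exist_split[OF assms(2) sm] obtain k where k: "norm (\<Sum>i. r (i + k)) < e" by auto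
  have "(\<Sum>i. f (i + k)) = ennreal (\<Sum>i. r (i + k))"
    unfolding f using r(1) sm by (intro suminf_ennreal2) (auto simp: summable_iff_shift)
  also have "\<dots> < ennreal e" using k assms by (intro ennreal_lessI) auto
  finally show ?thesis by (rule that)
qed

text \<open>Caratheodory's argument for metric outer measures. The sets \<open>Tk k\<close> keep a
  positive distance from A, and the part of T - A outside \<open>Tk k\<close> is covered by the
  rings \<open>R j\<close> with j \<ge> k. Rings of equal parity are separated, so the even and the
  odd series are each at most the measure of T; hence the whole series converges and its tail, which
  bounds what \<open>Tk k\<close> misses, tends to 0.\<close>

lemma closed_in_lambda_system_hausdorff:
  fixes A :: "'a::metric_space set"
  assumes "closed A"
  shows "A \<in> lambda_system UNIV UNIV (hausdorff m)"
proof (cases "A = {}")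
  case True
  show ?thesis unfolding lambda_system_def True by simp
next
  case False
  have key: "hausdorff m (A \<inter> T) + hausdorff m (T - A) \<le> hausdorff m T" if fin: "hausdorff m T < top" for T
  proof -
    define I where "I x = infdist x A" for x
    have Id: "I x - I y \<le> dist x y" for x y
      unfolding I_def using infdist_triangle[of x A y] by simp
    define u :: "nat \<Rightarrow> real" where "u k = 1 / real (Suc k)" for k
    have u_pos: "u k > 0" for k by (simp add: u_def)
    have u_mono: "i \<le> j \<Longrightarrow> u j \<le> u i" for i j unfolding u_def by (rule divide_left_mono) auto
    have u_less: "u (Suc j) < u j" for j unfolding u_def by (rule divide_strict_left_mono) auto
    define Tk where "Tk k = {x \<in> T. u k \<le> I x}" for k
    define R where "R j = {x \<in> T. u (Suc j) \<le> I x \<and> I x < u j}" for j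
    have alt: "(\<Sum>i. hausdorff m (R (2 * i + c))) \<le> hausdorff m T" for c
    proof (rule suminf_le_const)
      fix N
      have "(\<Sum>i<N. hausdorff m (R (2 * i + c))) \<le> hausdorff m (\<Union>i<N. R (2 * i + c))"
      \<comment> \<open>Points of the earlier ring have distance to A at least u(2i+c+1), those of a
        later ring of the same parity less than u(2j+c), which is at most u(2i+c+2). As
        \<open>I\<close> is 1-Lipschitz, the difference of the two bounds separates the
        rings.\<close>
      proof (rule hausdorff_sum_separated[where \<epsilon>="\<lambda>i. u (2*i+c+1) - u (2*i+c+2)"])
        fix i j x y assume "i < (j::nat)" "x \<in> R (2 * i + c)" "y \<in> R (2 * j + c)"
        moreover have "u (2*j+c) \<le> u (2*i+c+2)" using \<open>i < j\<close> by (intro u_mono) auto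
        ultimately show "u (2*i+c+1) - u (2*i+c+2) \<le> dist x y"
          using Id[of x y] by (simp add: R_def)
      next
        show "0 < u (2*i+c+1) - u (2*i+c+2)" for i using u_less[of "2*i+c+1"] by simp
      qed
      also have "\<dots> \<le> hausdorff m T" by (rule hausdorff_mono) (auto simp: R_def)
      finally show "(\<Sum>i<N. hausdorff m (R (2 * i + c))) \<le> hausdorff m T" .
    qed auto
    have "(\<Sum>i<2*N. hausdorff m (R i)) \<le> hausdorff m T + hausdorff m T" for N
    proof -
      have "(\<Sum>i<2*N. hausdorff m (R i)) = (\<Sum>i<N. hausdorff m (R (2*i))) + (\<Sum>i<N. hausdorff m (R (2*i+1)))"
        by (induction N) (auto simp: algebra_simps)
      also have "\<dots> \<le> (\<Sum>i. hausdorff m (R (2*i))) + (\<Sum>i. hausdorff m (R (2*i+1)))"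
        by (intro add_mono sum_le_suminf) auto
      also have "\<dots> \<le> hausdorff m T + hausdorff m T"
        using alt[of 0] alt[of 1] by (intro add_mono) auto
      finally show ?thesis .
    qed
    note two = this
    then have "(\<Sum>i<N. hausdorff m (R i)) \<le> hausdorff m T + hausdorff m T" for N
    proof -
      have "(\<Sum>i<N. hausdorff m (R i)) \<le> (\<Sum>i<2*N. hausdorff m (R i))" by (rule sum_mono2) auto
      also have "\<dots> \<le> hausdorff m T + hausdorff m T" by (rule two)
      finally show ?thesis .
    qed
    then have "(\<Sum>i. hausdorff m (R i)) \<le> hausdorff m T + hausdorff m T"
      by (intro suminf_le_const summableI)
    then have finR: "(\<Sum>i. hausdorff m (R i)) < top"
      by (rule le_less_trans) (use fin in simp)
    show ?thesis
    proof (rule ennreal_le_epsilon)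
      fix e :: real assume "e > 0"
      from suminf_tail_ennreal[OF finR this] obtain k
        where k: "(\<Sum>i. hausdorff m (R (i + k))) < ennreal e" .
      have "T - A \<subseteq> Tk k \<union> (\<Union>i. R (i + k))"
      proof
        fix x assume x: "x \<in> T - A"
        then have "I x > 0" unfolding I_def using assms False
          by (simp add: infdist_pos_not_in_closed)
        then obtain n where "inverse (real (Suc n)) < I x" using reals_Archimedean by blast
        then have ex: "\<exists>n. u n \<le> I x" by (auto simp: u_def inverse_eq_divide intro: less_imp_le)
        define j where "j = (LEAST n. u n \<le> I x)"
        have j: "u j \<le> I x" unfolding j_def using ex by (rule LeastI_ex)
        show "x \<in> Tk k \<union> (\<Union>i. R (i + k))"
        proof (cases "u k \<le> I x")
          case True then show ?thesis using x by (auto simp: Tk_def)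
        next
          case False
          then have "j > k" using j u_mono[of j k] by (meson leI order_trans)
          then obtain i where i: "j = Suc (i + k)" using less_imp_Suc_add[of k j] by (auto simp: add.commute)
          have "\<not> u (i + k) \<le> I x" using not_less_Least[of "i + k" "\<lambda>n. u n \<le> I x"] i j_def by auto
          then have "x \<in> R (i + k)" using x j i by (auto simp: R_def)
          then show ?thesis by auto
        qed
      qed
      then have "hausdorff m (T - A) \<le> hausdorff m (Tk k) + hausdorff m (\<Union>i. R (i + k))"
        by (intro order_trans[OF hausdorff_mono hausdorff_Un])
      also have "\<dots> \<le> hausdorff m (Tk k) + ennreal e"
        by (intro add_left_mono order_trans[OF hausdorff_UN] less_imp_le[OF k])
      finally have "hausdorff m (A \<inter> T) + hausdorff m (T - A) \<le> hausdorff m (A \<inter> T) + (hausdorff m (Tk k) + ennreal e)"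
        by (rule add_left_mono)
      also have "\<dots> = hausdorff m (A \<inter> T) + hausdorff m (Tk k) + ennreal e" by (simp add: add.assoc)
      also have "hausdorff m (A \<inter> T) + hausdorff m (Tk k) \<le> hausdorff m (A \<inter> T \<union> Tk k)"
      proof (rule hausdorff_separated[OF u_pos[of k]])
        fix x y assume "x \<in> A \<inter> T" "y \<in> Tk k"
        then show "u k \<le> dist x y"
          using infdist_le[of x A y] by (auto simp: Tk_def I_def dist_commute)
      qed
      also have "\<dots> \<le> hausdorff m T" by (rule hausdorff_mono) (auto simp: Tk_def)
      finally show "hausdorff m (A \<inter> T) + hausdorff m (T - A) \<le> hausdorff m T + ennreal e"
        by (simp add: add_right_mono)
    qed
  qed
  have "hausdorff m (A \<inter> T) + hausdorff m (T - A) = hausdorff m T" for T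
  proof (rule antisym)
    show "hausdorff m T \<le> hausdorff m (A \<inter> T) + hausdorff m (T - A)"
      by (rule order_trans[OF hausdorff_mono hausdorff_Un]) auto
    show "hausdorff m (A \<inter> T) + hausdorff m (T - A) \<le> hausdorff m T"
      using key[of T] by (cases "hausdorff m T < top") (auto simp: not_less top_unique)
  qed
  then show ?thesis by (auto simp: lambda_system_def Diff_eq Int_commute)
qed

lemma measure_space_hausdorff: "measure_space UNIV (sets borel) (hausdorff m :: 'a::metric_space set \<Rightarrow> ennreal)"
proof -
  let ?h = "hausdorff m :: 'a set \<Rightarrow> ennreal"
  interpret S: sigma_algebra "UNIV :: 'a set" UNIV using sigma_algebra_Pow[of "UNIV :: 'a set"] by simp
  have "outer_measure_space UNIV ?h"
    by (auto simp: outer_measure_space_def positive_def increasing_def countably_subadditive_def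
        intro: hausdorff_mono hausdorff_UN)
  from S.caratheodory_lemma[OF this]
  have ms: "measure_space UNIV (lambda_system UNIV UNIV ?h) ?h" .
  then interpret L: sigma_algebra "UNIV :: 'a set" "lambda_system UNIV UNIV ?h"
    by (simp add: measure_space_def)
  have "sigma_sets UNIV (Collect closed) \<subseteq> lambda_system UNIV UNIV ?h"
    by (rule L.sigma_sets_subset) (auto intro: closed_in_lambda_system_hausdorff)
  then have sub: "sets borel \<subseteq> lambda_system UNIV UNIV ?h"
    by (simp add: borel_eq_closed)
  show ?thesis
    unfolding measure_space_def
  proof (intro conjI)
    show "sigma_algebra (UNIV :: 'a set) (sets borel)"
      using sets.sigma_algebra_axioms[of "borel :: 'a measure"] by simp
    show "countably_additive (sets borel) ?h"
      using ms sub unfolding measure_space_def countably_additive_def by (blast intro: subset_trans)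
  qed (auto simp: positive_def)
qed

lemma space_area_measure [simp]: "space area_measure = UNIV"
  by (simp add: area_measure_def space_measure_of_conv)

lemma sets_area_measure [simp, measurable_cong]: "sets area_measure = sets borel"
  unfolding area_measure_def using sets.sigma_sets_eq[of borel] by (simp add: sets_measure_of)

lemma emeasure_area_measure:
  fixes A :: "'a::euclidean_space set"
  assumes "A \<in> sets borel"
  shows "emeasure area_measure A = hausdorff (DIM('a) - 1) A"
  unfolding area_measure_def
  using measure_space_hausdorff[of "DIM('a) - 1", where 'a='a] assms
  by (intro emeasure_measure_of_sigma) (auto simp: measure_space_def)

lemma hausdorff_lipschitz_image:
  fixes f :: "'a::euclidean_space \<Rightarrow> 'b::euclidean_space"
  assumes "L > 0" and lip: "\<And>x y. x \<in> A \<Longrightarrow> y \<in> A \<Longrightarrow> dist (f x) (f y) \<le> L * dist x y"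
  shows "hausdorff m (f ` A) \<le> ennreal (L ^ m) * hausdorff m A"
proof (rule hausdorff_le)
  fix \<delta> :: real assume \<delta>: "\<delta> > 0"
  let ?c = "ennreal (L ^ m)"
  have c: "?c \<noteq> 0" "?c \<noteq> top" using assms by (auto simp: ennreal_eq_0_iff not_le)
  \<comment> \<open>The factor is divided away because \<open>le_hausdorff_content\<close> bounds a
    bare content from below. A cover of A at scale \<delta> / L has images at scale
    \<delta>.\<close>
  have "hausdorff_content m \<delta> (f ` A) / ?c \<le> hausdorff_content m (\<delta> / L) A"
  proof (rule le_hausdorff_content)
    fix C :: "nat \<Rightarrow> 'a set"
    assume C: "A \<subseteq> (\<Union>i. C i)" "\<And>i. bounded (C i)" "\<And>i. diameter (C i) \<le> \<delta> / L"
    have b: "dist x y \<le> L * diameter (C i)" if "x \<in> f ` (C i \<inter> A)" "y \<in> f ` (C i \<inter> A)" for x y i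
    proof -
      from that obtain x' y' where "x' \<in> C i \<inter> A" "y' \<in> C i \<inter> A" "x = f x'" "y = f y'" by blast
      then show ?thesis
        using lip[of x' y'] mult_left_mono[OF diameter_bounded_bound[OF C(2), of x' i y'], of L] \<open>L > 0\<close>
        by (metis IntE less_imp_le order_trans)
    qed
    have d: "diameter (f ` (C i \<inter> A)) \<le> L * diameter (C i)" for i
      using b[of _ i] diameter_ge_0[OF C(2)[of i]] \<open>L > 0\<close> by (intro diameter_le) (auto simp: dist_norm)
    have bd: "bounded (f ` (C i \<inter> A))" for i
      using b bounded_two_points by blast
    have "hausdorff_content m \<delta> (f ` A) \<le> (\<Sum>i. hausdorff_cost m (f ` (C i \<inter> A)))"
    proof (rule hausdorff_content_le)
      show "f ` A \<subseteq> (\<Union>i. f ` (C i \<inter> A))" using C(1) by blast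
      show "diameter (f ` (C i \<inter> A)) \<le> \<delta>" for i
        using d[of i] mult_left_mono[OF C(3)[of i], of L] \<open>L > 0\<close> by simp
    qed (rule bd)
    also have "\<dots> \<le> (\<Sum>i. ?c * hausdorff_cost m (C i))"
    proof (rule suminf_le)
      fix i
      show "hausdorff_cost m (f ` (C i \<inter> A)) \<le> ?c * hausdorff_cost m (C i)"
      proof (cases "C i \<inter> A = {}")
        case False
        then have "hausdorff_cost m (f ` (C i \<inter> A)) \<le> ennreal (unit_ball_vol m * (L * diameter (C i) / 2) ^ m)"
          using d[of i] diameter_ge_0[OF bd[of i]] unfolding hausdorff_cost_def
          by (auto intro!: ennreal_leI mult_left_mono power_mono)
        also have "\<dots> = ?c * hausdorff_cost m (C i)"
          using False \<open>L > 0\<close> unfolding hausdorff_cost_def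
          by (subst if_not_P, blast, subst ennreal_mult'[symmetric])
             (auto simp: power_mult_distrib power_divide algebra_simps)
        finally show ?thesis .
      qed auto
    qed auto
    finally have "hausdorff_content m \<delta> (f ` A) \<le> ?c * (\<Sum>i. hausdorff_cost m (C i))" by simp
    then have "hausdorff_content m \<delta> (f ` A) / ?c \<le> ?c * (\<Sum>i. hausdorff_cost m (C i)) / ?c"
      by (rule divide_right_mono_ennreal)
    also have "\<dots> = (\<Sum>i. hausdorff_cost m (C i))"
      using c by (subst mult.commute) (rule ennreal_mult_divide_eq)
    finally show "hausdorff_content m \<delta> (f ` A) / ?c \<le> \<dots>" .
  qed
  also have "\<dots> \<le> hausdorff m A" using \<delta> \<open>L > 0\<close> by (intro hausdorff_content_le_hausdorff) auto
  finally have "hausdorff_content m \<delta> (f ` A) / ?c * ?c \<le> hausdorff m A * ?c" by (rule mult_right_mono) auto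
  moreover have "hausdorff_content m \<delta> (f ` A) / ?c * ?c = hausdorff_content m \<delta> (f ` A)"
    using c by (simp add: ennreal_divide_times)
  ultimately show "hausdorff_content m \<delta> (f ` A) \<le> ?c * hausdorff m A"
    by (simp only: mult.commute)
qed

section \<open>Slicing Lebesgue measure along a direction\<close>

lemma nn_integral_lborel_translate:
  fixes f :: "'a::euclidean_space \<Rightarrow> ennreal"
  assumes "f \<in> borel_measurable borel"
  shows "(\<integral>\<^sup>+x. f (x + c) \<partial>lborel) = (\<integral>\<^sup>+x. f x \<partial>lborel)"
proof -
  have "(\<integral>\<^sup>+x. f x \<partial>lborel) = (\<integral>\<^sup>+x. f x \<partial>distr lborel borel ((+) c))"
    by (simp add: lborel_distr_plus)
  also have "\<dots> = (\<integral>\<^sup>+x. f (c + x) \<partial>lborel)"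
    using assms by (subst nn_integral_distr) auto
  finally show ?thesis by (simp add: add.commute)
qed

lemma nn_integral_lborel_scale:
  fixes f :: "'a::euclidean_space \<Rightarrow> ennreal"
  assumes "f \<in> borel_measurable borel" "c > 0"
  shows "(\<integral>\<^sup>+x. f x \<partial>lborel) = ennreal (c ^ DIM('a)) * (\<integral>\<^sup>+x. f (c *\<^sub>R x) \<partial>lborel)"
proof -
  have "(\<integral>\<^sup>+x. f x \<partial>lborel)
      = (\<integral>\<^sup>+x. f x \<partial>density (distr lborel borel (\<lambda>x. 0 + c *\<^sub>R x)) (\<lambda>_. ennreal (\<bar>c\<bar> ^ DIM('a))))"
    using lborel_affine[of c "0 :: 'a"] assms by simp
  also have "\<dots> = ennreal (c ^ DIM('a)) * (\<integral>\<^sup>+x. f (c *\<^sub>R x) \<partial>lborel)"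
    using assms by (subst nn_integral_density, simp, simp, subst nn_integral_distr)
       (simp_all add: nn_integral_cmult)
  finally show ?thesis .
qed

lemma nn_integral_line_translate:
  fixes f :: "'a::euclidean_space \<Rightarrow> ennreal"
  assumes [measurable]: "f \<in> borel_measurable borel"
  shows "(\<integral>\<^sup>+s. f (x + (s + t) *\<^sub>R e) \<partial>lborel) = (\<integral>\<^sup>+s. f (x + s *\<^sub>R e) \<partial>lborel)"
  using nn_integral_lborel_translate[of "\<lambda>s. f (x + s *\<^sub>R e)" t] by simp

text \<open>Averaging over the slab \<open>0 \<le> y \<bullet> e \<le> 1\<close> takes the place of integrating over the
  hyperplane \<open>y \<bullet> e = 0\<close>, so that no type of dimension \<open>DIM('a) - 1\<close> is needed.\<close>

lemma nn_integral_slab_lines: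
  fixes G :: "'a::euclidean_space \<Rightarrow> ennreal"
  assumes [measurable]: "G \<in> borel_measurable borel" and e: "norm e = 1"
  shows "(\<integral>\<^sup>+z. G z \<partial>lborel)
      = (\<integral>\<^sup>+y. indicator {y. 0 \<le> y \<bullet> e \<and> y \<bullet> e \<le> 1} y * (\<integral>\<^sup>+s. G (y + s *\<^sub>R e) \<partial>lborel) \<partial>lborel)"
proof -
  let ?I = "\<lambda>y. indicator {y. 0 \<le> y \<bullet> e \<and> y \<bullet> e \<le> 1} y :: ennreal"
  have ee: "e \<bullet> e = 1" using e by (simp add: dot_square_norm)
  have "(\<integral>\<^sup>+y. ?I y * (\<integral>\<^sup>+s. G (y + s *\<^sub>R e) \<partial>lborel) \<partial>lborel)
      = (\<integral>\<^sup>+y. \<integral>\<^sup>+s. ?I y * G (y + s *\<^sub>R e) \<partial>lborel \<partial>lborel)"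
    by (intro nn_integral_cong nn_integral_cmult[symmetric]) measurable
  also have "\<dots> = (\<integral>\<^sup>+s. \<integral>\<^sup>+y. ?I y * G (y + s *\<^sub>R e) \<partial>lborel \<partial>lborel)"
    by (rule lborel_pair.Fubini'[symmetric]) measurable
  \<comment> \<open>With z = y + s e the slab condition on y says z \<bullet> e - 1 \<le> s \<le> z
    \<bullet> e, an interval of length 1 in s; once s is integrated first the weight
    disappears.\<close>
  also have "\<dots> = (\<integral>\<^sup>+s. \<integral>\<^sup>+z. indicator {z \<bullet> e - 1 .. z \<bullet> e} s * G z \<partial>lborel \<partial>lborel)"
  proof (rule nn_integral_cong)
    fix s :: real
    have "(\<integral>\<^sup>+z. indicator {z \<bullet> e - 1 .. z \<bullet> e} s * G z \<partial>lborel)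
        = (\<integral>\<^sup>+z. indicator {z. z \<bullet> e - 1 \<le> s \<and> s \<le> z \<bullet> e} z * G z \<partial>lborel)"
      by (intro nn_integral_cong) (auto simp: indicator_def)
    also have "\<dots> = (\<integral>\<^sup>+y. indicator {z. z \<bullet> e - 1 \<le> s \<and> s \<le> z \<bullet> e} (y + s *\<^sub>R e) * G (y + s *\<^sub>R e) \<partial>lborel)"
      by (rule nn_integral_lborel_translate[symmetric]) measurable
    also have "\<dots> = (\<integral>\<^sup>+y. ?I y * G (y + s *\<^sub>R e) \<partial>lborel)"
      by (intro nn_integral_cong) (auto simp: indicator_def inner_add_left ee)
    finally show "(\<integral>\<^sup>+y. ?I y * G (y + s *\<^sub>R e) \<partial>lborel) = (\<integral>\<^sup>+z. indicator {z \<bullet> e - 1 .. z \<bullet> e} s * G z \<partial>lborel)" ..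
  qed
  also have "\<dots> = (\<integral>\<^sup>+z. \<integral>\<^sup>+s. indicator {z \<bullet> e - 1 .. z \<bullet> e} s * G z \<partial>lborel \<partial>lborel)"
  proof (rule lborel_pair.Fubini')
    have "(\<lambda>(z, s). indicator {z \<bullet> e - 1 .. z \<bullet> e} s * G z)
        = (\<lambda>p. indicator {p. fst p \<bullet> e - 1 \<le> snd p \<and> snd p \<le> fst p \<bullet> e} p * G (fst p))"
      by (auto simp: fun_eq_iff indicator_def)
    also have "\<dots> \<in> borel_measurable (lborel \<Otimes>\<^sub>M lborel)" by measurable
    finally show "(\<lambda>(z, s). indicator {z \<bullet> e - 1 .. z \<bullet> e} s * G z) \<in> borel_measurable (lborel \<Otimes>\<^sub>M lborel)" .
  qed
  also have "\<dots> = (\<integral>\<^sup>+z. G z \<partial>lborel)"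
    by (intro nn_integral_cong) (simp add: nn_integral_multc)
  finally show ?thesis ..
qed

section \<open>Slices by hyperplanes and the measure of flat discs\<close>

definition perp :: "'a::euclidean_space \<Rightarrow> 'a \<Rightarrow> 'a" where
  "perp e z = z - (z \<bullet> e) *\<^sub>R e"

lemma perp_measurable [measurable]: "perp e \<in> borel_measurable borel"
  unfolding perp_def by measurable

lemma perp_add: "perp e (x + y) = perp e x + perp e y"
  and perp_diff: "perp e (x - y) = perp e x - perp e y"
  and perp_scaleR: "perp e (c *\<^sub>R x) = c *\<^sub>R perp e x"
  by (auto simp: perp_def algebra_simps)

lemma perp_self: "norm e = 1 \<Longrightarrow> perp e e = 0"
  by (simp add: perp_def dot_square_norm)

lemma perp_inner_self: "norm e = 1 \<Longrightarrow> perp e x \<bullet> e = 0"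
  by (simp add: perp_def inner_diff_left dot_square_norm)

lemma perp_plus: "perp e z + (z \<bullet> e) *\<^sub>R e = z"
  by (simp add: perp_def)

lemma norm_perp_sq:
  assumes "norm e = 1"
  shows "(norm (perp e z))\<^sup>2 + (z \<bullet> e)\<^sup>2 = (norm z)\<^sup>2"
proof -
  have "e \<bullet> e = 1" using assms by (simp add: dot_square_norm)
  then show ?thesis
    unfolding power2_norm_eq_inner perp_def
    by (simp add: inner_diff inner_commute power2_eq_square algebra_simps)
qed

lemma norm_perp_le: "norm e = 1 \<Longrightarrow> norm (perp e z) \<le> norm z"
  using norm_perp_sq[of e z] zero_le_power2[of "z \<bullet> e"] by (intro power2_le_imp_le[OF _ norm_ge_zero]) linarith

lemma continuous_on_perp [continuous_intros]:
  "continuous_on A f \<Longrightarrow> continuous_on A (\<lambda>x. perp e (f x))"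
  unfolding perp_def by (intro continuous_intros)

text \<open>Shifting the parameter of each line by y \<bullet> e makes s the height of the point
  above the hyperplane; Tonelli then puts the heights outside and averages each slice over the
  slab.\<close>

lemma nn_integral_slab_slices:
  fixes G :: "'a::euclidean_space \<Rightarrow> ennreal"
  assumes [measurable]: "G \<in> borel_measurable borel" and e: "norm e = 1"
  shows "(\<integral>\<^sup>+z. G z \<partial>lborel)
      = (\<integral>\<^sup>+s. \<integral>\<^sup>+y. indicator {y. 0 \<le> y \<bullet> e \<and> y \<bullet> e \<le> 1} y * G (perp e y + s *\<^sub>R e) \<partial>lborel \<partial>lborel)"
proof -
  let ?I = "\<lambda>y. indicator {y. 0 \<le> y \<bullet> e \<and> y \<bullet> e \<le> 1} y :: ennreal"
  have "(\<integral>\<^sup>+z. G z \<partial>lborel) = (\<integral>\<^sup>+y. ?I y * (\<integral>\<^sup>+s. G (y + s *\<^sub>R e) \<partial>lborel) \<partial>lborel)"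
    by (rule nn_integral_slab_lines) fact+
  also have "\<dots> = (\<integral>\<^sup>+y. \<integral>\<^sup>+s. ?I y * G (perp e y + s *\<^sub>R e) \<partial>lborel \<partial>lborel)"
  proof (rule nn_integral_cong)
    fix y
    have "(\<integral>\<^sup>+s. G (perp e y + s *\<^sub>R e) \<partial>lborel) = (\<integral>\<^sup>+s. G (perp e y + (s + y \<bullet> e) *\<^sub>R e) \<partial>lborel)"
      by (rule nn_integral_line_translate[symmetric]) fact
    also have "\<dots> = (\<integral>\<^sup>+s. G (y + s *\<^sub>R e) \<partial>lborel)" by (simp add: perp_def algebra_simps)
    finally show "?I y * (\<integral>\<^sup>+s. G (y + s *\<^sub>R e) \<partial>lborel) = (\<integral>\<^sup>+s. ?I y * G (perp e y + s *\<^sub>R e) \<partial>lborel)"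
      by (subst nn_integral_cmult) auto
  qed
  also have "\<dots> = (\<integral>\<^sup>+s. \<integral>\<^sup>+y. ?I y * G (perp e y + s *\<^sub>R e) \<partial>lborel \<partial>lborel)"
    by (rule lborel_pair.Fubini'[symmetric]) measurable
  finally show ?thesis .
qed

text \<open>The (n-1)-dimensional Lebesgue measure of the part of the hyperplane orthogonal to e
  where Q holds, encoded as the volume of the cylinder of height 1 over it.\<close>

definition slab_vol :: "'a::euclidean_space \<Rightarrow> ('a \<Rightarrow> bool) \<Rightarrow> ennreal" where
  "slab_vol e Q = emeasure lborel {y. Q (perp e y) \<and> 0 \<le> y \<bullet> e \<and> y \<bullet> e \<le> 1}"

lemma emeasure_cylinder:
  fixes e :: "'a::euclidean_space"
  assumes e: "norm e = 1" and [measurable]: "Measurable.pred borel Q" "A \<in> sets borel"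
  shows "emeasure lborel {z. Q (perp e z) \<and> z \<bullet> e \<in> A} = slab_vol e Q * emeasure lborel (A :: real set)"
proof -
  let ?I = "\<lambda>y. indicator {y. 0 \<le> y \<bullet> e \<and> y \<bullet> e \<le> 1} y :: ennreal"
  have ee: "e \<bullet> e = 1" using e by (simp add: dot_square_norm)
  have "emeasure lborel {z. Q (perp e z) \<and> z \<bullet> e \<in> A} = (\<integral>\<^sup>+z. indicator {z. Q (perp e z) \<and> z \<bullet> e \<in> A} z \<partial>lborel)"
    by (rule nn_integral_indicator[symmetric]) measurable
  also have "\<dots> = (\<integral>\<^sup>+s. \<integral>\<^sup>+y. ?I y * indicator {z. Q (perp e z) \<and> z \<bullet> e \<in> A} (perp e y + s *\<^sub>R e) \<partial>lborel \<partial>lborel)"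
    by (rule nn_integral_slab_slices) (use e in measurable)
  also have "\<dots> = (\<integral>\<^sup>+s. \<integral>\<^sup>+y. indicator A s * indicator {y. Q (perp e y) \<and> 0 \<le> y \<bullet> e \<and> y \<bullet> e \<le> 1} y \<partial>lborel \<partial>lborel)"
  proof (intro nn_integral_cong)
    fix s y
    have "perp e (perp e y + s *\<^sub>R e) = perp e y" "(perp e y + s *\<^sub>R e) \<bullet> e = s"
      using e ee by (auto simp: perp_def algebra_simps inner_diff_left)
    then show "?I y * indicator {z. Q (perp e z) \<and> z \<bullet> e \<in> A} (perp e y + s *\<^sub>R e)
        = indicator A s * indicator {y. Q (perp e y) \<and> 0 \<le> y \<bullet> e \<and> y \<bullet> e \<le> 1} y"
      by (auto simp: indicator_def)
  qed
  also have "\<dots> = (\<integral>\<^sup>+s. indicator A s * slab_vol e Q \<partial>lborel)"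
    by (intro nn_integral_cong) (simp add: nn_integral_cmult slab_vol_def)
  also have "\<dots> = slab_vol e Q * emeasure lborel A"
    by (simp add: nn_integral_multc mult.commute)
  finally show ?thesis .
qed

text \<open>The Beta factor is the integral of sqrt(1 - s^2)^m over [-1, 1], in the form given by
  \<open>emeasure_cball_aux_integral\<close>; \<open>slab_vol_disc_pos\<close> cancels it.\<close>

lemma unit_ball_vol_Suc:
  "unit_ball_vol (real (Suc m)) = unit_ball_vol (real m) * Beta (1 / 2) (real m / 2 + 1)"
  by (auto simp: unit_ball_vol_def Beta_def Gamma_eq_zero_iff field_simps
      Gamma_one_half_real powr_half_sqrt [symmetric] powr_add [symmetric])

text \<open>The cylinder of radius \<rho> and height \<rho> is the dilation by \<rho> of the one of
  radius and height 1, so its volume scales by \<rho>^n; the height accounts for one factor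
  \<rho>.\<close>

lemma slab_vol_scale:
  fixes e :: "'a::euclidean_space"
  assumes e: "norm e = 1" and "\<rho> > 0"
  shows "slab_vol e (\<lambda>y. norm y \<le> \<rho>) = ennreal (\<rho> ^ (DIM('a) - 1)) * slab_vol e (\<lambda>y. norm y \<le> 1)"
proof -
  let ?n = "DIM('a)"
  have "slab_vol e (\<lambda>y. norm y \<le> \<rho>) * ennreal \<rho> = emeasure lborel {z. norm (perp e z) \<le> \<rho> \<and> z \<bullet> e \<in> {0..\<rho>}}"
    using \<open>\<rho> > 0\<close> by (subst emeasure_cylinder[OF e]) auto
  also have "\<dots> = (\<integral>\<^sup>+z. indicator {z. norm (perp e z) \<le> \<rho> \<and> z \<bullet> e \<in> {0..\<rho>}} z \<partial>lborel)"
    by (rule nn_integral_indicator[symmetric]) measurable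
  also have "\<dots> = ennreal (\<rho> ^ ?n) * (\<integral>\<^sup>+z. indicator {z. norm (perp e z) \<le> \<rho> \<and> z \<bullet> e \<in> {0..\<rho>}} (\<rho> *\<^sub>R z) \<partial>lborel)"
    by (rule nn_integral_lborel_scale) (use \<open>\<rho> > 0\<close> in measurable)
  also have "(\<integral>\<^sup>+z. indicator {z. norm (perp e z) \<le> \<rho> \<and> z \<bullet> e \<in> {0..\<rho>}} (\<rho> *\<^sub>R z) \<partial>lborel)
      = (\<integral>\<^sup>+z. indicator {y. norm (perp e y) \<le> 1 \<and> 0 \<le> y \<bullet> e \<and> y \<bullet> e \<le> 1} z \<partial>lborel)"
    using \<open>\<rho> > 0\<close> by (intro nn_integral_cong) (auto simp: indicator_def perp_scaleR zero_le_mult_iff mult_le_cancel_left1)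
  also have "\<dots> = slab_vol e (\<lambda>y. norm y \<le> 1)"
    unfolding slab_vol_def by (rule nn_integral_indicator) measurable
  also have "ennreal (\<rho> ^ ?n) = ennreal (\<rho> ^ (?n - 1)) * ennreal \<rho>"
    using \<open>\<rho> > 0\<close> power_minus_mult[OF DIM_positive[where 'a='a], of \<rho>]
    by (subst ennreal_mult'[symmetric]) simp_all
  finally have "slab_vol e (\<lambda>y. norm y \<le> \<rho>) * ennreal \<rho> / ennreal \<rho>
      = (ennreal (\<rho> ^ (?n - 1)) * slab_vol e (\<lambda>y. norm y \<le> 1)) * ennreal \<rho> / ennreal \<rho>"
    by (simp add: ac_simps)
  then show ?thesis using \<open>\<rho> > 0\<close> by (simp add: ennreal_mult_divide_eq)
qed

text \<open>Slicing the n-dimensional unit ball orthogonally to e gives discs of radius sqrt(1 -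
  s^2), so by scaling its volume is the measure \<open>?K\<close> of the unit disc times a Beta
  value. The known volume of the ball and \<open>unit_ball_vol_Suc\<close> then determine
  \<open>?K\<close>.\<close>

lemma slab_vol_disc_pos:
  fixes e :: "'a::euclidean_space"
  assumes e: "norm e = 1" and "\<rho> > 0"
  shows "slab_vol e (\<lambda>y. norm y \<le> \<rho>) = ennreal (unit_ball_vol (real (DIM('a) - 1)) * \<rho> ^ (DIM('a) - 1))"
proof -
  let ?m = "DIM('a) - 1"
  let ?K = "slab_vol e (\<lambda>y. norm y \<le> 1)"
  let ?b = "Beta (1 / 2) (real ?m / 2 + 1)"
  have ee: "e \<bullet> e = 1" using e by (simp add: dot_square_norm)
  have Suc: "DIM('a) = Suc ?m" using DIM_positive[where 'a='a] by linarith
  have bpos: "?b > 0"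
    unfolding Beta_def by (intro divide_pos_pos mult_pos_pos Gamma_real_pos) (auto intro: add_nonneg_pos add_pos_nonneg)
  have "ennreal (unit_ball_vol (real DIM('a))) = emeasure lborel (cball (0::'a) 1)"
    by (simp add: emeasure_cball)
  also have "\<dots> = (\<integral>\<^sup>+z. indicator (cball (0::'a) 1) z \<partial>lborel)" by simp
  also have "\<dots> = (\<integral>\<^sup>+s. \<integral>\<^sup>+y. indicator {y. 0 \<le> y \<bullet> e \<and> y \<bullet> e \<le> 1} y * indicator (cball (0::'a) 1) (perp e y + s *\<^sub>R e) \<partial>lborel \<partial>lborel)"
    by (rule nn_integral_slab_slices) (use e in \<open>auto intro!: borel_measurable_indicator borel_closed\<close>)
  also have "\<dots> = (\<integral>\<^sup>+s. ?K * ennreal (indicator {-1..1} s * sqrt (1 - s\<^sup>2) ^ ?m) \<partial>lborel)"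
  proof (intro nn_integral_cong_AE)
    \<comment> \<open>At s = -1 and s = 1 the slice has radius 0, which
      \<open>slab_vol_scale\<close> does not cover.\<close>
    have "AE s in lborel. s \<notin> {-1, 1::real}"
      by (intro AE_not_in countable_imp_null_set_lborel) auto
    then show "AE s in lborel. (\<integral>\<^sup>+y. indicator {y. 0 \<le> y \<bullet> e \<and> y \<bullet> e \<le> 1} y * indicator (cball (0::'a) 1) (perp e y + s *\<^sub>R e) \<partial>lborel)
        = ?K * ennreal (indicator {-1..1} s * sqrt (1 - s\<^sup>2) ^ ?m)"
    proof eventually_elim
      case (elim s)
      have nsq: "(norm (perp e y + s *\<^sub>R e))\<^sup>2 = (norm (perp e y))\<^sup>2 + s\<^sup>2" for y
        using perp_inner_self[OF e, of y] ee unfolding power2_norm_eq_inner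
        by (simp add: inner_add inner_commute power2_eq_square)
      have n1: "norm (perp e y + s *\<^sub>R e) \<le> 1 \<longleftrightarrow> (norm (perp e y))\<^sup>2 + s\<^sup>2 \<le> 1" for y
        using nsq[of y] by (metis abs_norm_cancel abs_square_le_1)
      show ?case
      proof (cases "s \<in> {-1<..<1}")
        case True
        then have "\<bar>s\<bar> < 1" by auto
        then have s: "s\<^sup>2 < 1" by (simp add: abs_square_less_1)
        have "norm (perp e y + s *\<^sub>R e) \<le> 1 \<longleftrightarrow> norm (perp e y) \<le> sqrt (1 - s\<^sup>2)" for y
          unfolding n1 by (metis abs_norm_cancel le_diff_eq real_sqrt_abs real_sqrt_le_iff)
        then have "(\<integral>\<^sup>+y. indicator {y. 0 \<le> y \<bullet> e \<and> y \<bullet> e \<le> 1} y * indicator (cball (0::'a) 1) (perp e y + s *\<^sub>R e) \<partial>lborel)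
            = (\<integral>\<^sup>+y. indicator {y. norm (perp e y) \<le> sqrt (1 - s\<^sup>2) \<and> 0 \<le> y \<bullet> e \<and> y \<bullet> e \<le> 1} y \<partial>lborel)"
          by (intro nn_integral_cong) (auto simp: indicator_def)
        also have "\<dots> = slab_vol e (\<lambda>y. norm y \<le> sqrt (1 - s\<^sup>2))"
          unfolding slab_vol_def by (rule nn_integral_indicator) measurable
        also have "\<dots> = ennreal (sqrt (1 - s\<^sup>2) ^ ?m) * ?K"
          by (rule slab_vol_scale) (use e s in auto)
        finally show ?thesis using True by (simp add: mult.commute)
      next
        case False
        then have "\<bar>s\<bar> > 1" using elim by auto
        then have "s\<^sup>2 > 1" by (metis abs_square_le_1 not_le)
        then have "\<not> norm (perp e y + s *\<^sub>R e) \<le> 1" for y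
          unfolding n1 using zero_le_power2[of "norm (perp e y)"] by linarith
        then show ?thesis using False elim by (auto simp: indicator_def)
      qed
    qed
  qed
  also have "\<dots> = ?K * ennreal ?b"
    by (subst nn_integral_cmult) (auto simp: emeasure_cball_aux_integral)
  finally have "ennreal (unit_ball_vol (real ?m) * ?b) = ?K * ennreal ?b"
    by (subst (asm) Suc) (simp only: unit_ball_vol_Suc)
  then have "ennreal (unit_ball_vol (real ?m)) * ennreal ?b / ennreal ?b = ?K * ennreal ?b / ennreal ?b"
    using ennreal_mult[of "unit_ball_vol (real ?m)" ?b] bpos by (metis less_imp_le of_nat_0_le_iff unit_ball_vol_nonneg)
  then have K: "?K = ennreal (unit_ball_vol (real ?m))"
    using bpos by (simp add: ennreal_mult_divide_eq del: of_nat_diff)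
  show ?thesis
    using slab_vol_scale[OF assms] \<open>\<rho> > 0\<close> by (simp add: K ennreal_mult mult.commute)
qed

text \<open>Radius 0 occurs for sets of diameter 0 in the isodiametric estimate; it follows by
  letting positive radii tend to 0.\<close>

lemma slab_vol_disc:
  fixes e :: "'a::euclidean_space"
  assumes e: "norm e = 1" and "\<rho> \<ge> 0" and "DIM('a) \<ge> 2"
  shows "slab_vol e (\<lambda>y. norm y \<le> \<rho>) = ennreal (unit_ball_vol (real (DIM('a) - 1)) * \<rho> ^ (DIM('a) - 1))"
proof (cases "\<rho> = 0")
  case True
  let ?m = "DIM('a) - 1"
  have "slab_vol e (\<lambda>y. norm y \<le> 0) \<le> ennreal (unit_ball_vol (real ?m) * t ^ ?m)" if "t > 0" for t
    unfolding slab_vol_disc_pos[OF e that, symmetric] unfolding slab_vol_def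
    by (rule emeasure_mono) (use that in \<open>auto, measurable\<close>)
  then have "\<forall>\<^sub>F t in at_right 0. slab_vol e (\<lambda>y. norm y \<le> 0) \<le> ennreal (unit_ball_vol (real ?m) * t ^ ?m)"
    by (auto simp: eventually_at intro!: exI[of _ 1])
  moreover have "((\<lambda>t. ennreal (unit_ball_vol (real ?m) * t ^ ?m)) \<longlongrightarrow> ennreal (unit_ball_vol (real ?m) * 0 ^ ?m)) (at_right 0)"
    by (intro tendsto_intros)
  ultimately have "slab_vol e (\<lambda>y. norm y \<le> 0) \<le> ennreal (unit_ball_vol (real ?m) * 0 ^ ?m)"
    by (intro tendsto_lowerbound) auto
  then show ?thesis using True assms by (auto simp: power_0_left)
qed (use assms slab_vol_disc_pos[OF e] in auto)

section \<open>Steiner symmetrization and an isodiametric inequality\<close>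

definition line_length :: "'a::euclidean_space \<Rightarrow> 'a set \<Rightarrow> 'a \<Rightarrow> ennreal" where
  "line_length b X x = (\<integral>\<^sup>+s. indicator X (x + s *\<^sub>R b) \<partial>lborel)"

text \<open>On every line in direction b the section of X is replaced by the open interval of the
  same length centred at height 0. The strict inequality is what yields the contradiction in
  \<open>steiner_diff\<close>.\<close>

definition steiner :: "'a::euclidean_space \<Rightarrow> 'a set \<Rightarrow> 'a set" where
  "steiner b X = {x. ennreal (2 * \<bar>x \<bullet> b\<bar>) < line_length b X x}"

definition reflect :: "'a::euclidean_space \<Rightarrow> 'a \<Rightarrow> 'a" where
  "reflect b x = x - (2 * (x \<bullet> b)) *\<^sub>R b"

lemma line_length_measurable [measurable]:
  assumes [measurable]: "X \<in> sets borel"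
  shows "line_length b X \<in> borel_measurable borel"
  unfolding line_length_def by measurable

lemma line_length_translate:
  assumes "X \<in> sets borel"
  shows "line_length b X (x + t *\<^sub>R b) = line_length b X x"
  unfolding line_length_def
  using nn_integral_line_translate[of "indicator X" x t b] assms by (simp add: algebra_simps)

lemma steiner_measurable [measurable]:
  assumes [measurable]: "X \<in> sets borel"
  shows "steiner b X \<in> sets borel"
  unfolding steiner_def by measurable

text \<open>On each line in direction b the two sets have sections of equal length, and
  \<open>nn_integral_slab_lines\<close> integrates these lengths.\<close>

lemma emeasure_steiner:
  fixes X :: "'a::euclidean_space set"
  assumes [measurable]: "X \<in> sets borel" and b: "norm b = 1"
  shows "emeasure lborel (steiner b X) = emeasure lborel X"
proof -
  let ?I = "\<lambda>y. indicator {y. 0 \<le> y \<bullet> b \<and> y \<bullet> b \<le> 1} y :: ennreal"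
  have bb: "b \<bullet> b = 1" using b by (simp add: dot_square_norm)
  have "(\<integral>\<^sup>+s. indicator (steiner b X) (y + s *\<^sub>R b) \<partial>lborel) = line_length b X y" for y
  proof -
    have eq: "y + s *\<^sub>R b \<in> steiner b X \<longleftrightarrow> ennreal (2 * \<bar>y \<bullet> b + s\<bar>) < line_length b X y" for s
      by (simp add: steiner_def line_length_translate inner_add_left bb)
    show ?thesis
    proof (cases "line_length b X y")
      case (real l)
      have "(\<integral>\<^sup>+s. indicator (steiner b X) (y + s *\<^sub>R b) \<partial>lborel)
          = (\<integral>\<^sup>+s. indicator {- l / 2 - y \<bullet> b <..< l / 2 - y \<bullet> b} s \<partial>lborel)"
        using real by (intro nn_integral_cong) (auto simp: indicator_def eq ennreal_less_iff, (linarith | argo)+)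
      also have "\<dots> = ennreal l" using real by simp
      finally show ?thesis using real by simp
    next
      case top
      then have "(\<integral>\<^sup>+s. indicator (steiner b X) (y + s *\<^sub>R b) \<partial>lborel) = (\<integral>\<^sup>+s. 1 \<partial>(lborel :: real measure))"
        by (intro nn_integral_cong) (auto simp: indicator_def eq)
      then show ?thesis using top by simp
    qed
  qed
  then have "(\<integral>\<^sup>+z. indicator (steiner b X) z \<partial>lborel) = (\<integral>\<^sup>+z. indicator X z \<partial>lborel)"
    using nn_integral_slab_lines[of "indicator (steiner b X)" b] nn_integral_slab_lines[of "indicator X" b] b
    by (simp add: line_length_def)
  then show ?thesis by simp
qed

text \<open>N plays the part of the bound on differences: symmetrization preserves it if N is stable
  under shortening the b-component. The sections A and B of X on the lines through x and y contain
  points at least as far apart in height as x and y are, and these two points of X differ by a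
  vector that shortens to x - y.\<close>

lemma steiner_diff:
  fixes X :: "'a::euclidean_space set"
  assumes [measurable]: "X \<in> sets borel" and b: "norm b = 1"
    and X: "\<And>x y. x \<in> X \<Longrightarrow> y \<in> X \<Longrightarrow> x - y \<in> N"
    and N: "\<And>z t. z \<in> N \<Longrightarrow> \<bar>t\<bar> \<le> \<bar>z \<bullet> b\<bar> \<Longrightarrow> z + (t - z \<bullet> b) *\<^sub>R b \<in> N"
    and x: "x \<in> steiner b X" and y: "y \<in> steiner b X"
  shows "x - y \<in> N"
proof -
  have bb: "b \<bullet> b = 1" using b by (simp add: dot_square_norm)
  define A where "A = {s. x + (s - x \<bullet> b) *\<^sub>R b \<in> X}"
  define B where "B = {s. y + (s - y \<bullet> b) *\<^sub>R b \<in> X}"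
  have len: "line_length b X z = emeasure lborel {s. z + (s - z \<bullet> b) *\<^sub>R b \<in> X}" for z
  proof -
    have "line_length b X z = (\<integral>\<^sup>+s. indicator X (z + (s + (- (z \<bullet> b))) *\<^sub>R b) \<partial>lborel)"
      unfolding line_length_def by (rule nn_integral_line_translate[symmetric]) simp
    also have "\<dots> = (\<integral>\<^sup>+s. indicator {s. z + (s - z \<bullet> b) *\<^sub>R b \<in> X} s \<partial>lborel)"
      by (intro nn_integral_cong) (auto simp: indicator_def)
    also have "\<dots> = emeasure lborel {s. z + (s - z \<bullet> b) *\<^sub>R b \<in> X}"
      by (rule nn_integral_indicator) measurable
    finally show ?thesis .
  qed
  have Ax: "ennreal (2 * \<bar>x \<bullet> b\<bar>) < emeasure lborel A" and By: "ennreal (2 * \<bar>y \<bullet> b\<bar>) < emeasure lborel B"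
    using x y by (auto simp: steiner_def len A_def B_def)
  define l where "l = \<bar>x \<bullet> b - y \<bullet> b\<bar>"
  have "\<exists>t\<in>A. \<exists>u\<in>B. l \<le> \<bar>t - u\<bar>"
  proof (rule ccontr)
    assume "\<not> ?thesis"
    then have less: "\<And>t u. t \<in> A \<Longrightarrow> u \<in> B \<Longrightarrow> \<bar>t - u\<bar> \<le> l" by fastforce
    have "A \<noteq> {}" "B \<noteq> {}" using Ax By by auto
    then obtain t0 u0 where t0: "t0 \<in> A" and u0: "u0 \<in> B" by auto
    have "bdd_above B" "bdd_below B"
      unfolding bdd_above_def bdd_below_def
      by (rule exI[of _ "t0 + l"], use less[OF t0] in \<open>fastforce simp: abs_le_iff\<close>,
          rule exI[of _ "t0 - l"], use less[OF t0] in \<open>fastforce simp: abs_le_iff\<close>)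
    have "B \<subseteq> {Inf B .. Sup B}"
      using \<open>bdd_above B\<close> \<open>bdd_below B\<close> by (auto intro: cInf_lower cSup_upper)
    then have "emeasure lborel B \<le> emeasure lborel {Inf B .. Sup B}"
      by (rule emeasure_mono) simp
    moreover have IS: "Inf B \<le> Sup B" using \<open>bdd_above B\<close> \<open>bdd_below B\<close> u0 by (meson cInf_lower cSup_upper order_trans)
    ultimately have mB: "emeasure lborel B \<le> ennreal (Sup B - Inf B)" by simp
    \<comment> \<open>Every point of A is within l of both ends of B, so the lengths of A and B add
      up to at most 2 l, whereas they exceed 2 |x \<bullet> b| and 2 |y \<bullet> b|, whose sum is
      at least 2 l.\<close>
    have "A \<subseteq> {Sup B - l .. Inf B + l}"
    proof
      fix t assume "t \<in> A"
      have "Sup B \<le> t + l" using \<open>B \<noteq> {}\<close> less[OF \<open>t \<in> A\<close>] by (intro cSup_least) (fastforce simp: abs_le_iff)+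
      moreover have "t - l \<le> Inf B" using \<open>B \<noteq> {}\<close> less[OF \<open>t \<in> A\<close>] by (intro cInf_greatest) (fastforce simp: abs_le_iff)+
      ultimately show "t \<in> {Sup B - l .. Inf B + l}" by auto
    qed
    moreover from this t0 have le: "Sup B - l \<le> Inf B + l" by auto
    ultimately have mA: "emeasure lborel A \<le> ennreal (Inf B + l - (Sup B - l))"
      using emeasure_mono[of A "{Sup B - l .. Inf B + l}" lborel] by simp
    have "2 * \<bar>x \<bullet> b\<bar> < Inf B + l - (Sup B - l)"
      using less_le_trans[OF Ax mA] le by (simp add: ennreal_less_iff)
    moreover have "2 * \<bar>y \<bullet> b\<bar> < Sup B - Inf B"
      using less_le_trans[OF By mB] IS by (simp add: ennreal_less_iff)
    ultimately show False unfolding l_def by linarith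
  qed
  then obtain t u where tu: "t \<in> A" "u \<in> B" "l \<le> \<bar>t - u\<bar>" by blast
  define z where "z = (x + (t - x \<bullet> b) *\<^sub>R b) - (y + (u - y \<bullet> b) *\<^sub>R b)"
  have "z \<in> N" unfolding z_def using tu by (intro X) (auto simp: A_def B_def)
  moreover have zb: "z \<bullet> b = t - u" by (simp add: z_def algebra_simps bb)
  ultimately have "z + ((x \<bullet> b - y \<bullet> b) - z \<bullet> b) *\<^sub>R b \<in> N"
    using tu by (intro N) (auto simp: l_def)
  also have "z + ((x \<bullet> b - y \<bullet> b) - z \<bullet> b) *\<^sub>R b = x - y"
    unfolding zb by (simp add: z_def algebra_simps)
  finally show ?thesis .
qed

lemma reflect_steiner_self:
  assumes "X \<in> sets borel" "norm b = 1" "x \<in> steiner b X"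
  shows "reflect b x \<in> steiner b X"
proof -
  have "b \<bullet> b = 1" using assms by (simp add: dot_square_norm)
  then show ?thesis
    using assms line_length_translate[of X b x "- (2 * (x \<bullet> b))"]
    by (simp add: steiner_def reflect_def inner_diff_left)
qed

text \<open>Symmetrizing in direction b keeps a symmetry in an orthogonal direction c, because
  reflection in c carries lines parallel to b to such lines and preserves heights along b. The
  symmetries gained in successive directions thus accumulate.\<close>

lemma reflect_steiner_other:
  assumes X: "\<And>x. x \<in> X \<Longrightarrow> reflect c x \<in> X" and c: "norm c = 1" "c \<bullet> b = 0" and x: "x \<in> steiner b X"
  shows "reflect c x \<in> steiner b X"
proof -
  have cc: "c \<bullet> c = 1" using c by (simp add: dot_square_norm)
  have r: "reflect c (x + s *\<^sub>R b) = reflect c x + s *\<^sub>R b" for s x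
    using c by (simp add: reflect_def inner_add_left inner_commute[of b c])
  have inv: "reflect c (reflect c x) = x" for x
    by (simp add: reflect_def algebra_simps cc)
  have "reflect c x \<in> X \<longleftrightarrow> x \<in> X" for x using X inv by metis
  then have "line_length b X (reflect c x) = line_length b X x"
    unfolding line_length_def by (intro nn_integral_cong) (simp add: r[symmetric] indicator_def)
  moreover have "reflect c x \<bullet> b = x \<bullet> b" using c by (simp add: reflect_def inner_diff_left)
  ultimately show ?thesis using x by (simp add: steiner_def)
qed

text \<open>After symmetrization along a whole orthonormal basis the set is invariant under x
  \<mapsto> -x, so 2 x = x - (-x) lies in N for each of its points, while its volume and the
  inclusion of its differences in N are preserved. Keeping N abstract lets it be a cylinder instead
  of a ball.\<close>

lemma emeasure_le_symmetric:
  fixes X :: "'a::euclidean_space set"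
  assumes "X \<in> sets borel" and B: "pairwise orthogonal B" "\<And>b. b \<in> B \<Longrightarrow> norm b = 1" "independent B" "span B = UNIV"
    and X: "\<And>x y. x \<in> X \<Longrightarrow> y \<in> X \<Longrightarrow> x - y \<in> N"
    and N: "\<And>z t b. b \<in> B \<Longrightarrow> z \<in> N \<Longrightarrow> \<bar>t\<bar> \<le> \<bar>z \<bullet> b\<bar> \<Longrightarrow> z + (t - z \<bullet> b) *\<^sub>R b \<in> N"
    and meas: "{z. 2 *\<^sub>R z \<in> N} \<in> sets borel"
  shows "emeasure lborel X \<le> emeasure lborel {z. 2 *\<^sub>R z \<in> N}"
proof -
  have fB: "finite B" using B by (simp add: finiteI_independent)
  have orth: "b \<bullet> c = 0" if "b \<in> B" "c \<in> B" "b \<noteq> c" for b c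
    using B(1) that by (auto simp: pairwise_def orthogonal_def)
  have "\<exists>Y \<in> sets borel. emeasure lborel Y = emeasure lborel X \<and> (\<forall>x\<in>Y. \<forall>y\<in>Y. x - y \<in> N)
      \<and> (\<forall>b\<in>F. \<forall>x\<in>Y. reflect b x \<in> Y)" if "F \<subseteq> B" for F
    using finite_subset[OF that fB] that
  proof (induction F rule: finite_induct)
    case empty
    then show ?case using assms(1) X by auto
  next
    case (insert b F)
    then obtain Y where Y: "Y \<in> sets borel" "emeasure lborel Y = emeasure lborel X"
        "\<forall>x\<in>Y. \<forall>y\<in>Y. x - y \<in> N" "\<forall>b\<in>F. \<forall>x\<in>Y. reflect b x \<in> Y" by auto
    have b: "norm b = 1" "b \<in> B" using insert B by auto
    have "\<forall>x\<in>steiner b Y. \<forall>y\<in>steiner b Y. x - y \<in> N"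
      using steiner_diff[OF Y(1) b(1), of N] Y(3) N[OF b(2)] by blast
    moreover have "\<forall>c\<in>insert b F. \<forall>x\<in>steiner b Y. reflect c x \<in> steiner b Y"
    proof safe
      fix x assume "x \<in> steiner b Y"
      then show "reflect b x \<in> steiner b Y" by (rule reflect_steiner_self[OF Y(1) b(1)])
    next
      fix c x assume c: "c \<in> F" and x: "x \<in> steiner b Y"
      have "c \<bullet> b = 0" using c insert.hyps insert.prems by (intro orth) auto
      moreover have "norm c = 1" using c insert.prems B by auto
      ultimately show "reflect c x \<in> steiner b Y"
        using Y(4) c x by (intro reflect_steiner_other) auto
    qed
    ultimately show ?case
      using emeasure_steiner[OF Y(1) b(1)] Y(1,2) by (intro bexI[of _ "steiner b Y"]) auto
  qed
  from this[OF order_refl] obtain Y where Y: "Y \<in> sets borel" "emeasure lborel Y = emeasure lborel X"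
        "\<forall>x\<in>Y. \<forall>y\<in>Y. x - y \<in> N" "\<forall>b\<in>B. \<forall>x\<in>Y. reflect b x \<in> Y" by auto
  have "Y \<subseteq> {z. 2 *\<^sub>R z \<in> N}"
  proof
    fix x assume x: "x \<in> Y"
    \<comment> \<open>Composing the reflections in the vectors of F subtracts twice the
      F-components; for F = B this is x \<mapsto> -x.\<close>
    have "x - (\<Sum>b\<in>F. (2 * (x \<bullet> b)) *\<^sub>R b) \<in> Y" if "F \<subseteq> B" for F
      using finite_subset[OF that fB] that
    proof (induction F rule: finite_induct)
      case (insert b F)
      let ?y = "x - (\<Sum>b\<in>F. (2 * (x \<bullet> b)) *\<^sub>R b)"
      have "(\<Sum>c\<in>F. (2 * (x \<bullet> c)) *\<^sub>R c) \<bullet> b = 0"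
        unfolding inner_sum_left using insert orth by (intro sum.neutral) auto
      then have "?y \<bullet> b = x \<bullet> b" by (simp add: inner_diff_left)
      then have "reflect b ?y = x - (\<Sum>b\<in>insert b F. (2 * (x \<bullet> b)) *\<^sub>R b)"
        using insert by (simp add: reflect_def algebra_simps)
      moreover have "reflect b ?y \<in> Y" using insert Y by auto
      ultimately show ?case by simp
    qed (use x in auto)
    from this[of B] have "x - (\<Sum>b\<in>B. (2 * (x \<bullet> b)) *\<^sub>R b) \<in> Y" by simp
    moreover have "(\<Sum>b\<in>B. (x \<bullet> b) *\<^sub>R b) = x"
    proof -
      have "x \<in> span B" using B by simp
      then obtain u where u: "x = (\<Sum>b\<in>B. u b *\<^sub>R b)" using span_finite[OF fB] by auto
      have "x \<bullet> c = u c" if "c \<in> B" for c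
      proof -
        have "x \<bullet> c = (\<Sum>b\<in>B. u b * (b \<bullet> c))" by (subst u) (simp add: inner_sum_left)
        also have "\<dots> = (\<Sum>b\<in>B. if b = c then u b else 0)"
          using that orth B(2)[OF that] by (intro sum.cong) (auto simp: dot_square_norm)
        finally show ?thesis using that fB by simp
      qed
      then show ?thesis by (subst (2) u) (intro sum.cong, auto)
    qed
    moreover have "(\<Sum>b\<in>B. (2 * (x \<bullet> b)) *\<^sub>R b) = 2 *\<^sub>R (\<Sum>b\<in>B. (x \<bullet> b) *\<^sub>R b)"
      by (simp add: scaleR_sum_right)
    ultimately have "- x \<in> Y" by (simp add: scaleR_2)
    then have "x - (- x) \<in> N" using Y x by blast
    then show "x \<in> {z. 2 *\<^sub>R z \<in> N}" by (simp add: scaleR_2)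
  qed
  then show ?thesis using Y(2) meas by (metis emeasure_mono sets_lborel)
qed

text \<open>With \<open>L\<close> as a spectator this is the isodiametric inequality in the hyperplane orthogonal to \<open>e\<close>.\<close>

lemma emeasure_le_cylinder:
  fixes X :: "'a::euclidean_space set"
  assumes X: "X \<in> sets borel" and e: "norm e = 1" and "DIM('a) \<ge> 2" and DL: "D \<ge> 0" "L \<ge> 0"
    and diff: "\<And>x y. x \<in> X \<Longrightarrow> y \<in> X \<Longrightarrow> norm (perp e (x - y)) \<le> D"
      "\<And>x y. x \<in> X \<Longrightarrow> y \<in> X \<Longrightarrow> \<bar>(x - y) \<bullet> e\<bar> \<le> L"
  shows "emeasure lborel X \<le> ennreal (unit_ball_vol (real (DIM('a) - 1)) * (D / 2) ^ (DIM('a) - 1) * L)"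
proof -
  define N where "N = {z. norm (perp e z) \<le> D \<and> \<bar>z \<bullet> e\<bar> \<le> L}"
  \<comment> \<open>With e in the basis, shortening along e affects only the height |z \<bullet> e|,
    and shortening along another basis vector only the norm of \<open>perp e z\<close>, so N has the
    required stability.\<close>
  obtain B where B: "e \<in> B" "pairwise orthogonal B" "\<And>b. b \<in> B \<Longrightarrow> norm b = 1" "independent B" "span B = UNIV"
    using vector_in_orthonormal_basis[OF e] by metis
  have ee: "e \<bullet> e = 1" using e by (simp add: dot_square_norm)
  have eq: "{z. 2 *\<^sub>R z \<in> N} = {z. norm (perp e z) \<le> D / 2 \<and> z \<bullet> e \<in> {- (L / 2) .. L / 2}}"
    by (auto simp: N_def perp_scaleR abs_le_iff)
  have "emeasure lborel X \<le> emeasure lborel {z. 2 *\<^sub>R z \<in> N}"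
  proof (rule emeasure_le_symmetric[OF X B(2-5)])
    fix z t b assume b: "b \<in> B" and z: "z \<in> N" and t: "\<bar>t\<bar> \<le> \<bar>z \<bullet> b\<bar>"
    have bb: "b \<bullet> b = 1" using B(3)[OF b] by (simp add: dot_square_norm)
    show "z + (t - z \<bullet> b) *\<^sub>R b \<in> N"
    proof (cases "b = e")
      case True
      then show ?thesis using z t e ee
        by (auto simp: N_def perp_add perp_scaleR perp_self inner_add_left)
    next
      case False
      then have be: "b \<bullet> e = 0" "e \<bullet> b = 0" using B(1,2) b by (auto simp: pairwise_def orthogonal_def inner_commute)
      have p: "perp e (z + (t - z \<bullet> b) *\<^sub>R b) = perp e z + (t - perp e z \<bullet> b) *\<^sub>R b"
        using be by (simp add: perp_def algebra_simps)
      have "(norm (perp e z + (t - perp e z \<bullet> b) *\<^sub>R b))\<^sup>2 = (norm (perp e z))\<^sup>2 + t\<^sup>2 - (perp e z \<bullet> b)\<^sup>2"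
        using bb unfolding power2_norm_eq_inner
        by (simp add: inner_add inner_diff inner_commute power2_eq_square algebra_simps)
      also have "(perp e z \<bullet> b)\<^sup>2 = (z \<bullet> b)\<^sup>2" using be by (simp add: perp_def algebra_simps)
      also have "(norm (perp e z))\<^sup>2 + t\<^sup>2 - (z \<bullet> b)\<^sup>2 \<le> (norm (perp e z))\<^sup>2"
        using t by (simp add: abs_le_square_iff)
      finally have "norm (perp e z + (t - perp e z \<bullet> b) *\<^sub>R b) \<le> norm (perp e z)"
        by (rule power2_le_imp_le) simp
      moreover have "(z + (t - z \<bullet> b) *\<^sub>R b) \<bullet> e = z \<bullet> e" using be by (simp add: inner_add_left)
      ultimately show ?thesis using z by (auto simp: N_def p)
    qed
  next
    show "{z. 2 *\<^sub>R z \<in> N} \<in> sets borel" unfolding eq by measurable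
  qed (use diff in \<open>auto simp: N_def\<close>)
  also have "\<dots> = slab_vol e (\<lambda>y. norm y \<le> D / 2) * emeasure lborel {- (L / 2) .. L / 2}"
    unfolding eq by (rule emeasure_cylinder[OF e]) measurable
  also have "\<dots> = ennreal (unit_ball_vol (real (DIM('a) - 1)) * (D / 2) ^ (DIM('a) - 1)) * ennreal L"
    using DL \<open>DIM('a) \<ge> 2\<close> by (subst slab_vol_disc[OF e]) auto
  also have "\<dots> = ennreal (unit_ball_vol (real (DIM('a) - 1)) * (D / 2) ^ (DIM('a) - 1) * L)"
    using DL by (simp add: ennreal_mult)
  finally show ?thesis .
qed

section \<open>The cone measure on the unit sphere\<close>

lemma sgn_borel_measurable [measurable]: "(sgn :: 'a::euclidean_space \<Rightarrow> 'a) \<in> borel_measurable borel"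
  unfolding sgn_div_norm[abs_def] by measurable

text \<open>The area of a part W of the unit sphere is n times the volume of the cone over W in the
  unit ball. The push-forward under \<open>sgn\<close> makes this a measure, which is later
  identified with Hausdorff measure on the sphere.\<close>

definition cone_measure :: "'a::euclidean_space measure" where
  "cone_measure = distr (density lborel (\<lambda>x. ennreal (real DIM('a)) * indicator (cball 0 1 - {0}) x)) borel sgn"

lemma sets_cone_measure [simp, measurable_cong]: "sets cone_measure = sets borel"
  and space_cone_measure [simp]: "space cone_measure = UNIV"
  by (auto simp: cone_measure_def)

lemma nn_integral_cone_measure:
  fixes f :: "'a::euclidean_space \<Rightarrow> ennreal"
  assumes [measurable]: "f \<in> borel_measurable borel"
  shows "(\<integral>\<^sup>+y. f y \<partial>cone_measure)
    = (\<integral>\<^sup>+x. ennreal (real DIM('a)) * indicator (cball 0 1 - {0}) x * f (sgn x) \<partial>lborel)"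
proof -
  have [measurable]: "(\<lambda>x. ennreal (real DIM('a)) * indicator (cball 0 1 - {0}) x) \<in> borel_measurable (borel :: 'a measure)"
    by (intro borel_measurable_times_ennreal borel_measurable_indicator borel_measurable_const sets.Diff borel_closed) auto
  show ?thesis
    unfolding cone_measure_def
    by (subst nn_integral_distr, simp, simp, subst nn_integral_density) auto
qed

definition cone_vol :: "'a::euclidean_space set \<Rightarrow> real \<Rightarrow> ennreal" where
  "cone_vol W b = emeasure lborel {x. 0 < norm x \<and> norm x \<le> b \<and> sgn x \<in> W}"

lemma emeasure_cone_measure:
  fixes W :: "'a::euclidean_space set"
  assumes [measurable]: "W \<in> sets borel"
  shows "emeasure cone_measure W = ennreal (real DIM('a)) * cone_vol W 1"
proof -
  have "emeasure cone_measure W = (\<integral>\<^sup>+y. indicator W y \<partial>cone_measure)" by simp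
  also have "\<dots> = (\<integral>\<^sup>+x. ennreal (real DIM('a)) * indicator {x::'a. 0 < norm x \<and> norm x \<le> 1 \<and> sgn x \<in> W} x \<partial>lborel)"
    by (subst nn_integral_cone_measure) (auto intro!: nn_integral_cong simp: indicator_def)
  also have "\<dots> = ennreal (real DIM('a)) * cone_vol W 1"
    unfolding cone_vol_def by (rule nn_integral_cmult_indicator) measurable
  finally show ?thesis .
qed

lemma cone_vol_scale:
  fixes W :: "'a::euclidean_space set"
  assumes [measurable]: "W \<in> sets borel" and "b > 0"
  shows "cone_vol W b = ennreal (b ^ DIM('a)) * cone_vol W 1"
proof -
  have "cone_vol W b = (\<integral>\<^sup>+x. indicator {x::'a. 0 < norm x \<and> norm x \<le> b \<and> sgn x \<in> W} x \<partial>lborel)"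
    unfolding cone_vol_def by (rule nn_integral_indicator[symmetric]) measurable
  also have "\<dots> = ennreal (b ^ DIM('a)) * (\<integral>\<^sup>+x. indicator {x::'a. 0 < norm x \<and> norm x \<le> b \<and> sgn x \<in> W} (b *\<^sub>R x) \<partial>lborel)"
    by (rule nn_integral_lborel_scale) (use \<open>b > 0\<close> in measurable)
  also have "(\<integral>\<^sup>+x. indicator {x::'a. 0 < norm x \<and> norm x \<le> b \<and> sgn x \<in> W} (b *\<^sub>R x) \<partial>lborel)
      = (\<integral>\<^sup>+x. indicator {x::'a. 0 < norm x \<and> norm x \<le> 1 \<and> sgn x \<in> W} x \<partial>lborel)"
    using \<open>b > 0\<close> by (intro nn_integral_cong) (auto simp: indicator_def sgn_scaleR mult_le_cancel_left1)
  also have "\<dots> = cone_vol W 1"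
    unfolding cone_vol_def by (rule nn_integral_indicator) measurable
  finally show ?thesis .
qed

lemma cone_vol_finite: "cone_vol (W::'a::euclidean_space set) 1 < top"
proof -
  have "cone_vol W 1 \<le> emeasure lborel (cball (0::'a) 1)"
    unfolding cone_vol_def by (rule emeasure_mono) auto
  also have "\<dots> < top" by (simp add: emeasure_cball)
  finally show ?thesis .
qed

lemma finite_measure_cone_measure: "finite_measure (cone_measure :: 'a::euclidean_space measure)"
proof
  have "emeasure cone_measure (UNIV :: 'a set) < top"
    using cone_vol_finite[of "UNIV :: 'a set"] by (simp add: emeasure_cone_measure ennreal_mult_less_top)
  then show "emeasure (cone_measure :: 'a measure) (space cone_measure) \<noteq> \<infinity>" by simp
qed

lemma emeasure_cone_measure_UNIV:
  "emeasure cone_measure (UNIV :: 'a::euclidean_space set) = ennreal (real DIM('a) * unit_ball_vol (real DIM('a)))"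
proof -
  have "cone_vol (UNIV :: 'a set) 1 = emeasure lborel (cball (0::'a) 1 - {0})"
    unfolding cone_vol_def by (rule arg_cong[where f="emeasure lborel"]) auto
  also have "\<dots> = emeasure lborel (cball (0::'a) 1)"
    by (rule emeasure_Diff_null_set) auto
  finally show ?thesis by (simp add: emeasure_cone_measure emeasure_cball ennreal_mult)
qed

lemma emeasure_shell:
  fixes W :: "'a::euclidean_space set"
  assumes [measurable]: "W \<in> sets borel" and ab: "0 < a" "a \<le> b"
  shows "emeasure lborel {x. a < norm x \<and> norm x \<le> b \<and> sgn x \<in> W}
    = ennreal (measure cone_measure W * (b ^ DIM('a) - a ^ DIM('a)) / DIM('a))"
proof -
  interpret finite_measure "cone_measure :: 'a measure" by (rule finite_measure_cone_measure)
  let ?n = "DIM('a)"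
  define v where "v = enn2real (cone_vol W 1)"
  have v: "cone_vol W 1 = ennreal v" "v \<ge> 0"
    using cone_vol_finite[of W] by (auto simp: v_def)
  have "ennreal (measure cone_measure W) = ennreal (real ?n * v)"
    using emeasure_cone_measure[of W] v by (simp add: emeasure_eq_measure ennreal_mult)
  then have mv: "measure cone_measure W = real ?n * v" using v by simp
  have eq: "{x. a < norm x \<and> norm x \<le> b \<and> sgn x \<in> W}
      = {x::'a. 0 < norm x \<and> norm x \<le> b \<and> sgn x \<in> W} - {x. 0 < norm x \<and> norm x \<le> a \<and> sgn x \<in> W}"
    using ab by auto
  have "emeasure lborel {x. a < norm x \<and> norm x \<le> b \<and> sgn x \<in> W} = cone_vol W b - cone_vol W a"
    unfolding eq cone_vol_def
  proof (rule emeasure_Diff)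
    show "emeasure lborel {x. 0 < norm x \<and> norm x \<le> a \<and> sgn x \<in> W} \<noteq> \<infinity>"
      using cone_vol_scale[OF assms(1) ab(1)] cone_vol_finite[of W] unfolding cone_vol_def[symmetric]
      by (auto simp: ennreal_mult_eq_top_iff)
  qed (use ab in auto)
  also have "\<dots> = ennreal (b ^ ?n * v) - ennreal (a ^ ?n * v)"
    using ab v by (simp add: cone_vol_scale[of W b] cone_vol_scale[of W a] ennreal_mult)
  also have "\<dots> = ennreal (b ^ ?n * v - a ^ ?n * v)"
    using ab v by (intro ennreal_minus) auto
  also have "b ^ ?n * v - a ^ ?n * v = measure cone_measure W * (b ^ ?n - a ^ ?n) / ?n"
    unfolding mv by (simp add: field_simps)
  finally show ?thesis .
qed

text \<open>Unfolding \<open>cone_measure\<close> gives a double integral over x in the unit ball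
  and t > 0 of f at t \<open>sgn x\<close>. The substitutions t = s |x| for fixed x and z = s x for
  fixed s move all dependence on s into n s^(-n-1) over s \<ge> |z|, whose integral |z|^(-n) cancels
  the factor |z|^n.\<close>

lemma nn_integral_polar:
  fixes f :: "'a::euclidean_space \<Rightarrow> ennreal"
  assumes [measurable]: "f \<in> borel_measurable borel" and dim: "DIM('a) = Suc m"
  shows "(\<integral>\<^sup>+x. f x \<partial>lborel)
    = (\<integral>\<^sup>+t. indicator {0<..} t * ennreal (t ^ m) * (\<integral>\<^sup>+y. f (t *\<^sub>R y) \<partial>cone_measure) \<partial>lborel)"
proof -
  let ?n = "ennreal (real DIM('a))"
  let ?B = "\<lambda>x::'a. indicator (cball 0 1 - {0}) x :: ennreal"
  let ?P = "\<lambda>t::real. indicator {0<..} t :: ennreal"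
  have [measurable]: "?B \<in> borel_measurable borel"
    by (intro borel_measurable_indicator sets.Diff borel_closed) auto
  have "(\<integral>\<^sup>+t. ?P t * ennreal (t ^ m) * (\<integral>\<^sup>+y. f (t *\<^sub>R y) \<partial>cone_measure) \<partial>lborel)
      = (\<integral>\<^sup>+t. \<integral>\<^sup>+x. ?P t * ennreal (t ^ m) * (?n * ?B x * f (t *\<^sub>R sgn x)) \<partial>lborel \<partial>lborel)"
    by (intro nn_integral_cong, subst nn_integral_cone_measure, measurable)
       (simp add: nn_integral_cmult[symmetric])
  also have "\<dots> = (\<integral>\<^sup>+x. \<integral>\<^sup>+t. ?P t * ennreal (t ^ m) * (?n * ?B x * f (t *\<^sub>R sgn x)) \<partial>lborel \<partial>lborel)"
    by (rule lborel_pair.Fubini') measurable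
  also have "\<dots> = (\<integral>\<^sup>+x. \<integral>\<^sup>+s. ?P s * ennreal (s ^ m) * (?n * ?B x * ennreal (norm x ^ DIM('a)) * f (s *\<^sub>R x)) \<partial>lborel \<partial>lborel)"
  proof (rule nn_integral_cong)
    fix x :: 'a
    show "(\<integral>\<^sup>+t. ?P t * ennreal (t ^ m) * (?n * ?B x * f (t *\<^sub>R sgn x)) \<partial>lborel)
        = (\<integral>\<^sup>+s. ?P s * ennreal (s ^ m) * (?n * ?B x * ennreal (norm x ^ DIM('a)) * f (s *\<^sub>R x)) \<partial>lborel)"
    proof (cases "x = 0")
      case False
      have "(\<integral>\<^sup>+t. ?P t * ennreal (t ^ m) * (?n * ?B x * f (t *\<^sub>R sgn x)) \<partial>lborel)
          = ennreal \<bar>norm x\<bar> * (\<integral>\<^sup>+s. ?P (0 + norm x * s) * ennreal ((0 + norm x * s) ^ m) * (?n * ?B x * f ((0 + norm x * s) *\<^sub>R sgn x)) \<partial>lborel)"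
        by (rule nn_integral_real_affine) (use False in \<open>measurable, simp\<close>)
      also have "\<dots> = (\<integral>\<^sup>+s. ennreal \<bar>norm x\<bar> * (?P (0 + norm x * s) * ennreal ((0 + norm x * s) ^ m) * (?n * ?B x * f ((0 + norm x * s) *\<^sub>R sgn x))) \<partial>lborel)"
        by (rule nn_integral_cmult[symmetric]) measurable
      also have "\<dots> = (\<integral>\<^sup>+s. ?P s * ennreal (s ^ m) * (?n * ?B x * ennreal (norm x ^ DIM('a)) * f (s *\<^sub>R x)) \<partial>lborel)"
      proof (intro nn_integral_cong)
        fix s :: real
        show "ennreal \<bar>norm x\<bar> * (?P (0 + norm x * s) * ennreal ((0 + norm x * s) ^ m) * (?n * ?B x * f ((0 + norm x * s) *\<^sub>R sgn x)))
            = ?P s * ennreal (s ^ m) * (?n * ?B x * ennreal (norm x ^ DIM('a)) * f (s *\<^sub>R x))"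
        proof (cases "s > 0")
          case True
          have 1: "(0 + norm x * s) *\<^sub>R sgn x = s *\<^sub>R x" using False by (simp add: sgn_div_norm)
          have 2: "ennreal (norm x ^ DIM('a)) = ennreal (norm x) * ennreal (norm x ^ m)"
            by (simp add: dim ennreal_mult')
          have 3: "ennreal ((0 + norm x * s) ^ m) = ennreal (norm x ^ m) * ennreal (s ^ m)"
            using True by (simp add: power_mult_distrib ennreal_mult')
          have 4: "?P (0 + norm x * s) = 1" "?P s = 1" using True False by (auto simp: zero_less_mult_iff)
          show ?thesis unfolding 1 2 3 4 by (simp add: ac_simps)
        qed (use False in \<open>auto simp: indicator_def zero_less_mult_iff\<close>)
      qed
      finally show ?thesis .
    qed auto
  qed
  also have "\<dots> = (\<integral>\<^sup>+s. \<integral>\<^sup>+x. ?P s * ennreal (s ^ m) * (?n * ?B x * ennreal (norm x ^ DIM('a)) * f (s *\<^sub>R x)) \<partial>lborel \<partial>lborel)"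
    by (rule lborel_pair.Fubini'[symmetric]) measurable
  also have "\<dots> = (\<integral>\<^sup>+s. \<integral>\<^sup>+z. ?n * indicator {z. 0 < norm z \<and> norm z \<le> s} z * ennreal (norm z ^ DIM('a)) * f z * ennreal (inverse (s ^ Suc DIM('a))) \<partial>lborel \<partial>lborel)"
  proof (rule nn_integral_cong)
    fix s :: real
    show "(\<integral>\<^sup>+x. ?P s * ennreal (s ^ m) * (?n * ?B x * ennreal (norm x ^ DIM('a)) * f (s *\<^sub>R x)) \<partial>lborel)
        = (\<integral>\<^sup>+z. ?n * indicator {z. 0 < norm z \<and> norm z \<le> s} z * ennreal (norm z ^ DIM('a)) * f z * ennreal (inverse (s ^ Suc DIM('a))) \<partial>lborel)"
    proof (cases "s > 0")
      case False
      have "\<not> (0 < norm z \<and> norm z \<le> s)" for z :: 'a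
        using False by (intro notI, elim conjE) linarith
      then have "indicator {z::'a. 0 < norm z \<and> norm z \<le> s} z = (0::ennreal)" for z
        unfolding indicator_def mem_Collect_eq by (simp only: of_bool_eq)
      then show ?thesis using False by simp
    next
      case True
      have "(\<integral>\<^sup>+z. ?n * indicator {z. 0 < norm z \<and> norm z \<le> s} z * ennreal (norm z ^ DIM('a)) * f z * ennreal (inverse (s ^ Suc DIM('a))) \<partial>lborel)
         = ennreal (s ^ DIM('a)) * (\<integral>\<^sup>+x. ?n * indicator {z. 0 < norm z \<and> norm z \<le> s} (s *\<^sub>R x) * ennreal (norm (s *\<^sub>R x) ^ DIM('a)) * f (s *\<^sub>R x) * ennreal (inverse (s ^ Suc DIM('a))) \<partial>(lborel :: 'a measure))"
        by (rule nn_integral_lborel_scale) (use True in measurable)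
      also have "\<dots> = (\<integral>\<^sup>+x. ennreal (s ^ DIM('a)) * (?n * indicator {z. 0 < norm z \<and> norm z \<le> s} (s *\<^sub>R x) * ennreal (norm (s *\<^sub>R x) ^ DIM('a)) * f (s *\<^sub>R x) * ennreal (inverse (s ^ Suc DIM('a)))) \<partial>(lborel :: 'a measure))"
        by (rule nn_integral_cmult[symmetric]) measurable
      also have "\<dots> = (\<integral>\<^sup>+x. ?P s * ennreal (s ^ m) * (?n * ?B x * ennreal (norm x ^ DIM('a)) * f (s *\<^sub>R x)) \<partial>lborel)"
      proof (intro nn_integral_cong)
        fix x :: 'a
        have 1: "indicator {z. 0 < norm z \<and> norm z \<le> s} (s *\<^sub>R x) = ?B x"
          using True by (auto simp: indicator_def mult_le_cancel_left1)
        have 2: "ennreal (norm (s *\<^sub>R x) ^ DIM('a)) = ennreal (s ^ DIM('a)) * ennreal (norm x ^ DIM('a))"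
          using True by (simp add: power_mult_distrib ennreal_mult')
        have "s ^ DIM('a) * s ^ DIM('a) * inverse (s ^ Suc DIM('a)) = s ^ m"
          using True by (simp add: dim field_simps)
        then have 3: "ennreal (s ^ DIM('a)) * ennreal (s ^ DIM('a)) * ennreal (inverse (s ^ Suc DIM('a))) = ennreal (s ^ m)"
          using True by (simp add: ennreal_mult'[symmetric])
        have 4: "?P s = 1" using True by simp
        show "ennreal (s ^ DIM('a)) * (?n * indicator {z. 0 < norm z \<and> norm z \<le> s} (s *\<^sub>R x) * ennreal (norm (s *\<^sub>R x) ^ DIM('a)) * f (s *\<^sub>R x) * ennreal (inverse (s ^ Suc DIM('a))))
          = ?P s * ennreal (s ^ m) * (?n * ?B x * ennreal (norm x ^ DIM('a)) * f (s *\<^sub>R x))"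
          unfolding 1 2 4 3[symmetric] by (simp only: mult_1_left ac_simps)
      qed
      finally show ?thesis ..
    qed
  qed
  also have "\<dots> = (\<integral>\<^sup>+z. \<integral>\<^sup>+s. ?n * indicator {z. 0 < norm z \<and> norm z \<le> s} z * ennreal (norm z ^ DIM('a)) * f z * ennreal (inverse (s ^ Suc DIM('a))) \<partial>lborel \<partial>lborel)"
  proof (rule lborel_pair.Fubini')
    have "(\<lambda>(z, s). ?n * indicator {z. 0 < norm z \<and> norm z \<le> s} z * ennreal (norm z ^ DIM('a)) * f z * ennreal (inverse (s ^ Suc DIM('a))))
       = (\<lambda>p. ?n * indicator {p. 0 < norm (fst p) \<and> norm (fst p) \<le> snd p} p * ennreal (norm (fst p) ^ DIM('a)) * f (fst p) * ennreal (inverse (snd p ^ Suc DIM('a))))"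
      by (auto simp: fun_eq_iff indicator_def)
    also have "\<dots> \<in> borel_measurable (lborel \<Otimes>\<^sub>M lborel)" by measurable
    finally show "(\<lambda>(z, s). ?n * indicator {z. 0 < norm z \<and> norm z \<le> s} z * ennreal (norm z ^ DIM('a)) * f z * ennreal (inverse (s ^ Suc DIM('a))))
      \<in> borel_measurable (lborel \<Otimes>\<^sub>M lborel)" .
  qed
  also have "\<dots> = (\<integral>\<^sup>+z. f z \<partial>lborel)"
  proof (rule nn_integral_cong_AE)
    have "AE z::'a in lborel. z \<notin> {0}" by (intro AE_not_in) auto
    then show "AE z in lborel. (\<integral>\<^sup>+s. ?n * indicator {z. 0 < norm z \<and> norm z \<le> s} z * ennreal (norm z ^ DIM('a)) * f z * ennreal (inverse (s ^ Suc DIM('a))) \<partial>lborel) = f z"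
    proof eventually_elim
      case (elim z)
      then have nz: "norm z > 0" by simp
      let ?N = "DIM('a)"
      have "(\<integral>\<^sup>+s. ?n * indicator {z. 0 < norm z \<and> norm z \<le> s} z * ennreal (norm z ^ ?N) * f z * ennreal (inverse (s ^ Suc ?N)) \<partial>lborel)
          = (\<integral>\<^sup>+s. (ennreal (norm z ^ ?N) * f z) * (ennreal (real ?N * inverse (s ^ Suc ?N)) * indicator {norm z..} s) \<partial>lborel)"
      proof (intro nn_integral_cong)
        fix s :: real
        show "?n * indicator {z. 0 < norm z \<and> norm z \<le> s} z * ennreal (norm z ^ ?N) * f z * ennreal (inverse (s ^ Suc ?N))
          = (ennreal (norm z ^ ?N) * f z) * (ennreal (real ?N * inverse (s ^ Suc ?N)) * indicator {norm z..} s)"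
          using nz unfolding ennreal_mult'[OF of_nat_0_le_iff]
          by (cases "norm z \<le> s") (simp_all add: indicator_def ac_simps del: power_Suc)
      qed
      also have "\<dots> = (ennreal (norm z ^ ?N) * f z) * (\<integral>\<^sup>+s. ennreal (real ?N * inverse (s ^ Suc ?N)) * indicator {norm z..} s \<partial>lborel)"
        by (rule nn_integral_cmult) measurable
      also have "(\<integral>\<^sup>+s. ennreal (real ?N * inverse (s ^ Suc ?N)) * indicator {norm z..} s \<partial>lborel)
          = ennreal (0 - (- inverse (norm z ^ ?N)))"
      proof (rule nn_integral_FTC_atLeast)
        show "DERIV (\<lambda>s. - inverse (s ^ ?N)) s :> real ?N * inverse (s ^ Suc ?N)" if "norm z \<le> s" for s
        proof -
          have "s > 0" using nz that by linarith
          have "DERIV (\<lambda>s. s ^ Suc m) s :> real (Suc m) * s ^ m"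
            using DERIV_pow[of "Suc m" s] by simp
          from DERIV_minus[OF DERIV_inverse'[OF this]] \<open>s > 0\<close>
          have "DERIV (\<lambda>s. - inverse (s ^ Suc m)) s :> inverse (s ^ Suc m) * (real (Suc m) * s ^ m) * inverse (s ^ Suc m)"
            by simp
          also have "inverse (s ^ Suc m) * (real (Suc m) * s ^ m) * inverse (s ^ Suc m) = real (Suc m) * inverse (s ^ Suc (Suc m))"
            using \<open>s > 0\<close> by (simp add: field_simps)
          finally show ?thesis unfolding dim .
        qed
        have "((\<lambda>s::real. inverse (s ^ ?N)) \<longlongrightarrow> 0) at_top"
          by (intro tendsto_inverse_0_at_top filterlim_pow_at_top filterlim_ident) auto
        from tendsto_minus[OF this] show "((\<lambda>s::real. - inverse (s ^ ?N)) \<longlongrightarrow> 0) at_top" by simp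
      next
        show "0 \<le> real ?N * inverse (s ^ Suc ?N)" if "norm z \<le> s" for s
          using order_trans[OF norm_ge_zero that] by simp
      qed measurable
      also have "ennreal (norm z ^ ?N) * f z * ennreal (0 - (- inverse (norm z ^ ?N))) = f z * ennreal (norm z ^ ?N * inverse (norm z ^ ?N))"
        by (simp add: ennreal_mult' ac_simps)
      also have "norm z ^ ?N * inverse (norm z ^ ?N) = 1" using nz by simp
      finally show ?case by simp
    qed
  qed
  finally show ?thesis ..
qed

section \<open>Lower bound for Hausdorff measure on the sphere by the cone measure\<close>

lemma one_minus_power_ge:
  fixes h :: real
  assumes "0 \<le> h" "h \<le> 1"
  shows "real (Suc m) * h * (1 - h) ^ m \<le> 1 - (1 - h) ^ Suc m"
proof (induction m)
  case (Suc m)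
  have "(1 - h) * (real (Suc m) * h * (1 - h) ^ m) \<le> (1 - h) * (1 - (1 - h) ^ Suc m)"
    using Suc assms by (intro mult_left_mono) auto
  moreover have "h * (1 - h) ^ Suc m \<le> h * 1"
    using assms by (intro mult_left_mono power_le_one) auto
  ultimately show ?case by (simp add: algebra_simps)
qed auto

lemma power_minus_one_le:
  fixes h :: real
  assumes "0 \<le> h"
  shows "(1 + h) ^ Suc m - 1 \<le> real (Suc m) * h * (1 + h) ^ m"
proof (induction m)
  case (Suc m)
  have "(1 + h) * ((1 + h) ^ Suc m - 1) \<le> (1 + h) * (real (Suc m) * h * (1 + h) ^ m)"
    using Suc assms by (intro mult_left_mono) auto
  moreover have "h * 1 \<le> h * (1 + h) ^ Suc m"
    using assms by (intro mult_left_mono one_le_power) auto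
  ultimately show ?case by (simp add: algebra_simps)
qed auto

text \<open>The truncated cone over a piece of diameter \<open>d\<close> of the sphere fits into a cylinder with
  axis through the piece, up to factors tending to 1.\<close>

lemma emeasure_truncated_cone_le:
  fixes C :: "'a::euclidean_space set"
  assumes C: "closed C" "bounded C" and W: "W \<in> sets borel" "W \<subseteq> sphere 0 1" and h: "0 < h" "h < 1"
    and dim: "DIM('a) = Suc m" "m > 0"
  shows "emeasure lborel {x. 1 - h < norm x \<and> norm x \<le> 1 \<and> sgn x \<in> C \<inter> W}
    \<le> ennreal ((1 + h) ^ m * (h + (diameter C)\<^sup>2 / 2)) * ennreal (unit_ball_vol m * (diameter C / 2) ^ m)"
proof (cases "C \<inter> W = {}")
  case False
  then obtain e where e: "e \<in> C" "e \<in> W" by auto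
  have ne: "norm e = 1" using e W by auto
  then have ee: "e \<bullet> e = 1" by (simp add: dot_square_norm)
  define d where "d = diameter C"
  have d0: "d \<ge> 0" using C by (simp add: d_def diameter_ge_0)
  define X where "X = {x. 1 - h < norm x \<and> norm x \<le> 1 \<and> sgn x \<in> C \<inter> W}"
  have [measurable]: "C \<inter> W \<in> sets borel" using C W by auto
  have rep: "\<exists>t y. x = t *\<^sub>R y \<and> 1 - h < t \<and> t \<le> 1 \<and> y \<in> C \<and> norm y = 1" if "x \<in> X" for x
  proof -
    have "norm x \<noteq> 0" using that h by (auto simp: X_def)
    then have "x = norm x *\<^sub>R sgn x" by (simp add: sgn_div_norm)
    moreover have "norm (sgn x) = 1" using that W by (auto simp: X_def)
    ultimately show ?thesis using that by (intro exI[of _ "norm x"] exI[of _ "sgn x"]) (auto simp: X_def)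
  qed
  have dd: "norm (y - y') \<le> d" if "y \<in> C" "y' \<in> C" for y y'
    using diameter_bounded_bound[OF C(2) that] by (simp add: dist_norm d_def)
  have "emeasure lborel X \<le> ennreal (unit_ball_vol (real (DIM('a) - 1)) * ((d * (1 + h)) / 2) ^ (DIM('a) - 1) * (h + d\<^sup>2 / 2))"
  proof (rule emeasure_le_cylinder[OF _ ne])
    show "X \<in> sets borel" unfolding X_def by measurable
    show "DIM('a) \<ge> 2" using dim by simp
    show "0 \<le> d * (1 + h)" "0 \<le> h + d\<^sup>2 / 2" using d0 h by auto
  next
    fix x x' assume "x \<in> X" "x' \<in> X"
    then obtain t y t' y' where ty: "x = t *\<^sub>R y" "1 - h < t" "t \<le> 1" "y \<in> C" "norm y = 1"
      "x' = t' *\<^sub>R y'" "1 - h < t'" "t' \<le> 1" "y' \<in> C" "norm y' = 1"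
      using rep by meson
    \<comment> \<open>Since \<open>perp e e\<close> is 0, e may be subtracted from y', so the change
      of radius contributes h d instead of h.\<close>
    have "perp e (x - x') = t *\<^sub>R perp e (y - y') + (t - t') *\<^sub>R perp e (y' - e)"
      by (simp add: ty perp_diff perp_scaleR perp_self[OF ne] algebra_simps)
    also have "norm \<dots> \<le> \<bar>t\<bar> * norm (perp e (y - y')) + \<bar>t - t'\<bar> * norm (perp e (y' - e))"
      by (metis norm_scaleR norm_triangle_ineq)
    also have "\<dots> \<le> 1 * d + h * d"
      using ty h d0 norm_perp_le[OF ne, of "y - y'"] norm_perp_le[OF ne, of "y' - e"] dd[of y y'] dd[of y' e] e
      by (intro add_mono mult_mono) auto
    finally show "norm (perp e (x - x')) \<le> d * (1 + h)" by (simp add: algebra_simps)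
    \<comment> \<open>For unit vectors y \<bullet> e = 1 - |y - e|^2 / 2, so the curvature of the
      sphere costs d^2 / 2 in height.\<close>
    have ye: "1 - d\<^sup>2 / 2 \<le> y \<bullet> e \<and> y \<bullet> e \<le> 1" if "y \<in> C" "norm y = 1" for y
    proof -
      have "(norm (y - e))\<^sup>2 = 2 - 2 * (y \<bullet> e)"
        using that(2) ee unfolding power2_norm_eq_inner norm_eq_1
        by (simp add: inner_diff inner_commute)
      moreover have "(norm (y - e))\<^sup>2 \<le> d\<^sup>2" using dd[OF that(1) e(1)] by (intro power_mono) auto
      moreover have "(norm (y - e))\<^sup>2 \<ge> 0" by simp
      ultimately show ?thesis by linarith
    qed
    have xe: "1 - h - d\<^sup>2 / 2 \<le> t * (y \<bullet> e) \<and> t * (y \<bullet> e) \<le> 1"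
      if "y \<in> C" "norm y = 1" "1 - h < t" "t \<le> 1" for t y
    proof -
      have t0: "t \<ge> 0" using that h by auto
      have "t * (1 - d\<^sup>2 / 2) \<le> t * (y \<bullet> e)" "t * (y \<bullet> e) \<le> t * 1"
        using ye[OF that(1,2)] t0 by (blast intro: mult_left_mono)+
      moreover have "t * (d\<^sup>2 / 2) \<le> 1 * (d\<^sup>2 / 2)" using that by (intro mult_right_mono) auto
      ultimately show ?thesis using that by (simp add: algebra_simps)
    qed
    show "\<bar>(x - x') \<bullet> e\<bar> \<le> h + d\<^sup>2 / 2"
      using xe[OF ty(4,5,2,3)] xe[OF ty(9,10,7,8)] by (simp add: ty(1,6) inner_diff_left abs_le_iff)
  qed
  also have "\<dots> = ennreal ((1 + h) ^ m * (h + d\<^sup>2 / 2)) * ennreal (unit_ball_vol m * (d / 2) ^ m)"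
    using d0 h by (subst ennreal_mult[symmetric]) (auto simp: dim power_mult_distrib power_divide)
  finally show ?thesis by (simp add: X_def d_def)
qed auto

text \<open>Truncated cones of depth h over the sets of a cover fill the shell over W, and by
  \<open>emeasure_truncated_cone_le\<close> each has volume at most its Hausdorff cost times a
  factor close to h. Comparison with the volume of the shell, about h times the cone measure, gives
  the bound as the scales shrink.\<close>

lemma cone_measure_le_hausdorff:
  fixes W :: "'a::euclidean_space set"
  assumes W: "W \<in> sets borel" "W \<subseteq> sphere 0 1" and dim: "DIM('a) = Suc m" "m > 0"
  shows "emeasure cone_measure W \<le> hausdorff m W"
proof (cases "hausdorff m W < top")
  case False
  then show ?thesis by (simp add: top.not_eq_extremum[symmetric])
next
  case True
  interpret finite_measure "cone_measure :: 'a measure" by (rule finite_measure_cone_measure)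
  define \<eta> where "\<eta> = enn2real (hausdorff m W)"
  have \<eta>: "hausdorff m W = ennreal \<eta>" "\<eta> \<ge> 0" using True by (auto simp: \<eta>_def)
  define s where "s = measure cone_measure W"
  have main: "s * (1 - (1 - h) ^ Suc m) / Suc m \<le> (1 + h) ^ m * (h + \<delta>\<^sup>2 / 2) * \<eta>"
    if h: "0 < h" "h < 1" and \<delta>: "\<delta> > 0" for h \<delta>
  proof -
    let ?c = "(1 + h) ^ m * (h + \<delta>\<^sup>2 / 2)"
    let ?X = "\<lambda>A. {x::'a. 1 - h < norm x \<and> norm x \<le> 1 \<and> sgn x \<in> A}"
    have c: "?c > 0" using h by (intro mult_pos_pos add_pos_nonneg) auto
    then have c': "ennreal ?c \<noteq> 0" "ennreal ?c \<noteq> top" by (simp_all only: ennreal_eq_0_iff not_le ennreal_neq_top not_False_eq_True)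
    have "emeasure lborel (?X W) / ennreal ?c \<le> hausdorff_content m \<delta> W"
    proof (rule le_hausdorff_content)
      fix C :: "nat \<Rightarrow> 'a set"
      assume C: "W \<subseteq> (\<Union>i. C i)" "\<And>i. bounded (C i)" "\<And>i. diameter (C i) \<le> \<delta>"
      \<comment> \<open>Covering sets are arbitrary; their closures are Borel and have the same
        diameter.\<close>
      have [measurable]: "W \<in> sets borel" "closure (C i) \<in> sets borel" for i using W by auto
      have "emeasure lborel (?X W) \<le> emeasure lborel (\<Union>i. ?X (closure (C i) \<inter> W))"
      proof (rule emeasure_mono)
        show "?X W \<subseteq> (\<Union>i. ?X (closure (C i) \<inter> W))" using C(1) closure_subset by blast
        have "?X (closure (C i) \<inter> W) \<in> sets lborel" for i by measurable
        then show "(\<Union>i. ?X (closure (C i) \<inter> W)) \<in> sets lborel" by (intro sets.countable_UN'') auto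
      qed
      also have "\<dots> \<le> (\<Sum>i. emeasure lborel (?X (closure (C i) \<inter> W)))"
        by (intro emeasure_subadditive_countably) auto
      also have "\<dots> \<le> (\<Sum>i. ennreal ?c * hausdorff_cost m (C i))"
      proof (rule suminf_le)
        fix i
        show "emeasure lborel (?X (closure (C i) \<inter> W)) \<le> ennreal ?c * hausdorff_cost m (C i)"
        proof (cases "C i = {}")
          case False
          have d: "diameter (closure (C i)) = diameter (C i)" "diameter (C i) \<ge> 0"
            using C(2) by (auto intro: diameter_closure diameter_ge_0)
          have "emeasure lborel (?X (closure (C i) \<inter> W))
            \<le> ennreal ((1 + h) ^ m * (h + (diameter (C i))\<^sup>2 / 2)) * ennreal (unit_ball_vol m * (diameter (C i) / 2) ^ m)"
            using emeasure_truncated_cone_le[of "closure (C i)" W h m] C(2) W h dim by (simp add: d bounded_closure)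
          also have "\<dots> \<le> ennreal ?c * ennreal (unit_ball_vol m * (diameter (C i) / 2) ^ m)"
            using h d C(3)[of i]
            by (intro mult_right_mono ennreal_leI mult_left_mono add_left_mono divide_right_mono power_mono) auto
          finally show ?thesis using False by (simp add: hausdorff_cost_def)
        qed auto
      qed auto
      finally have "emeasure lborel (?X W) \<le> ennreal ?c * (\<Sum>i. hausdorff_cost m (C i))" by simp
      then have "emeasure lborel (?X W) / ennreal ?c \<le> (\<Sum>i. hausdorff_cost m (C i)) * ennreal ?c / ennreal ?c"
        by (subst mult.commute) (rule divide_right_mono_ennreal)
      then show "emeasure lborel (?X W) / ennreal ?c \<le> (\<Sum>i. hausdorff_cost m (C i))"
        by (simp only: ennreal_mult_divide_eq[OF c'])
    qed
    also have "\<dots> \<le> ennreal \<eta>" unfolding \<eta>(1)[symmetric] by (rule hausdorff_content_le_hausdorff) fact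
    also have "emeasure lborel (?X W) = ennreal (s * (1 - (1 - h) ^ Suc m) / Suc m)"
      using emeasure_shell[of W "1 - h" 1] W h dim by (simp add: s_def)
    finally have "ennreal (s * (1 - (1 - h) ^ Suc m) / Suc m / ?c) \<le> ennreal \<eta>"
      using c h by (subst divide_ennreal[symmetric]) (auto simp: s_def power_le_one mult_nonneg_nonneg simp del: power_Suc)
    then have "s * (1 - (1 - h) ^ Suc m) / Suc m / ?c \<le> \<eta>"
      using \<eta>(2) by simp
    then show ?thesis using c by (simp only: pos_divide_le_eq mult.commute)
  qed
  \<comment> \<open>The error \<delta>^2 / 2 has to vanish against h, so \<delta> tends to 0 first;
    after division by h, h tends to 0.\<close>
  have main2: "s * (1 - h) ^ m \<le> (1 + h) ^ m * \<eta>" if h: "0 < h" "h < 1" for h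
  proof -
    have ev: "\<forall>\<^sub>F \<delta> in at_right 0. s * (1 - (1 - h) ^ Suc m) / Suc m \<le> (1 + h) ^ m * (h + \<delta>\<^sup>2 / 2) * \<eta>"
      unfolding eventually_at_right_field by (rule exI[of _ 1]) (use main[OF h] in auto)
    have "((\<lambda>\<delta>. (1 + h) ^ m * (h + \<delta>\<^sup>2 / 2) * \<eta>) \<longlongrightarrow> (1 + h) ^ m * (h + 0\<^sup>2 / 2) * \<eta>) (at_right 0)"
      by (intro tendsto_intros) auto
    from tendsto_lowerbound[OF this ev]
    have "s * (1 - (1 - h) ^ Suc m) / Suc m \<le> (1 + h) ^ m * h * \<eta>" by simp
    moreover have "s * (real (Suc m) * h * (1 - h) ^ m) / Suc m \<le> s * (1 - (1 - h) ^ Suc m) / Suc m"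
      using h by (intro divide_right_mono mult_left_mono one_minus_power_ge) (auto simp: s_def)
    moreover have "s * (real (Suc m) * h * (1 - h) ^ m) / Suc m = h * (s * (1 - h) ^ m)"
      by (simp add: field_simps del: of_nat_Suc)
    ultimately have "h * (s * (1 - h) ^ m) \<le> h * ((1 + h) ^ m * \<eta>)" by (simp add: ac_simps)
    then show ?thesis using h by simp
  qed
  have ev: "\<forall>\<^sub>F h in at_right 0. s * (1 - h) ^ m \<le> (1 + h) ^ m * \<eta>"
    unfolding eventually_at_right_field by (rule exI[of _ 1]) (use main2 in auto)
  have "s * (1 - 0) ^ m \<le> (1 + 0) ^ m * \<eta>"
    by (rule tendsto_le[OF _ _ _ ev], simp) (intro tendsto_intros)+
  then show ?thesis using \<eta> by (simp add: emeasure_eq_measure s_def)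
qed

section \<open>Upper density bounds and the area of spheres\<close>

text \<open>The content bound is self-improving: a Vitali family of disjoint small balls covers a fixed
  proportion of the content at the price \<open>c0\<close>, so the best constant in the bound is \<open>c0\<close>.\<close>

lemma hausdorff_content_density_step:
  fixes S :: "'a::euclidean_space set" and \<mu> :: "'a measure"
  assumes \<mu>: "sets \<mu> = sets borel" "finite_measure \<mu>" and m: "m > 0" and c0: "c0 > 0" and \<delta>: "\<delta> > 0"
    and dens: "\<And>x. x \<in> S \<Longrightarrow> \<exists>r0>0. \<forall>r. 0 < r \<and> r < r0 \<longrightarrow> unit_ball_vol m * r ^ m \<le> c0 * measure \<mu> (cball x r)"
    and U: "open U"
  obtains a B where "\<And>i. a i \<ge> 0" "\<And>i::nat. closed (B i)" "\<And>i. B i \<subseteq> U" "disjoint_family B"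
    "\<And>i. a i \<le> c0 * measure \<mu> (B i)" "\<And>N. hausdorff_content m \<delta> (\<Union>i<N. B i) \<le> ennreal (\<Sum>i<N. a i)"
    "hausdorff_content m \<delta> (S \<inter> U) \<le> ennreal (5 ^ m) * (\<Sum>i. ennreal (a i))"
proof -
  define w where "w = unit_ball_vol m"
  have w: "w > 0" by (simp add: w_def)
  \<comment> \<open>Pairs of a centre and a radius. Radii up to \<delta> / 10 leave the balls of
    fivefold radius with diameter at most \<delta>.\<close>
  define K where "K = {p. fst p \<in> S \<inter> U \<and> 0 < snd p \<and> snd p \<le> \<delta> / 10 \<and> cball (fst p) (snd p) \<subseteq> U
      \<and> w * snd p ^ m \<le> c0 * measure \<mu> (cball (fst p) (snd p))}"
  have "S \<inter> U \<subseteq> (\<Union>p\<in>K. cball (fst p) (snd p))"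
  proof
    fix x assume x: "x \<in> S \<inter> U"
    from dens[of x] x obtain r0 where r0: "r0 > 0" "\<And>r. 0 < r \<Longrightarrow> r < r0 \<Longrightarrow> w * r ^ m \<le> c0 * measure \<mu> (cball x r)"
      by (auto simp: w_def)
    obtain r1 where r1: "r1 > 0" "cball x r1 \<subseteq> U" using U x open_contains_cball by blast
    define r where "r = min (r0 / 2) (min r1 (\<delta> / 10))"
    have r: "0 < r" "r < r0" "r \<le> r1" "r \<le> \<delta> / 10" using r0(1) r1 \<delta> by (auto simp: r_def)
    then have "(x, r) \<in> K" using x r1 r0(2)[of r] subset_cball[of r r1 x] by (auto simp: K_def)
    then show "x \<in> (\<Union>p\<in>K. cball (fst p) (snd p))" using r by (intro UN_I[of "(x, r)"]) auto
  qed
  then obtain C where C: "countable C" "C \<subseteq> K"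
      "pairwise (\<lambda>i j. disjnt (cball (fst i) (snd i)) (cball (fst j) (snd j))) C"
      "S \<inter> U \<subseteq> (\<Union>p\<in>C. cball (fst p) (5 * snd p))"
    by (rule Vitali_covering_lemma_cballs[where r=snd and B="\<delta> / 10"]) (auto simp: K_def)
  define f where "f = to_nat_on C"
  have finj: "inj_on f C" unfolding f_def using C(1) by (rule inj_on_to_nat_on)
  define q where "q = inv_into C f"
  have q: "q (f p) = p" if "p \<in> C" for p using finj that by (simp add: q_def)
  have qC: "q i \<in> C" if "i \<in> f ` C" for i using that by (auto simp: q)
  define Bk where "Bk k i = (if i \<in> f ` C then cball (fst (q i)) (k * snd (q i)) else {})" for k :: real and i
  define a where "a i = (if i \<in> f ` C then w * snd (q i) ^ m else 0)" for i
  have K: "0 < snd (q i)" "snd (q i) \<le> \<delta> / 10" "cball (fst (q i)) (snd (q i)) \<subseteq> U"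
      "w * snd (q i) ^ m \<le> c0 * measure \<mu> (cball (fst (q i)) (snd (q i)))" if "i \<in> f ` C" for i
    using C(2) qC[OF that] by (auto simp: K_def)
  have cost: "hausdorff_cost m (Bk k i) \<le> ennreal (k ^ m) * ennreal (a i)" and diam: "diameter (Bk k i) \<le> \<delta>"
    if "1 \<le> k" "k \<le> 5" for k i
  proof -
    have "diameter (Bk k i) \<le> 2 * (k * snd (q i)) \<and> hausdorff_cost m (Bk k i) \<le> ennreal (k ^ m) * ennreal (a i)" if i: "i \<in> f ` C"
    proof -
      have d: "diameter (Bk k i) = 2 * (k * snd (q i))"
        using i K(1)[OF i] \<open>1 \<le> k\<close> by (simp add: Bk_def mult_less_0_iff)
      have "hausdorff_cost m (Bk k i) \<le> ennreal (w * (diameter (Bk k i) / 2) ^ m)"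
        by (simp add: hausdorff_cost_def w_def)
      also have "w * (diameter (Bk k i) / 2) ^ m = k ^ m * a i"
        using i by (simp add: d a_def power_mult_distrib)
      also have "ennreal (k ^ m * a i) = ennreal (k ^ m) * ennreal (a i)"
        using \<open>1 \<le> k\<close> by (intro ennreal_mult') auto
      finally show ?thesis using d by simp
    qed
    moreover have "k * snd (q i) \<le> 5 * (\<delta> / 10)" if "i \<in> f ` C"
      using K[OF that] \<open>1 \<le> k\<close> \<open>k \<le> 5\<close> by (intro mult_mono) auto
    ultimately show "hausdorff_cost m (Bk k i) \<le> ennreal (k ^ m) * ennreal (a i)" "diameter (Bk k i) \<le> \<delta>"
      using \<delta> by (force simp: Bk_def)+
  qed
  have bd: "bounded (Bk k i)" for k i by (simp add: Bk_def)
  show ?thesis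
  proof (rule that[of a "Bk 1"])
    show "a i \<ge> 0" for i using K(1)[of i] w by (auto simp: a_def)
    show "closed (Bk 1 i)" for i by (simp add: Bk_def)
    show "Bk 1 i \<subseteq> U" for i using K(3)[of i] by (auto simp: Bk_def)
    show "disjoint_family (Bk 1)"
    proof -
      have "Bk 1 i \<inter> Bk 1 j = {}" if "i \<noteq> j" for i j
      proof (cases "i \<in> f ` C \<and> j \<in> f ` C")
        case True
        then have "q i \<noteq> q j" using that q by auto
        then show ?thesis using True C(3) qC[of i] qC[of j] by (auto simp: Bk_def pairwise_def disjnt_def)
      qed (auto simp: Bk_def)
      then show ?thesis by (auto simp: disjoint_family_on_def)
    qed
    show "a i \<le> c0 * measure \<mu> (Bk 1 i)" for i using K(4)[of i] c0 by (auto simp: a_def Bk_def)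
    have a0: "a i \<ge> 0" for i using K(1)[of i] w by (auto simp: a_def)
    show "hausdorff_content m \<delta> (\<Union>i<N. Bk 1 i) \<le> ennreal (\<Sum>i<N. a i)" for N
    proof -
      have "hausdorff_content m \<delta> (\<Union>i<N. Bk 1 i) \<le> (\<Sum>i. hausdorff_cost m (if i < N then Bk 1 i else {}))"
        using \<delta> bd diam[of 1] by (intro hausdorff_content_le) auto
      also have "\<dots> = (\<Sum>i<N. hausdorff_cost m (Bk 1 i))"
        by (subst suminf_finite[of "{..<N}"]) auto
      also have "\<dots> \<le> (\<Sum>i<N. ennreal (a i))" using cost[of 1] by (intro sum_mono) auto
      also have "\<dots> = ennreal (\<Sum>i<N. a i)" using a0 by (simp add: sum_ennreal)
      finally show ?thesis .
    qed
    have "hausdorff_content m \<delta> (S \<inter> U) \<le> (\<Sum>i. hausdorff_cost m (Bk 5 i))"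
    proof (rule hausdorff_content_le)
      show "S \<inter> U \<subseteq> (\<Union>i. Bk 5 i)"
      proof
        fix x assume "x \<in> S \<inter> U"
        then obtain p where p: "p \<in> C" "x \<in> cball (fst p) (5 * snd p)" using C(4) by blast
        then have "x \<in> Bk 5 (f p)" by (simp add: Bk_def q)
        then show "x \<in> (\<Union>i. Bk 5 i)" by blast
      qed
    qed (use bd diam[of 5] in auto)
    also have "\<dots> \<le> (\<Sum>i. ennreal (5 ^ m) * ennreal (a i))" using cost[of 5] by (intro suminf_le) auto
    finally show "hausdorff_content m \<delta> (S \<inter> U) \<le> ennreal (5 ^ m) * (\<Sum>i. ennreal (a i))" by simp
  qed
qed

text \<open>Bounds Hausdorff measure by a comparison measure with the constant c0 of the density
  hypothesis itself. The Vitali covering alone would give 5^m c0, too weak for the exact area of a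
  sphere.\<close>

lemma hausdorff_le_density:
  fixes S :: "'a::euclidean_space set" and \<mu> :: "'a measure"
  assumes \<mu>: "sets \<mu> = sets borel" "finite_measure \<mu>" and m: "m > 0" and c0: "c0 > 0"
    and dens: "\<And>x. x \<in> S \<Longrightarrow> \<exists>r0>0. \<forall>r. 0 < r \<and> r < r0 \<longrightarrow> unit_ball_vol m * r ^ m \<le> c0 * measure \<mu> (cball x r)"
  shows "hausdorff m S \<le> ennreal (c0 * measure \<mu> UNIV)"
proof (rule hausdorff_le)
  fix \<delta> :: real assume \<delta>: "\<delta> > 0"
  interpret finite_measure \<mu> by fact
  note step = hausdorff_content_density_step[OF \<mu> m c0 \<delta> dens]
  let ?X = "\<lambda>U. hausdorff_content m \<delta> (S \<inter> U)"
  \<comment> \<open>Half of 1 / 5^m: the weights of the whole family add up to at least x U / 5^m,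
    so finitely many of them already reach half of that.\<close>
  let ?t = "1 / (2 * 5 ^ m) :: real"
  have sp: "space \<mu> = UNIV" using sets_eq_imp_space_eq[OF \<mu>(1)] by simp
  have sumle: "(\<Sum>i<N. measure \<mu> (B i)) \<le> measure \<mu> U"
    if "open U" "\<And>i. B i \<subseteq> U" "disjoint_family B" "\<And>i. closed (B i)" for U N and B :: "nat \<Rightarrow> 'a set"
  proof -
    have "(\<Sum>i<N. measure \<mu> (B i)) = measure \<mu> (\<Union>i<N. B i)"
      using that \<mu>(1) by (intro finite_measure_finite_Union[symmetric]) (auto intro: disjoint_family_on_mono)
    also have "\<dots> \<le> measure \<mu> U" using that \<mu>(1) by (intro finite_measure_mono) auto
    finally show ?thesis .
  qed
  have fin: "?X U \<le> ennreal (5 ^ m * c0 * measure \<mu> U)" if U: "open U" for U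
  proof -
    from step[OF _ U] obtain a B where aB: "\<And>i. a i \<ge> 0" "\<And>i::nat. closed (B i)" "\<And>i. B i \<subseteq> U" "disjoint_family B"
      "\<And>i. a i \<le> c0 * measure \<mu> (B i)" "\<And>N. hausdorff_content m \<delta> (\<Union>i<N. B i) \<le> ennreal (\<Sum>i<N. a i)"
      "?X U \<le> ennreal (5 ^ m) * (\<Sum>i. ennreal (a i))" by metis
    have "(\<Sum>i. ennreal (a i)) \<le> ennreal (c0 * measure \<mu> U)"
    proof (rule suminf_le_const)
      fix N
      have "(\<Sum>i<N. ennreal (a i)) = ennreal (\<Sum>i<N. a i)" using aB(1) by (simp add: sum_ennreal)
      also have "\<dots> \<le> ennreal (\<Sum>i<N. c0 * measure \<mu> (B i))" by (intro ennreal_leI sum_mono aB)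
      also have "\<dots> \<le> ennreal (c0 * measure \<mu> U)"
        using sumle[OF U aB(3,4,2), of N] c0 unfolding sum_distrib_left[symmetric] by (intro ennreal_leI mult_left_mono) auto
      finally show "(\<Sum>i<N. ennreal (a i)) \<le> ennreal (c0 * measure \<mu> U)" .
    qed auto
    then have "?X U \<le> ennreal (5 ^ m) * ennreal (c0 * measure \<mu> U)"
      by (intro order_trans[OF aB(7)] mult_left_mono) auto
    then show ?thesis using c0 by (simp add: ennreal_mult'[symmetric] mult.assoc)
  qed
  define x where "x U = enn2real (?X U)" for U
  have x: "?X U = ennreal (x U)" "x U \<ge> 0" if "open U" for U
    using fin[OF that] le_less_trans[OF fin[OF that] ennreal_less_top] by (auto simp: x_def less_top)
  \<comment> \<open>The finitely many balls are paid at the price c0, and what is left of S lies in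
    the open set V, where the constant c still applies.\<close>
  have impr: "x U * (1 + ?t * (c / c0 - 1)) \<le> c * measure \<mu> U"
    if U: "open U" and c: "c \<ge> c0" and hyp: "\<And>U. open U \<Longrightarrow> x U \<le> c * measure \<mu> U" for U c
  proof (cases "x U = 0")
    case True
    then show ?thesis using c c0 by auto
  next
    case False
    then have xpos: "x U > 0" using x[OF U] by auto
    from step[OF _ U] obtain a B where aB: "\<And>i. a i \<ge> 0" "\<And>i::nat. closed (B i)" "\<And>i. B i \<subseteq> U" "disjoint_family B"
      "\<And>i. a i \<le> c0 * measure \<mu> (B i)" "\<And>N. hausdorff_content m \<delta> (\<Union>i<N. B i) \<le> ennreal (\<Sum>i<N. a i)"
      "?X U \<le> ennreal (5 ^ m) * (\<Sum>i. ennreal (a i))" by metis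
    have "\<exists>N. x U * ?t \<le> (\<Sum>i<N. a i)"
    proof (rule ccontr)
      assume "\<not> ?thesis"
      then have "(\<Sum>i. ennreal (a i)) \<le> ennreal (x U * ?t)"
        using aB(1) by (intro suminf_le_const) (auto simp: not_le intro!: ennreal_leI intro: less_imp_le)
      then have "ennreal (x U) \<le> ennreal (5 ^ m) * ennreal (x U * ?t)"
        unfolding x(1)[OF U, symmetric] by (intro order_trans[OF aB(7)] mult_left_mono) auto
      also have "\<dots> = ennreal (x U / 2)" by (simp add: ennreal_mult'[symmetric])
      finally show False using xpos by simp
    qed
    then obtain N where N: "x U * ?t \<le> (\<Sum>i<N. a i)" by blast
    define Y where "Y = (\<Sum>i<N. a i)"
    define V where "V = U - (\<Union>i<N. B i)"
    have V: "open V" unfolding V_def using U aB(2) by (intro open_Diff closed_UN) auto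
    have "?X U \<le> hausdorff_content m \<delta> ((\<Union>i<N. B i) \<union> (S \<inter> V))"
      by (rule hausdorff_content_mono) (auto simp: V_def)
    also have "\<dots> \<le> ennreal Y + ennreal (x V)"
      unfolding Y_def x(1)[OF V, symmetric]
      using \<delta> by (intro order_trans[OF hausdorff_content_Un] add_mono aB) auto
    also have "\<dots> = ennreal (Y + x V)"
      using aB(1) x[OF V] by (intro ennreal_plus[symmetric]) (auto simp: Y_def intro!: sum_nonneg)
    finally have "ennreal (x U) \<le> ennreal (Y + x V)" unfolding x(1)[OF U] .
    then have "x U \<le> Y + x V"
      by (rule iffD1[OF ennreal_le_iff, rotated])
         (use x(2)[OF V] aB(1) in \<open>auto simp: Y_def intro!: sum_nonneg add_nonneg_nonneg\<close>)
    also have "\<dots> \<le> Y + c * measure \<mu> V" using hyp[OF V] by simp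
    also have "measure \<mu> V = measure \<mu> U - (\<Sum>i<N. measure \<mu> (B i))"
    proof -
      have "measure \<mu> V = measure \<mu> U - measure \<mu> (\<Union>i<N. B i)"
        unfolding V_def using aB(2,3) U \<mu>(1) by (intro finite_measure_Diff) auto
      moreover have "B ` {..<N} \<subseteq> sets \<mu>" using aB(2) \<mu>(1) by auto
      moreover have "disjoint_family_on B {..<N}" using aB(4) by (rule disjoint_family_on_mono[rotated]) simp
      ultimately show ?thesis by (simp add: finite_measure_finite_Union)
    qed
    also have "Y + c * (measure \<mu> U - (\<Sum>i<N. measure \<mu> (B i))) \<le> Y + c * (measure \<mu> U - Y / c0)"
    proof -
      have "Y \<le> (\<Sum>i<N. c0 * measure \<mu> (B i))" unfolding Y_def by (intro sum_mono aB)
      then have "Y / c0 \<le> (\<Sum>i<N. measure \<mu> (B i))"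
        using c0 by (simp add: sum_distrib_left[symmetric] pos_divide_le_eq mult.commute)
      then show ?thesis using c c0 by (intro add_left_mono mult_left_mono) auto
    qed
    finally have "x U + Y * (c / c0 - 1) \<le> c * measure \<mu> U" by (simp add: algebra_simps)
    moreover have "x U * ?t * (c / c0 - 1) \<le> Y * (c / c0 - 1)"
      using N c c0 by (intro mult_right_mono) (auto simp: Y_def)
    ultimately show ?thesis by (simp add: algebra_simps)
  qed
  define Kc where "Kc = {c. c0 \<le> c \<and> (\<forall>U. open U \<longrightarrow> x U \<le> c * measure \<mu> U)}"
  have "5 ^ m * c0 \<in> Kc"
  proof -
    have "c0 \<le> 5 ^ m * c0" using c0 by simp
    moreover have "x U \<le> 5 ^ m * c0 * measure \<mu> U" if "open U" for U
      using fin[OF that] c0 unfolding x(1)[OF that] by (subst (asm) ennreal_le_iff) auto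
    ultimately show ?thesis by (simp add: Kc_def)
  qed
  then have ne: "Kc \<noteq> {}" by auto
  have bb: "bdd_below Kc" by (auto simp: Kc_def bdd_below_def)
  define c where "c = Inf Kc"
  have cc0: "c \<ge> c0" unfolding c_def using ne by (intro cInf_greatest) (auto simp: Kc_def)
  have cK: "x U \<le> c * measure \<mu> U" if U: "open U" for U
  proof (rule field_le_epsilon)
    fix e :: real assume e: "e > 0"
    define e' where "e' = e / (measure \<mu> U + 1)"
    have e': "e' > 0" using e by (auto simp: e'_def intro!: divide_pos_pos add_nonneg_pos)
    then have "Inf Kc < c + e'" by (simp add: c_def)
    then obtain d where d: "d \<in> Kc" "d < c + e'" using ne bb cInf_less_iff by blast
    have "x U \<le> d * measure \<mu> U" using d U by (auto simp: Kc_def)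
    also have "\<dots> \<le> (c + e') * measure \<mu> U" using d by (intro mult_right_mono) auto
    also have "(c + e') * measure \<mu> U \<le> c * measure \<mu> U + e"
    proof -
      have "measure \<mu> U + 1 > 0" by (simp add: add_nonneg_pos)
      then have "e' * (measure \<mu> U + 1) = e" by (simp add: e'_def)
      moreover have "e' * measure \<mu> U \<le> e' * (measure \<mu> U + 1)" using e' by (intro mult_left_mono) auto
      ultimately show ?thesis by (simp add: distrib_right)
    qed
    finally show "x U \<le> c * measure \<mu> U + e" .
  qed
  \<comment> \<open>By \<open>impr\<close> the best constant c may be replaced by c / D, and c0
    \<le> c / D keeps c / D among the admissible constants. As c is their infimum, D = 1, that is, c
    = c0.\<close>
  define D where "D = 1 + ?t * (c / c0 - 1)"
  have "c / c0 \<ge> 1" using cc0 c0 by simp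
  then have D1: "D \<ge> 1" by (simp add: D_def)
  have "?t * (c / c0 - 1) \<le> 1 * (c / c0 - 1)"
    using \<open>c / c0 \<ge> 1\<close> by (intro mult_right_mono) (auto simp: field_simps intro: order_trans[OF one_le_power[of "5::real" m]])
  then have "D \<le> c / c0" by (simp add: D_def)
  then have "c0 * D \<le> c" using c0 by (simp add: pos_le_divide_eq mult.commute)
  then have "c0 \<le> c / D" using D1 by (simp add: pos_le_divide_eq)
  moreover have "x U \<le> c / D * measure \<mu> U" if "open U" for U
    using impr[OF that cc0 cK, folded D_def] D1 by (simp add: pos_le_divide_eq)
  ultimately have "c / D \<in> Kc" by (auto simp: Kc_def)
  then have "c \<le> c / D" unfolding c_def using bb by (intro cInf_lower)
  then have "c * D \<le> c" using D1 by (simp add: pos_le_divide_eq)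
  then have "D \<le> 1" using cc0 c0 by (simp add: mult_le_cancel_left1)
  then have "(c / c0 - 1) / (2 * 5 ^ m) \<le> 0" by (simp add: D_def)
  moreover have "(2 * 5 ^ m :: real) > 0" by simp
  ultimately have "c / c0 - 1 \<le> 0" by (meson divide_pos_pos not_le)
  then have "c \<le> c0" using c0 by (simp add: divide_le_eq)
  then have "x UNIV \<le> c0 * measure \<mu> UNIV" using cK[of UNIV] cc0 by simp
  then show "hausdorff_content m \<delta> S \<le> ennreal (c0 * measure \<mu> UNIV)"
    using x(1)[of UNIV] by (simp add: ennreal_leI)
qed

text \<open>A line parallel to the axis at distance a from it meets the upper half of the shell 1 <
  |z| \<le> 1 + h in length s2 - s1 = ((1 + h)^2 - 1) / (s1 + s2), and both roots are at most
  sqrt((1 + h)^2 - \<rho>1^2) when a \<ge> \<rho>1. For small h the factor is close to h / sqrt(1 -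
  \<rho>1^2), which is h times the slope factor of the sphere at distance \<rho>1.\<close>

lemma emeasure_shell_cylinder_ge:
  fixes e :: "'a::euclidean_space"
  assumes e: "norm e = 1" and A[measurable]: "A \<in> sets borel" "A \<subseteq> {\<rho>1..1}" and \<rho>1: "0 \<le> \<rho>1" "\<rho>1 \<le> 1" and h: "h > 0"
  shows "ennreal ((2 * h + h\<^sup>2) / (2 * sqrt ((1 + h)\<^sup>2 - \<rho>1\<^sup>2))) * slab_vol e (\<lambda>y. norm y \<in> A)
    \<le> emeasure lborel {z. norm (perp e z) \<in> A \<and> 0 \<le> z \<bullet> e \<and> 1 < norm z \<and> norm z \<le> 1 + h}"
    (is "ennreal ?c * _ \<le> emeasure lborel ?P")
proof -
  let ?I = "\<lambda>y. indicator {y. 0 \<le> y \<bullet> e \<and> y \<bullet> e \<le> 1} y :: ennreal"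
  have ee: "e \<bullet> e = 1" using e by (simp add: dot_square_norm)
  have P[measurable]: "?P \<in> sets borel" by measurable
  have hh: "(1 + h)\<^sup>2 - 1 = 2 * h + h\<^sup>2" by (simp add: power2_eq_square algebra_simps)
  have "ennreal ?c * slab_vol e (\<lambda>y. norm y \<in> A)
      = (\<integral>\<^sup>+y. ennreal ?c * indicator {y. norm (perp e y) \<in> A \<and> 0 \<le> y \<bullet> e \<and> y \<bullet> e \<le> 1} y \<partial>lborel)"
    unfolding slab_vol_def by (rule nn_integral_cmult_indicator[symmetric]) measurable
  also have "\<dots> \<le> (\<integral>\<^sup>+y. ?I y * (\<integral>\<^sup>+s. indicator ?P (y + s *\<^sub>R e) \<partial>lborel) \<partial>lborel)"
  proof (rule nn_integral_mono)
    fix y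
    show "ennreal ?c * indicator {y. norm (perp e y) \<in> A \<and> 0 \<le> y \<bullet> e \<and> y \<bullet> e \<le> 1} y
      \<le> ?I y * (\<integral>\<^sup>+s. indicator ?P (y + s *\<^sub>R e) \<partial>lborel)"
    proof (cases "norm (perp e y) \<in> A")
      case True
      define a where "a = norm (perp e y)"
      have a: "\<rho>1 \<le> a" "a \<le> 1" "a \<ge> 0" using True A(2) \<rho>1 by (auto simp: a_def)
      have a2: "\<rho>1\<^sup>2 \<le> a\<^sup>2" "a\<^sup>2 \<le> 1" using a \<rho>1 by (auto intro: power_mono power_le_one)
      have h2: "(1 + h)\<^sup>2 > 1" using h by (intro one_less_power) auto
      define s1 where "s1 = sqrt (1 - a\<^sup>2)"
      define s2 where "s2 = sqrt ((1 + h)\<^sup>2 - a\<^sup>2)"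
      define s3 where "s3 = sqrt ((1 + h)\<^sup>2 - \<rho>1\<^sup>2)"
      have s: "0 \<le> s1" "s1 < s2" "s2 \<le> s3" unfolding s1_def s2_def s3_def using a2 h2 by auto
      have sq: "s1\<^sup>2 = 1 - a\<^sup>2" "s2\<^sup>2 = (1 + h)\<^sup>2 - a\<^sup>2" unfolding s1_def s2_def using a2 h2 by auto
      have "(s2 - s1) * (s2 + s1) = 2 * h + h\<^sup>2"
        using sq hh by (simp add: power2_eq_square algebra_simps)
      then have "s2 - s1 = (2 * h + h\<^sup>2) / (s2 + s1)" using s by (simp add: field_simps)
      also have "\<dots> \<ge> (2 * h + h\<^sup>2) / (2 * s3)" using s h by (intro divide_left_mono) auto
      finally have "?c \<le> s2 - s1" by (simp add: s3_def)
      then have "ennreal ?c \<le> emeasure lborel {s1 - y \<bullet> e <.. s2 - y \<bullet> e}" using s by (simp add: ennreal_leI)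
      also have "\<dots> = (\<integral>\<^sup>+s. indicator {s1 - y \<bullet> e <.. s2 - y \<bullet> e} s \<partial>lborel)" by simp
      also have "\<dots> \<le> (\<integral>\<^sup>+s. indicator ?P (y + s *\<^sub>R e) \<partial>lborel)"
      proof (rule nn_integral_mono)
        fix s
        have "y + s *\<^sub>R e \<in> ?P" if "s \<in> {s1 - y \<bullet> e <.. s2 - y \<bullet> e}"
        proof -
          let ?z = "y + s *\<^sub>R e"
          have pz: "perp e ?z = perp e y" by (simp add: perp_add perp_scaleR perp_self[OF e])
          have ze: "?z \<bullet> e = y \<bullet> e + s" by (simp add: inner_add_left ee)
          have b: "s1 < ?z \<bullet> e" "?z \<bullet> e \<le> s2" using that ze by auto
          have "s1\<^sup>2 < (?z \<bullet> e)\<^sup>2" "(?z \<bullet> e)\<^sup>2 \<le> s2\<^sup>2" using b s by (auto intro!: power_strict_mono power_mono)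
          moreover have "a\<^sup>2 + (?z \<bullet> e)\<^sup>2 = (norm ?z)\<^sup>2" using norm_perp_sq[OF e, of ?z] pz by (simp add: a_def)
          ultimately have "1 < (norm ?z)\<^sup>2" "(norm ?z)\<^sup>2 \<le> (1 + h)\<^sup>2" using sq by auto
          then have "1 < norm ?z" "norm ?z \<le> 1 + h"
            using h by (auto intro: power2_le_imp_le power2_less_imp_less[of 1])
          then show ?thesis using b s True pz by auto
        qed
        then show "indicator {s1 - y \<bullet> e <.. s2 - y \<bullet> e} s \<le> (indicator ?P (y + s *\<^sub>R e) :: ennreal)"
          by (auto simp: indicator_def)
      qed
      finally show ?thesis by (auto simp: indicator_def)
    qed auto
  qed
  also have "\<dots> = (\<integral>\<^sup>+z. indicator ?P z \<partial>lborel)"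
    using e by (intro nn_integral_slab_lines[symmetric] borel_measurable_indicator P)
  also have "\<dots> = emeasure lborel ?P" by (rule nn_integral_indicator) simp
  finally show ?thesis .
qed

definition cap :: "'a::euclidean_space \<Rightarrow> real \<Rightarrow> 'a set" where
  "cap e \<rho> = {y. norm y = 1 \<and> 0 \<le> y \<bullet> e \<and> norm (perp e y) \<le> \<rho>}"

lemma cap_measurable [measurable]: "cap e \<rho> \<in> sets borel"
  unfolding cap_def by measurable

text \<open>The cap lies over its flat shadow with area density 1 / sqrt(1 - a^2) at distance a from
  the axis. Bounding this below by 1 for a \<le> \<rho>/2 and by its value at \<rho>/2 beyond
  already makes the cap strictly larger than the disc.\<close>

lemma disc_less_cone_measure_cap:
  fixes e :: "'a::euclidean_space"
  assumes e: "norm e = 1" and \<rho>: "0 < \<rho>" "\<rho> \<le> 1" and dim: "DIM('a) = Suc m" "m > 0"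
  shows "unit_ball_vol m * \<rho> ^ m < measure cone_measure (cap e \<rho>)"
proof -
  define w where "w = unit_ball_vol m * \<rho> ^ m"
  \<comment> \<open>The fraction of the disc that lies within radius \<rho>/2.\<close>
  define \<theta> where "\<theta> = (1/2 :: real) ^ m"
  have w: "w > 0" using \<rho> by (simp add: w_def)
  have \<theta>: "0 < \<theta>" "\<theta> < 1" using dim by (auto simp: \<theta>_def power_less_one_iff)
  define s where "s = measure cone_measure (cap e \<rho>)"
  have s0: "s \<ge> 0" by (simp add: s_def)
  \<comment> \<open>The lower bound for the volume of the shell over the cap, divided by h so that h
    can tend to 0.\<close>
  let ?f = "\<lambda>h. w * (\<theta> * ((2 + h) / (2 * sqrt ((1 + h)\<^sup>2 - 0\<^sup>2))) + (1 - \<theta>) * ((2 + h) / (2 * sqrt ((1 + h)\<^sup>2 - (\<rho>/2)\<^sup>2))))"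
  have main: "?f h \<le> s * (1 + h) ^ m" if h: "h > 0" for h
  proof -
    define P where "P A = {z. norm (perp e z) \<in> A \<and> 0 \<le> z \<bullet> e \<and> 1 < norm z \<and> norm z \<le> 1 + h}" for A
    have [measurable]: "P A \<in> sets borel" if [measurable]: "A \<in> sets borel" for A
      unfolding P_def by measurable
    have v1: "slab_vol e (\<lambda>y. norm y \<in> {0..\<rho>/2}) = ennreal (\<theta> * w)"
      using slab_vol_disc_pos[OF e, of "\<rho>/2"] \<rho>
      by (simp add: dim w_def \<theta>_def power_divide field_simps)
    have v2: "slab_vol e (\<lambda>y. norm y \<in> {\<rho>/2<..\<rho>}) = ennreal ((1 - \<theta>) * w)"
    proof -
      have "slab_vol e (\<lambda>y. norm y \<in> {\<rho>/2<..\<rho>}) = slab_vol e (\<lambda>y. norm y \<le> \<rho>) - slab_vol e (\<lambda>y. norm y \<in> {0..\<rho>/2})"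
        unfolding slab_vol_def
      proof (subst emeasure_Diff[symmetric])
        show "emeasure lborel {y. norm (perp e y) \<in> {0..\<rho>/2} \<and> 0 \<le> y \<bullet> e \<and> y \<bullet> e \<le> 1} \<noteq> \<infinity>"
          using v1 by (simp add: slab_vol_def)
      qed (use \<rho> in \<open>auto intro!: arg_cong[where f="emeasure lborel"]\<close>)
      also have "\<dots> = ennreal w - ennreal (\<theta> * w)"
        unfolding v1 using slab_vol_disc_pos[OF e, of \<rho>] \<rho> by (simp add: dim w_def)
      also have "\<dots> = ennreal ((1 - \<theta>) * w)" using w \<theta> by (subst ennreal_minus) (auto simp: algebra_simps)
      finally show ?thesis .
    qed
    define c1 where "c1 = (2 * h + h\<^sup>2) / (2 * sqrt ((1 + h)\<^sup>2 - 0\<^sup>2))"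
    define c2 where "c2 = (2 * h + h\<^sup>2) / (2 * sqrt ((1 + h)\<^sup>2 - (\<rho>/2)\<^sup>2))"
    have "(\<rho>/2)\<^sup>2 \<le> 1" using \<rho> by (intro power_le_one) auto
    moreover have "(1 + h)\<^sup>2 > 1" using h by (intro one_less_power) auto
    ultimately have "(\<rho>/2)\<^sup>2 \<le> (1 + h)\<^sup>2" by linarith
    then have cp: "c1 \<ge> 0" "c2 \<ge> 0"
      using h unfolding c1_def c2_def by (auto intro!: divide_nonneg_nonneg add_nonneg_nonneg simp del: power_divide)
    have "ennreal (c1 * (\<theta> * w) + c2 * ((1 - \<theta>) * w)) = ennreal c1 * ennreal (\<theta> * w) + ennreal c2 * ennreal ((1 - \<theta>) * w)"
      using cp w \<theta> by (subst ennreal_plus) (auto simp: ennreal_mult')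
    also have "\<dots> \<le> emeasure lborel (P {0..\<rho>/2}) + emeasure lborel (P {\<rho>/2<..\<rho>})"
      unfolding v1[symmetric] v2[symmetric] c1_def c2_def P_def
      using \<rho> h by (intro add_mono emeasure_shell_cylinder_ge[OF e]) auto
    also have "\<dots> = emeasure lborel (P {0..\<rho>/2} \<union> P {\<rho>/2<..\<rho>})"
      by (rule plus_emeasure) (auto simp: P_def)
    also have "\<dots> \<le> emeasure lborel {x. 1 < norm x \<and> norm x \<le> 1 + h \<and> sgn x \<in> cap e \<rho>}"
    proof (rule emeasure_mono)
      show "P {0..\<rho>/2} \<union> P {\<rho>/2<..\<rho>} \<subseteq> {x. 1 < norm x \<and> norm x \<le> 1 + h \<and> sgn x \<in> cap e \<rho>}"
      proof
        fix z assume z: "z \<in> P {0..\<rho>/2} \<union> P {\<rho>/2<..\<rho>}"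
        then have z1: "norm z > 1" "norm (perp e z) \<le> \<rho>" "0 \<le> z \<bullet> e" "norm z \<le> 1 + h" using \<rho> by (auto simp: P_def)
        have "norm (sgn z) = 1" using z1 by (auto simp: norm_sgn)
        moreover have "0 \<le> sgn z \<bullet> e" using z1 by (auto simp: sgn_div_norm)
        moreover have "norm (perp e (sgn z)) \<le> \<rho>"
        proof -
          have "norm (perp e (sgn z)) = norm (perp e z) / norm z"
            by (simp add: sgn_div_norm perp_scaleR divide_inverse mult.commute)
          also have "\<dots> \<le> norm (perp e z) / 1" using z1 by (intro divide_left_mono) auto
          finally show ?thesis using z1 by simp
        qed
        ultimately show "z \<in> {x. 1 < norm x \<and> norm x \<le> 1 + h \<and> sgn x \<in> cap e \<rho>}" using z1 by (simp add: cap_def)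
      qed
    qed measurable
    also have "\<dots> = ennreal (s * ((1 + h) ^ Suc m - 1) / Suc m)"
      using emeasure_shell[of "cap e \<rho>" 1 "1 + h"] h by (simp add: dim s_def)
    finally have "c1 * (\<theta> * w) + c2 * ((1 - \<theta>) * w) \<le> s * ((1 + h) ^ Suc m - 1) / Suc m"
      using h by (subst (asm) ennreal_le_iff) (auto simp: s_def one_le_power simp del: power_Suc intro!: divide_nonneg_nonneg mult_nonneg_nonneg)
    also have "\<dots> \<le> s * (real (Suc m) * h * (1 + h) ^ m) / Suc m"
      using h s0 by (intro divide_right_mono mult_left_mono power_minus_one_le) auto
    also have "\<dots> = h * (s * (1 + h) ^ m)" by (simp add: field_simps del: of_nat_Suc)
    also have "c1 * (\<theta> * w) + c2 * ((1 - \<theta>) * w) = h * ?f h"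
      by (simp add: c1_def c2_def power2_eq_square field_simps add_divide_distrib)
    finally show ?thesis using h by (simp only: mult_le_cancel_left_pos)
  qed
  have "\<forall>\<^sub>F h in at_right 0. ?f h \<le> s * (1 + h) ^ m"
    unfolding eventually_at_right_field by (rule exI[of _ 1]) (use main in auto)
  moreover have r4: "(\<rho>/2)\<^sup>2 < 1" using \<rho> power_strict_mono[of "\<rho>/2" 1 2] by simp
  then have "(?f \<longlongrightarrow> ?f 0) (at_right 0)"
    by (intro tendsto_intros) auto
  moreover have "((\<lambda>h. s * (1 + h) ^ m) \<longlongrightarrow> s * (1 + 0) ^ m) (at_right 0)"
    by (intro tendsto_intros)
  ultimately have "?f 0 \<le> s * (1 + 0) ^ m"
    by (intro tendsto_le[of "at_right 0"]) auto
  moreover have "w < ?f 0"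
  proof -
    have q: "0 < sqrt (1 - (\<rho>/2)\<^sup>2)" "sqrt (1 - (\<rho>/2)\<^sup>2) < 1" using r4 \<rho> by auto
    have "\<theta> * 1 + (1 - \<theta>) * 1 < \<theta> * 1 + (1 - \<theta>) * (1 / sqrt (1 - (\<rho>/2)\<^sup>2))"
      using q \<theta> by (intro add_strict_left_mono mult_strict_left_mono) (auto simp: less_divide_eq)
    then have "w * 1 < w * (\<theta> * 1 + (1 - \<theta>) * (1 / sqrt (1 - (\<rho>/2)\<^sup>2)))"
      using w by (intro mult_strict_left_mono) auto
    then show ?thesis by (simp add: field_simps)
  qed
  ultimately have "w < s * (1 + 0) ^ m" by linarith
  then show ?thesis by (simp add: s_def w_def)
qed

text \<open>A unit vector at distance d from x has inner product 1 - d^2/2 with x, hence distance d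
  sqrt(1 - d^2/4) from the axis through x.\<close>

lemma cap_subset_cball:
  fixes x :: "'a::euclidean_space"
  assumes x: "norm x = 1" and d: "0 \<le> d" "d \<le> 1"
  shows "cap x (d * sqrt (1 - d\<^sup>2 / 4)) \<subseteq> cball x d"
proof
  fix y assume y: "y \<in> cap x (d * sqrt (1 - d\<^sup>2 / 4))"
  then have ny: "norm y = 1" "0 \<le> y \<bullet> x" "norm (perp x y) \<le> d * sqrt (1 - d\<^sup>2 / 4)" by (auto simp: cap_def)
  have d2: "d\<^sup>2 \<le> 1" using d by (simp add: power_le_one)
  have "(norm (perp x y))\<^sup>2 \<le> (d * sqrt (1 - d\<^sup>2 / 4))\<^sup>2" using ny by (intro power_mono) auto
  also have "\<dots> = d\<^sup>2 * (1 - d\<^sup>2 / 4)" using d2 by (simp add: power_mult_distrib)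
  finally have "(y \<bullet> x)\<^sup>2 \<ge> 1 - d\<^sup>2 * (1 - d\<^sup>2 / 4)" using norm_perp_sq[OF x, of y] ny(1) by simp
  also have "1 - d\<^sup>2 * (1 - d\<^sup>2 / 4) = (1 - d\<^sup>2 / 2)\<^sup>2" by (simp add: power2_eq_square algebra_simps)
  finally have "1 - d\<^sup>2 / 2 \<le> y \<bullet> x" using ny(2) by (rule power2_le_imp_le)
  moreover have "(norm (x - y))\<^sup>2 = 2 - 2 * (y \<bullet> x)"
    using x ny(1) unfolding power2_norm_eq_inner norm_eq_1 by (simp add: inner_diff inner_commute)
  ultimately have "(norm (x - y))\<^sup>2 \<le> d\<^sup>2" by simp
  then show "y \<in> cball x d" using d by (auto simp: dist_norm intro: power2_le_imp_le)
qed

text \<open>A ball of radius d about a point of the sphere contains a cap of shadow radius d sqrt(1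
  - d^2/4), whose cone measure exceeds the area of its shadow. The ratio of the two radii tends to
  1, so every constant c0 > 1 is admissible in \<open>hausdorff_le_density\<close>.\<close>

lemma hausdorff_unit_sphere_le:
  assumes dim: "DIM('a::euclidean_space) = Suc m" "m > 0"
  shows "hausdorff m (sphere (0::'a) 1) \<le> emeasure cone_measure (UNIV :: 'a set)"
proof -
  interpret finite_measure "cone_measure :: 'a measure" by (rule finite_measure_cone_measure)
  let ?\<sigma> = "measure cone_measure (UNIV :: 'a set)"
  have *: "hausdorff m (sphere (0::'a) 1) \<le> ennreal (c0 * ?\<sigma>)" if c0: "c0 > 1" for c0
  proof (rule hausdorff_le_density[OF sets_cone_measure finite_measure_cone_measure dim(2)])
    fix x :: 'a assume x: "x \<in> sphere 0 1"
    have "((\<lambda>d. c0 * sqrt (1 - d\<^sup>2 / 4) ^ m) \<longlongrightarrow> c0 * sqrt (1 - 0\<^sup>2 / 4) ^ m) (at_right 0)"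
      by (intro tendsto_intros) auto
    then have "((\<lambda>d. c0 * sqrt (1 - d\<^sup>2 / 4) ^ m) \<longlongrightarrow> c0) (at_right 0)" by simp
    from order_tendstoD(1)[OF this c0] obtain b where b: "b > 0" "\<And>d. 0 < d \<Longrightarrow> d < b \<Longrightarrow> 1 < c0 * sqrt (1 - d\<^sup>2 / 4) ^ m"
      unfolding eventually_at_right_field by auto
    show "\<exists>r0>0. \<forall>d. 0 < d \<and> d < r0 \<longrightarrow> unit_ball_vol m * d ^ m \<le> c0 * measure cone_measure (cball x d)"
    proof (intro exI[of _ "min b 1"] conjI allI impI)
      fix d assume d: "0 < d \<and> d < min b 1"
      let ?\<rho> = "d * sqrt (1 - d\<^sup>2 / 4)"
      have d2: "d\<^sup>2 < 1" using d by (simp add: power_less_one_iff)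
      have "sqrt (1 - d\<^sup>2 / 4) > 0" "sqrt (1 - d\<^sup>2 / 4) \<le> 1" using d2 by auto
      then have \<rho>: "0 < ?\<rho>" "?\<rho> \<le> 1" using d by (auto intro: mult_le_one)
      have "unit_ball_vol m * d ^ m * 1 \<le> unit_ball_vol m * d ^ m * (c0 * sqrt (1 - d\<^sup>2 / 4) ^ m)"
        using d b(2)[of d] by (intro mult_left_mono) auto
      also have "\<dots> = c0 * (unit_ball_vol m * ?\<rho> ^ m)" by (simp add: power_mult_distrib)
      also have "\<dots> \<le> c0 * measure cone_measure (cap x ?\<rho>)"
        using disc_less_cone_measure_cap[of x ?\<rho> m] x \<rho> dim c0 by (intro mult_left_mono) auto
      also have "\<dots> \<le> c0 * measure cone_measure (cball x d)"
        using cap_subset_cball[of x d] x d c0 by (intro mult_left_mono finite_measure_mono) auto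
      finally show "unit_ball_vol m * d ^ m \<le> c0 * measure cone_measure (cball x d)" by simp
    qed (use b in auto)
  qed (use c0 in auto)
  have ev: "\<forall>\<^sub>F c in at_right 1. hausdorff m (sphere (0::'a) 1) \<le> ennreal (c * ?\<sigma>)"
    unfolding eventually_at_right_field by (rule exI[of _ 2]) (use * in auto)
  have "((\<lambda>c. ennreal (c * ?\<sigma>)) \<longlongrightarrow> ennreal (1 * ?\<sigma>)) (at_right 1)"
    by (intro tendsto_intros)
  from tendsto_lowerbound[OF this ev] show ?thesis by (simp add: emeasure_eq_measure)
qed

section \<open>Areas of spheres and of their slices\<close>

lemma emeasure_cone_measure_sphere:
  fixes W :: "'a::euclidean_space set"
  assumes [measurable]: "W \<in> sets borel"
  shows "emeasure cone_measure (W \<inter> sphere 0 1) = emeasure cone_measure W"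
  by (subst (1 2) emeasure_cone_measure)
     (auto simp: cone_vol_def norm_sgn intro!: arg_cong[where f="\<lambda>x. _ * x"] arg_cong[where f="emeasure lborel"])

text \<open>One inequality is known for every Borel part of the sphere and the reverse one for the
  whole sphere. Applying the first to the complement of W and cancelling its finite measure gives
  the reverse one for W.\<close>

lemma hausdorff_eq_cone_measure:
  fixes W :: "'a::euclidean_space set"
  assumes W: "W \<in> sets borel" "W \<subseteq> sphere 0 1" and dim: "DIM('a) = Suc m" "m > 0"
  shows "hausdorff m W = emeasure cone_measure W"
proof (rule antisym)
  interpret finite_measure "cone_measure :: 'a measure" by (rule finite_measure_cone_measure)
  show "emeasure cone_measure W \<le> hausdorff m W" by (rule cone_measure_le_hausdorff) fact+
  let ?S = "sphere (0::'a) 1"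
  have "hausdorff m W + hausdorff m (?S - W) = hausdorff m ?S"
    using plus_emeasure[of W area_measure "?S - W"] W
    by (simp add: emeasure_area_measure dim Un_absorb1 borel_closed)
  also have "\<dots> \<le> emeasure cone_measure (UNIV :: 'a set)" by (rule hausdorff_unit_sphere_le) fact+
  also have "\<dots> = emeasure cone_measure ?S"
    using emeasure_cone_measure_sphere[of "UNIV :: 'a set"] by simp
  also have "\<dots> = emeasure cone_measure W + emeasure cone_measure (?S - W)"
    using W plus_emeasure[of W cone_measure "?S - W"] by (simp add: Un_absorb1 borel_closed)
  also have "\<dots> \<le> emeasure cone_measure W + hausdorff m (?S - W)"
    using W by (intro add_left_mono cone_measure_le_hausdorff dim) auto
  finally have *: "hausdorff m (?S - W) + hausdorff m W \<le> hausdorff m (?S - W) + emeasure cone_measure W"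
    by (simp add: add.commute)
  have "hausdorff m (?S - W) \<le> hausdorff m ?S" by (rule hausdorff_mono) auto
  also have "\<dots> < top"
    using hausdorff_unit_sphere_le[OF dim] by (rule le_less_trans) (simp add: emeasure_eq_measure)
  finally show "hausdorff m W \<le> emeasure cone_measure W"
    using * by (auto simp: ennreal_add_left_cancel_le)
qed

lemma hausdorff_affine:
  fixes A :: "'a::euclidean_space set"
  assumes "r > 0"
  shows "hausdorff m ((\<lambda>x. p + r *\<^sub>R x) ` A) = ennreal (r ^ m) * hausdorff m A"
proof (rule antisym)
  let ?f = "\<lambda>x. p + r *\<^sub>R x" and ?g = "\<lambda>y. (1 / r) *\<^sub>R (y - p)"
  show "hausdorff m (?f ` A) \<le> ennreal (r ^ m) * hausdorff m A"
    using assms by (intro hausdorff_lipschitz_image) (auto simp: dist_norm scaleR_diff_right[symmetric])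
  have "hausdorff m (?g ` ?f ` A) \<le> ennreal ((1 / r) ^ m) * hausdorff m (?f ` A)"
    using assms by (intro hausdorff_lipschitz_image) (auto simp: dist_norm scaleR_diff_right[symmetric] divide_inverse)
  also have "?g ` ?f ` A = A" using assms by (simp add: image_image)
  finally have "ennreal (r ^ m) * hausdorff m A \<le> ennreal (r ^ m) * (ennreal ((1 / r) ^ m) * hausdorff m (?f ` A))"
    by (rule mult_left_mono) simp
  also have "\<dots> = hausdorff m (?f ` A)"
    using assms by (simp add: mult.assoc[symmetric] ennreal_mult'[symmetric] power_mult_distrib[symmetric])
  finally show "ennreal (r ^ m) * hausdorff m A \<le> hausdorff m (?f ` A)" .
qed

lemma hausdorff_sphere_slice:
  fixes E :: "'a::euclidean_space set"
  assumes [measurable]: "E \<in> sets borel" and t: "t > 0" and dim: "DIM('a) = Suc m" "m > 0"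
  shows "hausdorff m (E \<inter> sphere p t) = ennreal (t ^ m) * (\<integral>\<^sup>+y. indicator E (p + t *\<^sub>R y) \<partial>cone_measure)"
proof -
  define W where "W = {y. p + t *\<^sub>R y \<in> E}"
  have [measurable]: "W \<in> sets borel" unfolding W_def by measurable
  have eq: "E \<inter> sphere p t = (\<lambda>y. p + t *\<^sub>R y) ` (W \<inter> sphere 0 1)"
  proof safe
    fix x assume "x \<in> E" "x \<in> sphere p t"
    then show "x \<in> (\<lambda>y. p + t *\<^sub>R y) ` (W \<inter> sphere 0 1)"
      using t by (intro image_eqI[of _ _ "(1 / t) *\<^sub>R (x - p)"]) (auto simp: W_def dist_norm norm_minus_commute)
  qed (use t in \<open>auto simp: W_def dist_norm\<close>)
  have "hausdorff m (E \<inter> sphere p t) = ennreal (t ^ m) * hausdorff m (W \<inter> sphere 0 1)"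
    unfolding eq by (rule hausdorff_affine) fact
  also have "hausdorff m (W \<inter> sphere 0 1) = emeasure cone_measure (W \<inter> sphere 0 1)"
    by (intro hausdorff_eq_cone_measure dim) (auto intro: borel_closed)
  also have "\<dots> = emeasure cone_measure W" by (rule emeasure_cone_measure_sphere) simp
  also have "\<dots> = (\<integral>\<^sup>+y. indicator E (p + t *\<^sub>R y) \<partial>cone_measure)"
  proof -
    have "(\<integral>\<^sup>+y. indicator E (p + t *\<^sub>R y) \<partial>cone_measure) = (\<integral>\<^sup>+y. indicator W y \<partial>cone_measure)"
      by (intro nn_integral_cong) (auto simp: W_def indicator_def)
    then show ?thesis by simp
  qed
  finally show ?thesis .
qed

lemma hausdorff_sphere:
  assumes t: "t > 0" and dim: "DIM('a) = Suc m" "m > 0"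
  shows "hausdorff m (sphere (p::'a::euclidean_space) t) = ennreal (t ^ m * (real (Suc m) * unit_ball_vol (real (Suc m))))"
  using hausdorff_sphere_slice[of "UNIV :: 'a set" t m p] emeasure_cone_measure_UNIV[where 'a='a] t dim
  by (simp add: ennreal_mult')

lemma measurable_hausdorff_sphere_slice:
  fixes E :: "'a::euclidean_space set"
  assumes [measurable]: "E \<in> sets borel" and dim: "DIM('a) = Suc m" "m > 0"
  shows "(\<lambda>t. indicator {0<..} t * hausdorff m (E \<inter> sphere p t)) \<in> borel_measurable borel"
proof -
  interpret finite_measure "cone_measure :: 'a measure" by (rule finite_measure_cone_measure)
  have "(\<lambda>t. indicator {0<..} t * hausdorff m (E \<inter> sphere p t))
      = (\<lambda>t. indicator {0<..} t * (ennreal (t ^ m) * (\<integral>\<^sup>+y. indicator E (p + t *\<^sub>R y) \<partial>cone_measure)))"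
    using hausdorff_sphere_slice[OF assms(1) _ dim] by (auto simp: fun_eq_iff indicator_def)
  also have "\<dots> \<in> borel_measurable borel" by measurable
  finally show ?thesis .
qed

lemma nn_integral_spheres:
  fixes E :: "'a::euclidean_space set"
  assumes [measurable]: "E \<in> sets borel" "g \<in> borel_measurable borel" and dim: "DIM('a) = Suc m" "m > 0"
  shows "(\<integral>\<^sup>+x. indicator E x * g (dist p x) \<partial>lborel)
    = (\<integral>\<^sup>+t. indicator {0<..} t * (g t * hausdorff m (E \<inter> sphere p t)) \<partial>lborel)"
proof -
  have "(\<integral>\<^sup>+x. indicator E x * g (dist p x) \<partial>lborel) = (\<integral>\<^sup>+x. indicator E (x + p) * g (dist p (x + p)) \<partial>lborel)"
    by (rule nn_integral_lborel_translate[symmetric]) measurable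
  also have "\<dots> = (\<integral>\<^sup>+t. indicator {0<..} t * ennreal (t ^ m) *
      (\<integral>\<^sup>+y. indicator E (t *\<^sub>R y + p) * g (dist p (t *\<^sub>R y + p)) \<partial>cone_measure) \<partial>lborel)"
    by (rule nn_integral_polar) (use dim in \<open>measurable\<close>)
  also have "\<dots> = (\<integral>\<^sup>+t. indicator {0<..} t * (g t * hausdorff m (E \<inter> sphere p t)) \<partial>lborel)"
  proof (rule nn_integral_cong)
    fix t :: real
    show "indicator {0<..} t * ennreal (t ^ m) * (\<integral>\<^sup>+y. indicator E (t *\<^sub>R y + p) * g (dist p (t *\<^sub>R y + p)) \<partial>cone_measure)
      = indicator {0<..} t * (g t * hausdorff m (E \<inter> sphere p t))"
    proof (cases "t > 0")
      case True
      have "(\<integral>\<^sup>+y. indicator E (t *\<^sub>R y + p) * g (dist p (t *\<^sub>R y + p)) \<partial>cone_measure)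
          = (\<integral>\<^sup>+x. ennreal (real DIM('a)) * indicator (cball 0 1 - {0}) x * (indicator E (t *\<^sub>R sgn x + p) * g (dist p (t *\<^sub>R sgn x + p))) \<partial>lborel)"
        by (rule nn_integral_cone_measure) measurable
      also have "\<dots> = (\<integral>\<^sup>+x. ennreal (real DIM('a)) * indicator (cball 0 1 - {0}) x * (g t * indicator E (p + t *\<^sub>R sgn x)) \<partial>lborel)"
        using True by (intro nn_integral_cong) (auto simp: indicator_def dist_norm norm_sgn add.commute)
      also have "\<dots> = (\<integral>\<^sup>+y. g t * indicator E (p + t *\<^sub>R y) \<partial>cone_measure)"
        by (rule nn_integral_cone_measure[symmetric]) measurable
      also have "\<dots> = g t * (\<integral>\<^sup>+y. indicator E (p + t *\<^sub>R y) \<partial>cone_measure)"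
        by (rule nn_integral_cmult) measurable
      finally show ?thesis using True hausdorff_sphere_slice[OF assms(1) True dim, of p]
        by (simp add: ac_simps)
    qed simp
  qed
  finally show ?thesis .
qed

section \<open>Flat discs and spherical caps\<close>

lemma slab_vol_disc_translate:
  fixes e :: "'a::euclidean_space"
  assumes e: "norm e = 1" and q: "q \<bullet> e = 0"
  shows "slab_vol e (\<lambda>y. norm (y - q) \<le> r) = slab_vol e (\<lambda>y. norm y \<le> r)"
proof -
  have pq: "perp e q = q" using q by (simp add: perp_def)
  have "slab_vol e (\<lambda>y. norm (y - q) \<le> r)
      = (\<integral>\<^sup>+z. indicator {y. norm (perp e y - q) \<le> r \<and> 0 \<le> y \<bullet> e \<and> y \<bullet> e \<le> 1} z \<partial>lborel)"
    unfolding slab_vol_def by (rule nn_integral_indicator[symmetric]) measurable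
  also have "\<dots> = (\<integral>\<^sup>+z. indicator {y. norm (perp e y - q) \<le> r \<and> 0 \<le> y \<bullet> e \<and> y \<bullet> e \<le> 1} (z + q) \<partial>lborel)"
    by (rule nn_integral_lborel_translate[symmetric]) measurable
  also have "\<dots> = (\<integral>\<^sup>+z. indicator {y. norm (perp e y) \<le> r \<and> 0 \<le> y \<bullet> e \<and> y \<bullet> e \<le> 1} z \<partial>lborel)"
    by (intro nn_integral_cong) (auto simp: indicator_def perp_add pq inner_add_left q)
  also have "\<dots> = slab_vol e (\<lambda>y. norm y \<le> r)"
    unfolding slab_vol_def by (rule nn_integral_indicator) measurable
  finally show ?thesis .
qed

text \<open>The comparison measure is Lebesgue measure on the unit slab over a concentric disc of
  radius \<rho>' > \<rho>, pushed onto the plane of the disc. The larger radius lets small balls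
  about points of \<open>?D\<close> see full discs, so the density is exactly 1; then \<rho>' tends
  to \<rho>.\<close>

lemma hausdorff_disc_le:
  fixes e :: "'a::euclidean_space"
  assumes e: "norm e = 1" and \<rho>: "\<rho> > 0" and dim: "DIM('a) = Suc m" "m > 0"
  shows "hausdorff m {x. (x - p) \<bullet> e = c \<and> norm (perp e (x - p)) \<le> \<rho>} \<le> ennreal (unit_ball_vol m * \<rho> ^ m)"
    (is "hausdorff m ?D \<le> _")
proof -
  have *: "hausdorff m ?D \<le> ennreal (unit_ball_vol m * \<rho>' ^ m)" if \<rho>': "\<rho>' > \<rho>" for \<rho>'
  proof -
    define T where "T = {z. norm (perp e z) \<le> \<rho>' \<and> 0 \<le> z \<bullet> e \<and> z \<bullet> e \<le> 1}"
    have [measurable]: "T \<in> sets borel" unfolding T_def by measurable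
    define f where "f z = p + perp e z + c *\<^sub>R e" for z
    have [measurable]: "f \<in> borel_measurable borel" unfolding f_def by measurable
    define \<mu> where "\<mu> = distr (restrict_space lborel T) borel f"
    have Tv: "emeasure lborel T = ennreal (unit_ball_vol m * \<rho>' ^ m)"
      using slab_vol_disc_pos[OF e, of \<rho>'] \<rho> \<rho>' by (simp add: slab_vol_def T_def dim)
    have e\<mu>: "emeasure \<mu> A = emeasure lborel {z \<in> T. f z \<in> A}" if "A \<in> sets borel" for A
      unfolding \<mu>_def using that
      by (subst emeasure_distr, auto intro: measurable_restrict_space1 simp: emeasure_restrict_space space_restrict_space)
         (auto intro!: arg_cong[where f="emeasure lborel"] simp: emeasure_restrict_space)
    have fin: "finite_measure \<mu>"
      by (rule finite_measureI) (use e\<mu>[of UNIV] Tv in \<open>simp add: \<mu>_def\<close>)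
    interpret finite_measure \<mu> by (rule fin)
    have "hausdorff m ?D \<le> ennreal (1 * measure \<mu> UNIV)"
    proof (rule hausdorff_le_density[OF _ fin dim(2)])
      fix x assume x: "x \<in> ?D"
      define q where "q = perp e (x - p)"
      have q: "q \<bullet> e = 0" "norm q \<le> \<rho>" using x perp_inner_self[OF e] by (auto simp: q_def)
      have xq: "x = p + q + c *\<^sub>R e" using x by (auto simp: q_def perp_def)
      show "\<exists>r0>0. \<forall>r. 0 < r \<and> r < r0 \<longrightarrow> unit_ball_vol m * r ^ m \<le> 1 * measure \<mu> (cball x r)"
      proof (intro exI[of _ "\<rho>' - \<rho>"] conjI allI impI)
        fix r assume r: "0 < r \<and> r < \<rho>' - \<rho>"
        have "norm y \<le> \<rho>'" if "norm (y - q) \<le> r" for y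
          using norm_triangle_sub[of y q] that q r by linarith
        then have "{z \<in> T. f z \<in> cball x r} = {y. norm (perp e y - q) \<le> r \<and> 0 \<le> y \<bullet> e \<and> y \<bullet> e \<le> 1}"
          by (auto simp: T_def f_def xq dist_norm norm_minus_commute)
        then have "emeasure \<mu> (cball x r) = slab_vol e (\<lambda>y. norm (y - q) \<le> r)"
          by (simp add: e\<mu> slab_vol_def)
        also have "\<dots> = ennreal (unit_ball_vol m * r ^ m)"
          using slab_vol_disc_pos[OF e, of r] r by (simp add: slab_vol_disc_translate[OF e q(1)] dim)
        finally show "unit_ball_vol m * r ^ m \<le> 1 * measure \<mu> (cball x r)"
          using r by (simp add: emeasure_eq_measure)
      qed (use \<rho>' in auto)
    qed (auto simp: \<mu>_def)
    also have "\<dots> = emeasure lborel T" using e\<mu>[of UNIV] by (simp add: emeasure_eq_measure)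
    finally show ?thesis using Tv by simp
  qed
  have ev: "\<forall>\<^sub>F c in at_right \<rho>. hausdorff m ?D \<le> ennreal (unit_ball_vol m * c ^ m)"
    unfolding eventually_at_right_field by (rule exI[of _ "\<rho> + 1"]) (use * in auto)
  have "((\<lambda>c. ennreal (unit_ball_vol m * c ^ m)) \<longlongrightarrow> ennreal (unit_ball_vol m * \<rho> ^ m)) (at_right \<rho>)"
    by (intro tendsto_intros)
  from tendsto_lowerbound[OF this ev] show ?thesis by simp
qed

text \<open>Cutting a ball by a hyperplane replaces a cap by the flat disc below it; this is the
  strict gain in \<open>sphere_subset_closure\<close>.\<close>

lemma hausdorff_disc_less_cap:
  fixes e :: "'a::euclidean_space"
  assumes e: "norm e = 1" and r: "r > 0" and \<rho>: "0 < \<rho>" "\<rho> \<le> 1" and dim: "DIM('a) = Suc m" "m > 0"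
  shows "hausdorff m {x. (x - p) \<bullet> e = c \<and> norm (perp e (x - p)) \<le> r * \<rho>} < hausdorff m ((\<lambda>y. p + r *\<^sub>R y) ` cap e \<rho>)"
proof -
  interpret finite_measure "cone_measure :: 'a measure" by (rule finite_measure_cone_measure)
  have "hausdorff m {x. (x - p) \<bullet> e = c \<and> norm (perp e (x - p)) \<le> r * \<rho>} \<le> ennreal (unit_ball_vol m * (r * \<rho>) ^ m)"
    using assms by (intro hausdorff_disc_le) auto
  also have "\<dots> < ennreal (r ^ m * measure cone_measure (cap e \<rho>))"
  proof (intro ennreal_lessI)
    have less: "unit_ball_vol m * \<rho> ^ m < measure cone_measure (cap e \<rho>)"
      by (rule disc_less_cone_measure_cap) fact+
    then show "unit_ball_vol m * (r * \<rho>) ^ m < r ^ m * measure cone_measure (cap e \<rho>)"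
      using r by (simp add: power_mult_distrib mult.left_commute)
    have "0 \<le> unit_ball_vol m * \<rho> ^ m" using \<rho> by simp
    then show "0 < r ^ m * measure cone_measure (cap e \<rho>)" using less r by (intro mult_pos_pos) auto
  qed
  also have "\<dots> = ennreal (r ^ m) * emeasure cone_measure (cap e \<rho>)"
    using r by (simp add: emeasure_eq_measure ennreal_mult')
  also have "emeasure cone_measure (cap e \<rho>) = hausdorff m (cap e \<rho>)"
    by (intro hausdorff_eq_cone_measure[symmetric] dim) (auto simp: cap_def)
  also have "ennreal (r ^ m) * hausdorff m (cap e \<rho>) = hausdorff m ((\<lambda>y. p + r *\<^sub>R y) ` cap e \<rho>)"
    by (rule hausdorff_affine[symmetric]) fact
  finally show ?thesis .
qed

section \<open>Calculus of \<open>C\<^sup>1\<close> fields\<close>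

text \<open>The derivative is carried along explicitly, so products, compositions and extensions
  produce theirs by formula, and \<open>frechet_derivative\<close> appears only at the interface
  with \<open>C_k_on\<close> and \<open>divergence\<close>.\<close>

definition C1_on :: "'a::euclidean_space set \<Rightarrow> ('a \<Rightarrow> 'b::real_normed_vector) \<Rightarrow> ('a \<Rightarrow> 'a \<Rightarrow> 'b) \<Rightarrow> bool" where
  "C1_on U f f' \<longleftrightarrow> (\<forall>x\<in>U. (f has_derivative f' x) (at x)) \<and> (\<forall>v. continuous_on U (\<lambda>x. f' x v))"

lemma C1_onI:
  "(\<And>x. x \<in> U \<Longrightarrow> (f has_derivative f' x) (at x)) \<Longrightarrow> (\<And>v. continuous_on U (\<lambda>x. f' x v)) \<Longrightarrow> C1_on U f f'"
  by (simp add: C1_on_def)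

lemma C1_onD:
  assumes "C1_on U f f'"
  shows "x \<in> U \<Longrightarrow> (f has_derivative f' x) (at x)" "continuous_on U (\<lambda>x. f' x v)"
  using assms by (auto simp: C1_on_def)

lemma C1_on_subset: "C1_on U f f' \<Longrightarrow> V \<subseteq> U \<Longrightarrow> C1_on V f f'"
  by (auto simp: C1_on_def intro: continuous_on_subset)

lemma C1_on_continuous: "C1_on U f f' \<Longrightarrow> continuous_on U f"
  by (auto simp: C1_on_def intro!: continuous_at_imp_continuous_on dest: has_derivative_continuous)

lemma C1_on_frechet: "C1_on U f f' \<Longrightarrow> x \<in> U \<Longrightarrow> frechet_derivative f (at x) = f' x"
  by (metis C1_onD(1) frechet_derivative_at)

lemma C1_on_imp_C_k_on: "C1_on U f f' \<Longrightarrow> C_k_on 1 U f"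
  by (auto simp: C1_on_frechet differentiable_def C1_on_def cong: continuous_on_cong)

lemma C_k_on_imp_C1_on: "C_k_on (Suc k) U f \<Longrightarrow> C1_on U f (\<lambda>x. frechet_derivative f (at x))"
proof (induction k arbitrary: f)
  case 0
  then show ?case by (auto simp: C1_on_def frechet_derivative_works)
next
  case (Suc k)
  then have "C1_on U (\<lambda>x. frechet_derivative f (at x) v) (\<lambda>x. frechet_derivative (\<lambda>x. frechet_derivative f (at x) v) (at x))" for v
    by auto
  from C1_on_continuous[OF this] have "continuous_on U (\<lambda>x. frechet_derivative f (at x) v)" for v .
  then show ?case using Suc.prems by (auto simp: C1_on_def frechet_derivative_works)
qed

lemma C1_on_const: "C1_on U (\<lambda>x. c) (\<lambda>x v. 0)"
  by (auto simp: C1_on_def)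

lemma C1_on_scaleR:
  assumes "C1_on U f f'" "C1_on U g g'"
  shows "C1_on U (\<lambda>x. f x *\<^sub>R g x) (\<lambda>x v. f x *\<^sub>R g' x v + f' x v *\<^sub>R g x)"
  by (rule C1_onI)
     (auto intro!: has_derivative_scaleR continuous_intros C1_onD[OF assms(1)] C1_onD[OF assms(2)]
       C1_on_continuous[OF assms(1)] C1_on_continuous[OF assms(2)])

lemma C1_on_inner:
  fixes f g :: "'a::euclidean_space \<Rightarrow> 'b::real_inner"
  assumes "C1_on U f f'" "C1_on U g g'"
  shows "C1_on U (\<lambda>x. f x \<bullet> g x) (\<lambda>x v. f x \<bullet> g' x v + f' x v \<bullet> g x)"
  by (rule C1_onI)
     (auto intro!: has_derivative_inner continuous_intros C1_onD[OF assms(1)] C1_onD[OF assms(2)]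
       C1_on_continuous[OF assms(1)] C1_on_continuous[OF assms(2)])

lemma C1_on_diff:
  assumes "C1_on U f f'" "C1_on U g g'"
  shows "C1_on U (\<lambda>x. f x - g x) (\<lambda>x v. f' x v - g' x v)"
  using assms by (auto simp: C1_on_def intro!: has_derivative_diff continuous_intros)

lemma C1_on_sum:
  assumes "\<And>i. i \<in> I \<Longrightarrow> C1_on U (f i) (f' i)"
  shows "C1_on U (\<lambda>x. \<Sum>i\<in>I. f i x) (\<lambda>x v. \<Sum>i\<in>I. f' i x v)"
  using assms by (auto simp: C1_on_def intro!: has_derivative_sum continuous_intros)

lemma C1_on_compose:
  fixes f :: "'a::euclidean_space \<Rightarrow> real" and h :: "real \<Rightarrow> real"
  assumes f: "C1_on U f f'" and h: "\<And>t. t \<in> f ` U \<Longrightarrow> DERIV h t :> h' t" "continuous_on (f ` U) h'"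
  shows "C1_on U (\<lambda>x. h (f x)) (\<lambda>x v. h' (f x) * f' x v)"
proof (rule C1_onI)
  fix x assume "x \<in> U"
  then show "((\<lambda>x. h (f x)) has_derivative (\<lambda>v. h' (f x) * f' x v)) (at x)"
    using has_derivative_compose[OF C1_onD(1)[OF f], of x h "(*) (h' (f x))"] h(1)[of "f x"]
    by (auto simp: has_field_derivative_def)
next
  fix v
  show "continuous_on U (\<lambda>x. h' (f x) * f' x v)"
    using continuous_on_compose2[OF h(2) C1_on_continuous[OF f]]
    by (intro continuous_intros C1_onD[OF f]) auto
qed

text \<open>U and the complement of K are open and cover the space; f vanishes on their overlap, so
  the two local descriptions agree.\<close>

lemma C1_on_extend_zero:
  assumes f: "C1_on U f f'" and U: "open U" and K: "closed K" "K \<subseteq> U" and z: "\<And>x. x \<in> U - K \<Longrightarrow> f x = 0"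
  shows "C1_on UNIV (\<lambda>x. if x \<in> U then f x else 0) (\<lambda>x v. if x \<in> U then f' x v else 0)"
proof -
  let ?g = "\<lambda>x. if x \<in> U then f x else 0" and ?g' = "\<lambda>x v. if x \<in> U then f' x v else 0"
  have oK: "open (- K)" using K by auto
  have d1: "(?g has_derivative f' x) (at x)" if "x \<in> U" for x
    by (rule has_derivative_transform_within_open[OF C1_onD(1)[OF f that] U that]) auto
  have d2: "(?g has_derivative (\<lambda>v. 0)) (at x)" if "x \<in> - K" for x
    by (rule has_derivative_transform_within_open[OF has_derivative_const oK that]) (use z in auto)
  have zero: "f' x = (\<lambda>v. 0)" if "x \<in> U" "x \<in> - K" for x
    using has_derivative_unique[OF d1[OF that(1)] d2[OF that(2)]] .
  show ?thesis
  proof (rule C1_onI)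
    fix x :: 'a
    show "(?g has_derivative ?g' x) (at x)"
      using d1[of x] d2[of x] K by (cases "x \<in> U") auto
  next
    fix v
    have "continuous_on U (\<lambda>x. ?g' x v)"
      using C1_onD(2)[OF f, of v] by (simp cong: continuous_on_cong)
    moreover have "continuous_on (- K) (\<lambda>x. ?g' x v)"
      by (subst continuous_on_cong[OF refl, of _ _ "\<lambda>x. 0"]) (auto simp: zero)
    ultimately have "continuous_on (U \<union> - K) (\<lambda>x. ?g' x v)"
      using U oK by (intro continuous_on_open_Un)
    moreover have "U \<union> - K = UNIV" using K by auto
    ultimately show "continuous_on UNIV (\<lambda>x. ?g' x v)" by simp
  qed
qed

lemma C1_on_UNIV_zero_outside:
  assumes f: "C1_on UNIV f f'" and K: "closed K" "\<And>x. x \<notin> K \<Longrightarrow> f x = 0" and x: "x \<notin> K"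
  shows "f' x v = 0"
proof -
  have "(f has_derivative (\<lambda>v. 0)) (at x)"
    by (rule has_derivative_transform_within_open[OF has_derivative_const[of 0], of "- K"]) (use K x in auto)
  from has_derivative_unique[OF C1_onD(1)[OF f UNIV_I] this] show ?thesis by simp
qed

lemma test_fieldI:
  assumes "C1_on UNIV \<phi> \<phi>'" "compact K" "\<And>x. x \<notin> K \<Longrightarrow> \<phi> x = 0"
  shows "test_field \<phi>"
proof -
  have "closure {x. \<phi> x \<noteq> 0} \<subseteq> K"
    using assms by (intro closure_minimal) (auto simp: compact_imp_closed)
  then show ?thesis
    unfolding test_field_def using C1_on_imp_C_k_on[OF assms(1)] assms(2)
    by (metis closed_closure compact_Int_closed inf.absorb_iff2)
qed

lemma test_fieldE:
  assumes "test_field \<phi>"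
  obtains \<phi>' K where "C1_on UNIV \<phi> \<phi>'" "compact K" "\<And>x. x \<notin> K \<Longrightarrow> \<phi> x = 0"
proof -
  have d: "C1_on UNIV \<phi> (\<lambda>x. frechet_derivative \<phi> (at x))"
    using assms C_k_on_imp_C1_on[of 0 UNIV \<phi>] by (simp add: test_field_def)
  have c: "compact (closure {x. \<phi> x \<noteq> 0})" using assms by (simp add: test_field_def)
  have "\<phi> x = 0" if "x \<notin> closure {x. \<phi> x \<noteq> 0}" for x
    using that closure_subset[of "{x. \<phi> x \<noteq> 0}"] by auto
  then show ?thesis by (rule that[OF d c])
qed

lemma divergence_eq: "C1_on U \<phi> \<phi>' \<Longrightarrow> x \<in> U \<Longrightarrow> divergence \<phi> x = (\<Sum>b\<in>Basis. \<phi>' x b \<bullet> b)"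
  by (simp add: divergence_def C1_on_frechet)

lemma linear_sum_Basis_inner:
  fixes L :: "'a::euclidean_space \<Rightarrow> real"
  assumes "linear L"
  shows "(\<Sum>b\<in>Basis. L b * (y \<bullet> b)) = L y"
proof -
  have "L y = L (\<Sum>b\<in>Basis. (y \<bullet> b) *\<^sub>R b)" by (simp add: euclidean_representation)
  also have "\<dots> = (\<Sum>b\<in>Basis. (y \<bullet> b) * L b)" by (simp add: linear_sum[OF assms] linear_cmul[OF assms])
  finally show ?thesis by (simp add: mult.commute)
qed

lemma divergence_scaleR:
  assumes f: "C1_on UNIV f f'" and \<phi>: "C1_on UNIV \<phi> \<phi>'"
  shows "divergence (\<lambda>x. f x *\<^sub>R \<phi> x) x = f x * divergence \<phi> x + f' x (\<phi> x)"
proof -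
  have "linear (f' x)" using C1_onD(1)[OF f UNIV_I] has_derivative_linear by blast
  then show ?thesis
    using linear_sum_Basis_inner[of "f' x" "\<phi> x"]
    by (simp add: divergence_eq[OF C1_on_scaleR[OF assms] UNIV_I] divergence_eq[OF \<phi> UNIV_I]
        inner_add_left sum.distrib sum_distrib_left)
qed

lemma divergence_continuous:
  assumes "C1_on UNIV \<phi> \<phi>'"
  shows "continuous_on UNIV (divergence \<phi>)"
proof -
  have "divergence \<phi> = (\<lambda>x. \<Sum>b\<in>Basis. \<phi>' x b \<bullet> b)"
    by (simp add: fun_eq_iff divergence_eq[OF assms])
  then show ?thesis by (auto intro!: continuous_intros C1_onD[OF assms])
qed

lemma divergence_zero_outside:
  "C1_on UNIV \<phi> \<phi>' \<Longrightarrow> closed K \<Longrightarrow> (\<And>x. x \<notin> K \<Longrightarrow> \<phi> x = 0) \<Longrightarrow> x \<notin> K \<Longrightarrow> divergence \<phi> x = 0"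
  by (simp add: divergence_eq C1_on_UNIV_zero_outside[of \<phi> \<phi>' K])

lemma test_field_scaleR:
  assumes f: "C1_on UNIV f f'" and \<phi>: "test_field \<phi>"
  shows "test_field (\<lambda>x. f x *\<^sub>R \<phi> x)"
proof -
  obtain \<phi>' K where "C1_on UNIV \<phi> \<phi>'" "compact K" "\<And>x. x \<notin> K \<Longrightarrow> \<phi> x = 0"
    using test_fieldE[OF \<phi>] by metis
  then show ?thesis using f by (intro test_fieldI[OF C1_on_scaleR[OF f]]) auto
qed

lemma integrable_continuous_compact_support:
  fixes g :: "'a::euclidean_space \<Rightarrow> real"
  assumes g: "continuous_on UNIV g" and K: "compact K" "\<And>x. x \<notin> K \<Longrightarrow> g x = 0"
  shows "integrable lborel g"
proof -
  have "integrable lborel (\<lambda>x. indicator K x *\<^sub>R g x)"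
    using borel_integrable_compact[OF K(1), of g] g by (auto intro: continuous_on_subset)
  also have "(\<lambda>x. indicator K x *\<^sub>R g x) = g" using K(2) by (auto simp: fun_eq_iff indicator_def)
  finally show ?thesis .
qed

lemma test_field_divergence_integrable:
  assumes "test_field \<phi>"
  shows "integrable lborel (divergence \<phi>)" "integrable lebesgue (divergence \<phi>)"
    "E \<in> sets lebesgue \<Longrightarrow> set_integrable lebesgue E (divergence \<phi>)"
    "divergence \<phi> \<in> borel_measurable borel"
proof -
  obtain \<phi>' K where p: "C1_on UNIV \<phi> \<phi>'" "compact K" "\<And>x. x \<notin> K \<Longrightarrow> \<phi> x = 0"
    using test_fieldE[OF assms] by metis
  show 1: "integrable lborel (divergence \<phi>)"
    using p by (intro integrable_continuous_compact_support[of _ K] divergence_continuous)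
      (auto intro: divergence_zero_outside[of \<phi> \<phi>' K] simp: compact_imp_closed)
  then show 2: "integrable lebesgue (divergence \<phi>)" by (simp add: integrable_completion)
  show "set_integrable lebesgue E (divergence \<phi>)" if "E \<in> sets lebesgue"
    using 2 that unfolding set_integrable_def by (rule integrable_mult_indicator[rotated])
  show "divergence \<phi> \<in> borel_measurable borel" using 1 by auto
qed

section \<open>Integration along lines\<close>

text \<open>The signed form of \<open>nn_integral_slab_lines\<close>. The same change of variables
  is made between \<open>F\<close> and \<open>H\<close>, and the nonnegative form, applied to |G|,
  supplies the integrability of \<open>F\<close> that Fubini asks for.\<close>

lemma integral_slab_lines:
  fixes G :: "'a::euclidean_space \<Rightarrow> real"
  assumes G: "integrable lborel G" and e: "norm e = 1"
  shows "(\<integral>z. G z \<partial>lborel)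
      = (\<integral>y. indicator {y. 0 \<le> y \<bullet> e \<and> y \<bullet> e \<le> 1} y * (\<integral>s. G (y + s *\<^sub>R e) \<partial>lborel) \<partial>lborel)"
proof -
  let ?I = "indicator {y. 0 \<le> y \<bullet> e \<and> y \<bullet> e \<le> 1} :: 'a \<Rightarrow> real"
  have ee: "e \<bullet> e = 1" using e by (simp add: dot_square_norm)
  have [measurable]: "G \<in> borel_measurable borel" using G by auto
  define F where "F = (\<lambda>(y, s). ?I y * G (y + s *\<^sub>R e))"
  define H where "H = (\<lambda>(z, s). indicator {p. fst p \<bullet> e - 1 \<le> snd p \<and> snd p \<le> fst p \<bullet> e} (z, s :: real) * G z)"
  have [measurable]: "F \<in> borel_measurable (lborel \<Otimes>\<^sub>M lborel)" "H \<in> borel_measurable (lborel \<Otimes>\<^sub>M lborel)"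
    unfolding F_def H_def split_def by measurable
  have fin: "(\<integral>\<^sup>+z. ennreal (norm (G z)) \<partial>lborel) < \<infinity>"
    using G by (simp add: integrable_iff_bounded)
  have "(\<integral>\<^sup>+p. ennreal (norm (F p)) \<partial>(lborel \<Otimes>\<^sub>M lborel))
      = (\<integral>\<^sup>+y. \<integral>\<^sup>+s. ennreal (norm (F (y, s))) \<partial>lborel \<partial>lborel)"
    by (rule lborel.nn_integral_fst[symmetric]) measurable
  also have "\<dots> = (\<integral>\<^sup>+y. indicator {y. 0 \<le> y \<bullet> e \<and> y \<bullet> e \<le> 1} y * (\<integral>\<^sup>+s. ennreal (norm (G (y + s *\<^sub>R e))) \<partial>lborel) \<partial>lborel)"
    by (intro nn_integral_cong, subst nn_integral_cmult[symmetric])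
       (auto intro!: nn_integral_cong simp: F_def indicator_def)
  also have "\<dots> = (\<integral>\<^sup>+z. ennreal (norm (G z)) \<partial>lborel)"
    by (rule nn_integral_slab_lines[symmetric]) (use e in \<open>measurable\<close>)
  finally have iF: "integrable (lborel \<Otimes>\<^sub>M lborel) F"
    using fin by (auto simp: integrable_iff_bounded)
  have "(\<integral>\<^sup>+p. ennreal (norm (H p)) \<partial>(lborel \<Otimes>\<^sub>M lborel))
      = (\<integral>\<^sup>+z. \<integral>\<^sup>+s. ennreal (norm (H (z, s))) \<partial>lborel \<partial>lborel)"
    by (rule lborel.nn_integral_fst[symmetric]) measurable
  also have "\<dots> = (\<integral>\<^sup>+z. \<integral>\<^sup>+s. ennreal (norm (G z)) * indicator {z \<bullet> e - 1 .. z \<bullet> e} s \<partial>lborel \<partial>lborel)"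
    by (intro nn_integral_cong) (auto simp: H_def indicator_def)
  also have "\<dots> = (\<integral>\<^sup>+z. ennreal (norm (G z)) \<partial>lborel)"
    by (intro nn_integral_cong) (simp add: nn_integral_cmult)
  finally have iH: "integrable (lborel \<Otimes>\<^sub>M lborel) H"
    using fin by (auto simp: integrable_iff_bounded)
  have "(\<integral>y. ?I y * (\<integral>s. G (y + s *\<^sub>R e) \<partial>lborel) \<partial>lborel) = (\<integral>y. \<integral>s. F (y, s) \<partial>lborel \<partial>lborel)"
    by (simp add: F_def)
  also have "\<dots> = (\<integral>s. \<integral>y. F (y, s) \<partial>lborel \<partial>lborel)"
    using lborel_pair.Fubini_integral[of "\<lambda>y s. F (y, s)"] iF by simp
  also have "\<dots> = (\<integral>s. \<integral>z. H (z, s) \<partial>lborel \<partial>lborel)"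
  proof (rule Bochner_Integration.integral_cong)
    fix s :: real
    have "(\<integral>z. H (z, s) \<partial>lborel) = (\<integral>z. H (z, s) \<partial>distr lborel borel ((+) (s *\<^sub>R e)))"
      by (simp add: lborel_distr_plus)
    also have "\<dots> = (\<integral>y. H (s *\<^sub>R e + y, s) \<partial>lborel)"
    proof (rule integral_distr)
      have "(\<lambda>z. H (z, s)) = (\<lambda>z. indicator {z. z \<bullet> e - 1 \<le> s \<and> s \<le> z \<bullet> e} z * G z)"
        by (auto simp: H_def fun_eq_iff indicator_def)
      also have "\<dots> \<in> borel_measurable borel" by measurable
      finally show "(\<lambda>z. H (z, s)) \<in> borel_measurable borel" .
    qed simp
    also have "\<dots> = (\<integral>y. F (y, s) \<partial>lborel)"
      by (rule Bochner_Integration.integral_cong)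
         (auto simp: F_def H_def indicator_def inner_add_left ee add.commute)
    finally show "(\<integral>y. F (y, s) \<partial>lborel) = (\<integral>z. H (z, s) \<partial>lborel)" ..
  qed simp
  also have "\<dots> = (\<integral>z. \<integral>s. H (z, s) \<partial>lborel \<partial>lborel)"
    using lborel_pair.Fubini_integral[of "\<lambda>y s. H (y, s)"] iH by simp
  also have "\<dots> = (\<integral>z. G z \<partial>lborel)"
  proof (rule Bochner_Integration.integral_cong)
    fix z
    have "(\<integral>s. H (z, s) \<partial>lborel) = (\<integral>s. indicator {z \<bullet> e - 1 .. z \<bullet> e} s * G z \<partial>lborel)"
      by (rule Bochner_Integration.integral_cong) (auto simp: H_def indicator_def)
    then show "(\<integral>s. H (z, s) \<partial>lborel) = G z" by simp
  qed simp
  finally show ?thesis ..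
qed

lemma C1_on_line_deriv:
  fixes f :: "'a::euclidean_space \<Rightarrow> real"
  assumes "C1_on UNIV f f'"
  shows "((\<lambda>s. f (y + s *\<^sub>R e)) has_real_derivative f' (y + s *\<^sub>R e) e) (at s)"
proof -
  have "linear (f' (y + s *\<^sub>R e))" using C1_onD(1)[OF assms UNIV_I] has_derivative_linear by blast
  moreover have "((\<lambda>s. y + s *\<^sub>R e) has_derivative (\<lambda>t. t *\<^sub>R e)) (at s)"
    by (auto intro!: derivative_eq_intros)
  from has_derivative_compose[OF this C1_onD(1)[OF assms UNIV_I]]
  have "((\<lambda>s. f (y + s *\<^sub>R e)) has_derivative (\<lambda>t. f' (y + s *\<^sub>R e) (t *\<^sub>R e))) (at s)" .
  ultimately show ?thesis
    by (simp add: has_field_derivative_def linear_cmul mult.commute[of _ "f' _ e"])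
qed

lemma integral_C1_halfline:
  fixes f :: "'a::euclidean_space \<Rightarrow> real"
  assumes f: "C1_on UNIV f f'" and K: "compact K" "\<And>x. x \<notin> K \<Longrightarrow> f x = 0" and e: "norm e = 1"
  shows "(\<integral>s. indicator {..s0} s * f' (y + s *\<^sub>R e) e \<partial>lborel) = f (y + s0 *\<^sub>R e)"
    and "(\<integral>s. f' (y + s *\<^sub>R e) e \<partial>lborel) = 0"
proof -
  from K(1) obtain R where R: "\<And>x. x \<in> K \<Longrightarrow> norm x \<le> R" using compact_imp_bounded bounded_iff by metis
  have cont: "continuous_on UNIV (\<lambda>s. f' (y + s *\<^sub>R e) e)"
    by (rule continuous_on_compose2[OF C1_onD(2)[OF f]]) (auto intro!: continuous_intros)
  define a where "a = R + norm y + 1"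
  have out: "y + s *\<^sub>R e \<notin> K" if "\<bar>s\<bar> \<ge> a" for s
    using R[of "y + s *\<^sub>R e"] norm_triangle_sub[of "s *\<^sub>R e" "- y"] that e unfolding a_def
    by (auto simp: add.commute)
  have out': "f' (y + s *\<^sub>R e) e = 0" "f (y + s *\<^sub>R e) = 0" if "\<bar>s\<bar> \<ge> a" for s
    using out[OF that] C1_on_UNIV_zero_outside[of f f' K] f K by (auto simp: compact_imp_closed)
  have FTC: "(\<integral>s. indicator {- b..t} s *\<^sub>R f' (y + s *\<^sub>R e) e \<partial>lborel) = f (y + t *\<^sub>R e)"
    if b: "b \<ge> a" "- b \<le> t" for t b
  proof -
    have "(\<integral>s. indicator {- b..t} s *\<^sub>R f' (y + s *\<^sub>R e) e \<partial>lborel) = f (y + t *\<^sub>R e) - f (y + (- b) *\<^sub>R e)"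
      using b(2) C1_on_line_deriv[OF f, of y e] cont
      by (intro integral_FTC_Icc)
         (auto intro: continuous_on_subset has_vector_derivative_at_within simp: has_real_derivative_iff_has_vector_derivative)
    moreover have "f (y + (- b) *\<^sub>R e) = 0" using b(1) by (intro out') auto
    ultimately show ?thesis by simp
  qed
  define b where "b = max a \<bar>s0\<bar>"
  have "(\<integral>s. indicator {..s0} s * f' (y + s *\<^sub>R e) e \<partial>lborel) = (\<integral>s. indicator {- b..s0} s *\<^sub>R f' (y + s *\<^sub>R e) e \<partial>lborel)"
  proof (rule Bochner_Integration.integral_cong)
    show "indicator {..s0} s * f' (y + s *\<^sub>R e) e = indicator {- b..s0} s *\<^sub>R f' (y + s *\<^sub>R e) e" for s
      by (cases "a \<le> \<bar>s\<bar>") (auto simp: out' indicator_def b_def)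
  qed simp
  then show "(\<integral>s. indicator {..s0} s * f' (y + s *\<^sub>R e) e \<partial>lborel) = f (y + s0 *\<^sub>R e)"
    using FTC[of b s0] by (auto simp: b_def)
  define c where "c = max a 0"
  have "(\<integral>s. f' (y + s *\<^sub>R e) e \<partial>lborel) = (\<integral>s. indicator {- c..c} s *\<^sub>R f' (y + s *\<^sub>R e) e \<partial>lborel)"
  proof (rule Bochner_Integration.integral_cong)
    show "f' (y + s *\<^sub>R e) e = indicator {- c..c} s *\<^sub>R f' (y + s *\<^sub>R e) e" for s
      by (cases "a \<le> \<bar>s\<bar>") (auto simp: out' indicator_def c_def)
  qed simp
  then show "(\<integral>s. f' (y + s *\<^sub>R e) e \<partial>lborel) = 0"
    using FTC[of c c] out'(2)[of c] by (auto simp: c_def)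
qed

lemma integral_C1_deriv_zero:
  fixes f :: "'a::euclidean_space \<Rightarrow> real"
  assumes f: "C1_on UNIV f f'" and K: "compact K" "\<And>x. x \<notin> K \<Longrightarrow> f x = 0" and e: "norm e = 1"
  shows "integrable lborel (\<lambda>x. f' x e)" "(\<integral>x. f' x e \<partial>lborel) = 0"
proof -
  show i: "integrable lborel (\<lambda>x. f' x e)"
    using K by (intro integrable_continuous_compact_support[OF C1_onD(2)[OF f] K(1)])
      (auto intro: C1_on_UNIV_zero_outside[of f f' K] f simp: compact_imp_closed)
  show "(\<integral>x. f' x e \<partial>lborel) = 0"
    by (subst integral_slab_lines[OF i e]) (simp add: integral_C1_halfline(2)[OF f K e])
qed

lemma integral_divergence_zero:
  assumes "test_field \<phi>"
  shows "(\<integral>x. divergence \<phi> x \<partial>lborel) = 0"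
proof -
  obtain \<phi>' K where p: "C1_on UNIV \<phi> \<phi>'" "compact K" "\<And>x. x \<notin> K \<Longrightarrow> \<phi> x = 0"
    using test_fieldE[OF assms] by metis
  have c: "C1_on UNIV (\<lambda>x. \<phi> x \<bullet> b) (\<lambda>x v. \<phi>' x v \<bullet> b)" for b
    using C1_on_inner[OF p(1) C1_on_const[of UNIV b]] by simp
  have z: "integrable lborel (\<lambda>x. \<phi>' x b \<bullet> b)" "(\<integral>x. \<phi>' x b \<bullet> b \<partial>lborel) = 0" if "b \<in> Basis" for b
    using integral_C1_deriv_zero[OF c p(2), of b b] p(3) that by auto
  show ?thesis
    by (simp add: divergence_eq[OF p(1) UNIV_I] Bochner_Integration.integral_sum z)
qed

section \<open>Cut-off functions\<close>

lemma DERIV_max_zero_power2: "DERIV (\<lambda>t. (max 0 t)\<^sup>2) t :> 2 * max 0 (t::real)"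
proof -
  consider "t > 0" | "t < 0" | "t = 0" by linarith
  then show ?thesis
  proof cases
    case 1
    have "DERIV (\<lambda>t. t\<^sup>2) t :> 2 * t" by (auto intro!: derivative_eq_intros)
    then have "DERIV (\<lambda>t. (max 0 t)\<^sup>2) t :> 2 * t"
      by (rule has_field_derivative_transform_within_open[of _ _ _ "{0<..}"]) (use 1 in auto)
    then show ?thesis using 1 by simp
  next
    case 2
    have "DERIV (\<lambda>t. 0) t :> 0" by simp
    then have "DERIV (\<lambda>t. (max 0 t)\<^sup>2) t :> 0"
      by (rule has_field_derivative_transform_within_open[of _ _ _ "{..<0}"]) (use 2 in auto)
    then show ?thesis using 2 by simp
  next
    case 3
    have "((\<lambda>h. ((max 0 (0 + h))\<^sup>2 - (max 0 0)\<^sup>2) / h) \<longlongrightarrow> 0) (at (0::real))"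
    proof (rule Lim_null_comparison)
      show "((\<lambda>h. \<bar>h\<bar>) \<longlongrightarrow> 0) (at (0::real))" by (auto intro!: tendsto_eq_intros)
      show "\<forall>\<^sub>F h in at 0. norm (((max 0 (0 + h))\<^sup>2 - (max 0 0)\<^sup>2) / h) \<le> \<bar>h::real\<bar>"
        by (auto simp: max_def power2_eq_square intro!: always_eventually)
    qed
    then show ?thesis using 3 by (simp add: DERIV_def)
  qed
qed

text \<open>A C1 quadratic spline equal to 1 up to -1 and to 0 from 0 on. The transition lies on the
  negative side, so step(j f) vanishes where f \<ge> 0 and tends to the indicator of the strict
  sublevel set f < 0.\<close>

definition step :: "real \<Rightarrow> real" where
  "step t = 1 - (2 * (max 0 (t + 1))\<^sup>2 - 4 * (max 0 (t + 1/2))\<^sup>2 + 2 * (max 0 t)\<^sup>2)"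

definition step' :: "real \<Rightarrow> real" where
  "step' t = - (4 * max 0 (t + 1) - 8 * max 0 (t + 1/2) + 4 * max 0 t)"

lemma DERIV_step: "DERIV step t :> step' t"
proof -
  have s: "DERIV (\<lambda>t. (max 0 (t + a))\<^sup>2) t :> 2 * max 0 (t + a)" for a
  proof -
    have "DERIV (\<lambda>t. t + a) t :> 1" by (auto intro!: derivative_eq_intros)
    from DERIV_chain2[where g="\<lambda>t. t + a", OF DERIV_max_zero_power2[of "t + a"] this] show ?thesis by simp
  qed
  show ?thesis
    unfolding step_def[abs_def] step'_def
    by (rule derivative_eq_intros refl s DERIV_max_zero_power2)+ simp
qed

lemma continuous_on_step': "continuous_on A step'"
  unfolding step'_def[abs_def] by (intro continuous_intros)

lemma step_eq: "t \<le> -1 \<Longrightarrow> step t = 1" "t \<ge> 0 \<Longrightarrow> step t = 0"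
  and step'_eq: "t \<le> -1 \<or> t \<ge> 0 \<Longrightarrow> step' t = 0"
  by (auto simp: step_def step'_def power2_eq_square algebra_simps max_def)

lemma step_bounds: "0 \<le> step t" "step t \<le> 1"
proof -
  consider "t \<le> -1" | "-1 < t" "t \<le> -1/2" | "-1/2 < t" "t < 0" | "t \<ge> 0" by linarith
  then have "0 \<le> step t \<and> step t \<le> 1"
  proof cases
    case 2
    then have s: "step t = 1 - 2 * (t + 1)\<^sup>2" by (simp add: step_def max_def)
    have "(t + 1)\<^sup>2 \<le> (1/2)\<^sup>2" using 2 by (intro power_mono) auto
    then show ?thesis using s by (simp add: power2_eq_square)
  next
    case 3
    then have s: "step t = 2 * t\<^sup>2" by (simp add: step_def max_def power2_eq_square algebra_simps)
    have "(- t)\<^sup>2 \<le> (1/2)\<^sup>2" using 3 by (intro power_mono) auto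
    then show ?thesis using s by (simp add: power2_eq_square)
  qed (auto simp: step_eq)
  then show "0 \<le> step t" "step t \<le> 1" by auto
qed

lemma step'_bound: "\<bar>step' t\<bar> \<le> 2"
  by (auto simp: step'_def max_def abs_le_iff)

lemma step_tendsto: "(\<lambda>j. step (real (Suc j) * t)) \<longlonglongrightarrow> indicator {..<0} t"
proof (cases "t < 0")
  case True
  obtain k :: nat where k: "real k * (- t) > 1"
    using True reals_Archimedean3[of "- t"] by (metis neg_0_less_iff_less)
  have "\<forall>\<^sub>F j in sequentially. step (real (Suc j) * t) = 1"
  proof (rule eventually_sequentiallyI[of k])
    fix j assume "k \<le> j"
    then have "real k * (- t) \<le> real (Suc j) * (- t)" using True by (intro mult_right_mono) auto
    then show "step (real (Suc j) * t) = 1" using k by (intro step_eq) simp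
  qed
  then show ?thesis using True by (simp add: tendsto_eventually)
next
  case False
  then have "step (real (Suc j) * t) = 0" for j by (intro step_eq) (simp add: mult_nonneg_nonneg)
  then show ?thesis using False by simp
qed

lemma C1_on_step:
  fixes f :: "'a::euclidean_space \<Rightarrow> real"
  assumes "C1_on U f f'"
  shows "C1_on U (\<lambda>x. step (c * f x)) (\<lambda>x v. (step' (c * f x) * c) * f' x v)"
proof (rule C1_on_compose[OF assms, of "\<lambda>t. step (c * t)" "\<lambda>t. step' (c * t) * c"])
  show "DERIV (\<lambda>t. step (c * t)) t :> step' (c * t) * c" for t
  proof -
    have "DERIV (\<lambda>t. c * t) t :> c" by (auto intro!: derivative_eq_intros)
    from DERIV_chain2[where g="\<lambda>t. c * t", OF DERIV_step[of "c * t"] this] show ?thesis .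
  qed
  show "continuous_on (f ` U) (\<lambda>t. step' (c * t) * c)"
    by (intro continuous_intros continuous_on_compose2[OF continuous_on_step'[of UNIV]]) auto
qed

lemma C1_on_norm_sq: "C1_on U (\<lambda>x::'a::euclidean_space. (norm (x - p))\<^sup>2 - c) (\<lambda>x v. 2 * ((x - p) \<bullet> v))"
  unfolding power2_norm_eq_inner
  by (rule C1_onI) (auto intro!: derivative_eq_intros continuous_intros simp: inner_commute)

lemma C1_on_linear: "C1_on U (\<lambda>x::'a::euclidean_space. (x - p) \<bullet> e - c) (\<lambda>x v. v \<bullet> e)"
  by (rule C1_onI) (auto intro!: derivative_eq_intros continuous_intros)

section \<open>Sets of finite perimeter\<close>

lemma set_integral_limit_step:
  fixes f :: "'a::euclidean_space \<Rightarrow> real"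
  assumes E: "E \<in> sets lebesgue" and g: "integrable lborel g" and f: "continuous_on UNIV f"
  shows "(\<lambda>j. LINT x:E|lebesgue. step (real (Suc j) * f x) * g x) \<longlonglongrightarrow> (LINT x:E \<inter> {x. f x < 0}|lebesgue. g x)"
proof -
  have g': "integrable lebesgue g" using g by (simp add: integrable_completion)
  have f'[measurable]: "f \<in> borel_measurable borel" using f by (rule borel_measurable_continuous_onI)
  have [measurable]: "g \<in> borel_measurable borel" using g by auto
  have st[measurable]: "step \<in> borel_measurable borel"
    by (intro borel_measurable_continuous_onI continuous_at_imp_continuous_on)
       (use DERIV_step in \<open>blast intro: DERIV_isCont\<close>)
  have m1: "(\<lambda>x. step (real (Suc j) * f x) * g x) \<in> borel_measurable lebesgue" for j
    by (intro measurable_completion) measurable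
  have m0: "{x. f x < 0} \<in> sets lebesgue" by (intro sets_completionI_sets) (simp, measurable)
  have "(\<lambda>j. LINT x|lebesgue. indicator E x *\<^sub>R (step (real (Suc j) * f x) * g x)) \<longlonglongrightarrow> (LINT x|lebesgue. indicator (E \<inter> {x. f x < 0}) x *\<^sub>R g x)"
  proof (rule integral_dominated_convergence[where w="\<lambda>x. norm (g x)"])
    show "(\<lambda>x. indicator (E \<inter> {x. f x < 0}) x *\<^sub>R g x) \<in> borel_measurable lebesgue"
      using E m0 g' by (intro borel_measurable_scaleR borel_measurable_indicator) auto
    show "(\<lambda>x. indicator E x *\<^sub>R (step (real (Suc j) * f x) * g x)) \<in> borel_measurable lebesgue" for j
      using E m1[of j] by (intro borel_measurable_scaleR borel_measurable_indicator) auto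
    show "integrable lebesgue (\<lambda>x. norm (g x))" using g' by simp
    show "AE x in lebesgue. norm (indicator E x *\<^sub>R (step (real (Suc j) * f x) * g x)) \<le> norm (g x)" for j
      using step_bounds[of "real (Suc j) * f _"]
      by (intro AE_I2) (auto simp: indicator_def abs_mult intro!: mult_left_le_one_le)
    have "(\<lambda>j. indicator E x *\<^sub>R (step (real (Suc j) * f x) * g x)) \<longlonglongrightarrow> indicator E x *\<^sub>R (indicator {..<0} (f x) * g x)" for x
      by (intro tendsto_intros step_tendsto)
    moreover have "indicator E x *\<^sub>R (indicator {..<0} (f x) * g x) = indicator (E \<inter> {x. f x < 0}) x *\<^sub>R g x" for x
      by (auto simp: indicator_def)
    ultimately show "AE x in lebesgue. (\<lambda>j. indicator E x *\<^sub>R (step (real (Suc j) * f x) * g x)) \<longlonglongrightarrow> indicator (E \<inter> {x. f x < 0}) x *\<^sub>R g x"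
      by (intro AE_I2) (simp only:)
  qed
  then show ?thesis by (simp add: set_lebesgue_integral_def)
qed

text \<open>A test field is cut off by step(c f). The divergence of the cut field is bounded through
  the perimeter of E; the remaining gradient term has size at most 2 c L and lives on the layer -1/c
  \<le> f \<le> 0 of volume at most C / c, so it contributes at most 2 L C, uniformly in c.\<close>

lemma finite_perimeter_Int_sublevel:
  fixes f :: "'a::euclidean_space \<Rightarrow> real"
  assumes E: "finite_perimeter E" and f: "C1_on UNIV f f'" and "L \<ge> 0" "C \<ge> 0"
    and grad: "\<And>x v. -1 \<le> f x \<Longrightarrow> f x \<le> 0 \<Longrightarrow> x \<in> E \<Longrightarrow> \<bar>f' x v\<bar> \<le> L * norm v"
    and vol: "\<And>\<epsilon>. 0 < \<epsilon> \<Longrightarrow> \<epsilon> \<le> 1 \<Longrightarrow> emeasure lebesgue (E \<inter> {x. -\<epsilon> \<le> f x \<and> f x \<le> 0}) \<le> ennreal (C * \<epsilon>)"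
  shows "finite_perimeter (E \<inter> {x. f x < 0})"
proof -
  have Em: "E \<in> sets lebesgue" using E by (simp add: finite_perimeter_def)
  obtain CE where CE: "\<And>\<phi>. test_field \<phi> \<Longrightarrow> (\<forall>x. norm (\<phi> x) \<le> 1) \<Longrightarrow> (LINT x:E|lebesgue. divergence \<phi> x) \<le> CE"
    using E unfolding finite_perimeter_def by blast
  have fb[measurable]: "f \<in> borel_measurable borel" using C1_on_continuous[OF f] by (rule borel_measurable_continuous_onI)
  have Sm: "{x. a \<le> f x \<and> f x \<le> b} \<in> sets lebesgue" for a b
    by (intro sets_completionI_sets) (simp, measurable)
  have "{x. f x < 0} \<in> sets lebesgue" by (intro sets_completionI_sets) (simp, measurable)
  then have m: "E \<inter> {x. f x < 0} \<in> sets lebesgue" using Em by auto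
  have "(LINT x:E \<inter> {x. f x < 0}|lebesgue. divergence \<phi> x) \<le> CE + 2 * L * C"
    if \<phi>: "test_field \<phi>" "\<forall>x. norm (\<phi> x) \<le> 1" for \<phi>
  proof (rule LIMSEQ_le_const2[OF set_integral_limit_step[OF Em _ C1_on_continuous[OF f]]])
    show "integrable lborel (divergence \<phi>)" using \<phi> by (simp add: test_field_divergence_integrable)
    obtain \<phi>' K where p: "C1_on UNIV \<phi> \<phi>'" using test_fieldE[OF \<phi>(1)] by metis
    have "(LINT x:E|lebesgue. step (real (Suc j) * f x) * divergence \<phi> x) \<le> CE + 2 * L * C" for j
    proof -
      define c where "c = real (Suc j)"
      have c: "c \<ge> 1" by (simp add: c_def)
      let ?\<psi> = "\<lambda>x. step (c * f x) *\<^sub>R \<phi> x"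
      let ?R = "\<lambda>x. step' (c * f x) * c * f' x (\<phi> x)"
      have \<psi>: "test_field ?\<psi>" by (rule test_field_scaleR[OF C1_on_step[OF f] \<phi>(1)])
      have dv: "divergence ?\<psi> x = step (c * f x) * divergence \<phi> x + ?R x" for x
        by (rule divergence_scaleR[OF C1_on_step[OF f] p])
      have i1: "set_integrable lebesgue E (divergence ?\<psi>)"
        using test_field_divergence_integrable(3)[OF \<psi> Em] .
      define S where "S = E \<inter> {x. -(1 / c) \<le> f x \<and> f x \<le> 0}"
      have S: "S \<in> sets lebesgue" unfolding S_def using Em Sm[of "-(1/c)" 0] by auto
      have volS: "emeasure lebesgue S \<le> ennreal (C * (1 / c))"
        unfolding S_def using c by (intro vol) auto
      then have Sfin: "emeasure lebesgue S < \<infinity>" by (rule le_less_trans) simp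
      have iS: "integrable lebesgue (\<lambda>x. 2 * c * L * indicator S x)"
        using S Sfin by (intro integrable_mult_right) (auto simp: integrable_indicator_iff)
      have Rb: "indicator E x * \<bar>?R x\<bar> \<le> 2 * c * L * indicator S x" for x
      proof (cases "x \<in> S")
        case True
        then have x: "x \<in> E" "-1 \<le> f x" "f x \<le> 0"
          using c by (auto simp: S_def) (smt (verit) divide_le_eq_1_pos)
        have "\<bar>f' x (\<phi> x)\<bar> \<le> L * norm (\<phi> x)" using x by (intro grad)
        also have "\<dots> \<le> L * 1" using \<phi>(2) \<open>L \<ge> 0\<close> by (intro mult_left_mono) auto
        finally have "\<bar>step' (c * f x)\<bar> * \<bar>f' x (\<phi> x)\<bar> \<le> 2 * L"
          using step'_bound[of "c * f x"] by (intro mult_mono) auto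
        then have "c * (\<bar>step' (c * f x)\<bar> * \<bar>f' x (\<phi> x)\<bar>) \<le> c * (2 * L)" using c by (intro mult_left_mono) auto
        then show ?thesis using True x c by (simp add: abs_mult ac_simps)
      next
        case False
        have "x \<notin> E \<or> c * f x \<le> -1 \<or> c * f x \<ge> 0"
          using False c by (auto simp: S_def field_simps mult_le_0_iff zero_le_mult_iff)
        then show ?thesis using False step'_eq[of "c * f x"] by (auto simp: indicator_def)
      qed
      have i2: "integrable lebesgue (\<lambda>x. indicator E x *\<^sub>R ?R x)"
      proof (rule Bochner_Integration.integrable_bound[OF iS])
        have "continuous_on UNIV (\<lambda>x. f' x (\<phi> x))"
        proof -
          have "f' x (\<phi> x) = (\<Sum>b\<in>Basis. f' x b * (\<phi> x \<bullet> b))" for x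
            using linear_sum_Basis_inner[of "f' x" "\<phi> x"] has_derivative_linear[OF C1_onD(1)[OF f UNIV_I]] by simp
          then show ?thesis by (simp, intro continuous_intros C1_onD[OF f] C1_on_continuous[OF p])
        qed
        then have "continuous_on UNIV ?R"
          by (intro continuous_intros continuous_on_compose2[OF continuous_on_step'[of UNIV]] C1_on_continuous[OF f]) auto
        then have "?R \<in> borel_measurable lebesgue"
          by (intro measurable_completion) (simp add: borel_measurable_continuous_onI)
        then show "(\<lambda>x. indicator E x *\<^sub>R ?R x) \<in> borel_measurable lebesgue"
          using Em by (intro borel_measurable_scaleR borel_measurable_indicator)
        show "AE x in lebesgue. norm (indicator E x *\<^sub>R ?R x) \<le> norm (2 * c * L * indicator S x)"
          using Rb c \<open>L \<ge> 0\<close> by (intro AE_I2) (auto simp: abs_mult)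
      qed
      have "(LINT x:E|lebesgue. step (c * f x) * divergence \<phi> x) = (LINT x|lebesgue. indicator E x *\<^sub>R divergence ?\<psi> x - indicator E x *\<^sub>R ?R x)"
        unfolding set_lebesgue_integral_def by (rule Bochner_Integration.integral_cong) (auto simp: dv indicator_def)
      also have "\<dots> = (LINT x:E|lebesgue. divergence ?\<psi> x) - (LINT x|lebesgue. indicator E x *\<^sub>R ?R x)"
        using i1 i2 unfolding set_lebesgue_integral_def set_integrable_def by (rule Bochner_Integration.integral_diff)
      also have "\<dots> \<le> CE + \<bar>LINT x|lebesgue. indicator E x *\<^sub>R ?R x\<bar>"
      proof -
        have "norm (?\<psi> x) \<le> 1" for x
          using \<phi>(2) step_bounds[of "c * f x"] by (auto simp: intro!: mult_le_one)
        then show ?thesis using CE[OF \<psi>] by (smt (verit))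
      qed
      also have "\<bar>LINT x|lebesgue. indicator E x *\<^sub>R ?R x\<bar> \<le> (LINT x|lebesgue. 2 * c * L * indicator S x)"
        using Rb by (intro order_trans[OF integral_abs_bound] integral_mono integrable_abs i2 iS) (auto simp: abs_mult)
      also have "\<dots> = 2 * c * L * measure lebesgue S" using S Sfin by (simp add: measure_def)
      also have "\<dots> \<le> 2 * c * L * (C * (1 / c))"
        using volS c \<open>C \<ge> 0\<close> \<open>L \<ge> 0\<close> unfolding measure_def
        by (intro mult_left_mono enn2real_leI) auto
      also have "\<dots> = 2 * L * C" using c by simp
      finally show ?thesis by (simp add: c_def)
    qed
    then show "\<exists>N. \<forall>n\<ge>N. (LINT x:E|lebesgue. step (real (Suc n) * f x) * divergence \<phi> x) \<le> CE + 2 * L * C" by blast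
  qed
  then show ?thesis unfolding finite_perimeter_def using m by blast
qed

section \<open>Finite perimeter of unions and of sets cut by balls or half-spaces\<close>

lemma finite_perimeter_UNIV: "finite_perimeter (UNIV :: 'a::euclidean_space set)"
proof -
  have "(LINT x:UNIV|lebesgue. divergence \<phi> x) \<le> 0" if "test_field \<phi>" for \<phi> :: "'a \<Rightarrow> 'a"
    using integral_divergence_zero[OF that] test_field_divergence_integrable(4)[OF that]
    by (simp add: set_lebesgue_integral_def integral_completion)
  then show ?thesis by (auto simp: finite_perimeter_def)
qed

text \<open>The indicator of the union is the sum of the two indicators minus that of A \<inter> B;
  the minus sign is absorbed by testing A \<inter> B with -\<phi>.\<close>

lemma finite_perimeter_Un:
  assumes "finite_perimeter A" "finite_perimeter B" "finite_perimeter (A \<inter> B)"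
  shows "finite_perimeter (A \<union> B)"
proof -
  have m: "A \<in> sets lebesgue" "B \<in> sets lebesgue" using assms by (auto simp: finite_perimeter_def)
  obtain a b c where
    a: "\<And>\<phi>. test_field \<phi> \<Longrightarrow> \<forall>x. norm (\<phi> x) \<le> 1 \<Longrightarrow> (LINT x:A|lebesgue. divergence \<phi> x) \<le> a" and
    b: "\<And>\<phi>. test_field \<phi> \<Longrightarrow> \<forall>x. norm (\<phi> x) \<le> 1 \<Longrightarrow> (LINT x:B|lebesgue. divergence \<phi> x) \<le> b" and
    c: "\<And>\<phi>. test_field \<phi> \<Longrightarrow> \<forall>x. norm (\<phi> x) \<le> 1 \<Longrightarrow> (LINT x:A \<inter> B|lebesgue. divergence \<phi> x) \<le> c"
    using assms unfolding finite_perimeter_def by metis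
  have "(LINT x:A \<union> B|lebesgue. divergence \<phi> x) \<le> a + b + c" if \<phi>: "test_field \<phi>" "\<forall>x. norm (\<phi> x) \<le> 1" for \<phi>
  proof -
    obtain \<phi>' where p: "C1_on UNIV \<phi> \<phi>'" using test_fieldE[OF \<phi>(1)] by metis
    let ?\<psi> = "\<lambda>x. (- 1) *\<^sub>R \<phi> x"
    have \<psi>: "test_field ?\<psi>" by (rule test_field_scaleR[OF C1_on_const \<phi>(1)])
    have d: "divergence ?\<psi> x = - divergence \<phi> x" for x
      using divergence_scaleR[OF C1_on_const[of UNIV "-1"] p, of x] by simp
    have i: "set_integrable lebesgue X (divergence \<phi>)" if "X \<in> sets lebesgue" for X
      using test_field_divergence_integrable(3)[OF \<phi>(1) that] .
    note i' = i[unfolded set_integrable_def]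
    have "(LINT x:A \<union> B|lebesgue. divergence \<phi> x) = (LINT x|lebesgue. indicator A x *\<^sub>R divergence \<phi> x + indicator B x *\<^sub>R divergence \<phi> x - indicator (A \<inter> B) x *\<^sub>R divergence \<phi> x)"
      unfolding set_lebesgue_integral_def by (rule Bochner_Integration.integral_cong) (auto simp: indicator_def)
    also have "\<dots> = (LINT x:A|lebesgue. divergence \<phi> x) + (LINT x:B|lebesgue. divergence \<phi> x) - (LINT x:A \<inter> B|lebesgue. divergence \<phi> x)"
      unfolding set_lebesgue_integral_def using i'[OF m(1)] i'[OF m(2)] i'[OF sets.Int[OF m]]
      by (simp add: Bochner_Integration.integral_diff Bochner_Integration.integral_add)
    moreover have "(LINT x:A \<inter> B|lebesgue. divergence ?\<psi> x) = - (LINT x:A \<inter> B|lebesgue. divergence \<phi> x)"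
      unfolding set_lebesgue_integral_def d by simp
    then have "(LINT x:A|lebesgue. divergence \<phi> x) + (LINT x:B|lebesgue. divergence \<phi> x) - (LINT x:A \<inter> B|lebesgue. divergence \<phi> x) \<le> a + b + c"
      using a[OF \<phi>] b[OF \<phi>] c[OF \<psi>] \<phi>(2) by simp
    ultimately show ?thesis by simp
  qed
  then show ?thesis unfolding finite_perimeter_def using m by blast
qed

lemma emeasure_thin_shell_le:
  fixes p :: "'a::euclidean_space"
  assumes r: "r > 0" and \<epsilon>: "\<epsilon> > 0"
  shows "emeasure lborel {x. r\<^sup>2 - \<epsilon> \<le> (norm (x - p))\<^sup>2 \<and> norm (x - p) \<le> r}
    \<le> ennreal (unit_ball_vol DIM('a) * real DIM('a) * r ^ DIM('a) / r\<^sup>2 * \<epsilon>)"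
proof -
  let ?n = "DIM('a)" and ?w = "unit_ball_vol (real DIM('a))"
  define h where "h = \<epsilon> / r\<^sup>2"
  have h: "h > 0" using r \<epsilon> by (simp add: h_def)
  \<comment> \<open>An inner radius that is easy to compute with: for \<epsilon> < r^2 it is a = r -
    \<epsilon> / r, with a^2 \<le> a r = r^2 - \<epsilon>, and the minimum sets a = 0 for larger
    \<epsilon>. Bernoulli's inequality then applies to 1 - min h 1.\<close>
  define a where "a = r * (1 - min h 1)"
  have a: "0 \<le> a" "a \<le> r" using r h by (auto simp: a_def mult_le_cancel_left1)
  have "{x. r\<^sup>2 - \<epsilon> \<le> (norm (x - p))\<^sup>2 \<and> norm (x - p) \<le> r} \<subseteq> cball p r - ball p a"
  proof safe
    fix x assume x: "r\<^sup>2 - \<epsilon> \<le> (norm (x - p))\<^sup>2" "norm (x - p) \<le> r"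
    then show "x \<in> cball p r" by (simp add: dist_norm norm_minus_commute)
    assume "x \<in> ball p a"
    then have xa: "norm (x - p) < a" by (simp add: dist_norm norm_minus_commute)
    have "a > 0" using xa norm_ge_zero[of "x - p"] by linarith
    then have h1: "h < 1" using r by (auto simp: a_def min_def zero_less_mult_iff split: if_splits)
    then have ar: "a = r - \<epsilon> / r" using r by (simp add: a_def h_def power2_eq_square field_simps)
    have "(norm (x - p))\<^sup>2 < a\<^sup>2" using xa by (intro power_strict_mono) auto
    also have "a\<^sup>2 \<le> a * r" using a by (simp add: power2_eq_square mult_left_mono)
    also have "\<dots> = r\<^sup>2 - \<epsilon>" using r by (simp add: ar power2_eq_square algebra_simps)
    finally show False using x by simp
  qed
  then have "emeasure lborel {x. r\<^sup>2 - \<epsilon> \<le> (norm (x - p))\<^sup>2 \<and> norm (x - p) \<le> r} \<le> emeasure lborel (cball p r - ball p a)"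
    by (rule emeasure_mono) simp
  also have "\<dots> = emeasure lborel (cball p r) - emeasure lborel (ball p a)"
    using a by (intro emeasure_Diff) (auto simp: emeasure_ball)
  also have "\<dots> = ennreal (?w * r ^ ?n - ?w * a ^ ?n)"
    using a r by (simp add: emeasure_ball emeasure_cball ennreal_minus)
  also have "\<dots> \<le> ennreal (?w * real ?n * r ^ ?n / r\<^sup>2 * \<epsilon>)"
  proof (rule ennreal_leI)
    have "1 + real ?n * (- min h 1) \<le> (1 + (- min h 1)) ^ ?n" using h by (intro Bernoulli_inequality) auto
    then have "1 - (1 - min h 1) ^ ?n \<le> real ?n * min h 1" by simp
    also have "\<dots> \<le> real ?n * h" by (intro mult_left_mono) auto
    finally have "?w * r ^ ?n * (1 - (1 - min h 1) ^ ?n) \<le> ?w * r ^ ?n * (real ?n * h)"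
      using r by (intro mult_left_mono) auto
    moreover have "a ^ ?n = r ^ ?n * (1 - min h 1) ^ ?n" unfolding a_def by (rule power_mult_distrib)
    moreover have "?w * real ?n * r ^ ?n / r\<^sup>2 * \<epsilon> = ?w * r ^ ?n * (real ?n * h)" by (simp add: h_def)
    ultimately show "?w * r ^ ?n - ?w * a ^ ?n \<le> ?w * real ?n * r ^ ?n / r\<^sup>2 * \<epsilon>"
      by (simp add: right_diff_distrib mult.assoc)
  qed
  finally show ?thesis .
qed

lemma emeasure_lebesgue_Int_le:
  assumes "A \<subseteq> B" "B \<in> sets borel" "emeasure lborel B \<le> c"
  shows "emeasure lebesgue A \<le> c"
proof -
  have "emeasure lebesgue A \<le> emeasure lebesgue B" using assms by (intro emeasure_mono) auto
  then show ?thesis using assms by simp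
qed

lemma finite_perimeter_Int_ball:
  fixes E :: "'a::euclidean_space set"
  assumes E: "finite_perimeter E" and r: "r > 0"
  shows "finite_perimeter (E \<inter> ball p r)"
proof -
  let ?C = "unit_ball_vol DIM('a) * real DIM('a) * r ^ DIM('a) / r\<^sup>2"
  have "finite_perimeter (E \<inter> {x. (norm (x - p))\<^sup>2 - r\<^sup>2 < 0})"
  proof (rule finite_perimeter_Int_sublevel[OF E C1_on_norm_sq, where L="2 * r" and C="?C"])
    fix x v :: 'a assume "(norm (x - p))\<^sup>2 - r\<^sup>2 \<le> 0"
    then have "(norm (x - p))\<^sup>2 \<le> r\<^sup>2" by linarith
    then have "norm (x - p) \<le> r" using r by (rule power2_le_imp_le[OF _ less_imp_le])
    then have "\<bar>(x - p) \<bullet> v\<bar> \<le> r * norm v"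
      using Cauchy_Schwarz_ineq2[of "x - p" v] mult_right_mono[of "norm (x - p)" r "norm v"] by simp
    then show "\<bar>2 * ((x - p) \<bullet> v)\<bar> \<le> 2 * r * norm v" by (simp add: abs_mult)
  next
    fix \<epsilon> :: real assume \<epsilon>: "0 < \<epsilon>" "\<epsilon> \<le> 1"
    show "emeasure lebesgue (E \<inter> {x. - \<epsilon> \<le> (norm (x - p))\<^sup>2 - r\<^sup>2 \<and> (norm (x - p))\<^sup>2 - r\<^sup>2 \<le> 0}) \<le> ennreal (?C * \<epsilon>)"
    proof (rule emeasure_lebesgue_Int_le[OF _ _ emeasure_thin_shell_le[OF r \<epsilon>(1)]])
      show "E \<inter> {x. - \<epsilon> \<le> (norm (x - p))\<^sup>2 - r\<^sup>2 \<and> (norm (x - p))\<^sup>2 - r\<^sup>2 \<le> 0}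
        \<subseteq> {x. r\<^sup>2 - \<epsilon> \<le> (norm (x - p))\<^sup>2 \<and> norm (x - p) \<le> r}"
      proof safe
        fix x assume "(norm (x - p))\<^sup>2 - r\<^sup>2 \<le> 0"
        then have "(norm (x - p))\<^sup>2 \<le> r\<^sup>2" by linarith
        then show "norm (x - p) \<le> r" using r by (rule power2_le_imp_le[OF _ less_imp_le])
      qed linarith
    qed measurable
  qed (use r in auto)
  moreover have "(norm (x - p))\<^sup>2 < r\<^sup>2 \<longleftrightarrow> norm (x - p) < r" for x
    using r by (metis less_imp_le norm_ge_zero power2_less_imp_less power_strict_mono zero_less_numeral)
  then have "{x. (norm (x - p))\<^sup>2 - r\<^sup>2 < 0} = ball p r"
    unfolding ball_def dist_norm norm_minus_commute[of p] by (simp only: diff_less_0_iff_less)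
  ultimately show ?thesis by simp
qed

text \<open>Boundedness places each layer -\<epsilon> \<le> (x - p) \<bullet> e - c \<le> 0 of E in
  a cylinder of height \<epsilon>, whose volume \<open>emeasure_le_cylinder\<close> bounds linearly
  in \<epsilon>.\<close>

lemma finite_perimeter_Int_halfspace:
  fixes E :: "'a::euclidean_space set"
  assumes E: "finite_perimeter E" "bounded E" and e: "norm e = 1" and dim: "DIM('a) \<ge> 2"
  shows "finite_perimeter (E \<inter> {x. (x - p) \<bullet> e < c})"
proof -
  obtain R where R: "R > 0" "\<And>x. x \<in> E \<Longrightarrow> norm x \<le> R" using E(2) bounded_pos by blast
  let ?C = "unit_ball_vol (real (DIM('a) - 1)) * (2 * R / 2) ^ (DIM('a) - 1)"
  have "finite_perimeter (E \<inter> {x. (x - p) \<bullet> e - c < 0})"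
  proof (rule finite_perimeter_Int_sublevel[OF E(1) C1_on_linear, where L=1 and C="?C"])
    show "\<bar>v \<bullet> e\<bar> \<le> 1 * norm v" for v using Cauchy_Schwarz_ineq2[of v e] e by simp
  next
    fix \<epsilon> :: real assume \<epsilon>: "0 < \<epsilon>" "\<epsilon> \<le> 1"
    let ?X = "{x. norm x \<le> R \<and> - \<epsilon> \<le> (x - p) \<bullet> e - c \<and> (x - p) \<bullet> e - c \<le> 0}"
    show "emeasure lebesgue (E \<inter> {x. - \<epsilon> \<le> (x - p) \<bullet> e - c \<and> (x - p) \<bullet> e - c \<le> 0}) \<le> ennreal (?C * \<epsilon>)"
    proof (rule emeasure_lebesgue_Int_le[where B="?X"])
      show "emeasure lborel ?X \<le> ennreal (?C * \<epsilon>)"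
      proof (rule emeasure_le_cylinder[OF _ e dim])
        fix x y assume xy: "x \<in> ?X" "y \<in> ?X"
        then have "norm (x - y) \<le> 2 * R" using norm_triangle_ineq4[of x y] by auto
        then show "norm (perp e (x - y)) \<le> 2 * R" using norm_perp_le[OF e, of "x - y"] by simp
        show "\<bar>(x - y) \<bullet> e\<bar> \<le> \<epsilon>" using xy by (auto simp: inner_diff_left abs_le_iff)
      qed (use R \<epsilon> in \<open>auto, measurable\<close>)
      show "?X \<in> sets borel" by measurable
    qed (use R in auto)
  qed (use R in auto)
  then show ?thesis by simp
qed

text \<open>Off the frontier E is locally all or nothing, so its Gauss-Green measure annihilates
  test fields supported near x. Testing with cut-offs of a ball times the supposed limit l makes the
  averages of \<nu> orthogonal to l, against their convergence to l.\<close>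

lemma reduced_boundary_subset_frontier:
  fixes E :: "'a::euclidean_space set"
  shows "reduced_boundary E \<subseteq> frontier E"
proof
  fix x assume "x \<in> reduced_boundary E"
  then obtain M \<nu> l where gg: "gauss_green E M \<nu>" and pos: "\<And>\<rho>. \<rho> > 0 \<Longrightarrow> measure M (ball x \<rho>) > 0" and l: "norm l = 1"
    and lim: "((\<lambda>\<rho>. (LINT y:ball x \<rho>|M. \<nu> y) /\<^sub>R measure M (ball x \<rho>)) \<longlongrightarrow> l) (at_right 0)"
    by (auto simp: reduced_boundary_def)
  have sM: "sets M = sets borel" and fM: "finite_measure M" and \<nu>: "\<nu> \<in> borel_measurable borel"
    and \<nu>1: "AE x in M. norm (\<nu> x) = 1"
    and GG: "\<And>\<phi>. test_field \<phi> \<Longrightarrow> (LINT x:E|lebesgue. divergence \<phi> x) = (LINT x|M. \<phi> x \<bullet> \<nu> x)"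
    using gg by (auto simp: gauss_green_def)
  interpret finite_measure M by (rule fM)
  have \<nu>M: "\<nu> \<in> borel_measurable M" using \<nu> sM measurable_cong_sets by blast
  have i\<nu>: "integrable M \<nu>" by (rule integrable_const_bound[where B=1]) (use \<nu>1 \<nu>M in auto)
  show "x \<in> frontier E"
  proof (rule ccontr)
    assume "x \<notin> frontier E"
    then have "x \<in> interior E \<or> x \<in> interior (- E)"
      by (auto simp: frontier_def interior_closure)
    then obtain r where r: "r > 0" "ball x r \<subseteq> E \<or> ball x r \<subseteq> - E"
      by (auto simp: mem_interior)
    have zero: "(LINT y:ball x \<rho>|M. \<nu> y) \<bullet> l = 0" if \<rho>: "0 < \<rho>" "\<rho> < r" for \<rho>
    proof -
      let ?f = "\<lambda>y. (norm (y - x))\<^sup>2 - \<rho>\<^sup>2"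
      have "(norm (y - x))\<^sup>2 < \<rho>\<^sup>2 \<longleftrightarrow> norm (y - x) < \<rho>" for y
        using \<rho> by (metis less_imp_le norm_ge_zero power2_less_imp_less power_strict_mono zero_less_numeral)
      then have fneg: "?f y < 0 \<longleftrightarrow> y \<in> ball x \<rho>" for y
        unfolding mem_ball dist_norm norm_minus_commute[of x] by (simp only: diff_less_0_iff_less)
      define \<phi> where "\<phi> j y = step (real (Suc j) * ?f y) *\<^sub>R l" for j y
      have c1: "C1_on UNIV (\<lambda>y. step (real (Suc j) * ?f y) *\<^sub>R l)
         (\<lambda>y v. step (real (Suc j) * ?f y) *\<^sub>R 0 + (step' (real (Suc j) * ?f y) * real (Suc j) * (2 * ((y - x) \<bullet> v))) *\<^sub>R l)" for j
        by (rule C1_on_scaleR[OF C1_on_step[OF C1_on_norm_sq] C1_on_const])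
      have out: "\<phi> j y = 0" if "y \<notin> cball x \<rho>" for j y
      proof -
        have "\<not> ?f y < 0" using that unfolding fneg by auto
        then have "step (real (Suc j) * ?f y) = 0" by (intro step_eq) (simp add: mult_nonneg_nonneg)
        then show ?thesis by (simp add: \<phi>_def)
      qed
      have tf: "test_field (\<phi> j)" for j
        unfolding \<phi>_def[abs_def] by (rule test_fieldI[OF c1, of "cball x \<rho>"]) (use out in \<open>auto simp: \<phi>_def\<close>)
      have dout: "divergence (\<phi> j) y = 0" if "y \<notin> cball x \<rho>" for j y
        unfolding \<phi>_def[abs_def]
        by (rule divergence_zero_outside[OF c1, of "cball x \<rho>"]) (use that out in \<open>auto simp: \<phi>_def\<close>)
      have sub: "cball x \<rho> \<subseteq> ball x r" using \<rho> by auto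
      have "(LINT y:E|lebesgue. divergence (\<phi> j) y) = 0" for j
        using r(2)
      proof
        assume "ball x r \<subseteq> E"
        then have "(LINT y:E|lebesgue. divergence (\<phi> j) y) = (LINT y|lebesgue. divergence (\<phi> j) y)"
          unfolding set_lebesgue_integral_def
        proof (intro Bochner_Integration.integral_cong)
          show "indicator E y *\<^sub>R divergence (\<phi> j) y = divergence (\<phi> j) y" for y
            using dout[of y j] subsetD[OF sub, of y] \<open>ball x r \<subseteq> E\<close> by (cases "y \<in> cball x \<rho>") auto
        qed simp
        also have "\<dots> = 0"
          using integral_divergence_zero[OF tf[of j]] test_field_divergence_integrable(4)[OF tf[of j]]
          by (simp add: integral_completion)
        finally show ?thesis .
      next
        assume "ball x r \<subseteq> - E"
        then have "(LINT y:E|lebesgue. divergence (\<phi> j) y) = (LINT y|(lebesgue :: 'a measure). 0)"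
          unfolding set_lebesgue_integral_def
        proof (intro Bochner_Integration.integral_cong)
          show "indicator E y *\<^sub>R divergence (\<phi> j) y = 0" for y
            using dout[of y j] subsetD[OF sub, of y] \<open>ball x r \<subseteq> - E\<close> by (cases "y \<in> cball x \<rho>") auto
        qed simp
        then show ?thesis by simp
      qed
      then have z: "(LINT y|M. \<phi> j y \<bullet> \<nu> y) = 0" for j using GG[OF tf[of j]] by simp
      have "(\<lambda>j. LINT y|M. \<phi> j y \<bullet> \<nu> y) \<longlonglongrightarrow> (LINT y|M. indicator (ball x \<rho>) y *\<^sub>R (\<nu> y \<bullet> l))"
      proof (rule integral_dominated_convergence[where w="\<lambda>_. 1"])
        have "\<phi> j \<in> borel_measurable borel" for j
          using C1_on_continuous[OF c1[of j]] unfolding \<phi>_def[abs_def] by (rule borel_measurable_continuous_onI)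
        then have "\<phi> j \<in> borel_measurable M" for j using sM measurable_cong_sets by blast
        then show "(\<lambda>y. \<phi> j y \<bullet> \<nu> y) \<in> borel_measurable M" for j using \<nu>M by (intro borel_measurable_inner)
        have "ball x \<rho> \<in> sets M" using sM by auto
        then show "(\<lambda>y. indicator (ball x \<rho>) y *\<^sub>R (\<nu> y \<bullet> l)) \<in> borel_measurable M"
          using \<nu>M by (intro borel_measurable_scaleR borel_measurable_indicator borel_measurable_inner) auto
        show "AE y in M. norm (\<phi> j y \<bullet> \<nu> y) \<le> 1" for j
          using \<nu>1
        proof eventually_elim
          case (elim y)
          have "\<bar>\<phi> j y \<bullet> \<nu> y\<bar> \<le> norm (\<phi> j y) * norm (\<nu> y)" by (rule Cauchy_Schwarz_ineq2)
          also have "\<dots> \<le> 1" using elim l step_bounds[of "real (Suc j) * ?f y"] by (simp add: \<phi>_def)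
          finally show ?case by simp
        qed
        have "(\<lambda>j. \<phi> j y \<bullet> \<nu> y) \<longlonglongrightarrow> indicator {..<0} (?f y) *\<^sub>R l \<bullet> \<nu> y" for y
          unfolding \<phi>_def by (intro tendsto_intros step_tendsto)
        moreover have "indicator {..<0} (?f y) *\<^sub>R l \<bullet> \<nu> y = indicator (ball x \<rho>) y *\<^sub>R (\<nu> y \<bullet> l)" for y
          using fneg[of y] by (simp add: indicator_def inner_commute)
        ultimately show "AE y in M. (\<lambda>j. \<phi> j y \<bullet> \<nu> y) \<longlonglongrightarrow> indicator (ball x \<rho>) y *\<^sub>R (\<nu> y \<bullet> l)" by simp
      qed simp
      then have z0: "(LINT y|M. indicator (ball x \<rho>) y *\<^sub>R (\<nu> y \<bullet> l)) = 0"
        unfolding z using LIMSEQ_unique tendsto_const by blast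
      have "ball x \<rho> \<in> sets M" using sM by auto
      then have "integrable M (\<lambda>y. indicator (ball x \<rho>) y *\<^sub>R \<nu> y)"
        by (rule integrable_mult_indicator[OF _ i\<nu>])
      from integral_inner_left[of l, OF this] z0 show ?thesis
        by (simp add: set_lebesgue_integral_def)
    qed
    have "((\<lambda>\<rho>. ((LINT y:ball x \<rho>|M. \<nu> y) /\<^sub>R measure M (ball x \<rho>)) \<bullet> l) \<longlongrightarrow> l \<bullet> l) (at_right 0)"
      by (intro tendsto_intros lim)
    moreover have "\<forall>\<^sub>F \<rho> in at_right 0. ((LINT y:ball x \<rho>|M. \<nu> y) /\<^sub>R measure M (ball x \<rho>)) \<bullet> l = 0"
      unfolding eventually_at_right_field by (rule exI[of _ r]) (use r zero in auto)
    ultimately have "((\<lambda>\<rho>::real. 0 :: real) \<longlongrightarrow> l \<bullet> l) (at_right 0)"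
      by (rule Lim_transform_eventually)
    then have "l \<bullet> l = 0" by (simp add: tendsto_const_iff)
    then show False using l by simp
  qed
qed

section \<open>The Gauss--Green formula near a boundary point\<close>

text \<open>G is the gradient of g as a vector field. It is required to be C1 because
  \<open>gauss_green_M\<close> divides by G \<bullet> e and takes derivatives of the result.\<close>

definition boundary_chart :: "'a::euclidean_space set \<Rightarrow> 'a set \<Rightarrow> ('a \<Rightarrow> real) \<Rightarrow> ('a \<Rightarrow> 'a) \<Rightarrow> ('a \<Rightarrow> 'a \<Rightarrow> 'a) \<Rightarrow> bool" where
  "boundary_chart \<Omega> U g G G' \<longleftrightarrow> open U \<and> C1_on U g (\<lambda>x v. G x \<bullet> v) \<and> C1_on U G G' \<and> (\<forall>x\<in>U. G x \<noteq> 0)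
     \<and> \<Omega> \<inter> U = {x \<in> U. g x < 0} \<and> frontier \<Omega> \<inter> U = {x \<in> U. g x = 0}"

lemma smooth_boundary_chart:
  fixes \<Omega> :: "'a::euclidean_space set"
  assumes "smooth_boundary \<Omega>" "p \<in> frontier \<Omega>"
  obtains U g G G' where "boundary_chart \<Omega> U g G G'" "p \<in> U"
proof -
  obtain U and g :: "'a \<Rightarrow> real" where U: "open U" "p \<in> U" "smooth_on U g"
    "\<forall>x\<in>U. frechet_derivative g (at x) \<noteq> (\<lambda>v. 0)" "\<Omega> \<inter> U = {x \<in> U. g x < 0}" "frontier \<Omega> \<inter> U = {x \<in> U. g x = 0}"
    using bspec[OF assms(1)[unfolded smooth_boundary_def] assms(2)] by (elim exE conjE) (rule that)
  let ?g' = "\<lambda>x. frechet_derivative g (at x)"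
  have ck: "C_k_on (Suc 0) U g" "C_k_on (Suc (Suc 0)) U g"
    using U(3) unfolding smooth_on_def by blast+
  have g1: "C1_on U g ?g'" using ck(1) by (rule C_k_on_imp_C1_on)
  have "C_k_on (Suc 0) U (\<lambda>x. ?g' x v)" for v using ck(2) by (subst (asm) C_k_on.simps) blast
  then have g2: "C1_on U (\<lambda>x. ?g' x v) (\<lambda>x. frechet_derivative (\<lambda>x. ?g' x v) (at x))" for v
    by (rule C_k_on_imp_C1_on)
  define G where "G x = (\<Sum>b\<in>Basis. ?g' x b *\<^sub>R b)" for x
  define G' where "G' x v = (\<Sum>b\<in>Basis. ?g' x b *\<^sub>R 0 + frechet_derivative (\<lambda>x. ?g' x b) (at x) v *\<^sub>R b)" for x v
  have CG: "C1_on U G G'"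
    unfolding G_def[abs_def] G'_def[abs_def] by (intro C1_on_sum C1_on_scaleR g2 C1_on_const)
  have Gv: "?g' x v = G x \<bullet> v" if "x \<in> U" for x v
    using linear_sum_Basis_inner[OF has_derivative_linear[OF C1_onD(1)[OF g1 that]], of v]
    unfolding inner_commute[of v] by (simp add: G_def inner_sum_left)
  have "C1_on U g (\<lambda>x v. G x \<bullet> v)"
  proof (rule C1_onI)
    fix x assume x: "x \<in> U"
    have "?g' x = (\<lambda>v. G x \<bullet> v)" using Gv[OF x] by auto
    then show "(g has_derivative (\<lambda>v. G x \<bullet> v)) (at x)" using C1_onD(1)[OF g1 x] by simp
  next
    show "continuous_on U (\<lambda>x. G x \<bullet> v)" for v by (intro continuous_intros C1_on_continuous[OF CG])
  qed
  moreover have "G x \<noteq> 0" if "x \<in> U" for x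
    using U(4) that Gv[OF that] by (auto simp: fun_eq_iff)
  ultimately have "boundary_chart \<Omega> U g G G'" using U CG by (simp add: boundary_chart_def)
  then show ?thesis using U(2) by (rule that)
qed

text \<open>A description of the outer unit normal by \<Omega> alone, which makes
  \<open>outer_normal\<close> independent of charts and defined on the whole frontier at
  once.\<close>

definition normal_at :: "'a::euclidean_space set \<Rightarrow> 'a \<Rightarrow> 'a \<Rightarrow> bool" where
  "normal_at \<Omega> x l \<longleftrightarrow> norm l = 1 \<and> (\<forall>v. v \<bullet> l < 0 \<longrightarrow> (\<forall>\<^sub>F t in at_right 0. x + t *\<^sub>R v \<in> \<Omega>))
     \<and> (\<forall>v. v \<bullet> l > 0 \<longrightarrow> (\<forall>\<^sub>F t in at_right 0. x + t *\<^sub>R v \<notin> \<Omega>))"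

text \<open>The default 0 makes it a Borel function on the whole space, as
  \<open>gauss_green\<close> demands of its density.\<close>

definition outer_normal :: "'a::euclidean_space set \<Rightarrow> 'a \<Rightarrow> 'a" where
  "outer_normal \<Omega> x = (if x \<in> frontier \<Omega> then THE l. normal_at \<Omega> x l else 0)"

text \<open>If l and l' were different unit vectors, the direction l' - l would point inward for l
  and outward for l'.\<close>

lemma normal_at_unique:
  assumes "normal_at \<Omega> x l" "normal_at \<Omega> x l'"
  shows "l = l'"
proof (rule ccontr)
  assume ne: "l \<noteq> l'"
  have n: "norm l = 1" "norm l' = 1" using assms by (auto simp: normal_at_def)
  have "0 < (norm (l - l'))\<^sup>2" using ne by simp
  also have "(norm (l - l'))\<^sup>2 = 2 - 2 * (l \<bullet> l')"
    using n unfolding power2_norm_eq_inner norm_eq_1 by (simp add: inner_diff inner_commute)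
  finally have "l \<bullet> l' < 1" by simp
  then have "(l' - l) \<bullet> l < 0" "(l' - l) \<bullet> l' > 0"
    using n unfolding norm_eq_1 by (simp_all add: inner_diff_left inner_diff_right inner_commute)
  then have "\<forall>\<^sub>F t in at_right 0. x + t *\<^sub>R (l' - l) \<in> \<Omega>" "\<forall>\<^sub>F t in at_right 0. x + t *\<^sub>R (l' - l) \<notin> \<Omega>"
    using assms by (auto simp: normal_at_def)
  then have "\<forall>\<^sub>F t::real in at_right 0. False" by eventually_elim auto
  then show False by simp
qed

lemma line_deriv:
  assumes "C1_on U g (\<lambda>x v. G x \<bullet> v)" "y + s *\<^sub>R e \<in> U"
  shows "((\<lambda>s. g (y + s *\<^sub>R e)) has_real_derivative G (y + s *\<^sub>R e) \<bullet> e) (at s)"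
proof -
  have "((\<lambda>s. y + s *\<^sub>R e) has_derivative (\<lambda>t. t *\<^sub>R e)) (at s)"
    by (auto intro!: derivative_eq_intros)
  from has_derivative_compose[OF this C1_onD(1)[OF assms]]
  show ?thesis by (simp add: has_field_derivative_def mult.commute[of _ "G _ \<bullet> e"])
qed

lemma outer_normal_chart:
  fixes \<Omega> :: "'a::euclidean_space set"
  assumes ch: "boundary_chart \<Omega> U g G G'" and x: "x \<in> U" "x \<in> frontier \<Omega>"
  shows "outer_normal \<Omega> x = sgn (G x)"
proof -
  have U: "open U" "C1_on U g (\<lambda>x v. G x \<bullet> v)" "G x \<noteq> 0" "\<Omega> \<inter> U = {x \<in> U. g x < 0}" "frontier \<Omega> \<inter> U = {x \<in> U. g x = 0}"
    using ch x by (auto simp: boundary_chart_def)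
  have g0: "g x = 0" using U(5) x by blast
  have inU: "\<forall>\<^sub>F t in at_right 0. x + t *\<^sub>R v \<in> U" for v
  proof -
    have "((\<lambda>t. x + t *\<^sub>R v) \<longlongrightarrow> x + 0 *\<^sub>R v) (at_right 0)" by (intro tendsto_intros)
    then show ?thesis using U(1) x(1) by (intro topological_tendstoD) auto
  qed
  have D: "((\<lambda>s. g (x + s *\<^sub>R v)) has_real_derivative G x \<bullet> v) (at 0)" for v
    using line_deriv[OF U(2), of x 0 v] x(1) by simp
  have "normal_at \<Omega> x (sgn (G x))"
    unfolding normal_at_def
  proof (intro conjI allI impI)
    show "norm (sgn (G x)) = 1" using U(3) by (simp add: norm_sgn)
  next
    fix v assume "v \<bullet> sgn (G x) < 0"
    then have "G x \<bullet> v < 0" using U(3) by (simp add: sgn_div_norm inner_commute mult_less_0_iff)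
    from DERIV_neg_dec_right[OF D this] have "\<exists>d>0. \<forall>h>0. h < d \<longrightarrow> g (x + h *\<^sub>R v) < 0" by (simp add: g0)
    then have "\<forall>\<^sub>F t in at_right 0. g (x + t *\<^sub>R v) < 0" by (auto simp: eventually_at_right_field)
    with inU[of v] show "\<forall>\<^sub>F t in at_right 0. x + t *\<^sub>R v \<in> \<Omega>"
      by eventually_elim (use U(4) in blast)
  next
    fix v assume "v \<bullet> sgn (G x) > 0"
    then have "G x \<bullet> v > 0" using U(3) by (simp add: sgn_div_norm inner_commute zero_less_mult_iff)
    from DERIV_pos_inc_right[OF D this] have "\<exists>d>0. \<forall>h>0. h < d \<longrightarrow> g (x + h *\<^sub>R v) > 0" by (simp add: g0)
    then have "\<forall>\<^sub>F t in at_right 0. g (x + t *\<^sub>R v) > 0" by (auto simp: eventually_at_right_field)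
    with inU[of v] show "\<forall>\<^sub>F t in at_right 0. x + t *\<^sub>R v \<notin> \<Omega>"
    proof eventually_elim
      case (elim t)
      then show ?case using U(4) by (auto simp: set_eq_iff) (metis less_asym)
    qed
  qed
  then have "(THE l. normal_at \<Omega> x l) = sgn (G x)"
    by (blast intro: the_equality normal_at_unique)
  then show ?thesis using x by (simp add: outer_normal_def)
qed

lemma continuous_on_outer_normal:
  fixes \<Omega> :: "'a::euclidean_space set"
  assumes "smooth_boundary \<Omega>"
  shows "continuous_on (frontier \<Omega>) (outer_normal \<Omega>)"
  unfolding continuous_on_def
proof
  fix x assume x: "x \<in> frontier \<Omega>"
  obtain U g G G' where ch: "boundary_chart \<Omega> U g G G'" and xU: "x \<in> U" using smooth_boundary_chart[OF assms x] by metis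
  then have U: "open U" "C1_on U G G'" "G x \<noteq> 0" by (auto simp: boundary_chart_def)
  have "isCont G x" using C1_on_continuous[OF U(2)] U(1) xU by (simp add: continuous_on_eq_continuous_at)
  then have "((\<lambda>y. sgn (G y)) \<longlongrightarrow> sgn (G x)) (at x within frontier \<Omega>)"
    using U(3) by (intro tendsto_sgn) (auto simp: isCont_def intro: tendsto_within_subset)
  moreover have "\<forall>\<^sub>F y in at x within frontier \<Omega>. sgn (G y) = outer_normal \<Omega> y"
    unfolding eventually_at_topological
    by (rule exI[of _ U]) (use U xU outer_normal_chart[OF ch] in auto)
  ultimately have "(outer_normal \<Omega> \<longlongrightarrow> sgn (G x)) (at x within frontier \<Omega>)"
    by (rule Lim_transform_eventually)
  then show "(outer_normal \<Omega> \<longlongrightarrow> outer_normal \<Omega> x) (at x within frontier \<Omega>)"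
    using outer_normal_chart[OF ch xU x] by simp
qed

lemma norm_outer_normal:
  assumes "smooth_boundary \<Omega>" "x \<in> frontier \<Omega>"
  shows "norm (outer_normal \<Omega> x) = 1"
proof -
  obtain U g G G' where ch: "boundary_chart \<Omega> U g G G'" and xU: "x \<in> U" using smooth_boundary_chart[OF assms] by metis
  then show ?thesis using outer_normal_chart[OF ch xU assms(2)] by (simp add: norm_sgn boundary_chart_def)
qed

lemma borel_measurable_outer_normal:
  assumes "smooth_boundary \<Omega>"
  shows "outer_normal \<Omega> \<in> borel_measurable borel"
proof -
  have "(\<lambda>x. if x \<in> frontier \<Omega> then outer_normal \<Omega> x else 0) \<in> borel_measurable borel"
    by (rule borel_measurable_continuous_on_if) (use continuous_on_outer_normal[OF assms] in auto)
  also have "(\<lambda>x. if x \<in> frontier \<Omega> then outer_normal \<Omega> x else 0) = outer_normal \<Omega>"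
    by (auto simp: outer_normal_def fun_eq_iff)
  finally show ?thesis .
qed

lemma divergence_scaleR_on:
  assumes f: "C1_on U f f'" and \<phi>: "C1_on U \<phi> \<phi>'" and x: "x \<in> U"
  shows "divergence (\<lambda>x. f x *\<^sub>R \<phi> x) x = f x * divergence \<phi> x + f' x (\<phi> x)"
proof -
  have "linear (f' x)" using C1_onD(1)[OF f x] has_derivative_linear by blast
  then show ?thesis
    using linear_sum_Basis_inner[of "f' x" "\<phi> x"]
    by (simp add: divergence_eq[OF C1_on_scaleR[OF f \<phi>] x] divergence_eq[OF \<phi> x]
        inner_add_left sum.distrib sum_distrib_left)
qed

text \<open>In the cut-off field step(j g) \<tau> the derivative falling on step produces the factor
  G \<bullet> \<tau> = 0. Hence its divergence is step(j g) times that of \<tau>; the integral is 0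
  for each j, and in the limit it becomes the integral over \<Omega>.\<close>

lemma integral_divergence_tangential:
  fixes \<tau> :: "'a::euclidean_space \<Rightarrow> 'a"
  assumes V: "open V" and g: "C1_on V g (\<lambda>x v. G x \<bullet> v)" and \<Omega>: "open \<Omega>" "\<Omega> \<inter> V = {x \<in> V. g x < 0}"
    and \<tau>: "C1_on UNIV \<tau> \<tau>'" and K: "compact K" "K \<subseteq> V" "\<And>x. x \<notin> K \<Longrightarrow> \<tau> x = 0"
    and tang: "\<And>x. x \<in> V \<Longrightarrow> G x \<bullet> \<tau> x = 0"
  shows "(\<integral>x. indicator \<Omega> x * divergence \<tau> x \<partial>lborel) = 0"
proof -
  have cK: "closed K" using K(1) by (rule compact_imp_closed)
  have d0: "divergence \<tau> x = 0" if "x \<notin> K" for x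
    using divergence_zero_outside[OF \<tau> cK K(3) that] .
  define \<psi> where "\<psi> j x = (if x \<in> V then step (real (Suc j) * g x) *\<^sub>R \<tau> x else 0)" for j x
  note \<tau>V = C1_on_subset[OF \<tau> subset_UNIV]
  note cs = C1_on_scaleR[OF C1_on_step[OF g] \<tau>V]
  have c\<psi>: "C1_on UNIV (\<psi> j) (\<lambda>x v. if x \<in> V then step (real (Suc j) * g x) *\<^sub>R \<tau>' x v
      + (step' (real (Suc j) * g x) * real (Suc j) * (G x \<bullet> v)) *\<^sub>R \<tau> x else 0)" for j
    unfolding \<psi>_def[abs_def] by (rule C1_on_extend_zero[OF cs V cK K(2)]) (use K(3) in auto)
  have \<psi>0: "\<psi> j x = 0" if "x \<notin> K" for j x using K(3)[OF that] by (simp add: \<psi>_def)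
  have tf: "test_field (\<psi> j)" for j by (rule test_fieldI[OF c\<psi> K(1) \<psi>0])
  have dv: "divergence (\<psi> j) x = (if x \<in> V then step (real (Suc j) * g x) * divergence \<tau> x else 0)" for j x
  proof (cases "x \<in> V")
    case True
    have "divergence (\<psi> j) x = divergence (\<lambda>x. step (real (Suc j) * g x) *\<^sub>R \<tau> x) x"
      using True by (simp add: divergence_eq[OF c\<psi> UNIV_I] divergence_eq[OF cs True])
    also have "\<dots> = step (real (Suc j) * g x) * divergence \<tau> x"
      using divergence_scaleR_on[OF C1_on_step[OF g] \<tau>V True] tang[OF True] by simp
    finally show ?thesis using True by simp
  next
    case False
    then have "x \<notin> K" using K(2) by blast
    then show ?thesis using divergence_zero_outside[OF c\<psi> cK \<psi>0] False by simp
  qed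
  have "(\<lambda>j. \<integral>x. divergence (\<psi> j) x \<partial>lborel) \<longlonglongrightarrow> (\<integral>x. indicator \<Omega> x * divergence \<tau> x \<partial>lborel)"
  proof (rule integral_dominated_convergence[where w="\<lambda>x. \<bar>divergence \<tau> x\<bar>"])
    have i: "integrable lborel (divergence \<tau>)"
      by (rule test_field_divergence_integrable(1)[OF test_fieldI[OF \<tau> K(1) K(3)]])
    then show "integrable lborel (\<lambda>x. \<bar>divergence \<tau> x\<bar>)" by simp
    show "(\<lambda>x. indicator \<Omega> x * divergence \<tau> x) \<in> borel_measurable lborel"
      using \<Omega>(1) i by (intro borel_measurable_times borel_measurable_indicator) auto
    show "divergence (\<psi> j) \<in> borel_measurable lborel" for j
      using test_field_divergence_integrable(4)[OF tf] by simp
    show "AE x in lborel. norm (divergence (\<psi> j) x) \<le> \<bar>divergence \<tau> x\<bar>" for j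
      using step_bounds by (intro AE_I2) (auto simp: dv abs_mult intro!: mult_left_le_one_le)
    have "(\<lambda>j. divergence (\<psi> j) x) \<longlonglongrightarrow> indicator \<Omega> x * divergence \<tau> x" for x
    proof (cases "x \<in> V")
      case True
      have "indicator \<Omega> x = (indicator {..<0} (g x) :: real)" using True \<Omega>(2) by (auto simp: indicator_def)
      then show ?thesis using True by (simp only: dv if_True) (intro tendsto_intros step_tendsto)
    next
      case False
      then have "x \<notin> K" using K(2) by blast
      then have "divergence \<tau> x = 0" by (rule d0)
      then show ?thesis using False by (simp add: dv)
    qed
    then show "AE x in lborel. (\<lambda>j. divergence (\<psi> j) x) \<longlonglongrightarrow> indicator \<Omega> x * divergence \<tau> x" by simp
  qed
  then show ?thesis using integral_divergence_zero[OF tf] by (simp add: LIMSEQ_const_iff)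
qed

lemma emeasure_lborel_open_pos:
  fixes N :: "'a::euclidean_space set"
  assumes "open N" "y \<in> N"
  shows "emeasure lborel N > 0"
proof -
  obtain r where r: "r > 0" "ball y r \<subseteq> N" using assms open_contains_ball by blast
  then have "0 < emeasure lborel (ball y r)" by (simp add: emeasure_ball)
  also have "\<dots> \<le> emeasure lborel N" using r assms by (intro emeasure_mono) auto
  finally show ?thesis .
qed

text \<open>A ball in which g increases along e at rate at least \<kappa>, so that the frontier is a
  graph over the hyperplane orthogonal to e; C / \<kappa> bounds its area density.\<close>

locale graph_patch =
  fixes \<Omega> V :: "'a::euclidean_space set" and g :: "'a \<Rightarrow> real" and G :: "'a \<Rightarrow> 'a" and G' :: "'a \<Rightarrow> 'a \<Rightarrow> 'a"
    and e :: 'a and x0 :: 'a and \<rho> \<kappa> C :: real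
  assumes \<rho>: "\<rho> > 0" and V: "V = ball x0 \<rho>" and g: "C1_on V g (\<lambda>x v. G x \<bullet> v)" and G: "C1_on V G G'"
    and e: "norm e = 1" and \<kappa>: "\<kappa> > 0" "\<And>x. x \<in> V \<Longrightarrow> \<kappa> \<le> G x \<bullet> e" and C: "\<And>x. x \<in> V \<Longrightarrow> norm (G x) \<le> C"
    and \<Omega>: "open \<Omega>" "\<Omega> \<inter> V = {x \<in> V. g x < 0}" "frontier \<Omega> \<inter> V = {x \<in> V. g x = 0}" and x0: "g x0 = 0"
begin

lemma openV: "open V" and convexV: "convex V" and x0V: "x0 \<in> V"
  using \<rho> by (auto simp: V)

lemma between_V:
  assumes "y + a *\<^sub>R e \<in> V" "y + b *\<^sub>R e \<in> V" "a \<le> s" "s \<le> b"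
  shows "y + s *\<^sub>R e \<in> V"
proof (cases "a = b")
  case False
  then have ab: "a < b" using assms by auto
  define t where "t = (s - a) / (b - a)"
  have t: "0 \<le> t" "t \<le> 1" using assms ab by (auto simp: t_def)
  have "(1 - t) *\<^sub>R (y + a *\<^sub>R e) + t *\<^sub>R (y + b *\<^sub>R e) \<in> V"
    using convexV assms t by (auto simp: convex_alt)
  moreover have "t * (b - a) = s - a" using ab by (simp add: t_def)
  then have "(1 - t) *\<^sub>R (y + a *\<^sub>R e) + t *\<^sub>R (y + b *\<^sub>R e) = y + s *\<^sub>R e"
    by (simp add: algebra_simps) (metis add_diff_cancel_left' diff_add_cancel scaleR_left_distrib)
  ultimately show ?thesis by simp
qed (use assms in auto)

lemma g_increasing:
  assumes "y + a *\<^sub>R e \<in> V" "y + b *\<^sub>R e \<in> V" "a < b"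
  shows "g (y + a *\<^sub>R e) < g (y + b *\<^sub>R e)"
proof (rule DERIV_pos_imp_increasing[OF assms(3)])
  fix s assume "a \<le> s" "s \<le> b"
  then have "y + s *\<^sub>R e \<in> V" using between_V[OF assms(1,2)] by blast
  then show "\<exists>D. ((\<lambda>s. g (y + s *\<^sub>R e)) has_real_derivative D) (at s) \<and> 0 < D"
    using line_deriv[OF g] \<kappa> by (meson less_le_trans)
qed

text \<open>A union of whole lines in direction e, those which meet the frontier inside V: the
  domain of the graph, thickened along e so that slab averages can replace integrals over the
  hyperplane.\<close>

definition Y where "Y = {y. \<exists>s. y + s *\<^sub>R e \<in> V \<and> g (y + s *\<^sub>R e) = 0}"
definition \<sigma> where "\<sigma> y = (THE s. y + s *\<^sub>R e \<in> V \<and> g (y + s *\<^sub>R e) = 0)"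
text \<open>The point of the graph on the line through y; the default x0 keeps all values on the
  frontier inside V.\<close>

definition P where "P y = (if y \<in> Y then y + \<sigma> y *\<^sub>R e else x0)"

lemma \<sigma>_eq: "y + s *\<^sub>R e \<in> V \<Longrightarrow> g (y + s *\<^sub>R e) = 0 \<Longrightarrow> \<sigma> y = s"
  unfolding \<sigma>_def by (rule the_equality) (auto, metis g_increasing less_irrefl linorder_neqE_linordered_idom)

lemma \<sigma>: "y \<in> Y \<Longrightarrow> y + \<sigma> y *\<^sub>R e \<in> V" "y \<in> Y \<Longrightarrow> g (y + \<sigma> y *\<^sub>R e) = 0"
  using \<sigma>_eq by (auto simp: Y_def)

lemma P: "P y \<in> V" "g (P y) = 0" "P y \<in> frontier \<Omega>"
proof -
  show "P y \<in> V" "g (P y) = 0" using \<sigma>[of y] x0 x0V by (auto simp: P_def)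
  then show "P y \<in> frontier \<Omega>" using \<Omega>(3) by blast
qed

text \<open>An implicit function argument by the intermediate value theorem: on the line through y,
  g is positive at height \<sigma> y + t and negative at \<sigma> y - t. This persists for nearby
  y', so a zero lies between.\<close>

lemma \<sigma>_near:
  assumes y: "y \<in> Y" and d: "d > 0"
  shows "\<forall>\<^sub>F y' in nhds y. y' \<in> Y \<and> \<bar>\<sigma> y' - \<sigma> y\<bar> < d"
proof -
  let ?s = "\<sigma> y"
  have "((\<lambda>t. y + (?s + t) *\<^sub>R e) \<longlongrightarrow> y + (?s + 0) *\<^sub>R e) (at_right 0)"
    "((\<lambda>t. y + (?s - t) *\<^sub>R e) \<longlongrightarrow> y + (?s - 0) *\<^sub>R e) (at_right 0)" by (intro tendsto_intros)+
  then have "\<forall>\<^sub>F t in at_right 0. y + (?s + t) *\<^sub>R e \<in> V" "\<forall>\<^sub>F t in at_right 0. y + (?s - t) *\<^sub>R e \<in> V"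
    using openV \<sigma>[OF y] by (auto intro!: topological_tendstoD)
  moreover have "\<forall>\<^sub>F t in at_right 0. 0 < t \<and> t < d" using d by (auto simp: eventually_at_right_field)
  ultimately have "\<forall>\<^sub>F t in at_right 0. y + (?s + t) *\<^sub>R e \<in> V \<and> y + (?s - t) *\<^sub>R e \<in> V \<and> 0 < t \<and> t < d"
    by eventually_elim auto
  then obtain t where t: "y + (?s + t) *\<^sub>R e \<in> V" "y + (?s - t) *\<^sub>R e \<in> V" "0 < t" "t < d"
    using eventually_happens'[of "at_right (0::real)"] by auto
  have pos: "g (y + (?s + t) *\<^sub>R e) > 0" "g (y + (?s - t) *\<^sub>R e) < 0"
    using g_increasing[OF \<sigma>(1)[OF y] t(1)] g_increasing[OF t(2) \<sigma>(1)[OF y]] t(3) \<sigma>(2)[OF y] by auto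
  have gc: "continuous_on V g" by (rule C1_on_continuous[OF g])
  have o1: "open (V \<inter> g -` {0<..})" "open (V \<inter> g -` {..<0})"
    using gc openV by (auto intro: continuous_open_preimage)
  have "\<forall>\<^sub>F y' in nhds y. y' + (?s + t) *\<^sub>R e \<in> (V \<inter> g -` {0<..})"
    using o1(1) t(1) pos by (intro topological_tendstoD[of "\<lambda>y'. y' + (?s + t) *\<^sub>R e" "y + (?s + t) *\<^sub>R e"] tendsto_intros) (auto simp: filterlim_ident)
  moreover have "\<forall>\<^sub>F y' in nhds y. y' + (?s - t) *\<^sub>R e \<in> (V \<inter> g -` {..<0})"
    using o1(2) t(2) pos by (intro topological_tendstoD[of "\<lambda>y'. y' + (?s - t) *\<^sub>R e" "y + (?s - t) *\<^sub>R e"] tendsto_intros) (auto simp: filterlim_ident)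
  ultimately show ?thesis
  proof eventually_elim
    case (elim y')
    have inV: "y' + s *\<^sub>R e \<in> V" if "?s - t \<le> s" "s \<le> ?s + t" for s
      using between_V[of y' "?s - t" "?s + t" s] elim that by auto
    have "continuous_on {?s - t .. ?s + t} (\<lambda>s. g (y' + s *\<^sub>R e))"
      by (rule continuous_on_compose2[OF gc]) (use inV in \<open>auto intro!: continuous_intros\<close>)
    then obtain s where s: "?s - t \<le> s" "s \<le> ?s + t" "g (y' + s *\<^sub>R e) = 0"
      using IVT'[of "\<lambda>s. g (y' + s *\<^sub>R e)" "?s - t" 0 "?s + t"] elim t(3) by auto
    then have "\<sigma> y' = s" "y' \<in> Y" using \<sigma>_eq[OF inV] inV[of s] by (auto simp: Y_def)
    then show ?case using s t by auto
  qed
qed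

lemma openY: "open Y"
proof (subst open_subopen, intro ballI)
  fix y assume "y \<in> Y"
  from \<sigma>_near[OF this, of 1] have "\<forall>\<^sub>F y' in nhds y. y' \<in> Y" by (rule eventually_mono) simp_all
  then show "\<exists>T. open T \<and> y \<in> T \<and> T \<subseteq> Y" unfolding eventually_nhds by blast
qed

lemma continuous_P: "continuous_on Y P"
proof -
  have "isCont \<sigma> y" if y: "y \<in> Y" for y
    unfolding continuous_at_eps_delta
  proof (intro allI impI)
    fix d :: real assume "d > 0"
    from \<sigma>_near[OF y this] have "\<forall>\<^sub>F y' in nhds y. dist (\<sigma> y') (\<sigma> y) < d"
      by (rule eventually_mono) (simp add: dist_real_def)
    then show "\<exists>\<delta>>0. \<forall>x'. dist x' y < \<delta> \<longrightarrow> dist (\<sigma> x') (\<sigma> y) < d"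
      by (auto simp: eventually_nhds_metric)
  qed
  then have "continuous_on Y (\<lambda>y. y + \<sigma> y *\<^sub>R e)"
    by (intro continuous_intros continuous_at_imp_continuous_on) auto
  then show ?thesis by (rule continuous_on_eq) (simp add: P_def)
qed

lemma P_measurable [measurable]: "P \<in> borel_measurable borel"
proof -
  have "(\<lambda>y. if y \<in> Y then P y else x0) \<in> borel_measurable borel"
    by (rule borel_measurable_continuous_on_if) (use openY continuous_P in auto)
  moreover have "(\<lambda>y. if y \<in> Y then P y else x0) = P" by (auto simp: P_def)
  ultimately show ?thesis by simp
qed

text \<open>The area element of the graph over the hyperplane: the norm of the gradient of g divided
  by its derivative along e.\<close>

definition w where "w y = norm (G (P y)) / (G (P y) \<bullet> e)"

lemma w_measurable [measurable]: "w \<in> borel_measurable borel"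
proof -
  have "(\<lambda>x. if x \<in> V then G x else e) \<in> borel_measurable borel"
    by (rule borel_measurable_continuous_on_if) (use openV C1_on_continuous[OF G] in auto)
  then have "(\<lambda>y. if P y \<in> V then G (P y) else e) \<in> borel_measurable borel"
    by (rule measurable_compose[OF P_measurable])
  then have [measurable]: "(\<lambda>y. G (P y)) \<in> borel_measurable borel" using P by simp
  show ?thesis unfolding w_def[abs_def] by measurable
qed

lemma w_bounds: "0 < w y" "w y \<le> C / \<kappa>"
proof -
  have k: "\<kappa> \<le> G (P y) \<bullet> e" "norm (G (P y)) \<le> C" using \<kappa> C P by auto
  then have "G (P y) \<noteq> 0" using \<kappa>(1) by auto
  then show "0 < w y" unfolding w_def using k \<kappa>(1) by (intro divide_pos_pos) auto
  show "w y \<le> C / \<kappa>" unfolding w_def using k \<kappa>(1) by (intro frac_le) (auto intro: order_trans[OF norm_ge_zero])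
qed

definition slabY where "slabY = Y \<inter> {y. 0 \<le> y \<bullet> e \<and> y \<bullet> e \<le> 1}"

lemma slabY_measurable [measurable]: "slabY \<in> sets borel"
  unfolding slabY_def using openY by (intro sets.Int) (simp, measurable)

lemma emeasure_slabY: "emeasure lborel slabY < top"
proof -
  have ee: "e \<bullet> e = 1" using e by (simp add: dot_square_norm)
  have "slabY \<subseteq> cball 0 (norm x0 + \<rho> + 1)"
  proof
    fix y assume y: "y \<in> slabY"
    then have "y + \<sigma> y *\<^sub>R e \<in> V" using \<sigma> by (auto simp: slabY_def)
    then have "norm (y + \<sigma> y *\<^sub>R e) \<le> norm x0 + \<rho>"
      using norm_triangle_sub[of "y + \<sigma> y *\<^sub>R e" x0] by (simp add: V dist_norm norm_minus_commute)
    then have "norm (perp e (y + \<sigma> y *\<^sub>R e)) \<le> norm x0 + \<rho>" using norm_perp_le[OF e] order_trans by blast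
    then have "norm (perp e y) \<le> norm x0 + \<rho>" by (simp add: perp_add perp_scaleR perp_self[OF e])
    moreover have "norm y \<le> norm (perp e y) + norm ((y \<bullet> e) *\<^sub>R e)"
      using norm_triangle_ineq[of "perp e y" "(y \<bullet> e) *\<^sub>R e"] by (simp add: perp_plus)
    ultimately show "y \<in> cball 0 (norm x0 + \<rho> + 1)" using y e by (auto simp: slabY_def)
  qed
  then have "emeasure lborel slabY \<le> emeasure lborel (cball (0::'a) (norm x0 + \<rho> + 1))"
    by (rule emeasure_mono) simp
  also have "\<dots> < top" using \<rho> by (subst emeasure_cball) (auto intro: add_nonneg_nonneg)
  finally show ?thesis .
qed

text \<open>The surface measure of the graph patch: the area element over the unit slab, carried to
  the frontier by \<open>P\<close>.\<close>

definition M where "M = distr (density lborel (\<lambda>y. ennreal (indicator slabY y * w y))) borel P"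

lemma sets_M [simp, measurable_cong]: "sets M = sets borel" and space_M [simp]: "space M = UNIV"
  by (auto simp: M_def)

lemma emeasure_M:
  assumes [measurable]: "A \<in> sets borel"
  shows "emeasure M A = (\<integral>\<^sup>+y. ennreal (indicator slabY y * w y) * indicator A (P y) \<partial>lborel)"
  unfolding M_def
proof (subst emeasure_distr, simp, simp, subst emeasure_density)
  show "P -` A \<inter> space (density lborel (\<lambda>y. ennreal (indicator slabY y * w y))) \<in> sets lborel"
    using measurable_sets[OF P_measurable assms] by simp
qed (auto intro!: nn_integral_cong simp: indicator_def)

lemma finite_M: "finite_measure M"
proof
  have "emeasure M UNIV \<le> (\<integral>\<^sup>+y. ennreal (C / \<kappa>) * indicator slabY y \<partial>lborel)"
    using w_bounds by (subst emeasure_M, simp) (auto intro!: nn_integral_mono simp: indicator_def ennreal_leI)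
  also have "\<dots> = ennreal (C / \<kappa>) * emeasure lborel slabY" by (rule nn_integral_cmult_indicator) simp
  also have "\<dots> < top" using emeasure_slabY by (simp add: ennreal_mult_less_top)
  finally show "emeasure M (space M) \<noteq> \<infinity>" by simp
qed

lemma AE_M: "AE x in M. x \<in> frontier \<Omega>"
  unfolding M_def by (subst AE_distr_iff) (auto simp: P)

lemma emeasure_M_pos:
  assumes s: "s > 0"
  shows "emeasure M (ball x0 s) > 0"
proof -
  have ee: "e \<bullet> e = 1" using e by (simp add: dot_square_norm)
  define N where "N = (Y \<inter> P -` ball x0 s) \<inter> {y. 0 < y \<bullet> e \<and> y \<bullet> e < 1}"
  have "open {y. 0 < y \<bullet> e \<and> y \<bullet> e < 1}"
    by (intro open_Collect_conj open_Collect_less continuous_intros)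
  moreover have "open (Y \<inter> P -` ball x0 s)"
    using continuous_P openY by (intro continuous_open_preimage) auto
  ultimately have oN: "open N" unfolding N_def by (rule open_Int[rotated])
  \<comment> \<open>x0 moved along e to height 1/2, the middle of the slab, so that a neighbourhood
    of y lies in the slab.\<close>
  define y where "y = x0 + (1/2 - x0 \<bullet> e) *\<^sub>R e"
  have yx: "y + (x0 \<bullet> e - 1/2) *\<^sub>R e = x0" by (simp add: y_def algebra_simps)
  have "y \<in> Y" unfolding Y_def using x0 x0V yx by (intro CollectI exI[of _ "x0 \<bullet> e - 1/2"]) simp
  moreover have "\<sigma> y = x0 \<bullet> e - 1/2" by (rule \<sigma>_eq) (use x0 x0V yx in auto)
  ultimately have "P y = x0" using yx by (simp add: P_def)
  then have yN: "y \<in> N" using \<open>y \<in> Y\<close> s by (auto simp: N_def y_def inner_add_left ee)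
  then have Npos: "emeasure lborel N > 0"
    using emeasure_lborel_open_pos[OF oN] by blast
  show ?thesis
  proof (rule ccontr)
    assume "\<not> ?thesis"
    then have "(\<integral>\<^sup>+y. ennreal (indicator slabY y * w y) * indicator (ball x0 s) (P y) \<partial>lborel) = 0"
      using emeasure_M[of "ball x0 s"] by simp
    moreover have "(\<lambda>y. indicator (ball x0 s) (P y) :: ennreal) \<in> borel_measurable borel"
      by (rule measurable_compose[OF P_measurable]) (intro borel_measurable_indicator borel_open open_ball)
    then have "(\<lambda>y. ennreal (indicator slabY y * w y) * indicator (ball x0 s) (P y)) \<in> borel_measurable lborel"
      by measurable
    ultimately have "AE y in lborel. ennreal (indicator slabY y * w y) * indicator (ball x0 s) (P y) = 0"
      by (simp add: nn_integral_0_iff_AE)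
    then have "AE y in lborel. y \<notin> N"
    proof eventually_elim
      case (elim y)
      then show ?case using w_bounds(1)[of y] by (auto simp: N_def slabY_def indicator_def split: if_splits)
    qed
    then have "emeasure lborel N = 0"
      using oN by (subst (asm) AE_iff_measurable[OF _ refl]) auto
    then show False using Npos by simp
  qed
qed

text \<open>The field splits as \<phi> = \<tau> + f e with f = (\<phi> \<bullet> G) / (G \<bullet>
  e) on V, which makes \<tau> tangential to the level sets of g. By
  \<open>integral_divergence_tangential\<close> \<tau> contributes nothing; the divergence of f e is
  a derivative along e, whose integral up to the graph leaves f(P y), and this is w y times the
  value of \<phi> \<bullet> \<nu> at P y.\<close>

lemma gauss_green_M:
  assumes \<phi>: "test_field \<phi>" and K: "compact K" "K \<subseteq> V" "\<And>x. x \<notin> K \<Longrightarrow> \<phi> x = 0"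
    and \<nu>: "\<nu> \<in> borel_measurable borel" "\<And>x. x \<in> V \<Longrightarrow> x \<in> frontier \<Omega> \<Longrightarrow> \<nu> x = sgn (G x)"
  shows "(LINT x:\<Omega>|lebesgue. divergence \<phi> x) = (LINT x|M. \<phi> x \<bullet> \<nu> x)"
proof -
  obtain \<phi>' where p: "C1_on UNIV \<phi> \<phi>'" using test_fieldE[OF \<phi>] by metis
  have cK: "closed K" using K(1) by (rule compact_imp_closed)
  note pV = C1_on_subset[OF p subset_UNIV]
  have Ge: "G x \<bullet> e > 0" if "x \<in> V" for x using \<kappa> that by (meson less_le_trans)
  have inv: "C1_on V (\<lambda>x. inverse (G x \<bullet> e)) (\<lambda>x v. (- (inverse (G x \<bullet> e) * inverse (G x \<bullet> e))) * (G x \<bullet> 0 + G' x v \<bullet> e))"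
  proof (rule C1_on_compose[OF C1_on_inner[OF G C1_on_const], where h=inverse and h'="\<lambda>t. - (inverse t * inverse t)"])
    fix t assume "t \<in> (\<lambda>x. G x \<bullet> e) ` V"
    then have "t \<noteq> 0" using Ge by force
    then show "DERIV inverse t :> - (inverse t * inverse t)"
      using DERIV_inverse[of t] by (simp add: power2_eq_square)
  next
    show "continuous_on ((\<lambda>x. G x \<bullet> e) ` V) (\<lambda>t. - (inverse t * inverse t))"
      using Ge by (intro continuous_intros) force+
  qed
  define f0 where "f0 x = inverse (G x \<bullet> e) *\<^sub>R (\<phi> x \<bullet> G x)" for x
  obtain f0' where f0: "C1_on V f0 f0'"
    using C1_on_scaleR[OF inv C1_on_inner[OF pV G]] unfolding f0_def[abs_def] by blast
  define f where "f x = (if x \<in> V then f0 x else 0)" for x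
  have fz: "f x = 0" if "x \<notin> K" for x using K(3)[OF that] by (simp add: f_def f0_def)
  obtain f' where cf: "C1_on UNIV f f'"
    using C1_on_extend_zero[OF f0 openV cK K(2)] K(3) unfolding f_def[abs_def] by (simp add: f0_def)
  define \<tau> where "\<tau> x = \<phi> x - f x *\<^sub>R e" for x
  note cfe = C1_on_scaleR[OF cf C1_on_const[of UNIV e]]
  have c\<tau>: "C1_on UNIV \<tau> (\<lambda>x v. \<phi>' x v - (f x *\<^sub>R 0 + f' x v *\<^sub>R e))"
    unfolding \<tau>_def[abs_def] by (rule C1_on_diff[OF p cfe])
  have \<tau>z: "\<tau> x = 0" if "x \<notin> K" for x using fz[OF that] K(3)[OF that] by (simp add: \<tau>_def)
  have "linear (f' x)" for x using has_derivative_linear[OF C1_onD(1)[OF cf UNIV_I]] .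
  then have dsum: "divergence \<phi> x = divergence \<tau> x + f' x e" for x
    using linear_sum_Basis_inner[of "f' x" e]
    by (simp add: divergence_eq[OF p UNIV_I] divergence_eq[OF c\<tau> UNIV_I] inner_diff_left sum_subtractf)
  have tang: "G x \<bullet> \<tau> x = 0" if "x \<in> V" for x
    using Ge[OF that] that by (simp add: \<tau>_def f_def f0_def inner_diff_right inner_commute)
  have if': "integrable lborel (\<lambda>x. f' x e)" by (rule integral_C1_deriv_zero(1)[OF cf K(1) fz e])
  have i\<tau>: "integrable lborel (divergence \<tau>)"
    by (rule test_field_divergence_integrable(1)[OF test_fieldI[OF c\<tau> K(1) \<tau>z]])
  have ind: "integrable lborel (\<lambda>x. indicator \<Omega> x * h x)" if "integrable lborel h" for h :: "'a \<Rightarrow> real"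
    using integrable_mult_indicator[OF _ that, of \<Omega>] \<Omega>(1) by simp
  have "(LINT x:\<Omega>|lebesgue. divergence \<phi> x) = (\<integral>x. indicator \<Omega> x * divergence \<phi> x \<partial>lborel)"
    unfolding set_lebesgue_integral_def real_scaleR_def
    using \<Omega>(1) test_field_divergence_integrable(4)[OF \<phi>]
    by (intro integral_completion) (simp add: borel_measurable_times borel_measurable_indicator)
  also have "\<dots> = (\<integral>x. indicator \<Omega> x * divergence \<tau> x + indicator \<Omega> x * f' x e \<partial>lborel)"
    by (simp add: dsum distrib_left)
  also have "\<dots> = (\<integral>x. indicator \<Omega> x * divergence \<tau> x \<partial>lborel) + (\<integral>x. indicator \<Omega> x * f' x e \<partial>lborel)"
    by (rule Bochner_Integration.integral_add[OF ind[OF i\<tau>] ind[OF if']])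
  also have "(\<integral>x. indicator \<Omega> x * divergence \<tau> x \<partial>lborel) = 0"
    by (rule integral_divergence_tangential[OF openV g \<Omega>(1,2) c\<tau> K(1,2) \<tau>z tang])
  also have "0 + (\<integral>x. indicator \<Omega> x * f' x e \<partial>lborel)
      = (\<integral>y. indicator {y. 0 \<le> y \<bullet> e \<and> y \<bullet> e \<le> 1} y * (\<integral>s. indicator \<Omega> (y + s *\<^sub>R e) * f' (y + s *\<^sub>R e) e \<partial>lborel) \<partial>lborel)"
    using integral_slab_lines[OF ind[OF if'] e] by simp
  also have "\<dots> = (\<integral>y. indicator slabY y * f (P y) \<partial>lborel)"
  proof (rule Bochner_Integration.integral_cong)
    fix y
    have f'z: "f' x e = 0" if "x \<notin> K" for x by (rule C1_on_UNIV_zero_outside[OF cf cK fz that])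
    have "(\<integral>s. indicator \<Omega> (y + s *\<^sub>R e) * f' (y + s *\<^sub>R e) e \<partial>lborel) = (if y \<in> Y then f (P y) else 0)"
    proof (cases "y \<in> Y")
      case True
      have "(\<integral>s. indicator \<Omega> (y + s *\<^sub>R e) * f' (y + s *\<^sub>R e) e \<partial>lborel) = (\<integral>s. indicator {..\<sigma> y} s * f' (y + s *\<^sub>R e) e \<partial>lborel)"
      proof (rule integral_cong_AE)
        have m1: "(\<lambda>x. indicator \<Omega> x * f' x e) \<in> borel_measurable borel" using ind[OF if'] by auto
        have m2: "(\<lambda>x. f' x e) \<in> borel_measurable borel" using if' by auto
        have l: "(\<lambda>s. y + s *\<^sub>R e) \<in> borel_measurable lborel" by measurable
        show "(\<lambda>s. indicator \<Omega> (y + s *\<^sub>R e) * f' (y + s *\<^sub>R e) e) \<in> borel_measurable lborel"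
          by (rule measurable_compose[OF l m1])
        show "(\<lambda>s. indicator {..\<sigma> y} s * f' (y + s *\<^sub>R e) e) \<in> borel_measurable lborel"
          by (intro borel_measurable_times borel_measurable_indicator measurable_compose[OF l m2]) simp
        have "AE s in lborel. s \<noteq> \<sigma> y" using AE_lborel_singleton by blast
        then show "AE s in lborel. indicator \<Omega> (y + s *\<^sub>R e) * f' (y + s *\<^sub>R e) e = indicator {..\<sigma> y} s * f' (y + s *\<^sub>R e) e"
        proof eventually_elim
          case (elim s)
          show ?case
          proof (cases "y + s *\<^sub>R e \<in> K")
            case yK: True
            then have yV: "y + s *\<^sub>R e \<in> V" using K(2) by blast
            have "y + s *\<^sub>R e \<in> \<Omega> \<longleftrightarrow> g (y + s *\<^sub>R e) < 0" using yV \<Omega>(2) by blast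
            also have "\<dots> \<longleftrightarrow> s \<le> \<sigma> y"
              using g_increasing[OF yV \<sigma>(1)[OF True]] g_increasing[OF \<sigma>(1)[OF True] yV] \<sigma>(2)[OF True] elim
              by (cases "s < \<sigma> y") auto
            finally show ?thesis by (simp add: indicator_def)
          qed (simp add: f'z)
        qed
      qed
      also have "\<dots> = f (y + \<sigma> y *\<^sub>R e)" by (rule integral_C1_halfline(1)[OF cf K(1) fz e])
      finally show ?thesis using True by (simp add: P_def)
    next
      case False
      have gc: "continuous_on V g" by (rule C1_on_continuous[OF g])
      have nz: "g (y + s *\<^sub>R e) \<noteq> 0" if "y + s *\<^sub>R e \<in> V" for s using False that by (auto simp: Y_def)
      have same: "g (y + a *\<^sub>R e) < 0 \<longleftrightarrow> g (y + b *\<^sub>R e) < 0" if ab: "y + a *\<^sub>R e \<in> V" "y + b *\<^sub>R e \<in> V" "a \<le> b" for a b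
      proof -
        have "continuous_on {a..b} (\<lambda>s. g (y + s *\<^sub>R e))"
          by (rule continuous_on_compose2[OF gc]) (use between_V[OF ab(1,2)] in \<open>auto intro!: continuous_intros\<close>)
        from IVT'[OF _ _ ab(3) this, of 0] nz between_V[OF ab(1,2)] ab
        have "\<not> (g (y + a *\<^sub>R e) \<le> 0 \<and> 0 \<le> g (y + b *\<^sub>R e))" by blast
        moreover have "g (y + a *\<^sub>R e) \<le> g (y + b *\<^sub>R e)"
          using g_increasing[OF ab(1,2)] ab(3) by (cases "a = b") auto
        ultimately show ?thesis using nz[OF ab(1)] nz[OF ab(2)] by linarith
      qed
      \<comment> \<open>A line that misses the frontier in V keeps one sign of g there, so its
        points in K lie all inside or all outside \<Omega>; in the first case the derivative of f is
        integrated over the full line and gives 0.\<close>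
      have "(\<forall>s. indicator \<Omega> (y + s *\<^sub>R e) * f' (y + s *\<^sub>R e) e = f' (y + s *\<^sub>R e) e) \<or> (\<forall>s. indicator \<Omega> (y + s *\<^sub>R e) * f' (y + s *\<^sub>R e) e = 0)"
      proof (cases "\<exists>a. y + a *\<^sub>R e \<in> V \<and> g (y + a *\<^sub>R e) < 0")
        case True
        then obtain a where a: "y + a *\<^sub>R e \<in> V" "g (y + a *\<^sub>R e) < 0" by blast
        have "y + s *\<^sub>R e \<in> \<Omega>" if "y + s *\<^sub>R e \<in> K" for s
        proof -
          have yV: "y + s *\<^sub>R e \<in> V" using that K(2) by blast
          then have "g (y + s *\<^sub>R e) < 0" using same[OF a(1) yV] same[OF yV a(1)] a(2) by linarith
          then show ?thesis using yV \<Omega>(2) by blast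
        qed
        then have "indicator \<Omega> (y + s *\<^sub>R e) * f' (y + s *\<^sub>R e) e = f' (y + s *\<^sub>R e) e" for s
          using f'z[of "y + s *\<^sub>R e"] by (cases "y + s *\<^sub>R e \<in> K") auto
        then show ?thesis by blast
      next
        case no: False
        have "y + s *\<^sub>R e \<notin> \<Omega>" if "y + s *\<^sub>R e \<in> K" for s
          using no that K(2) \<Omega>(2) by blast
        then have "indicator \<Omega> (y + s *\<^sub>R e) * f' (y + s *\<^sub>R e) e = 0" for s
          using f'z[of "y + s *\<^sub>R e"] by (cases "y + s *\<^sub>R e \<in> K") auto
        then show ?thesis by blast
      qed
      then have "(\<integral>s. indicator \<Omega> (y + s *\<^sub>R e) * f' (y + s *\<^sub>R e) e \<partial>lborel) = 0"
      proof
        assume h: "\<forall>s. indicator \<Omega> (y + s *\<^sub>R e) * f' (y + s *\<^sub>R e) e = f' (y + s *\<^sub>R e) e"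
        show ?thesis unfolding h[rule_format] by (rule integral_C1_halfline(2)[OF cf K(1) fz e])
      next
        assume h: "\<forall>s. indicator \<Omega> (y + s *\<^sub>R e) * f' (y + s *\<^sub>R e) e = 0"
        show ?thesis unfolding h[rule_format] by simp
      qed
      then show ?thesis using False by simp
    qed
    then show "indicator {y. 0 \<le> y \<bullet> e \<and> y \<bullet> e \<le> 1} y * (\<integral>s. indicator \<Omega> (y + s *\<^sub>R e) * f' (y + s *\<^sub>R e) e \<partial>lborel) = indicator slabY y * f (P y)"
      by (auto simp: slabY_def indicator_def)
  qed simp
  also have "\<dots> = (\<integral>y. (indicator slabY y * w y) *\<^sub>R (\<phi> (P y) \<bullet> \<nu> (P y)) \<partial>lborel)"
  proof (rule Bochner_Integration.integral_cong)
    fix y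
    have "\<nu> (P y) = sgn (G (P y))" using \<nu>(2) P by blast
    moreover have "G (P y) \<bullet> e > 0" using Ge P by blast
    moreover from this have "G (P y) \<noteq> 0" by auto
    ultimately have "w y * (\<phi> (P y) \<bullet> \<nu> (P y)) = f (P y)"
      using P(1)[of y] by (simp add: w_def f_def f0_def sgn_div_norm field_simps)
    then show "indicator slabY y * f (P y) = (indicator slabY y * w y) *\<^sub>R (\<phi> (P y) \<bullet> \<nu> (P y))"
      by (simp add: mult.assoc)
  qed simp
  also have "\<dots> = (\<integral>y. \<phi> (P y) \<bullet> \<nu> (P y) \<partial>density lborel (\<lambda>y. ennreal (indicator slabY y * w y)))"
  proof (rule integral_density[symmetric])
    have "\<phi> \<in> borel_measurable borel" using C1_on_continuous[OF p] by (rule borel_measurable_continuous_onI)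
    then show "(\<lambda>y. \<phi> (P y) \<bullet> \<nu> (P y)) \<in> borel_measurable lborel"
      using \<nu>(1) by (auto intro!: borel_measurable_inner measurable_compose[OF P_measurable])
    show "(\<lambda>y. indicator slabY y * w y) \<in> borel_measurable lborel" by measurable
    show "AE y in lborel. 0 \<le> indicator slabY y * w y" using w_bounds(1) by (intro AE_I2) (simp add: less_imp_le)
  qed
  also have "\<dots> = (LINT x|M. \<phi> x \<bullet> \<nu> x)"
    unfolding M_def
  proof (rule integral_distr[symmetric])
    have "\<phi> \<in> borel_measurable borel" using C1_on_continuous[OF p] by (rule borel_measurable_continuous_onI)
    then show "(\<lambda>x. \<phi> x \<bullet> \<nu> x) \<in> borel_measurable borel" using \<nu>(1) by (rule borel_measurable_inner)
  qed simp
  finally show ?thesis .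
qed

end

lemma local_gauss_green:
  fixes \<Omega> :: "'a::euclidean_space set"
  assumes sm: "smooth_boundary \<Omega>" and \<Omega>: "open \<Omega>" and x0: "x0 \<in> frontier \<Omega>"
  shows "\<exists>\<rho> M. \<rho> > 0 \<and> sets M = sets borel \<and> finite_measure M \<and> (AE x in M. x \<in> frontier \<Omega>)
    \<and> (\<forall>s>0. emeasure M (ball x0 s) > 0)
    \<and> (\<forall>\<phi> K. test_field \<phi> \<longrightarrow> compact K \<longrightarrow> K \<subseteq> ball x0 \<rho> \<longrightarrow> (\<forall>x. x \<notin> K \<longrightarrow> \<phi> x = 0) \<longrightarrow>
         (LINT x:\<Omega>|lebesgue. divergence \<phi> x) = (LINT x|M. \<phi> x \<bullet> outer_normal \<Omega> x))"
proof -
  obtain U g G G' where ch: "boundary_chart \<Omega> U g G G'" and xU: "x0 \<in> U" using smooth_boundary_chart[OF sm x0] by metis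
  then have U: "open U" "C1_on U g (\<lambda>x v. G x \<bullet> v)" "C1_on U G G'" "G x0 \<noteq> 0"
      "\<Omega> \<inter> U = {x \<in> U. g x < 0}" "frontier \<Omega> \<inter> U = {x \<in> U. g x = 0}" by (auto simp: boundary_chart_def)
  define e where "e = sgn (G x0)"
  \<comment> \<open>Where G differs from G x0 by less than half of |G x0|, its component along e
    stays at least \<kappa> and its norm at most 3 \<kappa>.\<close>
  define \<kappa> where "\<kappa> = norm (G x0) / 2"
  have ne: "norm e = 1" using U(4) by (simp add: e_def norm_sgn)
  have \<kappa>: "\<kappa> > 0" using U(4) by (simp add: \<kappa>_def)
  have "isCont G x0" using C1_on_continuous[OF U(3)] U(1) xU by (simp add: continuous_on_eq_continuous_at)
  then obtain r1 where r1: "r1 > 0" "\<And>y. dist y x0 < r1 \<Longrightarrow> dist (G y) (G x0) < \<kappa>"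
    using \<kappa> unfolding continuous_at_eps_delta by blast
  obtain r2 where r2: "r2 > 0" "ball x0 r2 \<subseteq> U" using U(1) xU open_contains_ball by blast
  define \<rho> where "\<rho> = min r1 r2"
  have rh: "\<rho> > 0" "ball x0 \<rho> \<subseteq> U" using r1 r2 by (auto simp: \<rho>_def)
  have near: "norm (G y - G x0) < \<kappa>" if "y \<in> ball x0 \<rho>" for y
    using r1(2)[of y] that by (simp add: \<rho>_def dist_norm norm_minus_commute)
  interpret graph_patch \<Omega> "ball x0 \<rho>" g G G' e x0 \<rho> \<kappa> "3 * \<kappa>"
  proof
    show "C1_on (ball x0 \<rho>) g (\<lambda>x v. G x \<bullet> v)" "C1_on (ball x0 \<rho>) G G'"
      using C1_on_subset U rh(2) by blast+
    show "\<kappa> \<le> G x \<bullet> e" if "x \<in> ball x0 \<rho>" for x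
    proof -
      have "\<bar>(G x - G x0) \<bullet> e\<bar> \<le> norm (G x - G x0) * norm e" by (rule Cauchy_Schwarz_ineq2)
      then have "\<bar>(G x - G x0) \<bullet> e\<bar> \<le> \<kappa>" using near[OF that] ne by simp
      moreover have "G x0 \<bullet> e = 2 * \<kappa>"
        using U(4) by (simp add: e_def \<kappa>_def sgn_div_norm dot_square_norm power2_eq_square)
      ultimately show ?thesis by (simp add: inner_diff_left)
    qed
    show "norm (G x) \<le> 3 * \<kappa>" if "x \<in> ball x0 \<rho>" for x
      using near[OF that] norm_triangle_sub[of "G x" "G x0"] by (simp add: \<kappa>_def)
    show "\<Omega> \<inter> ball x0 \<rho> = {x \<in> ball x0 \<rho>. g x < 0}" "frontier \<Omega> \<inter> ball x0 \<rho> = {x \<in> ball x0 \<rho>. g x = 0}"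
      using U(5,6) rh(2) by blast+
    show "g x0 = 0" using U(6) x0 xU by blast
  qed (use rh ne \<kappa> \<Omega> in auto)
  have "(LINT x:\<Omega>|lebesgue. divergence \<phi> x) = (LINT x|M. \<phi> x \<bullet> outer_normal \<Omega> x)"
    if "test_field \<phi>" "compact K" "K \<subseteq> ball x0 \<rho>" "\<forall>x. x \<notin> K \<longrightarrow> \<phi> x = 0" for \<phi> K
  proof (rule gauss_green_M[OF that(1-3)])
    show "outer_normal \<Omega> \<in> borel_measurable borel" by (rule borel_measurable_outer_normal[OF sm])
    show "outer_normal \<Omega> x = sgn (G x)" if "x \<in> ball x0 \<rho>" "x \<in> frontier \<Omega>" for x
      using outer_normal_chart[OF ch] that rh(2) by blast
  qed (use that in auto)
  then show ?thesis
    using rh(1) finite_M AE_M emeasure_M_pos sets_M by (intro exI[of _ \<rho>] exI[of _ M] conjI allI impI) blast+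
qed

section \<open>Gluing the local Gauss-Green measures\<close>

definition sum_measure :: "'a::topological_space measure \<Rightarrow> 'a measure \<Rightarrow> 'a measure" where
  "sum_measure M N = measure_of UNIV (sets borel) (\<lambda>A. emeasure M A + emeasure N A)"

lemma sets_sum_measure [simp, measurable_cong]: "sets (sum_measure M N) = sets borel"
  unfolding sum_measure_def using sets.sigma_sets_eq[of borel] by (simp add: sets_measure_of)

lemma space_sum_measure [simp]: "space (sum_measure M N) = UNIV"
  by (simp add: sum_measure_def space_measure_of_conv)

lemma emeasure_sum_measure:
  assumes "sets M = sets borel" "sets N = sets borel" "A \<in> sets borel"
  shows "emeasure (sum_measure M N) A = emeasure M A + emeasure N A"
  unfolding sum_measure_def
proof (rule emeasure_measure_of_sigma)
  show "sigma_algebra (UNIV :: 'a set) (sets borel)" using sets.sigma_algebra_axioms[of "borel :: 'a measure"] by simp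
  show "countably_additive (sets borel) (\<lambda>A. emeasure M A + emeasure N A)"
    unfolding countably_additive_def
  proof (intro allI impI)
    fix A :: "nat \<Rightarrow> 'a set" assume A: "range A \<subseteq> sets borel" "disjoint_family A" "(\<Union>i. A i) \<in> sets borel"
    have "(\<Sum>i. emeasure M (A i) + emeasure N (A i)) = (\<Sum>i. emeasure M (A i)) + (\<Sum>i. emeasure N (A i))"
      by (rule suminf_add[symmetric]) auto
    then show "(\<Sum>i. emeasure M (A i) + emeasure N (A i)) = emeasure M (\<Union>i. A i) + emeasure N (\<Union>i. A i)"
      using A assms suminf_emeasure[of A M] suminf_emeasure[of A N] by simp
  qed
qed (use assms in \<open>auto simp: positive_def\<close>)

lemma nn_integral_sum_measure:
  assumes MN: "sets M = sets borel" "sets N = sets borel" and f: "f \<in> borel_measurable borel"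
  shows "(\<integral>\<^sup>+x. f x \<partial>sum_measure M N) = (\<integral>\<^sup>+x. f x \<partial>M) + (\<integral>\<^sup>+x. f x \<partial>N)"
  using f
proof (induction rule: borel_measurable_induct)
  case (cong f g)
  then show ?case by (simp cong: nn_integral_cong)
next
  case (set A)
  then show ?case using MN by (simp add: emeasure_sum_measure)
next
  case (mult u c)
  then have "u \<in> borel_measurable M" "u \<in> borel_measurable N" "u \<in> borel_measurable (sum_measure M N)"
    using MN by (auto cong: measurable_cong_sets)
  then show ?case using mult by (simp add: nn_integral_cmult distrib_left)
next
  case (add u v)
  then have "u \<in> borel_measurable M" "u \<in> borel_measurable N" "u \<in> borel_measurable (sum_measure M N)"
    "v \<in> borel_measurable M" "v \<in> borel_measurable N" "v \<in> borel_measurable (sum_measure M N)"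
    using MN by (auto cong: measurable_cong_sets)
  then show ?case using add by (simp add: nn_integral_add ac_simps)
next
  case (seq F)
  then have m: "F i \<in> borel_measurable M" "F i \<in> borel_measurable N" "F i \<in> borel_measurable (sum_measure M N)" for i
    using MN by (auto cong: measurable_cong_sets)
  have inc: "incseq (\<lambda>i. \<integral>\<^sup>+x. F i x \<partial>K)" for K
    using seq(3) by (auto simp: incseq_def le_fun_def intro!: nn_integral_mono)
  have "(\<integral>\<^sup>+x. (SUP i. F i) x \<partial>sum_measure M N) = (SUP i. (\<integral>\<^sup>+x. F i x \<partial>M) + (\<integral>\<^sup>+x. F i x \<partial>N))"
    using seq m by (simp add: nn_integral_monotone_convergence_SUP image_comp)
  also have "\<dots> = (SUP i. \<integral>\<^sup>+x. F i x \<partial>M) + (SUP i. \<integral>\<^sup>+x. F i x \<partial>N)"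
    by (rule ennreal_SUP_add[OF inc inc])
  also have "\<dots> = (\<integral>\<^sup>+x. (SUP i. F i) x \<partial>M) + (\<integral>\<^sup>+x. (SUP i. F i) x \<partial>N)"
    using seq m by (simp add: nn_integral_monotone_convergence_SUP image_comp)
  finally show ?case .
qed

lemma integral_sum_measure:
  fixes f :: "'a::topological_space \<Rightarrow> real"
  assumes MN: "sets M = sets borel" "sets N = sets borel" and f: "f \<in> borel_measurable borel"
    and i: "integrable M f" "integrable N f"
  shows "(\<integral>x. f x \<partial>sum_measure M N) = (\<integral>x. f x \<partial>M) + (\<integral>x. f x \<partial>N)"
proof -
  note nn = nn_integral_sum_measure[OF MN]
  have m: "(\<lambda>x. ennreal (f x)) \<in> borel_measurable borel" "(\<lambda>x. ennreal (- f x)) \<in> borel_measurable borel"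
    "(\<lambda>x. ennreal (norm (f x))) \<in> borel_measurable borel"
    using f by measurable
  have "f \<in> borel_measurable (sum_measure M N)" using f by (simp cong: measurable_cong_sets)
  then have isum: "integrable (sum_measure M N) f"
    using i by (simp add: integrable_iff_bounded nn[OF m(3), simplified])
  have fin: "(\<integral>\<^sup>+x. ennreal (f x) \<partial>K) < top" "(\<integral>\<^sup>+x. ennreal (- f x) \<partial>K) < top" if "integrable K f" for K
  proof -
    have "(\<integral>\<^sup>+x. ennreal (f x) \<partial>K) \<le> (\<integral>\<^sup>+x. ennreal (norm (f x)) \<partial>K)"
      "(\<integral>\<^sup>+x. ennreal (- f x) \<partial>K) \<le> (\<integral>\<^sup>+x. ennreal (norm (f x)) \<partial>K)"
      by (auto intro!: nn_integral_mono ennreal_leI)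
    moreover have "(\<integral>\<^sup>+x. ennreal (norm (f x)) \<partial>K) < top" using that by (simp add: integrable_iff_bounded)
    ultimately show "(\<integral>\<^sup>+x. ennreal (f x) \<partial>K) < top" "(\<integral>\<^sup>+x. ennreal (- f x) \<partial>K) < top" by (auto intro: le_less_trans)
  qed
  show ?thesis
    using fin[OF i(1)] fin[OF i(2)]
    by (simp add: real_lebesgue_integral_def[OF isum] real_lebesgue_integral_def[OF i(1)] real_lebesgue_integral_def[OF i(2)]
        nn[OF m(1)] nn[OF m(2)] enn2real_plus)
qed

lemma test_field_bounded:
  fixes \<phi> :: "'a::euclidean_space \<Rightarrow> 'a"
  assumes "test_field \<phi>"
  obtains B where "\<And>x. norm (\<phi> x) \<le> B" "\<phi> \<in> borel_measurable borel"
proof -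
  obtain \<phi>' K where p: "C1_on UNIV \<phi> \<phi>'" "compact K" "\<And>x. x \<notin> K \<Longrightarrow> \<phi> x = 0"
    using test_fieldE[OF assms] by metis
  have c: "continuous_on UNIV \<phi>" by (rule C1_on_continuous[OF p(1)])
  then have "compact (\<phi> ` K)" using p(2) by (intro compact_continuous_image) (auto intro: continuous_on_subset)
  then obtain B where B: "\<And>y. y \<in> \<phi> ` K \<Longrightarrow> norm y \<le> B" using compact_imp_bounded bounded_iff by metis
  have "norm (\<phi> x) \<le> max B 0" for x using B[of "\<phi> x"] p(3)[of x] by (cases "x \<in> K") auto
  moreover have "\<phi> \<in> borel_measurable borel" using c by (rule borel_measurable_continuous_onI)
  ultimately show ?thesis by (rule that)
qed

text \<open>Induction over the balls with a cut-off \<beta> that is 1 on half of the ball about x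
  and 0 outside two thirds of it: the new measure is \<beta> \<open>Mx x\<close> + (1 - \<beta>) N,
  and \<phi> splits as \<beta> \<phi> + (1 - \<beta>) \<phi>. As the covering uses balls of a third
  of the radius, the support of the second part meets the frontier only in the remaining
  balls.\<close>

lemma gauss_green_glue:
  fixes \<Omega> :: "'a::euclidean_space set"
  assumes sm: "smooth_boundary \<Omega>" and \<Omega>: "open \<Omega>" and F: "finite F"
    and \<rho>: "\<And>x. x \<in> F \<Longrightarrow> \<rho> x > 0"
    and loc: "\<And>x. x \<in> F \<Longrightarrow> sets (Mx x) = sets borel \<and> finite_measure (Mx x) \<and> (AE y in Mx x. y \<in> frontier \<Omega>)
      \<and> (\<forall>\<phi> K. test_field \<phi> \<longrightarrow> compact K \<longrightarrow> K \<subseteq> ball x (\<rho> x) \<longrightarrow> (\<forall>y. y \<notin> K \<longrightarrow> \<phi> y = 0) \<longrightarrow>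
         (LINT y:\<Omega>|lebesgue. divergence \<phi> y) = (LINT y|Mx x. \<phi> y \<bullet> outer_normal \<Omega> y))"
  shows "\<exists>M. sets M = sets borel \<and> finite_measure M \<and> (AE y in M. y \<in> frontier \<Omega>)
    \<and> (\<forall>\<phi> K. test_field \<phi> \<longrightarrow> compact K \<longrightarrow> (\<forall>y. y \<notin> K \<longrightarrow> \<phi> y = 0) \<longrightarrow> K \<inter> frontier \<Omega> \<subseteq> (\<Union>x\<in>F. ball x (\<rho> x / 3)) \<longrightarrow>
         (LINT y:\<Omega>|lebesgue. divergence \<phi> y) = (LINT y|M. \<phi> y \<bullet> outer_normal \<Omega> y))"
  using F \<rho> loc
proof (induction F rule: finite_induct)
  case empty
  have ae: "AE y in null_measure borel. P y" for P :: "'a \<Rightarrow> bool"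
    by (rule AE_I[of _ _ UNIV]) auto
  have "(LINT y:\<Omega>|lebesgue. divergence \<phi> y) = (LINT y|null_measure borel. \<phi> y \<bullet> outer_normal \<Omega> y)"
    if \<phi>: "test_field \<phi>" and K: "compact K" "\<forall>y. y \<notin> K \<longrightarrow> \<phi> y = 0" "K \<inter> frontier \<Omega> \<subseteq> (\<Union>x\<in>{}. ball x (\<rho> x / 3))" for \<phi> K
  proof -
    obtain \<phi>' where p: "C1_on UNIV \<phi> \<phi>'" using test_fieldE[OF \<phi>] by metis
    note p\<Omega> = C1_on_subset[OF p subset_UNIV[of \<Omega>]]
    let ?K = "K \<inter> closure \<Omega>"
    have K': "closed ?K" "compact ?K" using K(1) by (auto intro: closed_Int compact_imp_closed)
    have sub: "?K \<subseteq> \<Omega>" using K(3) \<Omega> by (auto simp: frontier_def interior_open)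
    let ?\<psi> = "\<lambda>y. if y \<in> \<Omega> then \<phi> y else 0"
    \<comment> \<open>A field whose support misses the frontier stays C1 when set to 0 outside
      \<Omega>, and the divergence of such a test field integrates to 0.\<close>
    have c: "C1_on UNIV ?\<psi> (\<lambda>y v. if y \<in> \<Omega> then \<phi>' y v else 0)"
      by (rule C1_on_extend_zero[OF p\<Omega> \<Omega> K'(1) sub]) (use K(2) closure_subset in blast)
    have tf: "test_field ?\<psi>" by (rule test_fieldI[OF c K'(2)]) (use K(2) closure_subset in auto)
    have d: "indicator \<Omega> y *\<^sub>R divergence \<phi> y = divergence ?\<psi> y" for y
      by (cases "y \<in> \<Omega>") (simp_all add: divergence_eq[OF c UNIV_I] divergence_eq[OF p UNIV_I])
    have "(LINT y:\<Omega>|lebesgue. divergence \<phi> y) = (LINT y|lebesgue. divergence ?\<psi> y)"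
      unfolding set_lebesgue_integral_def d ..
    also have "\<dots> = 0"
      using integral_divergence_zero[OF tf] test_field_divergence_integrable(4)[OF tf] by (simp add: integral_completion)
    also have "0 = (LINT y|null_measure borel. \<phi> y \<bullet> outer_normal \<Omega> y)"
      by (rule integral_eq_zero_AE[symmetric]) (rule ae)
    finally show ?thesis .
  qed
  moreover have "finite_measure (null_measure (borel :: 'a measure))" by (rule finite_measureI) simp
  ultimately show ?case using ae by (intro exI[of _ "null_measure borel"]) simp
next
  case (insert x F)
  let ?\<nu> = "outer_normal \<Omega>"
  have "\<exists>N. sets N = sets borel \<and> finite_measure N \<and> (AE y in N. y \<in> frontier \<Omega>)
    \<and> (\<forall>\<phi> K. test_field \<phi> \<longrightarrow> compact K \<longrightarrow> (\<forall>y. y \<notin> K \<longrightarrow> \<phi> y = 0) \<longrightarrow> K \<inter> frontier \<Omega> \<subseteq> (\<Union>x\<in>F. ball x (\<rho> x / 3)) \<longrightarrow>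
         (LINT y:\<Omega>|lebesgue. divergence \<phi> y) = (LINT y|N. \<phi> y \<bullet> ?\<nu> y))"
  proof (rule insert.IH)
    show "\<rho> y > 0" if "y \<in> F" for y using insert.prems(1)[of y] that by simp
  qed (rule insert.prems(2), simp)
  then obtain N where N: "sets N = sets borel" "finite_measure N" "AE y in N. y \<in> frontier \<Omega>"
    and NG0: "\<forall>\<phi> K. test_field \<phi> \<longrightarrow> compact K \<longrightarrow> (\<forall>y. y \<notin> K \<longrightarrow> \<phi> y = 0) \<longrightarrow> K \<inter> frontier \<Omega> \<subseteq> (\<Union>x\<in>F. ball x (\<rho> x / 3)) \<longrightarrow>
         (LINT y:\<Omega>|lebesgue. divergence \<phi> y) = (LINT y|N. \<phi> y \<bullet> ?\<nu> y)"
    by (elim exE conjE) (rule that)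
  have NG: "(LINT y:\<Omega>|lebesgue. divergence \<phi> y) = (LINT y|N. \<phi> y \<bullet> ?\<nu> y)"
    if "test_field \<phi>" "compact K" "\<And>y. y \<notin> K \<Longrightarrow> \<phi> y = 0" "K \<inter> frontier \<Omega> \<subseteq> (\<Union>x\<in>F. ball x (\<rho> x / 3))" for \<phi> K
    using NG0[rule_format, OF that(1,2) _ that(4)] that(3) by blast
  let ?L = "Mx x" and ?r = "\<rho> x"
  have r: "?r > 0" using insert.prems(1) by auto
  have L: "sets ?L = sets borel" "finite_measure ?L" "AE y in ?L. y \<in> frontier \<Omega>"
    and LG: "\<And>\<phi> K. test_field \<phi> \<Longrightarrow> compact K \<Longrightarrow> K \<subseteq> ball x ?r \<Longrightarrow> (\<And>y. y \<notin> K \<Longrightarrow> \<phi> y = 0) \<Longrightarrow>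
         (LINT y:\<Omega>|lebesgue. divergence \<phi> y) = (LINT y|?L. \<phi> y \<bullet> ?\<nu> y)"
    using insert.prems(2)[of x] by auto
  \<comment> \<open>(1/2)^2 - (2/3)^2 = -7/36, so the factor 8 over the squared radius brings the
    argument of \<open>step\<close> below -1 on the ball of half the radius.\<close>
  define \<beta> where "\<beta> y = step (8 / ?r\<^sup>2 * ((norm (y - x))\<^sup>2 - (2 * ?r / 3)\<^sup>2))" for y
  obtain \<beta>' where c\<beta>: "C1_on UNIV \<beta> \<beta>'"
    using C1_on_step[OF C1_on_norm_sq[of UNIV x "(2 * ?r / 3)\<^sup>2"], of "8 / ?r\<^sup>2"] unfolding \<beta>_def[abs_def] by blast
  have c\<beta>2: "C1_on UNIV (\<lambda>y. 1 - \<beta> y) (\<lambda>y v. 0 - \<beta>' y v)" by (rule C1_on_diff[OF C1_on_const c\<beta>])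
  have \<beta>01: "0 \<le> \<beta> y" "\<beta> y \<le> 1" for y by (auto simp: \<beta>_def step_bounds)
  have \<beta>m: "\<beta> \<in> borel_measurable borel" using C1_on_continuous[OF c\<beta>] by (rule borel_measurable_continuous_onI)
  have \<beta>0: "\<beta> y = 0" if "y \<notin> cball x (2 * ?r / 3)" for y
  proof -
    have "(2 * ?r / 3)\<^sup>2 \<le> (norm (y - x))\<^sup>2" using that r by (intro power_mono) (auto simp: dist_norm norm_minus_commute)
    then show ?thesis unfolding \<beta>_def by (intro step_eq) simp
  qed
  have \<beta>1: "\<beta> y = 1" if "y \<in> ball x (?r / 2)" for y
  proof -
    have "(norm (y - x))\<^sup>2 \<le> (?r / 2)\<^sup>2" using that r by (intro power_mono) (auto simp: dist_norm norm_minus_commute)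
    then have "8 / ?r\<^sup>2 * ((norm (y - x))\<^sup>2 - (2 * ?r / 3)\<^sup>2) \<le> 8 / ?r\<^sup>2 * ((?r / 2)\<^sup>2 - (2 * ?r / 3)\<^sup>2)"
      by (intro mult_left_mono) auto
    also have "\<dots> \<le> -1" using r by (simp add: power2_eq_square field_simps)
    finally show ?thesis unfolding \<beta>_def by (intro step_eq)
  qed
  define M1 where "M1 = density ?L (\<lambda>y. ennreal (\<beta> y))"
  define M2 where "M2 = density N (\<lambda>y. ennreal (1 - \<beta> y))"
  have \<beta>mL: "(\<lambda>y. ennreal (\<beta> y)) \<in> borel_measurable ?L" and \<beta>mN: "(\<lambda>y. ennreal (1 - \<beta> y)) \<in> borel_measurable N"
    using \<beta>m L(1) N(1) by (simp_all cong: measurable_cong_sets)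
  have s12: "sets M1 = sets borel" "sets M2 = sets borel" using L N by (auto simp: M1_def M2_def)
  have fin_d: "finite_measure (density K (\<lambda>y. ennreal (h y)))"
    if "finite_measure K" "\<And>y. h y \<le> 1" "(\<lambda>y. ennreal (h y)) \<in> borel_measurable K" for K :: "'a measure" and h
  proof (rule finite_measureI)
    interpret finite_measure K by fact
    have "emeasure (density K (\<lambda>y. ennreal (h y))) (space K) = (\<integral>\<^sup>+y. ennreal (h y) \<partial>K)"
      using that(3) by (subst emeasure_density) (auto intro!: nn_integral_cong)
    also have "\<dots> \<le> (\<integral>\<^sup>+y. 1 \<partial>K)" using that(2) by (intro nn_integral_mono) (simp add: ennreal_le_1)
    also have "\<dots> < top" by (simp add: emeasure_finite less_top[symmetric])
    finally show "emeasure (density K (\<lambda>y. ennreal (h y))) (space (density K (\<lambda>y. ennreal (h y)))) \<noteq> \<infinity>" by simp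
  qed
  have f12: "finite_measure M1" "finite_measure M2"
    unfolding M1_def M2_def using L(2) N(2) \<beta>01 \<beta>mL \<beta>mN by (auto intro!: fin_d)
  have ae12: "AE y in M1. y \<in> frontier \<Omega>" "AE y in M2. y \<in> frontier \<Omega>"
    unfolding M1_def M2_def using L(3) N(3) \<beta>mL \<beta>mN by (auto simp: AE_density)
  define M where "M = sum_measure M1 M2"
  have fr: "- frontier \<Omega> \<in> sets borel" by (intro borel_open) auto
  have nul: "emeasure K (- frontier \<Omega>) = 0" if "sets K = sets borel" "AE y in K. y \<in> frontier \<Omega>" for K :: "'a measure"
    using that fr sets_eq_imp_space_eq[OF that(1)] by (subst (asm) AE_iff_measurable[of "- frontier \<Omega>"]) auto
  have aeM: "AE y in M. y \<in> frontier \<Omega>"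
    using fr nul[OF s12(1) ae12(1)] nul[OF s12(2) ae12(2)]
    by (intro AE_I[of _ _ "- frontier \<Omega>"]) (auto simp: M_def emeasure_sum_measure[OF s12])
  interpret M1: finite_measure M1 by (rule f12)
  interpret M2: finite_measure M2 by (rule f12)
  have "finite_measure M"
  proof (rule finite_measureI)
    show "emeasure M (space M) \<noteq> \<infinity>"
      using M1.emeasure_finite[of UNIV] M2.emeasure_finite[of UNIV] by (simp add: M_def emeasure_sum_measure[OF s12])
  qed
  moreover have "(LINT y:\<Omega>|lebesgue. divergence \<phi> y) = (LINT y|M. \<phi> y \<bullet> ?\<nu> y)"
    if \<phi>: "test_field \<phi>" and K: "compact K" "\<forall>y. y \<notin> K \<longrightarrow> \<phi> y = 0" "K \<inter> frontier \<Omega> \<subseteq> (\<Union>x\<in>insert x F. ball x (\<rho> x / 3))" for \<phi> K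
  proof -
    obtain \<phi>' where p: "C1_on UNIV \<phi> \<phi>'" using test_fieldE[OF \<phi>] by metis
    obtain B where B: "\<And>y. norm (\<phi> y) \<le> B" "\<phi> \<in> borel_measurable borel" using test_field_bounded[OF \<phi>] by metis
    let ?\<phi>1 = "\<lambda>y. \<beta> y *\<^sub>R \<phi> y" and ?\<phi>2 = "\<lambda>y. (1 - \<beta> y) *\<^sub>R \<phi> y"
    have t1: "test_field ?\<phi>1" by (rule test_field_scaleR[OF c\<beta> \<phi>])
    have t2: "test_field ?\<phi>2" by (rule test_field_scaleR[OF c\<beta>2 \<phi>])
    have \<Omega>l: "\<Omega> \<in> sets lebesgue" using \<Omega> by auto
    have dd: "divergence \<phi> y = divergence ?\<phi>1 y + divergence ?\<phi>2 y" for y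
      by (simp add: divergence_scaleR[OF c\<beta> p] divergence_scaleR[OF c\<beta>2 p] left_diff_distrib)
    have "(LINT y:\<Omega>|lebesgue. divergence \<phi> y) = (LINT y:\<Omega>|lebesgue. divergence ?\<phi>1 y) + (LINT y:\<Omega>|lebesgue. divergence ?\<phi>2 y)"
      unfolding dd by (rule set_integral_add[OF test_field_divergence_integrable(3)[OF t1 \<Omega>l] test_field_divergence_integrable(3)[OF t2 \<Omega>l]])
    also have "(LINT y:\<Omega>|lebesgue. divergence ?\<phi>1 y) = (LINT y|?L. ?\<phi>1 y \<bullet> ?\<nu> y)"
    proof (rule LG[OF t1])
      show "compact (K \<inter> cball x (2 * ?r / 3))" using K(1) by auto
      show "K \<inter> cball x (2 * ?r / 3) \<subseteq> ball x ?r" using r by auto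
      show "?\<phi>1 y = 0" if "y \<notin> K \<inter> cball x (2 * ?r / 3)" for y using that K(2) \<beta>0[of y] by auto
    qed
    also have "(LINT y:\<Omega>|lebesgue. divergence ?\<phi>2 y) = (LINT y|N. ?\<phi>2 y \<bullet> ?\<nu> y)"
    proof (rule NG[OF t2])
      show "compact (K - ball x (?r / 2))" using K(1) by (intro compact_diff) auto
      show "?\<phi>2 y = 0" if "y \<notin> K - ball x (?r / 2)" for y using that K(2) \<beta>1[of y] by auto
      show "(K - ball x (?r / 2)) \<inter> frontier \<Omega> \<subseteq> (\<Union>x\<in>F. ball x (\<rho> x / 3))"
        using K(3) r by fastforce
    qed
    also have "(LINT y|?L. ?\<phi>1 y \<bullet> ?\<nu> y) = (LINT y|M1. \<phi> y \<bullet> ?\<nu> y)"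
      unfolding M1_def using \<beta>01 \<beta>m B(2) borel_measurable_outer_normal[OF sm] L(1)
      by (subst integral_density) (auto cong: measurable_cong_sets intro: borel_measurable_inner)
    also have "(LINT y|N. ?\<phi>2 y \<bullet> ?\<nu> y) = (LINT y|M2. \<phi> y \<bullet> ?\<nu> y)"
      unfolding M2_def using \<beta>01 \<beta>m B(2) borel_measurable_outer_normal[OF sm] N(1)
      by (subst integral_density) (auto cong: measurable_cong_sets intro: borel_measurable_inner)
    also have "(LINT y|M1. \<phi> y \<bullet> ?\<nu> y) + (LINT y|M2. \<phi> y \<bullet> ?\<nu> y) = (LINT y|M. \<phi> y \<bullet> ?\<nu> y)"
    proof -
      have m: "(\<lambda>y. \<phi> y \<bullet> ?\<nu> y) \<in> borel_measurable borel"
        using B(2) borel_measurable_outer_normal[OF sm] by (rule borel_measurable_inner)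
      have n1: "norm (?\<nu> y) \<le> 1" for y
        using norm_outer_normal[OF sm, of y] by (cases "y \<in> frontier \<Omega>") (auto simp: outer_normal_def)
      have b: "norm (\<phi> y \<bullet> ?\<nu> y) \<le> B" for y
        using order_trans[OF Cauchy_Schwarz_ineq2[of "\<phi> y" "?\<nu> y"] mult_mono[OF B(1)[of y] n1[of y] order_trans[OF norm_ge_zero B(1)[of y]] norm_ge_zero]]
        by simp
      have "integrable M1 (\<lambda>y. \<phi> y \<bullet> ?\<nu> y)" "integrable M2 (\<lambda>y. \<phi> y \<bullet> ?\<nu> y)"
        using m s12 b by (auto intro!: M1.integrable_const_bound[where B=B] M2.integrable_const_bound[where B=B] cong: measurable_cong_sets)
      then show ?thesis unfolding M_def by (rule integral_sum_measure[OF s12 m, symmetric])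
    qed
    finally show ?thesis .
  qed
  ultimately show ?case using aeM by (intro exI[of _ M]) (simp add: M_def)
qed

lemma step_pos: "t < 0 \<Longrightarrow> step t > 0"
proof -
  assume t: "t < 0"
  consider "t \<le> -1" | "-1 < t" "t \<le> -1/2" | "-1/2 < t" by linarith
  then show ?thesis
  proof cases
    case 2
    then have s: "step t = 1 - 2 * (t + 1)\<^sup>2" by (simp add: step_def max_def)
    have "(t + 1)\<^sup>2 \<le> (1/2)\<^sup>2" using 2 by (intro power_mono) auto
    then show ?thesis using s by (simp add: power2_eq_square)
  next
    case 3
    then have "step t = 2 * t\<^sup>2" using t by (simp add: step_def max_def power2_eq_square algebra_simps)
    then show ?thesis using t by simp
  qed (simp add: step_eq)
qed

text \<open>The glued Gauss-Green pair has the outer normal as its density, which is continuous on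
  the frontier, so averages over small balls converge to the normal at the centre. What remains is
  that the measure charges every ball about a frontier point.\<close>

lemma frontier_subset_reduced_boundary:
  fixes \<Omega> :: "'a::euclidean_space set"
  assumes sm: "smooth_boundary \<Omega>" and \<Omega>: "open \<Omega>" "bounded \<Omega>"
  shows "frontier \<Omega> \<subseteq> reduced_boundary \<Omega>"
proof -
  let ?\<nu> = "outer_normal \<Omega>"
  have "\<forall>x\<in>frontier \<Omega>. \<exists>\<rho> M. \<rho> > 0 \<and> sets M = sets borel \<and> finite_measure M \<and> (AE x in M. x \<in> frontier \<Omega>)
    \<and> (\<forall>s>0. emeasure M (ball x s) > 0)
    \<and> (\<forall>\<phi> K. test_field \<phi> \<longrightarrow> compact K \<longrightarrow> K \<subseteq> ball x \<rho> \<longrightarrow> (\<forall>x. x \<notin> K \<longrightarrow> \<phi> x = 0) \<longrightarrow>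
         (LINT x:\<Omega>|lebesgue. divergence \<phi> x) = (LINT x|M. \<phi> x \<bullet> ?\<nu> x))"
    using local_gauss_green[OF sm \<Omega>(1)] by (intro ballI)
  then obtain \<rho> where "\<forall>x\<in>frontier \<Omega>. \<exists>M. \<rho> x > 0 \<and> sets M = sets borel \<and> finite_measure M \<and> (AE x in M. x \<in> frontier \<Omega>)
    \<and> (\<forall>s>0. emeasure M (ball x s) > 0)
    \<and> (\<forall>\<phi> K. test_field \<phi> \<longrightarrow> compact K \<longrightarrow> K \<subseteq> ball x (\<rho> x) \<longrightarrow> (\<forall>x. x \<notin> K \<longrightarrow> \<phi> x = 0) \<longrightarrow>
         (LINT x:\<Omega>|lebesgue. divergence \<phi> x) = (LINT x|M. \<phi> x \<bullet> ?\<nu> x))"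
    by (rule bchoice[THEN exE])
  then obtain Mx where loc: "\<forall>x\<in>frontier \<Omega>. \<rho> x > 0 \<and> sets (Mx x) = sets borel \<and> finite_measure (Mx x) \<and> (AE y in Mx x. y \<in> frontier \<Omega>)
    \<and> (\<forall>s>0. emeasure (Mx x) (ball x s) > 0)
    \<and> (\<forall>\<phi> K. test_field \<phi> \<longrightarrow> compact K \<longrightarrow> K \<subseteq> ball x (\<rho> x) \<longrightarrow> (\<forall>y. y \<notin> K \<longrightarrow> \<phi> y = 0) \<longrightarrow>
         (LINT y:\<Omega>|lebesgue. divergence \<phi> y) = (LINT y|Mx x. \<phi> y \<bullet> ?\<nu> y))"
    by (rule bchoice[THEN exE])
  have "compact (frontier \<Omega>)" using \<Omega>(2) by (rule compact_frontier_bounded)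
  then obtain F where F: "F \<subseteq> frontier \<Omega>" "finite F" "frontier \<Omega> \<subseteq> (\<Union>x\<in>F. ball x (\<rho> x / 3))"
  proof (rule compactE_image[of "frontier \<Omega>" "frontier \<Omega>" "\<lambda>x. ball x (\<rho> x / 3)"])
    show "frontier \<Omega> \<subseteq> (\<Union>x\<in>frontier \<Omega>. ball x (\<rho> x / 3))" using loc by auto
  qed auto
  have "\<exists>M. sets M = sets borel \<and> finite_measure M \<and> (AE y in M. y \<in> frontier \<Omega>)
    \<and> (\<forall>\<phi> K. test_field \<phi> \<longrightarrow> compact K \<longrightarrow> (\<forall>y. y \<notin> K \<longrightarrow> \<phi> y = 0) \<longrightarrow> K \<inter> frontier \<Omega> \<subseteq> (\<Union>x\<in>F. ball x (\<rho> x / 3)) \<longrightarrow>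
         (LINT y:\<Omega>|lebesgue. divergence \<phi> y) = (LINT y|M. \<phi> y \<bullet> ?\<nu> y))"
  proof (rule gauss_green_glue[OF sm \<Omega>(1) F(2), of \<rho> Mx])
    fix x assume "x \<in> F"
    then have "x \<in> frontier \<Omega>" using F(1) by blast
    note l = bspec[OF loc this]
    show "\<rho> x > 0" using l by (rule conjunct1)
    show "sets (Mx x) = sets borel \<and> finite_measure (Mx x) \<and> (AE y in Mx x. y \<in> frontier \<Omega>)
      \<and> (\<forall>\<phi> K. test_field \<phi> \<longrightarrow> compact K \<longrightarrow> K \<subseteq> ball x (\<rho> x) \<longrightarrow> (\<forall>y. y \<notin> K \<longrightarrow> \<phi> y = 0) \<longrightarrow>
         (LINT y:\<Omega>|lebesgue. divergence \<phi> y) = (LINT y|Mx x. \<phi> y \<bullet> ?\<nu> y))"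
      using l by (elim conjE) (intro conjI)
  qed
  then obtain M where M: "sets M = sets borel" "finite_measure M" "AE y in M. y \<in> frontier \<Omega>"
    and MG: "\<And>\<phi> K. test_field \<phi> \<Longrightarrow> compact K \<Longrightarrow> (\<forall>y. y \<notin> K \<longrightarrow> \<phi> y = 0) \<Longrightarrow>
         (LINT y:\<Omega>|lebesgue. divergence \<phi> y) = (LINT y|M. \<phi> y \<bullet> ?\<nu> y)"
    using F(3) by (meson inf_le2 order_trans)
  interpret finite_measure M by (rule M(2))
  have \<nu>b: "?\<nu> \<in> borel_measurable borel" by (rule borel_measurable_outer_normal[OF sm])
  have gg: "gauss_green \<Omega> M ?\<nu>"
    unfolding gauss_green_def
  proof (intro conjI allI impI)
    show "AE x in M. norm (?\<nu> x) = 1" using M(3) by eventually_elim (rule norm_outer_normal[OF sm])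
    fix \<phi> :: "'a \<Rightarrow> 'a" assume \<phi>: "test_field \<phi>"
    obtain \<phi>' K where "C1_on UNIV \<phi> \<phi>'" "compact K" "\<And>x. x \<notin> K \<Longrightarrow> \<phi> x = 0" using test_fieldE[OF \<phi>] by metis
    then show "(LINT x:\<Omega>|lebesgue. divergence \<phi> x) = (LINT x|M. \<phi> x \<bullet> ?\<nu> x)" using MG[OF \<phi>] by blast
  qed (use M \<nu>b in auto)
  show ?thesis
  proof
    fix x assume x: "x \<in> frontier \<Omega>"
    have \<nu>near: "\<exists>d>0. \<forall>y\<in>frontier \<Omega>. dist y x < d \<longrightarrow> dist (?\<nu> y) (?\<nu> x) < \<epsilon>" if "\<epsilon> > 0" for \<epsilon>
      using continuous_on_outer_normal[OF sm] x that unfolding continuous_on_iff by blast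
    have nx: "norm (?\<nu> x) = 1" by (rule norm_outer_normal[OF sm x])
    \<comment> \<open>The gluing does not show directly that M has mass near x. The local measure
      \<open>Mx x\<close> has, and M and \<open>Mx x\<close> give the same integral for the field
      \<zeta> times the normal at x, namely its flux through \<Omega>. That integral is positive for
      \<open>Mx x\<close>, as the normal varies little, and would be 0 if M vanished on the
      ball.\<close>
    have pos: "measure M (ball x s) > 0" if s: "s > 0" for s
    proof (rule ccontr)
      assume "\<not> ?thesis"
      then have "measure M (ball x s) = 0" using measure_nonneg[of M "ball x s"] by linarith
      then have z: "emeasure M (ball x s) = 0" by (simp add: emeasure_eq_measure)
      obtain d where d: "d > 0" "\<And>y. y \<in> frontier \<Omega> \<Longrightarrow> dist y x < d \<Longrightarrow> dist (?\<nu> y) (?\<nu> x) < 1/2"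
        using \<nu>near[of "1/2"] by auto
      define t where "t = min (s / 2) (min (d / 2) (\<rho> x / 2))"
      have t: "t > 0" "t < s" "t < d" "t < \<rho> x" using s d loc x by (auto simp: t_def)
      let ?L = "Mx x"
      have L: "sets ?L = sets borel" "finite_measure ?L" "AE y in ?L. y \<in> frontier \<Omega>" "emeasure ?L (ball x t) > 0"
        using loc x t(1) by auto
      have LG: "\<And>\<phi> K. test_field \<phi> \<Longrightarrow> compact K \<Longrightarrow> K \<subseteq> ball x (\<rho> x) \<Longrightarrow> (\<forall>y. y \<notin> K \<longrightarrow> \<phi> y = 0) \<Longrightarrow>
         (LINT y:\<Omega>|lebesgue. divergence \<phi> y) = (LINT y|?L. \<phi> y \<bullet> ?\<nu> y)" using loc x by blast
      let ?f = "\<lambda>y. (norm (y - x))\<^sup>2 - t\<^sup>2"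
      define \<zeta> where "\<zeta> y = step (1 * ?f y)" for y
      have "(norm (y - x))\<^sup>2 < t\<^sup>2 \<longleftrightarrow> norm (y - x) < t" for y
        using t by (metis less_imp_le norm_ge_zero power2_less_imp_less power_strict_mono zero_less_numeral)
      then have fneg: "?f y < 0 \<longleftrightarrow> y \<in> ball x t" for y
        unfolding mem_ball dist_norm norm_minus_commute[of x] by (simp only: diff_less_0_iff_less)
      have \<zeta>: "\<zeta> y > 0" if "y \<in> ball x t" for y unfolding \<zeta>_def using that fneg[of y] by (intro step_pos) simp
      have \<zeta>0: "\<zeta> y = 0" if "y \<notin> ball x t" for y
      proof -
        have "\<not> ?f y < 0" using that fneg[of y] by blast
        then show ?thesis unfolding \<zeta>_def by (intro step_eq(2)) (simp add: not_less)
      qed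
      define \<phi> where "\<phi> y = \<zeta> y *\<^sub>R ?\<nu> x" for y
      have \<phi>0: "\<phi> y = 0" if "y \<notin> cball x t" for y using \<zeta>0[of y] that by (auto simp: \<phi>_def)
      have tf: "test_field \<phi>"
        unfolding \<phi>_def[abs_def] \<zeta>_def
        by (rule test_fieldI[OF C1_on_scaleR[OF C1_on_step[OF C1_on_norm_sq] C1_on_const], of "cball x t"])
           (use \<phi>0 in \<open>auto simp: \<phi>_def \<zeta>_def\<close>)
      have "(LINT y|?L. \<phi> y \<bullet> ?\<nu> y) = (LINT y:\<Omega>|lebesgue. divergence \<phi> y)"
        by (rule LG[symmetric, OF tf, of "cball x t"]) (use t \<phi>0 in auto)
      also have "\<dots> = (LINT y|M. \<phi> y \<bullet> ?\<nu> y)" by (rule MG[OF tf, of "cball x t"]) (use \<phi>0 in auto)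
      also have "\<dots> = 0"
      proof (rule integral_eq_zero_AE)
        have "AE y in M. y \<notin> ball x s" using z M(1) by (intro AE_not_in) (auto simp: null_sets_def)
        then show "AE y in M. \<phi> y \<bullet> ?\<nu> y = 0"
          by eventually_elim (use \<zeta>0 t in \<open>auto simp: \<phi>_def\<close>)
      qed
      finally have int0: "(LINT y|?L. \<phi> y \<bullet> ?\<nu> y) = 0" .
      have p0: "0 < \<phi> y \<bullet> ?\<nu> y" if "y \<in> frontier \<Omega>" "y \<in> ball x t" for y
      proof -
        have "norm (?\<nu> y - ?\<nu> x) < 1/2" using d(2)[of y] that t by (simp add: dist_norm norm_minus_commute)
        moreover have "\<bar>?\<nu> x \<bullet> (?\<nu> y - ?\<nu> x)\<bar> \<le> norm (?\<nu> x) * norm (?\<nu> y - ?\<nu> x)" by (rule Cauchy_Schwarz_ineq2)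
        moreover have "?\<nu> x \<bullet> ?\<nu> x = 1" using nx by (simp add: dot_square_norm)
        ultimately have "?\<nu> x \<bullet> ?\<nu> y > 0" using nx by (simp add: inner_diff_right)
        then show ?thesis using \<zeta>[OF that(2)] by (simp add: \<phi>_def)
      qed
      have nn: "AE y in ?L. 0 \<le> \<phi> y \<bullet> ?\<nu> y"
        using L(3)
      proof eventually_elim
        case (elim y)
        then show ?case using p0[of y] \<zeta>0[of y] by (cases "y \<in> ball x t") (auto simp: \<phi>_def intro: less_imp_le)
      qed
      interpret L: finite_measure ?L by (rule L(2))
      obtain B where B: "\<And>y. norm (\<phi> y) \<le> B" "\<phi> \<in> borel_measurable borel" using test_field_bounded[OF tf] by metis
      have "integrable ?L (\<lambda>y. \<phi> y \<bullet> ?\<nu> y)"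
      proof (rule L.integrable_const_bound[where B=B])
        show "AE y in ?L. norm (\<phi> y \<bullet> ?\<nu> y) \<le> B"
          using L(3)
        proof eventually_elim
          case (elim y)
          then show ?case using Cauchy_Schwarz_ineq2[of "\<phi> y" "?\<nu> y"] B(1)[of y] norm_outer_normal[OF sm elim] by simp
        qed
        show "(\<lambda>y. \<phi> y \<bullet> ?\<nu> y) \<in> borel_measurable ?L"
          using B(2) \<nu>b L(1) by (auto cong: measurable_cong_sets intro: borel_measurable_inner)
      qed
      from integral_nonneg_eq_0_iff_AE[OF this nn] int0 have "AE y in ?L. \<phi> y \<bullet> ?\<nu> y = 0" by simp
      then have "AE y in ?L. y \<notin> ball x t"
        using L(3) by eventually_elim (use p0 in force)
      then have "emeasure ?L (ball x t) = 0"
        using L(1) sets_eq_imp_space_eq[OF L(1)] by (subst (asm) AE_iff_measurable[of "ball x t"]) auto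
      then show False using L(4) by simp
    qed
    have "((\<lambda>s. (LINT y:ball x s|M. ?\<nu> y) /\<^sub>R measure M (ball x s)) \<longlongrightarrow> ?\<nu> x) (at_right 0)"
    proof (rule tendstoI)
      fix \<epsilon> :: real assume "\<epsilon> > 0"
      then obtain d where d: "d > 0" "\<And>y. y \<in> frontier \<Omega> \<Longrightarrow> dist y x < d \<Longrightarrow> dist (?\<nu> y) (?\<nu> x) < \<epsilon> / 2"
        using \<nu>near[of "\<epsilon> / 2"] by auto
      have "dist ((LINT y:ball x s|M. ?\<nu> y) /\<^sub>R measure M (ball x s)) (?\<nu> x) < \<epsilon>" if s: "0 < s" "s < d" for s
      proof -
        let ?B = "ball x s"
        have Bs: "?B \<in> sets M" using M(1) by auto
        have \<nu>M: "?\<nu> \<in> borel_measurable M" using \<nu>b M(1) by (simp cong: measurable_cong_sets)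
        have i\<nu>: "integrable M ?\<nu>"
          by (rule integrable_const_bound[where B=1]) (use gg \<nu>M in \<open>auto simp: gauss_green_def\<close>)
        have i1: "integrable M (\<lambda>y. indicator ?B y *\<^sub>R ?\<nu> y)" by (rule integrable_mult_indicator[OF Bs i\<nu>])
        have i2: "integrable M (\<lambda>y. indicator ?B y *\<^sub>R ?\<nu> x)"
          using Bs by (intro integrable_mult_indicator) auto
        have "(LINT y|M. indicator ?B y *\<^sub>R ?\<nu> x) = measure M ?B *\<^sub>R ?\<nu> x"
          using Bs emeasure_finite[of ?B] by (simp add: less_top[symmetric])
        then have "(LINT y:?B|M. ?\<nu> y) - measure M ?B *\<^sub>R ?\<nu> x = (LINT y|M. indicator ?B y *\<^sub>R ?\<nu> y - indicator ?B y *\<^sub>R ?\<nu> x)"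
          using Bochner_Integration.integral_diff[OF i1 i2] by (simp add: set_lebesgue_integral_def)
        also have "norm \<dots> \<le> (LINT y|M. \<epsilon> / 2 * indicator ?B y)"
        proof (rule order_trans[OF integral_norm_bound integral_mono_AE])
          show "integrable M (\<lambda>y. norm (indicator ?B y *\<^sub>R ?\<nu> y - indicator ?B y *\<^sub>R ?\<nu> x))"
            using i1 i2 by (intro integrable_norm Bochner_Integration.integrable_diff)
          show "integrable M (\<lambda>y. \<epsilon> / 2 * indicator ?B y)"
            using Bs emeasure_finite[of ?B] by (intro integrable_mult_right) (auto simp: integrable_indicator_iff less_top[symmetric])
          show "AE y in M. norm (indicator ?B y *\<^sub>R ?\<nu> y - indicator ?B y *\<^sub>R ?\<nu> x) \<le> \<epsilon> / 2 * indicator ?B y"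
            using M(3)
          proof eventually_elim
            case (elim y)
            show ?case
            proof (cases "y \<in> ?B")
              case True
              then have "dist (?\<nu> y) (?\<nu> x) < \<epsilon> / 2" using s by (intro d(2) elim) (simp add: dist_commute)
              then show ?thesis using True by (simp add: dist_norm)
            qed simp
          qed
        qed
        also have "\<dots> = \<epsilon> / 2 * measure M ?B" using Bs emeasure_finite[of ?B] by (simp add: less_top[symmetric])
        finally have "norm ((LINT y:?B|M. ?\<nu> y) - measure M ?B *\<^sub>R ?\<nu> x) \<le> \<epsilon> / 2 * measure M ?B" .
        moreover have "(LINT y:?B|M. ?\<nu> y) /\<^sub>R measure M ?B - ?\<nu> x = ((LINT y:?B|M. ?\<nu> y) - measure M ?B *\<^sub>R ?\<nu> x) /\<^sub>R measure M ?B"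
          using pos[OF s(1)] by (simp add: scaleR_diff_right)
        then have "dist ((LINT y:?B|M. ?\<nu> y) /\<^sub>R measure M ?B) (?\<nu> x) = norm ((LINT y:?B|M. ?\<nu> y) - measure M ?B *\<^sub>R ?\<nu> x) / measure M ?B"
          using pos[OF s(1)] by (simp add: dist_norm divide_inverse mult.commute)
        ultimately have "dist ((LINT y:?B|M. ?\<nu> y) /\<^sub>R measure M ?B) (?\<nu> x) \<le> \<epsilon> / 2"
          using pos[OF s(1)] by (simp add: divide_le_eq)
        then show ?thesis using \<open>\<epsilon> > 0\<close> by simp
      qed
      then show "\<forall>\<^sub>F s in at_right 0. dist ((LINT y:ball x s|M. ?\<nu> y) /\<^sub>R measure M (ball x s)) (?\<nu> x) < \<epsilon>"
        unfolding eventually_at_right_field using d(1) by blast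
    qed
    then show "x \<in> reduced_boundary \<Omega>"
      unfolding reduced_boundary_def using gg pos nx by blast
  qed
qed

section \<open>Comparison of areas\<close>

text \<open>With x - p = s u and y - p = t v for unit vectors u and v, |x - y|^2 = (s - t)^2 + s t
  |u - v|^2, and s t \<ge> \<rho>^2.\<close>

lemma radial_projection_contracts:
  fixes x y :: "'a::euclidean_space"
  assumes "r > 0" "\<rho> \<ge> r" "norm (x - p) \<ge> \<rho>" "norm (y - p) \<ge> \<rho>"
  shows "dist (p + r *\<^sub>R sgn (x - p)) (p + r *\<^sub>R sgn (y - p)) \<le> r / \<rho> * dist x y"
proof -
  define s t where "s = norm (x - p)" and "t = norm (y - p)"
  define u v where "u = sgn (x - p)" and "v = sgn (y - p)"
  have \<rho>: "\<rho> > 0" using assms by linarith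
  have st: "s \<ge> \<rho>" "t \<ge> \<rho>" using assms by (auto simp: s_def t_def)
  have "norm (x - p) \<noteq> 0" "norm (y - p) \<noteq> 0" using st \<rho> by (auto simp: s_def t_def)
  then have xu: "x - p = s *\<^sub>R u" "y - p = t *\<^sub>R v" by (simp_all add: s_def t_def u_def v_def sgn_div_norm)
  have uv: "u \<bullet> u = 1" "v \<bullet> v = 1"
    using st \<rho> by (auto simp: s_def t_def u_def v_def norm_sgn norm_eq_1[symmetric])
  have le1: "u \<bullet> v \<le> 1"
    using Cauchy_Schwarz_ineq2[of u v] uv by (simp add: norm_eq_1[symmetric])
  have "(\<rho> * norm (u - v))\<^sup>2 = \<rho> * \<rho> * (2 - 2 * (u \<bullet> v))"
    unfolding power_mult_distrib power2_norm_eq_inner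
    by (simp add: inner_diff_left inner_diff_right uv inner_commute[of v u] power2_eq_square)
  also have "\<dots> \<le> s * t * (2 - 2 * (u \<bullet> v))"
    using st \<rho> le1 by (intro mult_right_mono mult_mono) auto
  also have "\<dots> \<le> (s - t)\<^sup>2 + s * t * (2 - 2 * (u \<bullet> v))" by simp
  also have "\<dots> = (norm (s *\<^sub>R u - t *\<^sub>R v))\<^sup>2"
    unfolding power2_norm_eq_inner
    by (simp add: inner_diff_left inner_diff_right uv inner_commute[of v u] power2_eq_square algebra_simps)
  also have "s *\<^sub>R u - t *\<^sub>R v = x - y" using xu by (simp add: algebra_simps)
  finally have "\<rho> * norm (u - v) \<le> norm (x - y)" by (rule power2_le_imp_le) simp
  then have "norm (u - v) \<le> norm (x - y) / \<rho>" using \<rho> by (simp add: pos_le_divide_eq mult.commute)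
  then have "r * norm (u - v) \<le> r * (norm (x - y) / \<rho>)" using assms(1) by (intro mult_left_mono) auto
  moreover have "dist (p + r *\<^sub>R u) (p + r *\<^sub>R v) = r * norm (u - v)"
    using assms(1) by (simp add: dist_norm scaleR_diff_right[symmetric])
  ultimately show ?thesis by (simp add: u_def v_def dist_norm)
qed

lemma AE_lborel_interval:
  assumes "AE t::real in lborel. t > 0 \<longrightarrow> P t" "0 \<le> a" "a < b"
  obtains t where "a < t" "t < b" "P t"
proof (rule ccontr)
  assume no: "\<not> thesis"
  from assms(1) have "AE t in lborel. t \<notin> {a<..<b}"
    by eventually_elim (use no that assms(2) in auto)
  then have "emeasure lborel {a<..<b} = 0"
    using AE_iff_null_sets[of "{a<..<b}" lborel] by (simp add: null_sets_def)
  then show False using assms(3) by simp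
qed

text \<open>Makes the radial projection of the outer part of the frontier cover the part of a sphere
  that lies inside \<Omega>.\<close>

lemma bounded_set_ray_frontier:
  fixes \<Omega> :: "'a::euclidean_space set"
  assumes "bounded \<Omega>" "y \<in> \<Omega>" "y \<noteq> p"
  obtains t where "t \<ge> 1" "p + t *\<^sub>R (y - p) \<in> frontier \<Omega>"
proof -
  obtain B where B: "\<And>x. x \<in> \<Omega> \<Longrightarrow> norm x \<le> B" using assms(1) bounded_iff by metis
  define n where "n = norm (y - p)"
  have n: "n > 0" using assms by (simp add: n_def)
  define T where "T = max 1 ((B + norm p + 1) / n)"
  have T: "T \<ge> 1" "T * n \<ge> B + norm p + 1" using n by (auto simp: T_def max_def pos_divide_le_eq not_le field_simps)
  let ?z = "p + T *\<^sub>R (y - p)"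
  have "norm (T *\<^sub>R (y - p)) \<le> norm ?z + norm p" using norm_triangle_sub[of "T *\<^sub>R (y - p)" "- p"] by (simp add: add.commute)
  then have "norm ?z > B" using T n by (simp add: n_def)
  then have z: "?z \<notin> \<Omega>" using B[of ?z] by auto
  have "closed_segment y ?z \<inter> frontier \<Omega> \<noteq> {}"
    by (rule connected_Int_frontier) (use assms z in auto)
  then obtain x where x: "x \<in> closed_segment y ?z" "x \<in> frontier \<Omega>" by blast
  then obtain u where u: "0 \<le> u" "u \<le> 1" "x = (1 - u) *\<^sub>R y + u *\<^sub>R ?z" by (auto simp: in_segment)
  have "x = p + (1 + u * (T - 1)) *\<^sub>R (y - p)" unfolding u(3) by (simp add: algebra_simps)
  moreover have "1 + u * (T - 1) \<ge> 1" using u T by simp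
  ultimately show ?thesis using that x(2) by metis
qed

locale minimizing_domain =
  fixes \<Omega> :: "'a::euclidean_space set" and m :: nat
  assumes dim: "DIM('a) = Suc m" "m > 0"
    and \<Omega>: "open \<Omega>" "connected \<Omega>" "\<Omega> \<noteq> {}" "bounded \<Omega>" "smooth_boundary \<Omega>" "outward_minimizing \<Omega>"
begin

abbreviation H :: "'a set \<Rightarrow> ennreal" where "H \<equiv> hausdorff m"
abbreviation area :: "'a set \<Rightarrow> real" where "area \<equiv> measure area_measure"
abbreviation \<Sigma> :: "'a set" where "\<Sigma> \<equiv> frontier \<Omega>"

lemma emeasure_area: "X \<in> sets borel \<Longrightarrow> emeasure area_measure X = H X"
  by (simp add: emeasure_area_measure dim)

lemma hausdorff_eq_area: "X \<in> sets borel \<Longrightarrow> H X < top \<Longrightarrow> H X = ennreal (area X)"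
  by (metis emeasure_area emeasure_eq_ennreal_measure less_irrefl)

lemma area_Un:
  "X \<in> sets borel \<Longrightarrow> Y \<in> sets borel \<Longrightarrow> H X < top \<Longrightarrow> H Y < top \<Longrightarrow> X \<inter> Y = {} \<Longrightarrow> area (X \<union> Y) = area X + area Y"
  by (rule measure_Union) (auto simp: emeasure_area)

definition \<omega> :: real where "\<omega> = real (Suc m) * unit_ball_vol (real (Suc m))"

lemma \<omega>: "\<omega> > 0"
  by (simp add: \<omega>_def)

lemma hausdorff_sphere': "t > 0 \<Longrightarrow> H (sphere p t) = ennreal (t ^ m * \<omega>)"
  unfolding \<omega>_def by (rule hausdorff_sphere[OF _ dim])

lemma hausdorff_sphere_finite: "t > 0 \<Longrightarrow> X \<subseteq> sphere p t \<Longrightarrow> H X < top"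
  using hausdorff_mono[of X "sphere p t" m] by (simp add: hausdorff_sphere' le_less_trans)

lemma area_sphere: "t > 0 \<Longrightarrow> area (sphere p t) = t ^ m * \<omega>"
  using hausdorff_eq_area[of "sphere p t"] \<omega> by (simp add: hausdorff_sphere' borel_closed)

text \<open>The perimeter of \<Omega> is bounded below by the area of its frontier and that of
  \<Omega> \<union> F above by the area of its topological frontier, so minimality becomes a
  statement about Hausdorff measures of frontiers.\<close>

lemma frontier_comparison:
  assumes F: "open F" "bounded F" "finite_perimeter F" "finite_perimeter (\<Omega> \<inter> F)"
  shows "H \<Sigma> \<le> H (\<Sigma> - F) + H (frontier F - \<Omega>)"
proof -
  have m1: "DIM('a) - 1 = m" using dim by simp
  have fp: "finite_perimeter \<Omega>" using \<Omega>(6) by (simp add: outward_minimizing_def)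
  have "H \<Sigma> \<le> perimeter \<Omega>"
    unfolding perimeter_def m1 by (rule hausdorff_mono[OF frontier_subset_reduced_boundary[OF \<Omega>(5,1,4)]])
  also have "\<dots> \<le> perimeter (\<Omega> \<union> F)"
  proof -
    have "finite_perimeter (\<Omega> \<union> F)" by (rule finite_perimeter_Un[OF fp F(3,4)])
    moreover have "bounded (\<Omega> \<union> F)" using \<Omega>(4) F(2) by simp
    moreover have "\<Omega> - (\<Omega> \<union> F) = {}" by auto
    ultimately show ?thesis using \<Omega>(6) unfolding outward_minimizing_def by (metis null_sets.empty_sets)
  qed
  also have "\<dots> \<le> H (frontier (\<Omega> \<union> F))"
    unfolding perimeter_def m1 by (rule hausdorff_mono[OF reduced_boundary_subset_frontier])
  also have "\<dots> \<le> H ((\<Sigma> - F) \<union> (frontier F - \<Omega>))"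
  proof (rule hausdorff_mono)
    have "frontier (\<Omega> \<union> F) = (closure \<Omega> \<union> closure F) - (\<Omega> \<union> F)"
      using interior_open[OF open_Un[OF \<Omega>(1) F(1)]] by (simp add: frontier_def closure_Un)
    moreover have "\<Sigma> = closure \<Omega> - \<Omega>" "frontier F = closure F - F"
      using interior_open[OF \<Omega>(1)] interior_open[OF F(1)] by (simp_all add: frontier_def)
    ultimately show "frontier (\<Omega> \<union> F) \<subseteq> (\<Sigma> - F) \<union> (frontier F - \<Omega>)" by blast
  qed
  also have "\<dots> \<le> H (\<Sigma> - F) + H (frontier F - \<Omega>)" by (rule hausdorff_Un)
  finally show ?thesis .
qed

lemma finite_perimeter_ball: "r > 0 \<Longrightarrow> finite_perimeter (ball (p::'a) r)" "r > 0 \<Longrightarrow> finite_perimeter (\<Omega> \<inter> ball p r)"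
  using finite_perimeter_Int_ball[OF finite_perimeter_UNIV, of r p] finite_perimeter_Int_ball[of \<Omega> r p] \<Omega>(6)
  by (auto simp: outward_minimizing_def)

lemma compact_frontier: "compact \<Sigma>" and frontier_borel [measurable]: "\<Sigma> \<in> sets borel"
  using \<Omega>(4) by (auto intro: compact_frontier_bounded borel_closed)

text \<open>The sphere bounding a ball that contains \<Sigma> has finite area; in the comparison
  with that ball no part of \<Sigma> is left on the right-hand side.\<close>

lemma frontier_finite: "H \<Sigma> < top"
proof -
  obtain B where B: "B > 0" "\<And>x. x \<in> \<Sigma> \<Longrightarrow> norm x \<le> B"
    using compact_imp_bounded[OF compact_frontier] bounded_pos by blast
  have e: "\<Sigma> - ball 0 (B + 1) = {}" using B(2) by force
  have "H \<Sigma> \<le> H (\<Sigma> - ball 0 (B + 1)) + H (frontier (ball 0 (B + 1)) - \<Omega>)"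
    by (rule frontier_comparison) (use finite_perimeter_ball[of "B + 1" 0] B(1) in simp_all)
  then have "H \<Sigma> \<le> H (frontier (ball 0 (B + 1)) - \<Omega>)" unfolding e by simp
  also have "\<dots> < top" using B(1) by (intro hausdorff_sphere_finite[of "B + 1" _ 0]) auto
  finally show ?thesis .
qed

lemma frontier_subset_finite: "X \<subseteq> \<Sigma> \<Longrightarrow> H X < top"
  using hausdorff_mono[of X \<Sigma> m] frontier_finite by (rule le_less_trans)

lemma area_frontier_Int_le:
  assumes F: "open F" "bounded F" "finite_perimeter F" "finite_perimeter (\<Omega> \<inter> F)"
  shows "ennreal (area (\<Sigma> \<inter> F)) \<le> H (frontier F - \<Omega>)"
proof -
  have b: "\<Sigma> \<inter> F \<in> sets borel" "\<Sigma> - F \<in> sets borel" using F(1) by auto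
  have f: "H (\<Sigma> \<inter> F) < top" "H (\<Sigma> - F) < top" by (auto intro: frontier_subset_finite)
  have "area \<Sigma> = area (\<Sigma> \<inter> F \<union> (\<Sigma> - F))" by (rule arg_cong[where f=area]) auto
  also have "\<dots> = area (\<Sigma> \<inter> F) + area (\<Sigma> - F)" by (rule area_Un[OF b f]) auto
  finally have eq: "ennreal (area \<Sigma>) = ennreal (area (\<Sigma> \<inter> F)) + ennreal (area (\<Sigma> - F))" by simp
  have "ennreal (area (\<Sigma> - F)) + ennreal (area (\<Sigma> \<inter> F)) \<le> ennreal (area (\<Sigma> - F)) + H (frontier F - \<Omega>)"
    using frontier_comparison[OF F] eq by (simp add: hausdorff_eq_area[OF b(2) f(2)] hausdorff_eq_area[OF frontier_borel frontier_finite] add.commute)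
  then show ?thesis by (simp add: ennreal_add_left_cancel_le)
qed

lemma area_frontier_ball_le:
  assumes t: "t > 0"
  shows "area (\<Sigma> \<inter> ball p t) \<le> area (sphere p t - \<Omega>)"
proof -
  have "ennreal (area (\<Sigma> \<inter> ball p t)) \<le> H (sphere p t - \<Omega>)"
    using area_frontier_Int_le[of "ball p t"] finite_perimeter_ball[OF t, of p] t by simp
  also have "\<dots> = ennreal (area (sphere p t - \<Omega>))"
    using \<Omega>(1) t by (intro hausdorff_eq_area hausdorff_sphere_finite[of t _ p]) (auto intro: borel_closed)
  finally show ?thesis by simp
qed

lemma area_frontier_split:
  assumes "X \<in> sets borel"
  shows "area \<Sigma> = area (\<Sigma> \<inter> X) + area (\<Sigma> - X)"
proof -
  have "area \<Sigma> = area (\<Sigma> \<inter> X \<union> (\<Sigma> - X))" by (rule arg_cong[where f=area]) auto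
  also have "\<dots> = area (\<Sigma> \<inter> X) + area (\<Sigma> - X)"
    using assms by (intro area_Un frontier_subset_finite) auto
  finally show ?thesis .
qed

lemma area_sphere_split:
  assumes "t > 0" "X \<in> sets borel"
  shows "t ^ m * \<omega> = area (sphere p t \<inter> X) + area (sphere p t - X)"
proof -
  have "t ^ m * \<omega> = area (sphere p t \<inter> X \<union> (sphere p t - X))"
    using area_sphere[OF assms(1), of p] by (simp add: Int_Diff_Un)
  also have "\<dots> = area (sphere p t \<inter> X) + area (sphere p t - X)"
    using assms by (intro area_Un hausdorff_sphere_finite[of t _ p]) (auto intro: borel_closed)
  finally show ?thesis .
qed

text \<open>The radial projection of the frontier onto the sphere of radius r covers the part of the
  sphere inside \<Omega>. The frontier beyond \<rho> is recorded separately because there the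
  projection contracts by r / \<rho>; this is the source of strictness in the equality case.\<close>

lemma area_sphere_Int_le_general:
  assumes r: "0 < r" "r \<le> \<rho>"
  shows "area (sphere p r \<inter> \<Omega>) \<le> area (\<Sigma> \<inter> ball p \<rho> - ball p r) + (r / \<rho>) ^ m * area (\<Sigma> - ball p \<rho>)"
proof -
  define \<pi> where "\<pi> x = p + r *\<^sub>R sgn (x - p)" for x
  let ?S1 = "\<Sigma> \<inter> ball p \<rho> - ball p r" and ?S2 = "\<Sigma> - ball p \<rho>"
  have \<rho>: "\<rho> > 0" using r by linarith
  have sub: "sphere p r \<inter> \<Omega> \<subseteq> \<pi> ` ?S1 \<union> \<pi> ` ?S2"
  proof
    fix y assume y: "y \<in> sphere p r \<inter> \<Omega>"
    then have ny: "norm (y - p) = r" by (simp add: dist_norm norm_minus_commute)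
    then have "y \<noteq> p" using r by auto
    then obtain t where t: "t \<ge> 1" "p + t *\<^sub>R (y - p) \<in> \<Sigma>" using bounded_set_ray_frontier[OF \<Omega>(4), of y p] y by auto
    let ?x = "p + t *\<^sub>R (y - p)"
    have "sgn (?x - p) = (1 / r) *\<^sub>R (y - p)" using t(1) ny by (simp add: sgn_scaleR sgn_div_norm divide_inverse)
    then have "\<pi> ?x = y" using r by (simp add: \<pi>_def)
    moreover have "norm (?x - p) \<ge> r" using t(1) ny r by (simp add: mult_le_cancel_right1)
    then have "?x \<notin> ball p r" by (simp add: dist_norm)
    ultimately show "y \<in> \<pi> ` ?S1 \<union> \<pi> ` ?S2" using t(2) by (cases "?x \<in> ball p \<rho>") (auto intro!: rev_image_eqI)
  qed
  have 1: "H (\<pi> ` ?S1) \<le> ennreal (1 ^ m) * H ?S1"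
  proof (rule hausdorff_lipschitz_image)
    fix x y assume "x \<in> ?S1" "y \<in> ?S1"
    then show "dist (\<pi> x) (\<pi> y) \<le> 1 * dist x y"
      using radial_projection_contracts[of r r x p y] r by (simp add: \<pi>_def dist_norm norm_minus_commute)
  qed simp
  have 2: "H (\<pi> ` ?S2) \<le> ennreal ((r / \<rho>) ^ m) * H ?S2"
  proof (rule hausdorff_lipschitz_image)
    fix x y assume "x \<in> ?S2" "y \<in> ?S2"
    then show "dist (\<pi> x) (\<pi> y) \<le> r / \<rho> * dist x y"
      using radial_projection_contracts[of r \<rho> x p y] r by (simp add: \<pi>_def dist_norm norm_minus_commute)
  qed (use r \<rho> in auto)
  have b: "?S1 \<in> sets borel" "?S2 \<in> sets borel" "sphere p r \<inter> \<Omega> \<in> sets borel" using \<Omega>(1) by (auto intro: borel_closed)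
  have "ennreal (area (sphere p r \<inter> \<Omega>)) = H (sphere p r \<inter> \<Omega>)"
    by (rule hausdorff_eq_area[symmetric, OF b(3)]) (rule hausdorff_sphere_finite[OF r(1), of _ p], auto)
  also have "\<dots> \<le> H (\<pi> ` ?S1) + H (\<pi> ` ?S2)" by (rule order_trans[OF hausdorff_mono[OF sub] hausdorff_Un])
  also have "\<dots> \<le> H ?S1 + ennreal ((r / \<rho>) ^ m) * H ?S2" using add_mono[OF 1 2] by simp
  also have "\<dots> = ennreal (area ?S1) + ennreal ((r / \<rho>) ^ m) * ennreal (area ?S2)"
  proof -
    have "H ?S1 = ennreal (area ?S1)" "H ?S2 = ennreal (area ?S2)"
      by (rule hausdorff_eq_area[OF b(1)] hausdorff_eq_area[OF b(2)], rule frontier_subset_finite, blast)+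
    then show ?thesis by simp
  qed
  also have "\<dots> = ennreal (area ?S1 + (r / \<rho>) ^ m * area ?S2)"
    using r \<rho> by (simp add: ennreal_mult)
  finally show ?thesis by (subst (asm) ennreal_le_iff) (use r \<rho> in auto)
qed

lemma area_sphere_Int_le: "0 < r \<Longrightarrow> area (sphere p r \<inter> \<Omega>) \<le> area (\<Sigma> - ball p r)"
  using area_sphere_Int_le_general[of r r p] by (simp add: Int_Diff)

text \<open>The cone over a nonempty relatively open part of the sphere contains a nonempty open
  set, so it has positive volume.\<close>

lemma area_sphere_Int_pos:
  assumes "y \<in> \<Omega>" "dist p y = t" "t > 0"
  shows "area (sphere p t \<inter> \<Omega>) > 0"
proof -
  have b: "\<Omega> \<inter> sphere p t \<in> sets borel" using \<Omega>(1) by (auto intro: borel_closed)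
  define W where "W = {u. p + t *\<^sub>R u \<in> \<Omega>}"
  have oW: "open W" unfolding W_def 
    using open_vimage[OF \<Omega>(1), of "\<lambda>u. p + t *\<^sub>R u", unfolded vimage_def] by (simp add: continuous_intros)
  define N where "N = (- {0} \<inter> sgn -` W) \<inter> ball 0 1"
  have "continuous_on (- {0::'a}) sgn"
    by (rule continuous_on_subset[OF continuous_on_sgn[OF continuous_on_id, of "- {0}"]]) auto
  then have oN: "open N" unfolding N_def using oW by (intro open_Int continuous_open_preimage) auto
  let ?u = "(1 / t) *\<^sub>R (y - p)"
  have nu: "norm ?u = 1" using assms by (simp add: dist_norm norm_minus_commute)
  have "sgn ((1/2) *\<^sub>R u) = u" if "norm u = 1" for u :: 'a
    using that by (simp add: sgn_div_norm)
  from this[OF nu] have "sgn ((1/2) *\<^sub>R ?u) = ?u" .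
  moreover have "?u \<in> W" using assms by (simp add: W_def)
  ultimately have "(1/2) *\<^sub>R ?u \<in> N" using nu by (auto simp: N_def)
  then have "0 < emeasure lborel N" by (rule emeasure_lborel_open_pos[OF oN])
  also have "\<dots> \<le> cone_vol W 1"
  proof -
    have [measurable]: "W \<in> sets borel" using oW by (rule borel_open)
    have "{x::'a. 0 < norm x \<and> norm x \<le> 1 \<and> sgn x \<in> W} \<in> sets lborel" by measurable
    then show ?thesis unfolding cone_vol_def by (intro emeasure_mono) (auto simp: N_def)
  qed
  finally have "emeasure cone_measure W > 0"
    using oW by (simp add: emeasure_cone_measure ennreal_zero_less_mult_iff borel_open)
  moreover have "(\<integral>\<^sup>+u. indicator \<Omega> (p + t *\<^sub>R u) \<partial>cone_measure) = (\<integral>\<^sup>+u. indicator W u \<partial>cone_measure)"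
    by (intro nn_integral_cong) (auto simp: W_def indicator_def)
  then have "(\<integral>\<^sup>+u. indicator \<Omega> (p + t *\<^sub>R u) \<partial>cone_measure) = emeasure cone_measure W"
    using oW by (simp add: borel_open)
  ultimately have "H (\<Omega> \<inter> sphere p t) > 0"
    using hausdorff_sphere_slice[of \<Omega> t m p] \<Omega>(1) assms dim by (simp add: borel_open ennreal_zero_less_mult_iff)
  moreover have "H (\<Omega> \<inter> sphere p t) = ennreal (area (\<Omega> \<inter> sphere p t))"
    by (rule hausdorff_eq_area[OF b]) (rule hausdorff_sphere_finite[OF assms(3), of _ p], auto)
  ultimately show ?thesis by (simp add: Int_commute)
qed

lemma area_frontier_pos: "area \<Sigma> > 0"
proof -
  obtain y where y: "y \<in> \<Omega>" using \<Omega>(3) by auto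
  \<comment> \<open>Any sphere through a point of \<Omega> meets \<Omega> in positive area, and the
    frontier outside it has at least that area.\<close>
  obtain p :: 'a where "dist p y = 1" by (metis vector_choose_dist zero_le_one dist_commute)
  then have "0 < area (sphere p 1 \<inter> \<Omega>)" by (rule area_sphere_Int_pos[OF y]) simp
  also have "\<dots> \<le> area (\<Sigma> - ball p 1)" by (rule area_sphere_Int_le) simp
  also have "\<dots> \<le> area \<Sigma>" using area_frontier_split[of "ball p 1"] by simp
  finally show ?thesis .
qed

text \<open>The layer at height \<open>t\<close> of the difference between the two sides of the inequality.\<close>

definition gap :: "'a \<Rightarrow> real \<Rightarrow> real" where
  "gap p t = area (\<Sigma> - ball p t) - area (sphere p t \<inter> \<Omega>) - max 0 (area \<Sigma> - t ^ m * \<omega>)"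

text \<open>Where the maximum is 0 this is the radial projection bound. Otherwise splitting \<Sigma>
  by the ball and the sphere by \<Omega> turns the gap into the area of
  \<open>sphere p t - \<Omega>\<close> minus that of
  \<open>\<Sigma> \<inter> ball p t\<close>.\<close>

lemma gap_nonneg: "t > 0 \<Longrightarrow> gap p t \<ge> 0"
  using area_sphere_Int_le[of t p] area_frontier_ball_le[of t p] area_frontier_split[of "ball p t"]
    area_sphere_split[of t \<Omega> p] \<Omega>(1) by (auto simp: gap_def max_def)

definition R where "R = (area \<Sigma> / \<omega>) powr (1 / real m)"

lemma R: "R > 0" "R ^ m * \<omega> = area \<Sigma>"
proof -
  show "R > 0" using area_frontier_pos \<omega> by (simp add: R_def)
  then have "R ^ m = R powr real m" by (simp add: powr_realpow)
  also have "\<dots> = area \<Sigma> / \<omega>" using area_frontier_pos \<omega> dim by (simp add: R_def powr_powr)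
  finally show "R ^ m * \<omega> = area \<Sigma>" using \<omega> by simp
qed

section \<open>The equality case\<close>

lemma subset_cball_of_gap:
  assumes ae: "AE t in lborel. t > 0 \<longrightarrow> gap p t = 0"
  shows "\<Omega> \<subseteq> cball p R"
proof
  fix x assume x: "x \<in> \<Omega>"
  show "x \<in> cball p R"
  proof (rule ccontr)
    assume "x \<notin> cball p R"
    then have \<rho>: "R < dist p x" by auto
    define \<rho> where "\<rho> = dist p x"
    obtain t where t: "R < t" "t < \<rho>" "gap p t = 0"
      using AE_lborel_interval[OF ae, of R \<rho>] R(1) \<rho> by (auto simp: \<rho>_def)
    have t0: "t > 0" using R(1) t by linarith
    have "R ^ m \<le> t ^ m" using t R(1) by (intro power_mono) auto
    then have "area \<Sigma> \<le> t ^ m * \<omega>" using R(2) \<omega> by (metis less_imp_le mult_right_mono)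
    then have eq: "area (\<Sigma> - ball p t) = area (sphere p t \<inter> \<Omega>)" using t(3) by (simp add: gap_def)
    \<comment> \<open>The sphere of radius \<rho> passes through the point x of \<Omega>, so it
      meets \<Omega> in positive area, and the frontier beyond \<rho> projects onto that
      part.\<close>
    have pos: "0 < area (\<Sigma> - ball p \<rho>)"
      by (rule less_le_trans[OF area_sphere_Int_pos[OF x \<rho>_def[symmetric]] area_sphere_Int_le]) (use t t0 in linarith)+
    have "area (\<Sigma> - ball p t) = area ((\<Sigma> \<inter> ball p \<rho> - ball p t) \<union> (\<Sigma> - ball p \<rho>))"
      using t by (intro arg_cong[where f=area]) auto
    also have "\<dots> = area (\<Sigma> \<inter> ball p \<rho> - ball p t) + area (\<Sigma> - ball p \<rho>)"
      by (intro area_Un frontier_subset_finite) auto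
    also have "(t / \<rho>) ^ m * area (\<Sigma> - ball p \<rho>) < 1 * area (\<Sigma> - ball p \<rho>)"
      using t t0 pos dim by (intro mult_strict_right_mono) (auto simp: power_less_one_iff)
    then have "area (\<Sigma> \<inter> ball p \<rho> - ball p t) + area (\<Sigma> - ball p \<rho>)
        > area (\<Sigma> \<inter> ball p \<rho> - ball p t) + (t / \<rho>) ^ m * area (\<Sigma> - ball p \<rho>)" by simp
    finally show False using area_sphere_Int_le_general[of t \<rho> p] t t0 eq by linarith
  qed
qed

text \<open>If the sphere leaves the closure of \<open>\<Omega>\<close> somewhere, cutting off a small cap there produces a
  competitor of strictly smaller perimeter.\<close>

lemma sphere_subset_closure:
  assumes t: "t > 0" and eq: "area (\<Sigma> \<inter> ball p t) = area (sphere p t - \<Omega>)"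
  shows "sphere p t \<subseteq> closure \<Omega>"
proof
  fix y assume y: "y \<in> sphere p t"
  show "y \<in> closure \<Omega>"
  proof (rule ccontr)
    assume "y \<notin> closure \<Omega>"
    then obtain \<epsilon> where \<epsilon>': "\<epsilon> > 0" "ball y \<epsilon> \<subseteq> - closure \<Omega>"
      using open_contains_ball[of "- closure \<Omega>"] by (metis ComplI closed_closure open_Compl)
    then have \<epsilon>: "\<epsilon> > 0" "ball y \<epsilon> \<inter> closure \<Omega> = {}" by auto
    define e where "e = (1 / t) *\<^sub>R (y - p)"
    have e: "norm e = 1" using y t by (simp add: e_def dist_norm norm_minus_commute)
    have ye: "y = p + t *\<^sub>R e" using t by (simp add: e_def)
    \<comment> \<open>Relative height of the cutting hyperplane. A point of the closed ball at
      height at least t h along e has squared distance at most 2 t^2 (1 - h) \<le> \<epsilon>^2 / 2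
      from y, so the piece cut off stays away from the closure of \<Omega>. The maximum with 0 keeps
      the cap within a half-sphere.\<close>
    define h where "h = max 0 (1 - \<epsilon>\<^sup>2 / (4 * t\<^sup>2))"
    have h: "0 \<le> h" "h < 1" using \<epsilon> t by (auto simp: h_def)
    have "1 - h \<le> \<epsilon>\<^sup>2 / (4 * t\<^sup>2)" by (simp add: h_def)
    then have "2 * t\<^sup>2 * (1 - h) \<le> 2 * t\<^sup>2 * (\<epsilon>\<^sup>2 / (4 * t\<^sup>2))" using t by (intro mult_left_mono) auto
    also have "\<dots> = \<epsilon>\<^sup>2 / 2" using t by simp
    also have "\<dots> < \<epsilon>\<^sup>2" using \<epsilon> by simp
    finally have hs: "2 * t\<^sup>2 * (1 - h) < \<epsilon>\<^sup>2" .
    \<comment> \<open>Shadow radius of the unit cap cut off at height h; it links the half-space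
      description of the cap with \<open>cap\<close>.\<close>
    define \<rho> where "\<rho> = sqrt (1 - h\<^sup>2)"
    have h2: "h\<^sup>2 < 1" using h by (simp add: abs_square_less_1)
    have \<rho>: "0 < \<rho>" "\<rho> \<le> 1" "\<rho>\<^sup>2 = 1 - h\<^sup>2" using h2 by (auto simp: \<rho>_def)
    have cut: "x \<in> ball y \<epsilon>" if "norm (x - p) \<le> t" "(x - p) \<bullet> e \<ge> t * h" for x
    proof -
      have "(norm (x - y))\<^sup>2 = (norm (x - p))\<^sup>2 - 2 * t * ((x - p) \<bullet> e) + t\<^sup>2"
      proof -
        have "x - y = (x - p) - t *\<^sub>R e" by (simp add: ye)
        moreover have "(norm (z - t *\<^sub>R e))\<^sup>2 = (norm z)\<^sup>2 - 2 * t * (z \<bullet> e) + t\<^sup>2" for z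
        proof -
          have "e \<bullet> e = 1" using e by (simp add: norm_eq_1)
          then show ?thesis unfolding power2_norm_eq_inner
            by (simp add: inner_diff_left inner_diff_right inner_commute[of e z] power2_eq_square right_diff_distrib)
        qed
        ultimately show ?thesis by (simp only:)
      qed
      also have "\<dots> \<le> t\<^sup>2 - 2 * t * (t * h) + t\<^sup>2"
        using that t by (intro add_right_mono diff_mono mult_left_mono power_mono) auto
      also have "\<dots> = 2 * t\<^sup>2 * (1 - h)" by (simp add: power2_eq_square algebra_simps)
      also have "\<dots> < \<epsilon>\<^sup>2" by (rule hs)
      finally have "norm (x - y) < \<epsilon>" using \<epsilon>(1) by (meson less_imp_le power2_less_imp_less)
      then show ?thesis by (simp add: dist_norm norm_minus_commute)
    qed
    define C where "C = (\<lambda>z. p + t *\<^sub>R z) ` cap e \<rho>"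
    have capeq: "cap e \<rho> = {z. norm z = 1 \<and> z \<bullet> e \<ge> h}"
    proof -
      have "0 \<le> z \<bullet> e \<and> norm (perp e z) \<le> \<rho> \<longleftrightarrow> z \<bullet> e \<ge> h" if "norm z = 1" for z
      proof -
        have s: "(norm (perp e z))\<^sup>2 + (z \<bullet> e)\<^sup>2 = 1" using norm_perp_sq[OF e, of z] that by simp
        have "norm (perp e z) \<le> \<rho> \<longleftrightarrow> (norm (perp e z))\<^sup>2 \<le> \<rho>\<^sup>2"
          using \<rho>(1) abs_le_square_iff[of "norm (perp e z)" \<rho>] by simp
        also have "\<dots> \<longleftrightarrow> h\<^sup>2 \<le> (z \<bullet> e)\<^sup>2" using s \<rho>(3) by linarith
        finally have "norm (perp e z) \<le> \<rho> \<longleftrightarrow> h\<^sup>2 \<le> (z \<bullet> e)\<^sup>2" .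
        moreover have "h\<^sup>2 \<le> (z \<bullet> e)\<^sup>2 \<longleftrightarrow> h \<le> z \<bullet> e" if "0 \<le> z \<bullet> e" using that h abs_le_square_iff[of h "z \<bullet> e"] by simp
        ultimately show ?thesis using h by (meson order_trans)
      qed
      then show ?thesis by (auto simp: cap_def)
    qed
    have Ceq: "C = {x. norm (x - p) = t \<and> (x - p) \<bullet> e \<ge> t * h}"
    proof safe
      fix x assume "x \<in> C"
      then obtain z where "norm z = 1" "z \<bullet> e \<ge> h" "x = p + t *\<^sub>R z" by (auto simp: C_def capeq)
      then show "norm (x - p) = t" "t * h \<le> (x - p) \<bullet> e" using t by auto
    next
      fix x assume "(x - p) \<bullet> e \<ge> norm (x - p) * h" "t = norm (x - p)"
      then have "h \<le> (1 / t) * ((x - p) \<bullet> e)" "norm (x - p) = t" using t by (simp_all add: pos_le_divide_eq mult.commute)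
      then have "norm ((1 / t) *\<^sub>R (x - p)) = 1" "((1 / t) *\<^sub>R (x - p)) \<bullet> e \<ge> h" using t
        by (simp_all only: norm_scaleR inner_scaleR_left) simp
      moreover have "x = p + t *\<^sub>R ((1 / t) *\<^sub>R (x - p))" using t by simp
      ultimately show "x \<in> C" unfolding C_def capeq by blast
    qed
    have Cb: "C \<in> sets borel" unfolding Ceq by measurable
    have C\<Omega>: "C \<subseteq> sphere p t - \<Omega>"
    proof
      fix x assume "x \<in> C"
      then have x: "norm (x - p) = t" "(x - p) \<bullet> e \<ge> t * h" by (auto simp: Ceq)
      then have "x \<in> ball y \<epsilon>" by (intro cut) auto
      then have "x \<notin> \<Omega>" using \<epsilon>(2) closure_subset[of \<Omega>] by blast
      moreover have "x \<in> sphere p t" using x(1) by (simp add: dist_norm norm_minus_commute)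
      ultimately show "x \<in> sphere p t - \<Omega>" by blast
    qed
    let ?hs = "{x. (x - p) \<bullet> e < t * h}"
    define F where "F = ball p t \<inter> ?hs"
    have ohs: "open ?hs" by (intro open_Collect_less continuous_intros)
    have oF: "open F" unfolding F_def using ohs by auto
    have "DIM('a) \<ge> 2" using dim by simp
    then have fpF: "finite_perimeter F" "finite_perimeter (\<Omega> \<inter> F)"
      unfolding F_def Int_assoc[symmetric]
      using finite_perimeter_ball[OF t, of p] e \<Omega>(4) by (auto intro!: finite_perimeter_Int_halfspace)
    have bF: "bounded F" unfolding F_def by auto
    \<comment> \<open>The piece cut off lies in the ball about y that is disjoint from the closure
      of \<Omega>, so no frontier is lost.\<close>
    have \<Sigma>F: "\<Sigma> \<inter> F = \<Sigma> \<inter> ball p t"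
    proof -
      have "x \<in> ?hs" if "x \<in> \<Sigma>" "x \<in> ball p t" for x
      proof (rule ccontr)
        assume "x \<notin> ?hs"
        then have "x \<in> ball y \<epsilon>"
          using that(2) by (intro cut) (auto simp: dist_norm norm_minus_commute)
        moreover have "x \<in> closure \<Omega>" using that(1) by (simp add: frontier_def)
        ultimately show False using \<epsilon>(2) by blast
      qed
      then show ?thesis unfolding F_def by blast
    qed
    let ?D = "{x. (x - p) \<bullet> e = t * h \<and> norm (perp e (x - p)) \<le> t * \<rho>}"
    have frF: "frontier F - \<Omega> \<subseteq> (sphere p t - \<Omega> - C) \<union> ?D"
    proof
      fix x assume x: "x \<in> frontier F - \<Omega>"
      have "closure F \<subseteq> cball p t \<inter> {x. (x - p) \<bullet> e \<le> t * h}"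
        unfolding F_def by (rule closure_minimal) (auto intro!: closed_Int closed_Collect_le continuous_intros)
      then have cl: "norm (x - p) \<le> t" "(x - p) \<bullet> e \<le> t * h"
        using x by (auto simp: frontier_def dist_norm norm_minus_commute)
      have nF: "\<not> (norm (x - p) < t \<and> (x - p) \<bullet> e < t * h)"
      proof -
        have "x \<notin> F" using x interior_open[OF oF] by (simp add: frontier_def)
        then show ?thesis by (simp add: F_def dist_norm norm_minus_commute)
      qed
      show "x \<in> (sphere p t - \<Omega> - C) \<union> ?D"
      proof (cases "(x - p) \<bullet> e < t * h")
        case True
        then show ?thesis using cl nF x by (auto simp: Ceq dist_norm norm_minus_commute)
      next
        case False
        then have eqh: "(x - p) \<bullet> e = t * h" using cl by simp
        have "(norm (perp e (x - p)))\<^sup>2 = (norm (x - p))\<^sup>2 - (t * h)\<^sup>2" using norm_perp_sq[OF e, of "x - p"] eqh by simp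
        also have "\<dots> \<le> t\<^sup>2 - (t * h)\<^sup>2" using cl by (intro diff_right_mono power_mono) auto
        also have "\<dots> = (t * \<rho>)\<^sup>2" by (simp add: power_mult_distrib \<rho>(3) right_diff_distrib)
        finally have "norm (perp e (x - p)) \<le> t * \<rho>" by (rule power2_le_imp_le) (use t \<rho> in auto)
        then show ?thesis using eqh by simp
      qed
    qed
    have S\<Omega>: "sphere p t - \<Omega> \<in> sets borel" using \<Omega>(1) by (auto intro: borel_closed)
    have fin: "H X < top" if "X \<subseteq> sphere p t - \<Omega>" for X using that by (intro hausdorff_sphere_finite[OF t, of _ p]) auto
    \<comment> \<open>By hypothesis the full ball already gives equality in the comparison. For F
      the cap C is replaced by the disc \<open>?D\<close>, and cancelling the rest of the sphere
      makes C at most as large as \<open>?D\<close>, contrary to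
      \<open>hausdorff_disc_less_cap\<close>.\<close>
    have "ennreal (area (sphere p t - \<Omega>)) = ennreal (area (\<Sigma> \<inter> F))" by (simp add: \<Sigma>F eq)
    also have "\<dots> \<le> H (frontier F - \<Omega>)" by (rule area_frontier_Int_le[OF oF bF fpF])
    also have "\<dots> \<le> H (sphere p t - \<Omega> - C) + H ?D" by (rule order_trans[OF hausdorff_mono[OF frF] hausdorff_Un])
    also have "H (sphere p t - \<Omega> - C) = ennreal (area (sphere p t - \<Omega> - C))"
      using S\<Omega> Cb by (intro hausdorff_eq_area fin) auto
    also have "area (sphere p t - \<Omega>) = area ((sphere p t - \<Omega> - C) \<union> C)"
      using C\<Omega> by (intro arg_cong[where f=area]) auto
    also have "\<dots> = area (sphere p t - \<Omega> - C) + area C"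
      using S\<Omega> Cb C\<Omega> by (intro area_Un fin) auto
    finally have "ennreal (area (sphere p t - \<Omega> - C)) + ennreal (area C) \<le> ennreal (area (sphere p t - \<Omega> - C)) + H ?D"
      by simp
    then have "ennreal (area C) \<le> H ?D" by (simp add: ennreal_add_left_cancel_le)
    moreover have "H C = ennreal (area C)" using Cb C\<Omega> by (intro hausdorff_eq_area fin)
    moreover have "H ?D < H C" unfolding C_def by (rule hausdorff_disc_less_cap[OF e t \<rho>(1,2) dim])
    ultimately show False by simp
  qed
qed

text \<open>The gap vanishes only for almost every radius, so the sphere through y itself may be
  exceptional; a slightly larger good radius gives a sphere inside the closure that passes within
  \<epsilon> of y.\<close>

lemma ball_subset_closure_of_gap:
  assumes ae: "AE t in lborel. t > 0 \<longrightarrow> gap p t = 0"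
  shows "ball p R \<subseteq> closure \<Omega>"
proof
  fix y assume y: "y \<in> ball p R"
  show "y \<in> closure \<Omega>"
  proof (rule ccontr)
    assume "y \<notin> closure \<Omega>"
    then obtain \<epsilon> where \<epsilon>': "\<epsilon> > 0" "ball y \<epsilon> \<subseteq> - closure \<Omega>"
      using open_contains_ball[of "- closure \<Omega>"] by (metis ComplI closed_closure open_Compl)
    then have \<epsilon>: "\<epsilon> > 0" "ball y \<epsilon> \<inter> closure \<Omega> = {}" by auto
    define d where "d = dist p y"
    have d: "0 \<le> d" "d < R" using y by (auto simp: d_def)
    define b where "b = min R (d + \<epsilon>)"
    have b: "d < b" using d \<epsilon> by (simp add: b_def)
    obtain t where "d < t" "t < b" "gap p t = 0" by (rule AE_lborel_interval[OF ae d(1) b])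
    then have t: "d < t" "t < R" "t < d + \<epsilon>" "gap p t = 0" by (auto simp: b_def)
    have t0: "t > 0" using t d by linarith
    have "t ^ m \<le> R ^ m" using t t0 by (intro power_mono) auto
    then have "t ^ m * \<omega> \<le> area \<Sigma>" using R(2) \<omega> by (metis less_imp_le mult_right_mono)
    then have "area (\<Sigma> \<inter> ball p t) = area (sphere p t - \<Omega>)"
      using t(4) area_frontier_split[of "ball p t"] area_sphere_split[OF t0, of \<Omega> p] \<Omega>(1) by (simp add: gap_def)
    from sphere_subset_closure[OF t0 this] have sub: "sphere p t \<subseteq> closure \<Omega>" .
    obtain z where z: "dist p z = t" "dist y z < \<epsilon>"
    proof (cases "y = p")
      case True
      obtain z where "dist p z = t" using vector_choose_dist[of t p] t0 by auto
      then show ?thesis using that True t by (simp add: d_def)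
    next
      case False
      let ?z = "p + t *\<^sub>R sgn (y - p)"
      have "dist p ?z = t" using False t0 by (simp add: dist_norm norm_sgn)
      moreover have "y - ?z = (d - t) *\<^sub>R sgn (y - p)"
        using False by (simp add: d_def dist_norm norm_minus_commute sgn_div_norm algebra_simps)
      then have "dist y ?z < \<epsilon>" using False t by (simp add: dist_norm norm_sgn)
      ultimately show ?thesis by (rule that)
    qed
    then have "z \<in> sphere p t" "z \<in> ball y \<epsilon>" by simp_all
    then show False using sub \<epsilon>(2) by blast
  qed
qed

text \<open>The two inclusions leave open that \<Omega> omits points of the ball. Smoothness of the
  boundary excludes this: arbitrarily near a frontier point there are points where g > 0, which lie
  outside the closure of \<Omega>, whereas the ball lies in it.\<close>

lemma frontier_eq_sphere_of_gap:
  assumes ae: "AE t in lborel. t > 0 \<longrightarrow> gap p t = 0"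
  shows "\<Sigma> = sphere p R"
proof -
  note sub = subset_cball_of_gap[OF ae] and sup = ball_subset_closure_of_gap[OF ae]
  have "\<Omega> \<subseteq> ball p R" using interior_maximal[OF sub \<Omega>(1)] by simp
  moreover have "ball p R \<subseteq> \<Omega>"
  proof
    fix x assume x: "x \<in> ball p R"
    show "x \<in> \<Omega>"
    proof (rule ccontr)
      assume "x \<notin> \<Omega>"
      then have xs: "x \<in> \<Sigma>" using sup x \<Omega>(1) by (auto simp: frontier_def interior_open)
      obtain U g G G' where ch: "boundary_chart \<Omega> U g G G'" and xU: "x \<in> U" using smooth_boundary_chart[OF \<Omega>(5) xs] by metis
      then have U: "open U" "C1_on U g (\<lambda>x v. G x \<bullet> v)" "G x \<noteq> 0"
        "\<Omega> \<inter> U = {x \<in> U. g x < 0}" "frontier \<Omega> \<inter> U = {x \<in> U. g x = 0}" by (auto simp: boundary_chart_def)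
      have g0: "g x = 0" using U(5) xU xs by blast
      have D: "((\<lambda>s. g (x + s *\<^sub>R G x)) has_real_derivative G x \<bullet> G x) (at 0)"
        using line_deriv[OF U(2), of x 0 "G x"] xU by simp
      have "G x \<bullet> G x > 0" using U(3) by simp
      from DERIV_pos_inc_right[OF D this] have "\<exists>d>0. \<forall>h>0. h < d \<longrightarrow> g (x + h *\<^sub>R G x) > 0" by (simp add: g0)
      then have "\<forall>\<^sub>F t in at_right 0. g (x + t *\<^sub>R G x) > 0" by (auto simp: eventually_at_right_field)
      moreover have "((\<lambda>t. x + t *\<^sub>R G x) \<longlongrightarrow> x + 0 *\<^sub>R G x) (at_right 0)" by (intro tendsto_intros)
      then have "\<forall>\<^sub>F t in at_right 0. x + t *\<^sub>R G x \<in> U \<inter> ball p R"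
        using U(1) xU x by (intro topological_tendstoD) auto
      ultimately have "\<forall>\<^sub>F t in at_right (0::real). False"
      proof eventually_elim
        case (elim t)
        let ?z = "x + t *\<^sub>R G x"
        have "?z \<in> closure \<Omega>" using elim sup by blast
        then have "?z \<in> \<Omega> \<or> ?z \<in> frontier \<Omega>" using \<Omega>(1) by (auto simp: frontier_def interior_open)
        then have "g ?z < 0 \<or> g ?z = 0" using U(4,5) elim by blast
        then show ?case using elim by linarith
      qed
      then show False by simp
    qed
  qed
  ultimately have "\<Omega> = ball p R" by auto
  then show ?thesis by (metis R(1) frontier_ball)
qed

text \<open>A ray from p through a point of \<Omega> meets the frontier at that point or farther
  out, so \<Omega> lies inside the sphere; the open ball is connected and free of frontier points,
  so \<Omega> fills it.\<close>

lemma gap_of_frontier_eq_sphere: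
  assumes r: "r > 0" and sph: "\<Sigma> = sphere p r"
  shows "AE t in lborel. t > 0 \<longrightarrow> gap p t = 0"
proof -
  have disj: "\<Omega> \<inter> \<Sigma> = {}" using \<Omega>(1) by (auto simp: frontier_def interior_open)
  have sub: "\<Omega> \<subseteq> ball p r"
  proof
    fix x assume x: "x \<in> \<Omega>"
    show "x \<in> ball p r"
    proof (rule ccontr)
      assume "x \<notin> ball p r"
      then have xr: "dist p x > r" using x disj sph by force
      then have "x \<noteq> p" using r by auto
      then obtain t where t: "t \<ge> 1" "p + t *\<^sub>R (x - p) \<in> sphere p r"
        using bounded_set_ray_frontier[OF \<Omega>(4) x] sph by metis
      then have "t * norm (x - p) = r" by (simp add: dist_norm)
      moreover have "1 * norm (x - p) \<le> t * norm (x - p)" using t by (intro mult_right_mono) auto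
      ultimately show False using xr by (simp add: dist_norm norm_minus_commute)
    qed
  qed
  have "ball p r \<subseteq> \<Omega>"
  proof (rule ccontr)
    assume "\<not> ball p r \<subseteq> \<Omega>"
    then have "ball p r \<inter> frontier \<Omega> \<noteq> {}" using sub \<Omega>(3) by (intro connected_Int_frontier) auto
    then show False using sph by auto
  qed
  then have B: "\<Omega> = ball p r" using sub by auto
  have T: "area \<Sigma> = r ^ m * \<omega>" using sph area_sphere[OF r] by simp
  \<comment> \<open>At t = r itself the gap is the whole area of \<Sigma>, since the sphere lies
    neither in the open ball nor in \<Omega>.\<close>
  have "AE t in lborel. t \<noteq> r" using AE_lborel_singleton by blast
  then show ?thesis
  proof eventually_elim
    case (elim t)
    show ?case
    proof
      assume t: "t > 0"
      show "gap p t = 0"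
      proof (cases "t < r")
        case True
        have "\<Sigma> - ball p t = \<Sigma>" "sphere p t \<inter> \<Omega> = sphere p t" using True sph B by auto
        moreover have "t ^ m \<le> r ^ m" using True t by (intro power_mono) auto
        then have "t ^ m * \<omega> \<le> area \<Sigma>" unfolding T using \<omega> by (intro mult_right_mono) auto
        ultimately show ?thesis using area_sphere[OF t, of p] by (simp add: gap_def)
      next
        case False
        then have tr: "t > r" using elim by auto
        then have "\<Sigma> - ball p t = {}" "sphere p t \<inter> \<Omega> = {}" using sph B by auto
        then have "area (\<Sigma> - ball p t) = 0" "area (sphere p t \<inter> \<Omega>) = 0" by (simp_all only: measure_empty)
        moreover have "r ^ m \<le> t ^ m" using tr r by (intro power_mono) auto
        then have "area \<Sigma> \<le> t ^ m * \<omega>" unfolding T using \<omega> by (intro mult_right_mono) auto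
        ultimately show ?thesis by (simp add: gap_def)
      qed
    qed
  qed
qed

end

section \<open>Layers in the distance to the origin\<close>

text \<open>The derivative of t^k on t > 0; the extension by 0 lets layer integrals run over the
  whole line.\<close>

definition layer_weight :: "real \<Rightarrow> real \<Rightarrow> ennreal" where
  "layer_weight k t = indicator {0<..} t * ennreal (k * t powr (k - 1))"

lemma layer_weight_measurable [measurable]: "layer_weight k \<in> borel_measurable borel"
  unfolding layer_weight_def by measurable

lemma nn_integral_layer_weight:
  assumes "k > 0" "d \<ge> 0"
  shows "(\<integral>\<^sup>+t. layer_weight k t * indicator {..d} t \<partial>lborel) = ennreal (d powr k)"
proof -
  have "((\<lambda>t. k * t powr (k - 1)) has_integral k * (d powr (k - 1 + 1) / (k - 1 + 1))) {0..d}"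
    by (intro has_integral_mult_right has_integral_powr_from_0) (use assms in auto)
  then have I: "((\<lambda>t. k * t powr (k - 1)) has_integral d powr k) {0..d}" using assms by simp
  have "(\<integral>\<^sup>+t. layer_weight k t * indicator {..d} t \<partial>lborel)
      = (\<integral>\<^sup>+t. ennreal (indicator {0..d} t * (k * t powr (k - 1))) \<partial>lborel)"
    by (intro nn_integral_cong) (auto simp: layer_weight_def indicator_def)
  also have "\<dots> = ennreal (d powr k)"
    by (rule nn_integral_has_integral_lebesgue[OF _ I]) (use assms in auto)
  finally show ?thesis .
qed

context minimizing_domain
begin

text \<open>The exchange of integrals asks for a \<sigma>-finite measure, so the area measure is
  first restricted to \<Sigma>, where it is finite.\<close>

lemma nn_integral_frontier_layers:
  assumes k: "k > 0"
  shows "(\<integral>\<^sup>+x. indicator \<Sigma> x * ennreal (dist p x powr k) \<partial>area_measure)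
    = (\<integral>\<^sup>+t. layer_weight k t * ennreal (area (\<Sigma> - ball p t)) \<partial>lborel)"
proof -
  define \<mu> where "\<mu> = density area_measure (indicator \<Sigma> :: 'a \<Rightarrow> ennreal)"
  have sets_\<mu> [measurable_cong]: "sets \<mu> = sets borel" by (simp add: \<mu>_def)
  have em: "emeasure \<mu> X = H (\<Sigma> \<inter> X)" if "X \<in> sets borel" for X
  proof -
    have "emeasure \<mu> X = (\<integral>\<^sup>+x. indicator \<Sigma> x * indicator X x \<partial>area_measure)"
      unfolding \<mu>_def using that by (intro emeasure_density) auto
    also have "\<dots> = (\<integral>\<^sup>+x. indicator (\<Sigma> \<inter> X) x \<partial>area_measure)"
      by (intro nn_integral_cong) (auto simp: indicator_def)
    finally show ?thesis using that by (simp add: emeasure_area)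
  qed
  interpret \<mu>: finite_measure \<mu>
    by standard (use em[of UNIV] frontier_finite in \<open>auto simp: \<mu>_def\<close>)
  interpret pair_sigma_finite \<mu> lborel by standard
  have "(\<integral>\<^sup>+x. indicator \<Sigma> x * ennreal (dist p x powr k) \<partial>area_measure) = (\<integral>\<^sup>+x. ennreal (dist p x powr k) \<partial>\<mu>)"
    unfolding \<mu>_def by (rule nn_integral_density[symmetric]) measurable
  also have "\<dots> = (\<integral>\<^sup>+x. \<integral>\<^sup>+t. layer_weight k t * indicator {..dist p x} t \<partial>lborel \<partial>\<mu>)"
    using k by (simp add: nn_integral_layer_weight)
  also have "\<dots> = (\<integral>\<^sup>+x. \<integral>\<^sup>+t. layer_weight k t * indicator {x. t \<le> dist p x} x \<partial>lborel \<partial>\<mu>)"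
    by (intro nn_integral_cong) (simp add: indicator_def)
  also have "\<dots> = (\<integral>\<^sup>+t. \<integral>\<^sup>+x. layer_weight k t * indicator {x. t \<le> dist p x} x \<partial>\<mu> \<partial>lborel)"
    by (rule Fubini'[symmetric]) (unfold indicator_def, measurable)
  also have "\<dots> = (\<integral>\<^sup>+t. layer_weight k t * ennreal (area (\<Sigma> - ball p t)) \<partial>lborel)"
  proof (rule nn_integral_cong)
    fix t :: real
    have [measurable]: "{x. t \<le> dist p x} \<in> sets borel" by measurable
    have "(\<integral>\<^sup>+x. layer_weight k t * indicator {x. t \<le> dist p x} x \<partial>\<mu>) = layer_weight k t * emeasure \<mu> {x. t \<le> dist p x}"
      by (rule nn_integral_cmult_indicator) measurable
    also have "emeasure \<mu> {x. t \<le> dist p x} = H (\<Sigma> \<inter> {x. t \<le> dist p x})" by (rule em) measurable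
    also have "\<Sigma> \<inter> {x. t \<le> dist p x} = \<Sigma> - ball p t" by auto
    also have "H (\<Sigma> - ball p t) = ennreal (area (\<Sigma> - ball p t))"
      by (rule hausdorff_eq_area) (auto intro: frontier_subset_finite)
    finally show "(\<integral>\<^sup>+x. layer_weight k t * indicator {x. t \<le> dist p x} x \<partial>\<mu>)
      = layer_weight k t * ennreal (area (\<Sigma> - ball p t))" .
  qed
  finally show ?thesis .
qed

lemma sphere_Int_domain:
  assumes "t > 0"
  shows "H (\<Omega> \<inter> sphere p t) = ennreal (area (sphere p t \<inter> \<Omega>))"
proof -
  have "H (sphere p t \<inter> \<Omega>) = ennreal (area (sphere p t \<inter> \<Omega>))"
    using \<Omega>(1) assms by (intro hausdorff_eq_area hausdorff_sphere_finite[of t _ p]) (auto intro: borel_closed)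
  then show ?thesis by (simp add: Int_commute)
qed

lemma nn_integral_domain_layers:
  assumes k: "k > 0"
  shows "ennreal k * (\<integral>\<^sup>+x. indicator \<Omega> x * ennreal (dist p x powr (k - 1)) \<partial>lborel)
    = (\<integral>\<^sup>+t. layer_weight k t * ennreal (area (sphere p t \<inter> \<Omega>)) \<partial>lborel)"
proof -
  have [measurable]: "\<Omega> \<in> sets borel" using \<Omega>(1) by (rule borel_open)
  have "ennreal k * (\<integral>\<^sup>+x. indicator \<Omega> x * ennreal (dist p x powr (k - 1)) \<partial>lborel)
      = (\<integral>\<^sup>+x. ennreal k * (indicator \<Omega> x * ennreal (dist p x powr (k - 1))) \<partial>lborel)"
    by (rule nn_integral_cmult[symmetric]) measurable
  also have "\<dots> = (\<integral>\<^sup>+x. indicator \<Omega> x * ennreal (k * dist p x powr (k - 1)) \<partial>lborel)"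
    using k by (intro nn_integral_cong) (simp add: ennreal_mult mult_ac)
  also have "\<dots> = (\<integral>\<^sup>+t. indicator {0<..} t * (ennreal (k * t powr (k - 1)) * H (\<Omega> \<inter> sphere p t)) \<partial>lborel)"
  proof (rule nn_integral_spheres[where g = "\<lambda>t. ennreal (k * t powr (k - 1))", OF _ _ dim])
    show "(\<lambda>t. ennreal (k * t powr (k - 1))) \<in> borel_measurable borel" by measurable
  qed fact
  also have "\<dots> = (\<integral>\<^sup>+t. layer_weight k t * ennreal (area (sphere p t \<inter> \<Omega>)) \<partial>lborel)"
    by (intro nn_integral_cong) (auto simp: layer_weight_def sphere_Int_domain indicator_def)
  finally show ?thesis .
qed

lemma nn_integral_excess_layers:
  assumes k: "k > 0"
  shows "(\<integral>\<^sup>+t. layer_weight k t * ennreal (max 0 (area \<Sigma> - t ^ m * \<omega>)) \<partial>lborel)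
    = ennreal (real m / (real m + k) * R powr k * area \<Sigma>)"
proof -
  define f where "f t = k * area \<Sigma> * t powr (k - 1) - k * \<omega> * t powr (k - 1 + m)" for t
  have f: "f t = k * t powr (k - 1) * (area \<Sigma> - t ^ m * \<omega>)" if "t > 0" for t
  proof -
    have "t powr (k - 1 + m) = t powr (k - 1) * t ^ m" using that by (simp add: powr_add powr_realpow)
    then show ?thesis by (simp add: f_def algebra_simps)
  qed
  have le_iff: "area \<Sigma> - t ^ m * \<omega> \<ge> 0 \<longleftrightarrow> t \<le> R" if "t > 0" for t
  proof -
    have "area \<Sigma> - t ^ m * \<omega> \<ge> 0 \<longleftrightarrow> t ^ m \<le> R ^ m" using \<omega> by (simp add: R(2)[symmetric])
    also have "\<dots> \<longleftrightarrow> t \<le> R" using that R(1) dim by (simp add: power_mono_iff)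
    finally show ?thesis .
  qed
  have "(f has_integral k * area \<Sigma> * (R powr (k - 1 + 1) / (k - 1 + 1))
      - k * \<omega> * (R powr (k - 1 + m + 1) / (k - 1 + m + 1))) {0..R}"
    unfolding f_def by (intro has_integral_diff has_integral_mult_right has_integral_powr_from_0) (use k R(1) in auto)
  moreover have "k * area \<Sigma> * (R powr (k - 1 + 1) / (k - 1 + 1)) - k * \<omega> * (R powr (k - 1 + m + 1) / (k - 1 + m + 1))
      = real m / (real m + k) * R powr k * area \<Sigma>"
  proof -
    \<comment> \<open>Since R^m \<omega> is the area of \<Sigma>, the second term is k / (m + k)
      times the first, which leaves the factor m / (m + k).\<close>
    have "R powr (k - 1 + m + 1) = R powr k * R ^ m" using R(1) by (simp add: powr_add[symmetric] powr_realpow[symmetric])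
    moreover have "k - 1 + real m + 1 = real m + k" by simp
    moreover have "real m + k > 0" using k by simp
    ultimately show ?thesis using k by (simp add: R(2)[symmetric] field_simps)
  qed
  ultimately have I: "(f has_integral real m / (real m + k) * R powr k * area \<Sigma>) {0..R}" by simp
  \<comment> \<open>\<open>powr\<close> with base 0 is 0 for every exponent, also for k \<le> 1;
    this matches the value 0 of \<open>layer_weight\<close> at 0.\<close>
  have f0: "f 0 = 0" by (simp add: f_def)
  have "(\<integral>\<^sup>+t. layer_weight k t * ennreal (max 0 (area \<Sigma> - t ^ m * \<omega>)) \<partial>lborel)
      = (\<integral>\<^sup>+t. ennreal (indicator {0..R} t * f t) \<partial>lborel)"
  proof (rule nn_integral_cong)
    fix t :: real
    show "layer_weight k t * ennreal (max 0 (area \<Sigma> - t ^ m * \<omega>)) = ennreal (indicator {0..R} t * f t)"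
    proof (cases "t > 0")
      case True
      then show ?thesis using le_iff[OF True] k
        by (cases "t \<le> R") (auto simp: layer_weight_def f ennreal_mult max_def)
    next
      case False
      then show ?thesis using f0 by (cases "t = 0") (auto simp: layer_weight_def)
    qed
  qed
  also have "\<dots> = ennreal (real m / (real m + k) * R powr k * area \<Sigma>)"
  proof (rule nn_integral_has_integral_lebesgue[OF _ I])
    fix t assume "t \<in> {0..R}"
    then show "f t \<ge> 0" using f0 f[of t] le_iff[of t] k by (cases "t = 0") auto
  qed
  finally show ?thesis .
qed

text \<open>The area of the frontier outside the ball is monotone in t, and the area of the sphere
  inside \<Omega> is measurable in t by \<open>measurable_hausdorff_sphere_slice\<close>.\<close>

lemma gap_measurable: "(\<lambda>t. layer_weight k t * ennreal (gap p t)) \<in> borel_measurable borel"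
  "(\<lambda>t. layer_weight k t * ennreal (area (sphere p t \<inter> \<Omega>))) \<in> borel_measurable borel"
proof -
  have "mono (\<lambda>t. - area (\<Sigma> - ball p t))"
  proof (rule monoI)
    fix s t :: real assume "s \<le> t"
    then have "\<Sigma> - ball p t \<subseteq> \<Sigma> - ball p s" by auto
    then have "H (\<Sigma> - ball p t) \<le> H (\<Sigma> - ball p s)" by (rule hausdorff_mono)
    then show "- area (\<Sigma> - ball p s) \<le> - area (\<Sigma> - ball p t)"
      by (simp add: hausdorff_eq_area frontier_subset_finite)
  qed
  then have [measurable]: "(\<lambda>t. - (- area (\<Sigma> - ball p t))) \<in> borel_measurable borel"
    by (intro borel_measurable_uminus borel_measurable_mono)
  define s where "s t = indicator {0<..} t * H (\<Omega> \<inter> sphere p t)" for t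
  have [measurable]: "s \<in> borel_measurable borel"
    unfolding s_def[abs_def] by (rule measurable_hausdorff_sphere_slice[OF _ dim]) (use \<Omega>(1) in \<open>rule borel_open\<close>)
  have s: "area (sphere p t \<inter> \<Omega>) = enn2real (s t)" if "t > 0" for t
    using sphere_Int_domain[OF that, of p] that by (simp add: s_def)
  have eq: "(\<lambda>t. layer_weight k t * ennreal (gap p t))
      = (\<lambda>t. layer_weight k t * ennreal (- (- area (\<Sigma> - ball p t)) - enn2real (s t) - max 0 (area \<Sigma> - t ^ m * \<omega>)))"
    by (auto simp: fun_eq_iff gap_def s layer_weight_def indicator_def)
  show "(\<lambda>t. layer_weight k t * ennreal (gap p t)) \<in> borel_measurable borel" unfolding eq by measurable
  have "(\<lambda>t. layer_weight k t * ennreal (area (sphere p t \<inter> \<Omega>))) = (\<lambda>t. layer_weight k t * ennreal (enn2real (s t)))"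
    by (auto simp: fun_eq_iff s layer_weight_def indicator_def)
  then show "(\<lambda>t. layer_weight k t * ennreal (area (sphere p t \<inter> \<Omega>))) \<in> borel_measurable borel" by simp
qed

text \<open>The estimate is kept as an identity with the integrated gap \<Delta> as its error term,
  so that the inequality and the equality case are both read off from it.\<close>

lemma frontier_integral_eq:
  assumes k: "k > 0"
  obtains \<Delta> where "\<Delta> \<ge> 0"
    and "(LINT x:\<Sigma>|area_measure. dist p x powr k)
      = real m / (real m + k) * R powr k * area \<Sigma> + k * (LINT x:\<Omega>|lebesgue. dist p x powr (k - 1)) + \<Delta>"
    and "\<Delta> = 0 \<longleftrightarrow> (AE t in lborel. t > 0 \<longrightarrow> gap p t = 0)"
proof -
  have [measurable]: "\<Omega> \<in> sets borel" using \<Omega>(1) by (rule borel_open)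
  define I where "I = (\<integral>\<^sup>+x. indicator \<Sigma> x * ennreal (dist p x powr k) \<partial>area_measure)"
  define J where "J = (\<integral>\<^sup>+x. indicator \<Omega> x * ennreal (dist p x powr (k - 1)) \<partial>lborel)"
  define D where "D = (\<integral>\<^sup>+t. layer_weight k t * ennreal (gap p t) \<partial>lborel)"
  let ?c = "real m / (real m + k) * R powr k * area \<Sigma>"
  have c: "?c \<ge> 0" using k by simp
  note [measurable] = gap_measurable[of k p]
  have "I = (\<integral>\<^sup>+t. layer_weight k t * ennreal (area (sphere p t \<inter> \<Omega>)) + layer_weight k t * ennreal (max 0 (area \<Sigma> - t ^ m * \<omega>))
      + layer_weight k t * ennreal (gap p t) \<partial>lborel)"
    unfolding I_def nn_integral_frontier_layers[OF k]
  proof (rule nn_integral_cong)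
    fix t :: real
    show "layer_weight k t * ennreal (area (\<Sigma> - ball p t))
      = layer_weight k t * ennreal (area (sphere p t \<inter> \<Omega>)) + layer_weight k t * ennreal (max 0 (area \<Sigma> - t ^ m * \<omega>))
        + layer_weight k t * ennreal (gap p t)"
    proof (cases "t > 0")
      case True
      have "area (\<Sigma> - ball p t) = area (sphere p t \<inter> \<Omega>) + max 0 (area \<Sigma> - t ^ m * \<omega>) + gap p t" by (simp add: gap_def)
      then have "ennreal (area (\<Sigma> - ball p t)) = ennreal (area (sphere p t \<inter> \<Omega>)) + ennreal (max 0 (area \<Sigma> - t ^ m * \<omega>)) + ennreal (gap p t)"
        using gap_nonneg[OF True, of p] by simp
      then show ?thesis by (simp only: distrib_left)
    qed (simp add: layer_weight_def)
  qed
  also have "\<dots> = ennreal k * J + ennreal ?c + D"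
    unfolding J_def D_def nn_integral_domain_layers[OF k] nn_integral_excess_layers[OF k, symmetric]
    by (subst nn_integral_add; (subst nn_integral_add)?; measurable)
  finally have eq: "I = ennreal k * J + ennreal ?c + D" .
  \<comment> \<open>The area integral is finite because \<Sigma> is compact and has finite area.
    Through the identity this makes every summand finite, including the volume integral when r^(k-1)
    is unbounded.\<close>
  have "I < top"
  proof -
    obtain B where B: "\<And>x. x \<in> \<Sigma> \<Longrightarrow> dist p x \<le> B"
      using compact_imp_bounded[OF compact_frontier] bounded_any_center by metis
    have "I \<le> (\<integral>\<^sup>+x. ennreal (B powr k) * indicator \<Sigma> x \<partial>area_measure)"
      unfolding I_def using B k by (intro nn_integral_mono) (auto simp: indicator_def intro!: ennreal_leI powr_mono2)
    also have "\<dots> = ennreal (B powr k) * H \<Sigma>"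
      by (subst nn_integral_cmult_indicator) (auto simp: emeasure_area)
    also have "\<dots> < top" using frontier_finite by (simp add: ennreal_mult_less_top)
    finally show ?thesis .
  qed
  then have fin: "ennreal k * J < top" "D < top" unfolding eq by auto
  have I': "(LINT x:\<Sigma>|area_measure. dist p x powr k) = enn2real I"
    unfolding set_lebesgue_integral_def I_def
    by (subst integral_eq_nn_integral) (auto intro!: arg_cong[where f=enn2real] nn_integral_cong simp: indicator_def)
  have "(LINT x:\<Omega>|lebesgue. dist p x powr (k - 1)) = (LINT x:\<Omega>|lborel. dist p x powr (k - 1))"
    unfolding set_lebesgue_integral_def by (rule integral_completion) measurable
  also have "\<dots> = enn2real J"
    unfolding set_lebesgue_integral_def J_def
    by (subst integral_eq_nn_integral) (auto intro!: arg_cong[where f=enn2real] nn_integral_cong simp: indicator_def)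
  finally have J': "(LINT x:\<Omega>|lebesgue. dist p x powr (k - 1)) = enn2real J" .
  show thesis
  proof
    show "enn2real D \<ge> 0" by simp
    have "enn2real I = enn2real (ennreal k * J) + ?c + enn2real D"
      unfolding eq using fin c by (simp add: enn2real_plus)
    then show "(LINT x:\<Sigma>|area_measure. dist p x powr k)
      = ?c + k * (LINT x:\<Omega>|lebesgue. dist p x powr (k - 1)) + enn2real D"
      unfolding I' J' using k by (simp add: enn2real_mult)
    have "enn2real D = 0 \<longleftrightarrow> D = 0" using fin by (auto simp: enn2real_eq_0_iff)
    also have "\<dots> \<longleftrightarrow> (AE t in lborel. layer_weight k t * ennreal (gap p t) = 0)"
      unfolding D_def by (rule nn_integral_0_iff_AE) measurable
    also have "\<dots> \<longleftrightarrow> (AE t in lborel. t > 0 \<longrightarrow> gap p t = 0)"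
    proof (rule AE_cong)
      fix t :: real
      show "layer_weight k t * ennreal (gap p t) = 0 \<longleftrightarrow> (t > 0 \<longrightarrow> gap p t = 0)"
        using gap_nonneg[of t p] k by (auto simp: layer_weight_def ennreal_eq_0_iff mult_le_0_iff not_le)
    qed
    finally show "enn2real D = 0 \<longleftrightarrow> (AE t in lborel. t > 0 \<longrightarrow> gap p t = 0)" .
  qed
qed

lemma gap_zero_iff: "(AE t in lborel. t > 0 \<longrightarrow> gap p t = 0) \<longleftrightarrow> (\<exists>r>0. \<Sigma> = sphere p r)"
  using frontier_eq_sphere_of_gap[of p] gap_of_frontier_eq_sphere[of _ p] R(1) by blast

lemma isoperimetric_constant:
  assumes k: "k > 0"
  shows "area (sphere 0 1) powr (- k / real m) * area \<Sigma> powr ((real m + k) / real m) = R powr k * area \<Sigma>"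
proof -
  have m: "real m > 0" using dim by simp
  have "area \<Sigma> powr ((real m + k) / real m) = area \<Sigma> powr (k / real m) * area \<Sigma>"
    using m area_frontier_pos by (simp add: add_divide_distrib powr_add mult.commute)
  moreover have "R powr k = \<omega> powr (- k / real m) * area \<Sigma> powr (k / real m)"
    using area_frontier_pos \<omega> m by (simp add: R_def powr_powr powr_divide powr_minus field_simps)
  ultimately show ?thesis using area_sphere[of 1 0] by simp
qed

end

theorem proposition3p1:
  fixes \<Omega> :: "(real ^ 'n) set" and p :: "real ^ 'n" and n :: nat and k :: real
  assumes "n = CARD('n)" and "n \<ge> 3"
    and "open \<Omega>" and "connected \<Omega>" and "\<Omega> \<noteq> {}" and "bounded \<Omega>"
    and "smooth_boundary \<Omega>"
    and "outward_minimizing \<Omega>"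
    and "k > 0"
  shows "(LINT x:frontier \<Omega>|area_measure. dist p x powr k)
           \<ge> (real n - 1) / (real n - 1 + k)
               * measure area_measure (sphere (0 :: real ^ 'n) 1) powr (- k / (real n - 1))
               * measure area_measure (frontier \<Omega>) powr ((real n - 1 + k) / (real n - 1))
             + k * (LINT x:\<Omega>|lebesgue. dist p x powr (k - 1))
       \<and> ((LINT x:frontier \<Omega>|area_measure. dist p x powr k)
           = (real n - 1) / (real n - 1 + k)
               * measure area_measure (sphere (0 :: real ^ 'n) 1) powr (- k / (real n - 1))
               * measure area_measure (frontier \<Omega>) powr ((real n - 1 + k) / (real n - 1))
             + k * (LINT x:\<Omega>|lebesgue. dist p x powr (k - 1))
          \<longleftrightarrow> (\<exists>R>0. frontier \<Omega> = sphere p R))"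
proof -
  have n: "real n - 1 = real (n - 1)" using assms(2) by simp
  interpret minimizing_domain \<Omega> "n - 1"
    by standard (use assms in auto)
  have c: "(real n - 1) / (real n - 1 + k) * measure area_measure (sphere (0 :: real ^ 'n) 1) powr (- k / (real n - 1))
        * measure area_measure (frontier \<Omega>) powr ((real n - 1 + k) / (real n - 1))
      = real (n - 1) / (real (n - 1) + k) * R powr k * area \<Sigma>"
    unfolding n using isoperimetric_constant[OF assms(9)] by (simp only: mult.assoc)
  obtain \<Delta> where \<Delta>: "\<Delta> \<ge> 0"
    "(LINT x:\<Sigma>|area_measure. dist p x powr k)
      = real (n - 1) / (real (n - 1) + k) * R powr k * area \<Sigma> + k * (LINT x:\<Omega>|lebesgue. dist p x powr (k - 1)) + \<Delta>"
    "\<Delta> = 0 \<longleftrightarrow> (AE t in lborel. t > 0 \<longrightarrow> gap p t = 0)"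
    using frontier_integral_eq[OF assms(9)] .
  show ?thesis unfolding c \<Delta>(2) using \<Delta>(1,3) gap_zero_iff[of p] by auto
qed

end
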